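(* Let $\nu,\mu,T>0$, let $\mathbf{u}_0,\mathbf{B}_0\in\mathbf{H}_0$ and let $\mathbf{f}\in L^2([0,T]\times\mathbb{T}_3)^3$ have zero spatial mean. Let $\alpha_1,\alpha_2>0$ and $N_1,N_2\in\mathbb{N}$ be given and fixed. Then the problem $$\begin{aligned} &\partial_t\mathbf{w}+\nabla\cdot G_1(D_{N_1}\mathbf{w}\otimes D_{N_1}\mathbf{w})-\nabla\cdot G_1(D_{N_2}\mathbf{b}\otimes D_{N_2}\mathbf{b})+\nabla q-\nu\Delta\mathbf{w}=G_1\mathbf{f},\\ &\partial_t\mathbf{b}+\nabla\cdot G_2(D_{N_2}\mathbf{b}\otimes D_{N_1}\mathbf{w})-\nabla\cdot G_2(D_{N_1}\mathbf{w}\otimes D_{N_2}\mathbf{b})-\mu\Delta\mathbf{b}=0,\\ &\nabla\cdot\mathbf{w}=\nabla\cdot\mathbf{b}=0,\qquad \mathbf{w}(0,\mathbf{x})=G_1\mathbf{u}_0(\mathbf{x}),\quad\mathbf{b}(0,\mathbf{x})=G_2\mathbf{B}_0(\mathbf{x}), \end{aligned}$$ on $[0,T]\times\mathbb{T}_3$ has a unique regular weak solution $(\mathbf{w},\mathbf{b},q)$.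
   Context: Fix $L>0$; $\mathbb{T}_3=\mathbb{R}^3/(L\mathbb{Z})^3$ is the three-dimensional torus. For $s\ge0$, $\mathbf{H}_s$ is the space of $\mathbf{w}\in H^s(\mathbb{T}_3)^3$ with $\nabla\cdot\mathbf{w}=0$ and $\int_{\mathbb{T}_3}\mathbf{w}\,d\mathbf{x}=\mathbf{0}$, with norm $\|\mathbf{w}\|_s^2=\sum_{\mathbf{k}\ne0}|\mathbf{k}|^{2s}|\widehat{\mathbf{w}}_{\mathbf{k}}|^2$ (Fourier coefficients, wave-numbers $\mathbf{k}\in\frac{2\pi}{L}\mathbb{Z}^3$). All fields, including the pressure $q$, are normalized to have zero mean over $\mathbb{T}_3$. $\mathbb{N}=\{0,1,2,\dots\}$. Conventions: $(\mathbf{a}\otimes\mathbf{c})_{ij}=a_ic_j$, $(\nabla\cdot M)_i=\sum_j\partial_jM_{ij}$, $(\nabla\mathbf{v})_{ij}=\partial_jv_i$, $M:M'=\sum_{i,j}M_{ij}M'_{ij}$. For $i=1,2$: $A_i=\mathrm{I}-\alpha_i^2\Delta$, $G_i=A_i^{-1}$ (acting componentwise on periodic scalar, vector and tensor fields), and $D_{N_i}=\sum_{n=0}^{N_i}(\mathrm{I}-G_i)^n$. A triple $(\mathbf{w},\mathbf{b},q)$ is a regular weak solution if: (1) $\mathbf{w},\mathbf{b}\in L^2([0,T];\mathbf{H}_2)\cap C([0,T];\mathbf{H}_1)$, $\partial_t\mathbf{w},\partial_t\mathbf{b}\in L^2([0,T];\mathbf{H}_0)$, $q\in L^2([0,T];H^1(\mathbb{T}_3))$;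 (2) $\lim_{t\to0}\|\mathbf{w}(t,\cdot)-G_1\mathbf{u}_0\|_{\mathbf{H}_1}=0$ and $\lim_{t\to0}\|\mathbf{b}(t,\cdot)-G_2\mathbf{B}_0\|_{\mathbf{H}_1}=0$; (3) for all $\mathbf{v},\mathbf{h}\in L^2([0,T];H^1(\mathbb{T}_3)^3)$, with integrals over $[0,T]\times\mathbb{T}_3$, $$\int\!\!\int\partial_t\mathbf{w}\cdot\mathbf{v}-\int\!\!\int G_1(D_{N_1}\mathbf{w}\otimes D_{N_1}\mathbf{w}):\nabla\mathbf{v}+\int\!\!\int G_1(D_{N_2}\mathbf{b}\otimes D_{N_2}\mathbf{b}):\nabla\mathbf{v}+\int\!\!\int\nabla q\cdot\mathbf{v}+\nu\int\!\!\int\nabla\mathbf{w}:\nabla\mathbf{v}=\int\!\!\int G_1\mathbf{f}\cdot\mathbf{v},$$ $$\int\!\!\int\partial_t\mathbf{b}\cdot\mathbf{h}-\int\!\!\int G_2(D_{N_2}\mathbf{b}\otimes D_{N_1}\mathbf{w}):\nabla\mathbf{h}+\int\!\!\int G_2(D_{N_1}\mathbf{w}\otimes D_{N_2}\mathbf{b}):\nabla\mathbf{h}+\mu\int\!\!\int\nabla\mathbf{b}:\nabla\mathbf{h}=0.$$ *)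

theory Defs
  imports "HOL-Analysis.Analysis"
begin

text \<open>
  The torus \<open>\<real>\<^sup>3 / (L\<int>)\<^sup>3\<close> is represented by \<open>L\<close>-periodic functions on \<open>real^3\<close>; integrals over the
  torus are integrals over the cell \<open>[0,L]\<^sup>3\<close>. Elements of \<open>L\<^sup>2\<close>, \<open>H\<^sup>s\<close> etc. are represented by Borel
  functions, to be read modulo equality almost everywhere.
\<close>

definition cell :: "real \<Rightarrow> (real^3) set" where
  "cell L = cbox 0 (\<chi> i. L)"

definition periodic :: "real \<Rightarrow> (real^3 \<Rightarrow> 'a) \<Rightarrow> bool" where
  "periodic L f \<longleftrightarrow> (\<forall>x i. f (x + axis i L) = f x)"

definition torus_integral :: "real \<Rightarrow> (real^3 \<Rightarrow> 'a::{banach, second_countable_topology}) \<Rightarrow> 'a" where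
  "torus_integral L f = (LINT x:cell L|lborel. f x)"

definition L1_torus :: "real \<Rightarrow> (real^3 \<Rightarrow> real) set" where
  "L1_torus L = {f. f \<in> borel_measurable borel \<and> periodic L f \<and> set_integrable lborel (cell L) f}"

definition L2_torus :: "real \<Rightarrow> (real^3 \<Rightarrow> real) set" where
  "L2_torus L = {f. f \<in> borel_measurable borel \<and> periodic L f \<and>
     set_integrable lborel (cell L) (\<lambda>x. (f x)\<^sup>2)}"

subsection \<open>Sobolev spaces\<close>

definition wave :: "real \<Rightarrow> int^3 \<Rightarrow> real^3" where
  "wave L n = (\<chi> i. 2 * pi / L * of_int (n $ i))"

definition fourier :: "real \<Rightarrow> (real^3 \<Rightarrow> real) \<Rightarrow> int^3 \<Rightarrow> complex" where
  "fourier L f n =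
     torus_integral L (\<lambda>x. complex_of_real (f x) * exp (- \<i> * complex_of_real (wave L n \<bullet> x)))
       / complex_of_real (L ^ 3)"

definition sobolev :: "real \<Rightarrow> real \<Rightarrow> (real^3 \<Rightarrow> real) set" where
  "sobolev L s = {f \<in> L2_torus L.
     (\<lambda>n. (1 + (norm (wave L n))\<^sup>2) powr s * (cmod (fourier L f n))\<^sup>2) summable_on UNIV}"

definition sobolev_norm :: "real \<Rightarrow> real \<Rightarrow> (real^3 \<Rightarrow> real) \<Rightarrow> real" where
  "sobolev_norm L s f =
     sqrt (\<Sum>\<^sub>\<infinity>n. (1 + (norm (wave L n))\<^sup>2) powr s * (cmod (fourier L f n))\<^sup>2)"

subsection \<open>Weak derivatives\<close>

definition partial :: "3 \<Rightarrow> (real^3 \<Rightarrow> real) \<Rightarrow> real^3 \<Rightarrow> real" where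
  "partial j \<phi> x = frechet_derivative \<phi> (at x) (axis j 1)"

fun Ck :: "nat \<Rightarrow> (real^3 \<Rightarrow> real) \<Rightarrow> bool" where
  "Ck 0 \<phi> \<longleftrightarrow> continuous_on UNIV \<phi>"
| "Ck (Suc k) \<phi> \<longleftrightarrow> (\<forall>x. \<phi> differentiable (at x)) \<and> (\<forall>j. Ck k (partial j \<phi>))"

definition torus_test :: "real \<Rightarrow> (real^3 \<Rightarrow> real) set" where
  "torus_test L = {\<phi>. periodic L \<phi> \<and> (\<forall>k. Ck k \<phi>)}"

definition weak_partial :: "real \<Rightarrow> 3 \<Rightarrow> (real^3 \<Rightarrow> real) \<Rightarrow> (real^3 \<Rightarrow> real) \<Rightarrow> bool" where
  "weak_partial L j f g \<longleftrightarrow> f \<in> L1_torus L \<and> g \<in> L1_torus L \<and>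
     (\<forall>\<phi>\<in>torus_test L.
        torus_integral L (\<lambda>x. f x * partial j \<phi> x) = - torus_integral L (\<lambda>x. g x * \<phi> x))"

text \<open>A representative of the weak derivative; it is determined almost everywhere when it exists.\<close>

definition wpartial :: "real \<Rightarrow> 3 \<Rightarrow> (real^3 \<Rightarrow> real) \<Rightarrow> real^3 \<Rightarrow> real" where
  "wpartial L j f = (SOME g. weak_partial L j f g)"

definition wgrad :: "real \<Rightarrow> (real^3 \<Rightarrow> real) \<Rightarrow> real^3 \<Rightarrow> real^3" where
  "wgrad L q x = (\<chi> j. wpartial L j q x)"

definition wjacobian :: "real \<Rightarrow> (real^3 \<Rightarrow> real^3) \<Rightarrow> real^3 \<Rightarrow> real^3^3" where
  "wjacobian L v x = (\<chi> i j. wpartial L j (\<lambda>y. v y $ i) x)"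

definition wlaplacian :: "real \<Rightarrow> (real^3 \<Rightarrow> real) \<Rightarrow> real^3 \<Rightarrow> real" where
  "wlaplacian L f x = (\<Sum>j\<in>UNIV. wpartial L j (wpartial L j f) x)"

text \<open>The divergence vanishes as a distribution (the single \<open>\<partial>\<^sub>j w\<^sub>j\<close> need not be functions).\<close>

definition weak_div_free :: "real \<Rightarrow> (real^3 \<Rightarrow> real^3) \<Rightarrow> bool" where
  "weak_div_free L w \<longleftrightarrow>
     (\<forall>\<phi>\<in>torus_test L. torus_integral L (\<lambda>x. \<Sum>j\<in>UNIV. w x $ j * partial j \<phi> x) = 0)"

definition Hsol :: "real \<Rightarrow> real \<Rightarrow> (real^3 \<Rightarrow> real^3) set" where
  "Hsol L s = {w. (\<forall>i. (\<lambda>x. w x $ i) \<in> sobolev L s) \<and> weak_div_free L w \<and> torus_integral L w = 0}"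

definition Hsol_norm :: "real \<Rightarrow> real \<Rightarrow> (real^3 \<Rightarrow> real^3) \<Rightarrow> real" where
  "Hsol_norm L s w = sqrt (\<Sum>\<^sub>\<infinity>n\<in>UNIV - {0}.
     norm (wave L n) powr (2 * s) * (norm (\<chi> i. fourier L (\<lambda>x. w x $ i) n))\<^sup>2)"

subsection \<open>Filtering and deconvolution\<close>

definition helmholtz :: "real \<Rightarrow> real \<Rightarrow> (real^3 \<Rightarrow> real) \<Rightarrow> real^3 \<Rightarrow> real" where
  "helmholtz L \<alpha> u x = u x - \<alpha>\<^sup>2 * wlaplacian L u x"

text \<open>The inverse of \<open>helmholtz L \<alpha> : H\<^sup>2 \<rightarrow> L\<^sup>2\<close>.\<close>

definition helmholtz_inv :: "real \<Rightarrow> real \<Rightarrow> (real^3 \<Rightarrow> real) \<Rightarrow> real^3 \<Rightarrow> real" where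
  "helmholtz_inv L \<alpha> f = (SOME u. u \<in> sobolev L 2 \<and> (AE x in lborel. helmholtz L \<alpha> u x = f x))"

definition deconv :: "real \<Rightarrow> real \<Rightarrow> nat \<Rightarrow> (real^3 \<Rightarrow> real) \<Rightarrow> real^3 \<Rightarrow> real" where
  "deconv L \<alpha> N f x = (\<Sum>n\<le>N. ((\<lambda>g y. g y - helmholtz_inv L \<alpha> g y) ^^ n) f x)"

definition componentwise ::
  "((real^3 \<Rightarrow> 'a) \<Rightarrow> real^3 \<Rightarrow> 'a) \<Rightarrow> (real^3 \<Rightarrow> 'a^3) \<Rightarrow> real^3 \<Rightarrow> 'a^3" where
  "componentwise F v x = (\<chi> i. F (\<lambda>y. v y $ i) x)"

definition G_vec :: "real \<Rightarrow> real \<Rightarrow> (real^3 \<Rightarrow> real^3) \<Rightarrow> real^3 \<Rightarrow> real^3" where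
  "G_vec L \<alpha> = componentwise (helmholtz_inv L \<alpha>)"

definition G_ten :: "real \<Rightarrow> real \<Rightarrow> (real^3 \<Rightarrow> real^3^3) \<Rightarrow> real^3 \<Rightarrow> real^3^3" where
  "G_ten L \<alpha> = componentwise (componentwise (helmholtz_inv L \<alpha>))"

definition D_vec :: "real \<Rightarrow> real \<Rightarrow> nat \<Rightarrow> (real^3 \<Rightarrow> real^3) \<Rightarrow> real^3 \<Rightarrow> real^3" where
  "D_vec L \<alpha> N = componentwise (deconv L \<alpha> N)"

definition tensor :: "(real^3 \<Rightarrow> real^3) \<Rightarrow> (real^3 \<Rightarrow> real^3) \<Rightarrow> real^3 \<Rightarrow> real^3^3" where
  "tensor a c x = (\<chi> i j. a x $ i * c x $ j)"

subsection \<open>Time-dependent fields\<close>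

definition jointly_measurable :: "real \<Rightarrow> (real \<Rightarrow> real^3 \<Rightarrow> 'a::real_normed_vector) \<Rightarrow> bool" where
  "jointly_measurable T u \<longleftrightarrow>
     set_borel_measurable borel ({0..T} \<times> UNIV) (\<lambda>p. u (fst p) (snd p))"

text \<open>
  The Bochner space \<open>L\<^sup>2([0,T]; X)\<close> for a space \<open>X\<close> with norm \<open>N\<close> that embeds continuously into the
  (separable) \<open>L\<^sup>2\<close> space of the torus: strongly measurable functions of time with values in such
  an \<open>X\<close> are exactly those with a jointly measurable representative. Time integrals below use the
  complete measure \<open>lebesgue\<close> since the fields belong to \<open>X\<close> only for almost every time.
\<close>

definition L2_time :: "real \<Rightarrow> (real^3 \<Rightarrow> 'a::real_normed_vector) set \<Rightarrow>
    ((real^3 \<Rightarrow> 'a) \<Rightarrow> real) \<Rightarrow> (real \<Rightarrow> real^3 \<Rightarrow> 'a) set" where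
  "L2_time T X N = {u. jointly_measurable T u \<and>
     (AE t in lebesgue. t \<in> {0..T} \<longrightarrow> u t \<in> X) \<and>
     set_integrable lebesgue {0..T} (\<lambda>t. (N (u t))\<^sup>2)}"

definition C_time :: "real \<Rightarrow> (real^3 \<Rightarrow> 'a::real_normed_vector) set \<Rightarrow>
    ((real^3 \<Rightarrow> 'a) \<Rightarrow> real) \<Rightarrow> (real \<Rightarrow> real^3 \<Rightarrow> 'a) set" where
  "C_time T X N = {u. (\<forall>t\<in>{0..T}. u t \<in> X) \<and>
     (\<forall>t\<in>{0..T}. ((\<lambda>s. N (\<lambda>x. u s x - u t x)) \<longlongrightarrow> 0) (at t within {0..T}))}"

definition L2_space_time :: "real \<Rightarrow> real \<Rightarrow> (real \<Rightarrow> real^3 \<Rightarrow> real^3) set" where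
  "L2_space_time L T = {f. jointly_measurable T f \<and> (\<forall>t\<in>{0..T}. periodic L (f t)) \<and>
     set_integrable lborel ({0..T} \<times> cell L) (\<lambda>p. (norm (f (fst p) (snd p)))\<^sup>2)}"

definition zero_mean :: "real \<Rightarrow> real \<Rightarrow>
    (real \<Rightarrow> real^3 \<Rightarrow> 'a::{banach, second_countable_topology}) \<Rightarrow> bool" where
  "zero_mean L T u \<longleftrightarrow> (AE t in lebesgue. t \<in> {0..T} \<longrightarrow> torus_integral L (u t) = 0)"

definition time_test :: "real \<Rightarrow> (real \<Rightarrow> real) set" where
  "time_test T = {\<phi>. (\<forall>n t. ((deriv ^^ n) \<phi>) differentiable (at t)) \<and>
     (\<exists>a b. 0 < a \<and> b < T \<and> (\<forall>t. t \<notin> {a..b} \<longrightarrow> \<phi> t = 0))}"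

text \<open>
  \<open>w'\<close> is the derivative of \<open>w\<close> in the sense of vector-valued distributions on \<open>(0,T)\<close>; the
  Bochner integrals in time are evaluated pointwise almost everywhere in space.
\<close>

definition time_derivative ::
  "real \<Rightarrow> (real \<Rightarrow> real^3 \<Rightarrow> real^3) \<Rightarrow> (real \<Rightarrow> real^3 \<Rightarrow> real^3) \<Rightarrow> bool" where
  "time_derivative T w w' \<longleftrightarrow> (\<forall>\<phi>\<in>time_test T. AE x in lborel.
     (LINT t:{0..T}|lebesgue. deriv \<phi> t *\<^sub>R w t x) = - (LINT t:{0..T}|lebesgue. \<phi> t *\<^sub>R w' t x))"

definition spacetime_integral :: "real \<Rightarrow> real \<Rightarrow> (real \<Rightarrow> real^3 \<Rightarrow> real) \<Rightarrow> real" where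
  "spacetime_integral L T F = (LINT t:{0..T}|lebesgue. torus_integral L (F t))"

text \<open>
  In the weak formulation \<open>M : M'\<close> is the inner product \<open>M \<bullet> M'\<close> of \<open>real^3^3\<close>. The iterated
  integrals do not depend on the representatives chosen by \<open>wpartial\<close> and \<open>helmholtz_inv\<close> at each
  time (these need not be jointly measurable).
\<close>

definition regular_weak_solution ::
  "real \<Rightarrow> real \<Rightarrow> real \<Rightarrow> real \<Rightarrow> real \<Rightarrow> real \<Rightarrow> nat \<Rightarrow> nat \<Rightarrow>
   (real^3 \<Rightarrow> real^3) \<Rightarrow> (real^3 \<Rightarrow> real^3) \<Rightarrow> (real \<Rightarrow> real^3 \<Rightarrow> real^3) \<Rightarrow>
   (real \<Rightarrow> real^3 \<Rightarrow> real^3) \<Rightarrow> (real \<Rightarrow> real^3 \<Rightarrow> real^3) \<Rightarrow> (real \<Rightarrow> real^3 \<Rightarrow> real) \<Rightarrow> bool" where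
  "regular_weak_solution L T \<nu> \<mu> \<alpha>1 \<alpha>2 N1 N2 u0 B0 f w b q \<longleftrightarrow>
     w \<in> L2_time T (Hsol L 2) (Hsol_norm L 2) \<inter> C_time T (Hsol L 1) (Hsol_norm L 1) \<and>
     b \<in> L2_time T (Hsol L 2) (Hsol_norm L 2) \<inter> C_time T (Hsol L 1) (Hsol_norm L 1) \<and>
     q \<in> L2_time T (sobolev L 1) (sobolev_norm L 1) \<and> zero_mean L T q \<and>
     ((\<lambda>t. Hsol_norm L 1 (\<lambda>x. w t x - G_vec L \<alpha>1 u0 x)) \<longlongrightarrow> 0) (at_right 0) \<and>
     ((\<lambda>t. Hsol_norm L 1 (\<lambda>x. b t x - G_vec L \<alpha>2 B0 x)) \<longlongrightarrow> 0) (at_right 0) \<and>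
     (\<exists>w' b'.
        w' \<in> L2_time T (Hsol L 0) (Hsol_norm L 0) \<and> time_derivative T w w' \<and>
        b' \<in> L2_time T (Hsol L 0) (Hsol_norm L 0) \<and> time_derivative T b b' \<and>
        (\<forall>v. (\<forall>i. (\<lambda>t x. v t x $ i) \<in> L2_time T (sobolev L 1) (sobolev_norm L 1)) \<longrightarrow>
             spacetime_integral L T (\<lambda>t x. w' t x \<bullet> v t x)
           - spacetime_integral L T (\<lambda>t x.
               G_ten L \<alpha>1 (tensor (D_vec L \<alpha>1 N1 (w t)) (D_vec L \<alpha>1 N1 (w t))) x \<bullet> wjacobian L (v t) x)
           + spacetime_integral L T (\<lambda>t x.
               G_ten L \<alpha>1 (tensor (D_vec L \<alpha>2 N2 (b t)) (D_vec L \<alpha>2 N2 (b t))) x \<bullet> wjacobian L (v t) x)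
           + spacetime_integral L T (\<lambda>t x. wgrad L (q t) x \<bullet> v t x)
           + \<nu> * spacetime_integral L T (\<lambda>t x. wjacobian L (w t) x \<bullet> wjacobian L (v t) x)
           = spacetime_integral L T (\<lambda>t x. G_vec L \<alpha>1 (f t) x \<bullet> v t x)) \<and>
        (\<forall>h. (\<forall>i. (\<lambda>t x. h t x $ i) \<in> L2_time T (sobolev L 1) (sobolev_norm L 1)) \<longrightarrow>
             spacetime_integral L T (\<lambda>t x. b' t x \<bullet> h t x)
           - spacetime_integral L T (\<lambda>t x.
               G_ten L \<alpha>2 (tensor (D_vec L \<alpha>2 N2 (b t)) (D_vec L \<alpha>1 N1 (w t))) x \<bullet> wjacobian L (h t) x)
           + spacetime_integral L T (\<lambda>t x.
               G_ten L \<alpha>2 (tensor (D_vec L \<alpha>1 N1 (w t)) (D_vec L \<alpha>2 N2 (b t))) x \<bullet> wjacobian L (h t) x)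
           + \<mu> * spacetime_integral L T (\<lambda>t x. wjacobian L (b t) x \<bullet> wjacobian L (h t) x)
           = 0))"

end

theory Submission
  imports Defs
begin

text \<open>
  On Fourier coefficients the filters, deconvolutions and the Leray projection are multipliers, and the
  two derivatives gained by \<open>G\<^sub>i\<close> make the nonlinearity locally Lipschitz on \<open>h\<^sup>1\<close>. Duhamel's formula with a
  radial cutoff of the unknown is solved by Picard iteration; testing with \<open>A\<^sub>1 D\<^sub>1 w\<close> and \<open>A\<^sub>2 D\<^sub>2 b\<close>
  cancels the trilinear terms, and the resulting energy bound shows that the cutoff is inactive on \<open>[0,T]\<close>.
  The pressure is the gradient part removed by the Leray projection. Conversely, the coefficients of any
  regular weak solution solve the same Duhamel equation, to which Gronwall's lemma applies.
\<close>

text \<open>The fields are given at each time only up to null sets, and \<open>helmholtz_inv\<close>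
  and \<open>wpartial\<close> choose representatives separately at every time, so these need not be
  measurable in time. Fourier coefficients do not see such choices and are Borel functions of time;
  therefore all estimates are made on sequences, and the way back to fields is a reconstruction that
  is jointly measurable in time and space by construction. Sobolev embedding is replaced by one
  lattice sum: in dimension three the sum of \<open>1 / jap^2\<close> converges, so convolution maps
  h^1 x h^1 to l^2, and the divergence then costs one derivative. The cutoff multiplies by a scalar.
  This makes the Picard map globally Lipschitz on all of \<open>[0,T]\<close> at once, without
  continuation of local solutions, and it does not disturb the cancellation. The energy bound is
  therefore independent of the radius, and the radius can be chosen after it.\<close>

abbreviation "BMs \<equiv> borel_measurable"
abbreviation "BM \<equiv> borel_measurable borel"
abbreviation "SI \<equiv> set_integrable lborel"
abbreviation "ST \<equiv> spacetime_integral"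
abbreviation infy :: ennreal where "infy \<equiv> \<infinity>"
abbreviation "NI A f \<equiv> (\<integral>\<^sup>+x\<in>A. f x \<partial>lborel)"
abbreviation nn_cs :: "('a \<Rightarrow> ennreal) \<Rightarrow> ennreal" (binder "SN " 10) where "nn_cs f \<equiv> integral\<^sup>N (count_space UNIV) f"
abbreviation nn_lb :: "('a::euclidean_space \<Rightarrow> ennreal) \<Rightarrow> ennreal" (binder "LN " 10) where "nn_lb f \<equiv> integral\<^sup>N lborel f"
abbreviation iff_ASC (infixr "<->" 25) where "p <-> q \<equiv> (p::bool) = q"
notation scaleR (infixr "*R" 75)
notation inner (infixl "<.>" 70)
notation pair_measure (infixr "<*M>" 80)
notation LIMSEQ (infixr "---->" 60)
notation tendsto (infixr "--->" 55)

lemmas bint_cong = Bochner_Integration.integral_cong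
lemmas bochner_add = Bochner_Integration.integral_add
lemmas bochner_diff = Bochner_Integration.integral_diff
lemmas bochner_nonneg = Bochner_Integration.integral_nonneg
lemmas bochner_mono = Bochner_Integration.integral_mono
lemmas bochner_sum = Bochner_Integration.integral_sum
lemmas bochnerI_add = Bochner_Integration.integrable_add
lemmas bochnerI_diff = Bochner_Integration.integrable_diff
lemmas bochnerI_bound = Bochner_Integration.integrable_bound
lemmas bochnerI_sum = Bochner_Integration.integrable_sum
lemmas bochnerI_cong = Bochner_Integration.integrable_cong
lemmas bm_cont = borel_measurable_continuous_onI
lemmas bm_cs_integral = sigma_finite_measure.borel_measurable_lebesgue_integral[OF sigma_finite_measure_count_space]
lemmas sli_def = set_lebesgue_integral_def
lemmas si_def = set_integrable_def
lemmas si_subset = set_integrable_subset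
lemmas mult_lt_top = ennreal_mult_less_top
lemmas mult_lmono = mult_left_mono
lemmas m_comp = measurable_compose
lemmas scaleR_cx = scaleR_conv_of_real[where 'a=complex]

section \<open>Cauchy-Schwarz and the calculus of primitives in time\<close>

lemma int_norm2_mult:
 fixes f :: "'a => 'b::{banach,second_countable_topology}" and g :: "'a => 'c::{banach,second_countable_topology}"
 assumes [measurable]: "f : BMs M" "g : BMs M" and "integrable M (%x. (norm (f x))^2)" "integrable M (%x. (norm (g x))^2)"
 shows "integrable M (%x. norm (f x) * norm (g x))"
proof (rule bochnerI_bound)
 show "integrable M (%x. (norm (f x))^2 + (norm (g x))^2)" using assms by simp
 show "AE x in M. norm (norm (f x) * norm (g x)) <= norm ((norm (f x))^2 + (norm (g x))^2)"
 proof (rule AE_I2)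
  fix x
  have "2 * norm (f x) * norm (g x) <= (norm (f x))^2 + (norm (g x))^2" by (rule sum_squares_bound)
  moreover have "0 <= norm (f x) * norm (g x)" by simp
  ultimately have "norm (f x) * norm (g x) <= (norm (f x))^2 + (norm (g x))^2" by linarith
  thus "norm (norm (f x) * norm (g x)) <= norm ((norm (f x))^2 + (norm (g x))^2)" by simp
 qed
qed simp

lemma integral_norm2_CS:
 fixes f :: "'a => 'b::{banach,second_countable_topology}" and g :: "'a => 'c::{banach,second_countable_topology}"
 assumes [measurable]: "f : BMs M" "g : BMs M"
  and f: "integrable M (%x. (norm (f x))^2)" and g: "integrable M (%x. (norm (g x))^2)"
 shows "(LINT x|M. norm (f x) * norm (g x))^2 <= (LINT x|M. (norm (f x))^2) * (LINT x|M. (norm (g x))^2)"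
proof -
 have i: "integrable M (%x. norm (f x) * norm (g x))" by (rule int_norm2_mult[OF assms])
 have "(\<integral>\<^sup>+x. ennreal (norm (f x)) * ennreal (norm (g x)) \<partial>M)^2
  <= (\<integral>\<^sup>+x. (ennreal (norm (f x)))^2 \<partial>M) * (\<integral>\<^sup>+x. (ennreal (norm (g x)))^2 \<partial>M)"
  by (rule Cauchy_Schwarz_nn_integral) auto
 also have "(\<integral>\<^sup>+x. ennreal (norm (f x)) * ennreal (norm (g x)) \<partial>M) = ennreal (LINT x|M. norm (f x) * norm (g x))"
  by (subst nn_integral_eq_integral[OF i, symmetric]) (auto simp: ennreal_mult)
 also have "(\<integral>\<^sup>+x. (ennreal (norm (f x)))^2 \<partial>M) = ennreal (LINT x|M. (norm (f x))^2)"
  by (subst nn_integral_eq_integral[OF f, symmetric]) (auto simp: ennreal_power)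
 also have "(\<integral>\<^sup>+x. (ennreal (norm (g x)))^2 \<partial>M) = ennreal (LINT x|M. (norm (g x))^2)"
  by (subst nn_integral_eq_integral[OF g, symmetric]) (auto simp: ennreal_power)
 finally show ?thesis by (simp add: ennreal_power ennreal_mult[symmetric] ennreal_le_iff)
qed

lemma integrable_bilinear_pair:
 fixes F :: "real => 'a::{banach,second_countable_topology}" and G :: "real => 'b::{banach,second_countable_topology}"
  and p :: "'a => 'b => 'c::{banach,second_countable_topology}" assumes bb: "bounded_bilinear p"
  and F: "integrable lborel F" and G: "integrable lborel G"
 shows "integrable (lborel <*M> lborel) (%z. p (F (fst z)) (G (snd z)))"
proof -
 interpret bounded_bilinear p by (rule bb)
 have [measurable]: "F : BMs lborel" "G : BMs lborel" using F G by auto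
 obtain C where C: "!!a b. norm (p a b) <= norm a * norm b * C" "C > 0" using pos_bounded by blast
 have m: "(%z. p (F (fst z)) (G (snd z))) : BMs (lborel <*M> lborel)" by (rule borel_measurable_continuous_Pair[where H="p"])
  (auto intro!: continuous_on continuous_intros)
 have i: "integrable (lborel <*M> lborel) (%(x,y). norm (F x) * norm (G y))"
 proof (rule lborel_pair.Fubini_integrable)
  show "integrable lborel (%x. (LINT y|lborel. norm (case (x, y) of (x, y) => norm (F x) * norm (G y))))" using F by simp
 qed (use G in auto)
 show ?thesis
 proof (rule bochnerI_bound[OF _ m])
  show "integrable (lborel <*M> lborel) (%z. C * (case z of (x,y) => norm (F x) * norm (G y)))" using i by simp
  show "AE x in lborel <*M> lborel. norm (p (F (fst x)) (G (snd x))) <= norm (C * (case x of (x, y) => norm (F x) * norm (G y)))"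
  using C by (intro AE_I2) (auto simp: mult.commute split: prod.split)
 qed
qed

text \<open>Fubini for \<open>p (F s) (G r)\<close> on the plane cut along the diagonal: the half
  \<open>r <= s\<close> gives the first integral, the half \<open>s < r\<close> the second. Stated
  for an arbitrary bounded bilinear \<open>p\<close>, it serves inner products, scalar multiples and
  the energy form alike.\<close>

lemma bilinear_integral_split:
 fixes F :: "real => 'a::{banach,second_countable_topology}" and G :: "real => 'b::{banach,second_countable_topology}"
  and p :: "'a => 'b => 'c::{banach,second_countable_topology}" assumes bb: "bounded_bilinear p"
  and F: "integrable lborel F" and G: "integrable lborel G"
 shows "integrable lborel (%s. p (F s) (LINT r|lborel. indicator {..s} r *R G r))" (is ?A)
  and "integrable lborel (%r. p (LINT s|lborel. indicator {..r} s *R F s) (G r))" (is ?B)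
  and "p (LINT s|lborel. F s) (LINT r|lborel. G r) =
  (LINT s|lborel. p (F s) (LINT r|lborel. indicator {..s} r *R G r))
  + (LINT r|lborel. p (LINT s|lborel. indicator {..r} s *R F s) (G r))" (is ?C)
proof -
 interpret bounded_bilinear p by (rule bb)
 let ?L = "lborel <*M> lborel :: (real \<times> real) measure"
 define H where "H = (%z. p (F (fst z)) (G (snd z)))"
 have H: "integrable ?L H" unfolding H_def by (rule integrable_bilinear_pair[OF assms])
 define S where "S = {z::real\<times>real. snd z <= fst z}"
 have Sm[measurable]: "S : sets ?L"
 proof -
  have "closed S" unfolding S_def by (intro closed_Collect_le continuous_intros)
  thus ?thesis by (metis borel_closed lborel_prod sets_lborel)
 qed
 have H1: "integrable ?L (%z. indicator S z *R H z)" by (rule integrable_mult_indicator[OF Sm H])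
 have "- S : sets ?L" using sets.compl_sets[OF Sm] by (simp add: Compl_eq_Diff_UNIV space_pair_measure)
 hence H2: "integrable ?L (%z. indicator (-S) z *R H z)" by (rule integrable_mult_indicator[OF _ H])
 have GI: "integrable lborel (%r. indicator {..s} r *R G r)" for s by (rule integrable_mult_indicator[OF _ G]) auto
 have FI: "integrable lborel (%r. indicator {..s} r *R F r)" for s by (rule integrable_mult_indicator[OF _ F]) auto
 have e1: "(LINT r|lborel. indicator S (s,r) *R H (s,r)) = p (F s) (LINT r|lborel. indicator {..s} r *R G r)" for s
 proof -
  have "(LINT r|lborel. p (F s) (indicator {..s} r *R G r)) = p (F s) (LINT r|lborel. indicator {..s} r *R G r)"
  by (rule integral_bounded_linear[OF bounded_linear_right GI])
  thus ?thesis by (simp add: S_def H_def scaleR_right indicator_def)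
 qed
 have e2: "(LINT s|lborel. indicator (-S) (s,r) *R H (s,r)) = p (LINT s|lborel. indicator {..r} s *R F s) (G r)" for r
 proof -
  have "(LINT s|lborel. p (indicator {..r} s *R F s) (G r)) = p (LINT s|lborel. indicator {..r} s *R F s) (G r)"
  by (rule integral_bounded_linear[OF bounded_linear_left FI])
  \<comment> \<open>The complement of \<open>S\<close> asks for \<open>s < r\<close>, the indicator
    of \<open>{..r}\<close> for \<open>s <= r\<close>; the two sections differ in the null set
    \<open>s = r\<close>.\<close>
  moreover have "(LINT s|lborel. indicator (-S) (s,r) *R H (s,r)) = (LINT s|lborel. p (indicator {..r} s *R F s) (G r))"
  proof (rule integral_cong_AE)
  have "AE s in lborel. s ~= r" by (rule AE_lborel_singleton)
  thus "AE s in lborel. indicator (-S) (s,r) *R H (s,r) = p (indicator {..r} s *R F s) (G r)"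
  by eventually_elim (auto simp: S_def H_def scaleR_left indicator_def zero_left)
  show "(%s. indicator (- S) (s, r) *R H (s, r)) : BMs lborel" using borel_measurable_integrable[OF H2] by measurable
  show "(%s. p (indicator {..r} s *R F s) (G r)) : BMs lborel"
  by (rule borel_measurable_continuous_Pair[where H=p]) (use FI in \<open>auto intro!: continuous_on continuous_intros borel_measurable_integrable\<close>)
  qed
  ultimately show ?thesis by simp
 qed
 show ?A using lborel_pair.integrable_fst'[OF H1] by (simp only: e1)
 show ?B using lborel_pair.integrable_snd[of "%s r. indicator (-S) (s,r) *R H (s,r)"] H2
  by (simp only: e2 split_beta' prod.collapse)
 have "(\<integral>z. H z \<partial>?L) = (\<integral>z. indicator S z *R H z + indicator (-S) z *R H z \<partial>?L)"
  by (rule bint_cong) (auto simp: indicator_def)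
 also have "... = (\<integral>z. indicator S z *R H z \<partial>?L) + (\<integral>z. indicator (-S) z *R H z \<partial>?L)"
  by (rule bochner_add[OF H1 H2])
 also have "(\<integral>z. indicator S z *R H z \<partial>?L) = (LINT s|lborel. (LINT r|lborel. indicator S (s,r) *R H (s,r)))"
  by (rule lborel_pair.integral_fst'[OF H1, symmetric])
 also have "(\<integral>z. indicator (-S) z *R H z \<partial>?L) = (LINT r|lborel. (LINT s|lborel. indicator (-S) (s,r) *R H (s,r)))"
  using lborel_pair.integral_snd[of "%s r. indicator (-S) (s,r) *R H (s,r)"] H2 by (simp add: split_beta')
 also have "(\<integral>z. H z \<partial>?L) = (LINT s|lborel. (LINT r|lborel. H (s,r)))"
  by (rule lborel_pair.integral_fst'[OF H, symmetric])
 also have "... = (LINT s|lborel. p (F s) (LINT r|lborel. G r))"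
  unfolding H_def by (simp add: integral_bounded_linear[OF bounded_linear_right G])
 also have "... = p (LINT s|lborel. F s) (LINT r|lborel. G r)" by (rule integral_bounded_linear[OF bounded_linear_left F])
 finally show ?C by (simp only: e1 e2)
qed

text \<open>Functions of the form \<open>f0 + \<integral>\<^sub>0\<^sup>t f'\<close> obey the product rule; no differentiation theorem is needed.\<close>

lemma ac_product_rule:
 fixes f' :: "real => 'a::{banach,second_countable_topology}" and g' :: "real => 'b::{banach,second_countable_topology}"
  and p :: "'a => 'b => 'c::{banach,second_countable_topology}" assumes bb: "bounded_bilinear p"
  and f': "SI {0..T} f'" and g': "SI {0..T} g'" and f: "!!t. t : {0..T} ==> f t = f0 + (LBINT s:{0..t}. f' s)"
  and g: "!!t. t : {0..T} ==> g t = g0 + (LBINT s:{0..t}. g' s)" and t: "t : {0..T}"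
 shows "SI {0..t} (%s. p (f' s) (g s) + p (f s) (g' s))"
  and "p (f t) (g t) = p f0 g0 + (LBINT s:{0..t}. p (f' s) (g s) + p (f s) (g' s))"
proof -
 interpret bounded_bilinear p by (rule bb)
 define F where "F = (%s. indicator {0..t} s *R f' s)"
 define G where "G = (%s. indicator {0..t} s *R g' s)"
 have sub: "{0..t} \<subseteq> {0..T}" using t by auto
 have F: "integrable lborel F" using si_subset[OF f' _ sub] by (simp add: si_def F_def)
 have G: "integrable lborel G" using si_subset[OF g' _ sub] by (simp add: si_def G_def)
 have f1: "f s = f0 + (LINT r|lborel. indicator {..s} r *R F r)" if "s : {0..t}" for s
 proof -
  have "f s = f0 + (LBINT r:{0..s}. f' r)" using f that t by auto
  also have "(LBINT r:{0..s}. f' r) = (LINT r|lborel. indicator {..s} r *R F r)" unfolding sli_def F_def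
  by (rule bint_cong) (use that in \<open>auto simp: indicator_def\<close>)
  finally show ?thesis .
 qed
 have g1: "g s = g0 + (LINT r|lborel. indicator {..s} r *R G r)" if "s : {0..t}" for s
 proof -
  have "g s = g0 + (LBINT r:{0..s}. g' r)" using g that t by auto
  also have "(LBINT r:{0..s}. g' r) = (LINT r|lborel. indicator {..s} r *R G r)" unfolding sli_def G_def
  by (rule bint_cong) (use that in \<open>auto simp: indicator_def\<close>)
  finally show ?thesis .
 qed
 note sp = bilinear_integral_split[OF bb F G]
 have iF: "integrable lborel (%s. p (F s) g0)" using integrable_bounded_linear[OF bounded_linear_left F] .
 have iG: "integrable lborel (%s. p f0 (G s))" using integrable_bounded_linear[OF bounded_linear_right G] .
 have eq: "indicator {0..t} s *R (p (f' s) (g s) + p (f s) (g' s)) =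
  (p (F s) g0 + p (F s) (LINT r|lborel. indicator {..s} r *R G r)) +
  (p f0 (G s) + p (LINT r|lborel. indicator {..s} r *R F r) (G s))" for s
 proof (cases "s : {0..t}")
  case True
  hence "F s = f' s" "G s = g' s" by (auto simp: F_def G_def)
  thus ?thesis using True by (simp add: f1[OF True] g1[OF True] add_left add_right)
 next
  case False
  hence "F s = 0" "G s = 0" by (auto simp: F_def G_def)
  thus ?thesis using False by (simp add: zero_left zero_right)
 qed
 show "SI {0..t} (%s. p (f' s) (g s) + p (f s) (g' s))" unfolding si_def eq using iF iG sp(1,2) by (intro bochnerI_add)
 have t0: "t : {0..t}" using t by auto
 have F0: "(LINT r|lborel. indicator {..t} r *R F r) = (LINT r|lborel. F r)" by (rule bint_cong) (auto simp: F_def indicator_def)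
 have G0: "(LINT r|lborel. indicator {..t} r *R G r) = (LINT r|lborel. G r)" by (rule bint_cong) (auto simp: G_def indicator_def)
 have "(LBINT s:{0..t}. p (f' s) (g s) + p (f s) (g' s)) =
  ((LINT s|lborel. p (F s) g0) + (LINT s|lborel. p (F s) (LINT r|lborel. indicator {..s} r *R G r))) +
  ((LINT s|lborel. p f0 (G s)) + (LINT s|lborel. p (LINT r|lborel. indicator {..s} r *R F r) (G s)))"
  unfolding sli_def eq using iF iG sp(1,2) by (simp add: bochner_add bochnerI_add)
 also have "(LINT s|lborel. p (F s) g0) = p (LINT s|lborel. F s) g0" by (rule integral_bounded_linear[OF bounded_linear_left F])
 also have "(LINT s|lborel. p f0 (G s)) = p f0 (LINT s|lborel. G s)" by (rule integral_bounded_linear[OF bounded_linear_right G])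
 finally show "p (f t) (g t) = p f0 g0 + (LBINT s:{0..t}. p (f' s) (g s) + p (f s) (g' s))"
  using sp(3) by (simp add: f1[OF t0] g1[OF t0] F0 G0 add_left add_right)
qed


lemma norm2_ac:
 fixes c' :: "real => 'a::euclidean_space" assumes c': "SI {0..T} c'"
  and c: "!!t. t : {0..T} ==> c t = c0 + (LBINT s:{0..t}. c' s)" and t: "t : {0..T}" shows "SI {0..t} (%s. 2 * (c s <.> c' s))"
  and "(norm (c t))^2 = (norm c0)^2 + (LBINT s:{0..t}. 2 * (c s <.> c' s))"
proof -
 have e: "c' s <.> c s + c s <.> c' s = 2 * (c s <.> c' s)" for s by (simp add: inner_commute)
 note r = ac_product_rule[OF bounded_bilinear_inner c' c' c c t, unfolded e]
 show "SI {0..t} (%s. 2 * (c s <.> c' s))" by (rule r(1))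
 show "(norm (c t))^2 = (norm c0)^2 + (LBINT s:{0..t}. 2 * (c s <.> c' s))" using r(2) by (simp only: power2_norm_eq_inner)
qed

text \<open>By coercivity and Young's inequality \<open>2 * (c <.> (- A c + N))\<close> is at most
  \<open>(norm N)^2 / (2 * ka)\<close>. The factor \<open>1 / ka\<close> matters: with
  \<open>ka\<close> of the order of the squared wave-number it is the derivative gained from the
  viscosity.\<close>

lemma dissipative_ode_bound:
 fixes c :: "real => 'a::euclidean_space" assumes i: "SI {0..T} (%s. - A (c s) + N s)"
  and c: "!!t. t : {0..T} ==> c t = c0 + (LBINT s:{0..t}. - A (c s) + N s)"
  and t: "t : {0..T}" and ka: "ka > 0" and A: "!!x. x <.> A x \<ge> ka * (norm x)^2" and N: "SI {0..T} (%s. (norm (N s))^2)"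
 shows "(norm (c t))^2 <= (norm c0)^2 + 1 / (2 * ka) * (LBINT s:{0..t}. (norm (N s))^2)"
proof -
 note e = norm2_ac[OF i c t]
 have N': "SI {0..t} (%s. (norm (N s))^2)" by (rule si_subset[OF N]) (use t in auto)
 have "(LBINT s:{0..t}. 2 * (c s <.> (- A (c s) + N s))) <= (LBINT s:{0..t}. 1 / (2 * ka) * (norm (N s))^2)"
 proof (rule set_integral_mono)
  show "SI {0..t} (%s. 1 / (2 * ka) * (norm (N s))^2)" using N' by simp
  fix s
  let ?a = "norm (c s)" and ?b = "norm (N s)"
  have "c s <.> (- A (c s) + N s) <= - ka * ?a^2 + ?a * ?b"
  using A[of "c s"] norm_cauchy_schwarz[of "c s" "N s"] by (simp add: inner_add_right inner_diff_right)
  moreover have "0 <= (2 * ka * ?a - ?b)^2" by simp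
  hence "4 * ka * (- ka * ?a^2 + ?a * ?b) <= ?b^2" by (simp add: power2_eq_square algebra_simps)
  hence "2 * (- ka * ?a^2 + ?a * ?b) <= 1 / (2 * ka) * ?b^2" using ka by (simp add: field_simps)
  ultimately show "2 * (c s <.> (- A (c s) + N s)) <= 1 / (2 * ka) * ?b^2" by (meson mult_lmono order_trans zero_le_numeral)
 qed (use e in auto)
 with e(2) show ?thesis by simp
qed

text \<open>Variation of constants for \<open>c' = - ka c + N\<close>. With the weight
  \<open>exp (ka * s)\<close> under the integral it is a product of two primitives, so the product
  rule yields the equation.\<close>

definition duhamel :: "real => 'a => (real => 'a::{banach,second_countable_topology}) => real => 'a" where
 "duhamel ka c0 N t = exp (- ka * t) *R (c0 + (LBINT s:{0..t}. exp (ka * s) *R N s))"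

lemma si_scaleR:
 fixes f :: "'a => 'b::{banach,second_countable_topology}"
 assumes f: "set_integrable M A f" and A: "A : sets M" and h: "h : BMs M" and b: "!!x. x : A ==> \<bar>h x\<bar> <= C"
 shows "set_integrable M A (%x. h x *R f x)"
proof -
 have "integrable M (%x. C *R norm (indicator A x *R f x))"
  using f unfolding si_def by (intro integrable_scaleR_right integrable_norm)
 thus ?thesis unfolding si_def
 proof (rule bochnerI_bound)
  have "(%x. indicator A x *R f x) : BMs M" using f by (auto simp: si_def)
  hence "(%x. h x *R (indicator A x *R f x)) : BMs M" by (rule borel_measurable_scaleR[OF h])
  thus "(%x. indicator A x *R h x *R f x) : BMs M" by (simp add: mult.commute)
  show "AE x in M. norm (indicator A x *R h x *R f x) <= norm (C *R norm (indicator A x *R f x))"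
  proof (rule AE_I2)
  fix x show "norm (indicator A x *R h x *R f x) <= norm (C *R norm (indicator A x *R f x))"
  using b[of x] by (cases "x : A") (auto intro!: mult_right_mono)
  qed
 qed
qed

lemma exp_integral_FTC:
 fixes t ka :: real assumes "0 <= t" shows "SI {0..t} (%s. - ka * exp (- ka * s))"
  and "exp (- ka * t) = 1 + (LBINT s:{0..t}. - ka * exp (- ka * s))"
proof -
 show i: "SI {0..t} (%s. - ka * exp (- ka * s))" by (rule borel_integrable_atLeastAtMost') (intro continuous_intros)
 have "(LINT s|lborel. (- ka * exp (- ka * s)) * indicator {0..t} s) = exp (- ka * t) - exp (- ka * 0)"
  by (rule integral_FTC_Icc_real[OF assms]) (auto intro!: derivative_eq_intros continuous_intros)
 thus "exp (- ka * t) = 1 + (LBINT s:{0..t}. - ka * exp (- ka * s))" by (simp add: sli_def mult.commute)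
qed

lemma duhamel_ode:
 fixes N :: "real => 'a::{banach,second_countable_topology}" assumes N: "SI {0..T} N" and t: "t : {0..T}"
 shows "SI {0..t} (%s. - ka *R duhamel ka c0 N s + N s)"
  and "duhamel ka c0 N t = c0 + (LBINT s:{0..t}. - ka *R duhamel ka c0 N s + N s)"
proof -
 let ?g = "%t. c0 + (LBINT s:{0..t}. exp (ka * s) *R N s)"
 have g': "SI {0..T} (%s. exp (ka * s) *R N s)"
 proof (rule si_scaleR[OF N, where C="exp (\<bar>ka\<bar> * T)"])
  fix x assume "x : {0..T}"
  hence "ka * x <= \<bar>ka\<bar> * T" by (intro mult_mono) auto
  thus "\<bar>exp (ka * x)\<bar> <= exp (\<bar>ka\<bar> * T)" by simp
 qed auto
 have T: "0 <= T" using t by auto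
 note r = ac_product_rule[OF bounded_bilinear_scaleR exp_integral_FTC(1)[OF T] g' exp_integral_FTC(2) refl t,
  of ka c0, simplified scaleR_one]
 have eq: "(- ka * exp (- ka * s)) *R ?g s + exp (- ka * s) *R exp (ka * s) *R N s = - ka *R duhamel ka c0 N s + N s" for s
  by (simp add: duhamel_def exp_minus)
 show "SI {0..t} (%s. - ka *R duhamel ka c0 N s + N s)" using r(1) unfolding eq by simp
 show "duhamel ka c0 N t = c0 + (LBINT s:{0..t}. - ka *R duhamel ka c0 N s + N s)"
  using r(2) unfolding eq by (simp add: duhamel_def)
qed

section \<open>Smooth test functions of time and weak derivatives\<close>

fun smooth_upto :: "nat => (real => real) => bool" where
 "smooth_upto 0 f <-> (\<forall>t. f differentiable (at t))"
| "smooth_upto (Suc n) f <-> (\<forall>t. f differentiable (at t)) & smooth_upto n (deriv f)"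

lemma smooth_upto_Suc: "smooth_upto (Suc n) f ==> smooth_upto n f" by (induction n arbitrary: f) auto

text \<open>Links the recursive notion, whose closure under sums, products and affine substitution
  is an induction, with the iterated derivatives required by \<open>time_test\<close>.\<close>

lemma smooth_upto_funpow: "smooth_upto n f ==> (deriv ^^ n) f differentiable (at t)"
proof (induction n arbitrary: f)
 case (Suc n)
 thus ?case by (simp add: funpow_swap1)
qed simp

lemma deriv_real_eqI: "(!!t. (f has_real_derivative f' t) (at t)) ==> deriv f = f'" by (auto intro: DERIV_imp_deriv)

lemma diff_deriv: "f differentiable (at t) ==> (f has_real_derivative deriv f t) (at t)" for f :: "real => real"
 by (simp add: DERIV_deriv_iff_real_differentiable)

lemma smooth_upto_const: "smooth_upto n (%x. c)" by (induction n arbitrary: c) auto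

lemma smooth_upto_add: "smooth_upto n f ==> smooth_upto n g ==> smooth_upto n (%x. f x + g x)"
proof (induction n arbitrary: f g)
 case (Suc n)
 have "deriv (%x. f x + g x) = (%x. deriv f x + deriv g x)" using Suc.prems by (intro deriv_real_eqI DERIV_add diff_deriv) auto
 thus ?case using Suc by simp
qed simp

lemma smooth_upto_mult: "smooth_upto n f ==> smooth_upto n g ==> smooth_upto n (%x. f x * g x)"
proof (induction n arbitrary: f g)
 case (Suc n)
 have "deriv (%x. f x * g x) = (%x. deriv f x * g x + deriv g x * f x)"
  using Suc.prems by (intro deriv_real_eqI DERIV_mult diff_deriv) auto
 thus ?case using Suc smooth_upto_Suc by (simp add: smooth_upto_add)
qed simp

lemma smooth_upto_affine: "smooth_upto n f ==> smooth_upto n (%x. f (a * x + b))"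
proof (induction n arbitrary: f)
 case 0
 hence "!!t. ((%x. f (a * x + b)) has_real_derivative deriv f (a * t + b) * a) (at t)"
  by (intro DERIV_chain'[where f="%x. a * x + b"] diff_deriv) (auto intro!: derivative_eq_intros)
 thus ?case using real_differentiable_def by auto
next
 case (Suc n)
 hence d: "!!t. ((%x. f (a * x + b)) has_real_derivative deriv f (a * t + b) * a) (at t)"
  by (intro DERIV_chain'[where f="%x. a * x + b"] diff_deriv) (auto intro!: derivative_eq_intros)
 have "deriv (%x. f (a * x + b)) = (%x. deriv f (a * x + b) * a)" by (rule deriv_real_eqI[OF d])
 thus ?case using Suc d real_differentiable_def by (auto intro!: smooth_upto_mult smooth_upto_const)
qed

text \<open>The family \<open>p (1/x) exp (-1/x)\<close> on the positive axis is closed under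
  differentiation, with \<open>p\<close> going to \<open>X^2 (p - p')\<close>; no formula for the
  higher derivatives of \<open>exp (-1/x)\<close> has to be found.\<close>

definition flat_exp :: "real poly => real => real" where
 "flat_exp p x = (if x > 0 then poly p (1 / x) * exp (- (1 / x)) else 0)"

lemma poly_exp_tendsto_0: "((%x::real. poly p x * exp (- x)) ---> 0) at_top"
proof -
 have "((%x. \<Sum>i\<le>degree p. coeff p i * (x ^ i / exp x)) ---> (\<Sum>i\<le>degree p. coeff p i * 0)) at_top"
  by (intro tendsto_sum tendsto_mult tendsto_const tendsto_power_div_exp_0)
 moreover have "(%x. \<Sum>i\<le>degree p. coeff p i * (x ^ i / exp x)) = (%x. poly p x * exp (- x))"
  by (auto simp: poly_altdef sum_distrib_right exp_minus field_simps sum_divide_distrib)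
 ultimately show ?thesis by simp
qed

lemma flat_exp_DERIV:
 "(flat_exp p has_real_derivative flat_exp (monom 1 2 * (p - pderiv p)) x) (at x)"
proof -
 consider "x > 0" | "x < 0" | "x = 0" by linarith
 thus ?thesis
 proof cases
  case 1
  have "((%x. poly p (1 / x) * exp (- (1 / x))) has_real_derivative flat_exp (monom 1 2 * (p - pderiv p)) x) (at x)"
  using 1 by (auto intro!: derivative_eq_intros DERIV_chain'[where g="poly p"] poly_DERIV
  simp: flat_exp_def poly_monom power2_eq_square field_simps)
  thus ?thesis by (rule DERIV_cong_ev[THEN iffD1, rotated -1, OF _ refl])
  (use 1 eventually_nhds_in_open[of "{0<..}" x] in \<open>auto simp: flat_exp_def elim!: eventually_mono\<close>)
 next
  case 2
  have "((%x. 0) has_real_derivative flat_exp (monom 1 2 * (p - pderiv p)) x) (at x)" using 2 by (simp add: flat_exp_def)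
  thus ?thesis by (rule DERIV_cong_ev[THEN iffD1, rotated -1, OF _ refl])
  (use 2 eventually_nhds_in_open[of "{..<0}" x] in \<open>auto simp: flat_exp_def elim!: eventually_mono\<close>)
 next
  case 3
  \<comment> \<open>At the origin the difference quotient is again of this form, with
    \<open>X p\<close> in place of \<open>p\<close>, and the exponential beats every
    polynomial.\<close>
  have "((%h. poly (monom 1 1 * p) (inverse h) * exp (- inverse h)) ---> 0) (at_right 0)"
  by (rule filterlim_compose[OF poly_exp_tendsto_0 filterlim_inverse_at_top_right])
  hence R: "((%h. flat_exp p h / h) ---> 0) (at_right 0)" by (rule Lim_transform_eventually)
  (auto simp: eventually_at_filter flat_exp_def poly_monom field_simps)
  have L: "((%h. flat_exp p h / h) ---> 0) (at_left 0)" by (rule Lim_transform_eventually[OF tendsto_const])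
  (auto simp: eventually_at_filter flat_exp_def)
  have "((%h. flat_exp p h / h) ---> 0) (at 0)" using L R by (simp add: filterlim_split_at)
  thus ?thesis using 3 by (simp add: DERIV_def flat_exp_def)
 qed
qed

lemma smooth_upto_flat_exp: "smooth_upto n (flat_exp p)"
proof (induction n arbitrary: p)
 case (Suc n)
 have "deriv (flat_exp p) = flat_exp (monom 1 2 * (p - pderiv p))" by (rule deriv_real_eqI[OF flat_exp_DERIV])
 thus ?case using Suc flat_exp_DERIV real_differentiable_def by auto
qed (use flat_exp_DERIV real_differentiable_def in auto)

definition bump :: "real => real" where
 "bump x = flat_exp 1 x * flat_exp 1 (1 - x)"

lemma bump_smooth: "smooth_upto n bump"
proof -
 have "smooth_upto n (%x. flat_exp 1 x * flat_exp 1 ((-1) * x + 1))"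
  by (intro smooth_upto_mult smooth_upto_affine smooth_upto_flat_exp)
 thus ?thesis by (simp add: bump_def[abs_def])
qed

lemma bump_nonneg: "0 <= bump x" by (simp add: bump_def flat_exp_def)
lemma bump_zero: "x \<notin> {0<..<1} ==> bump x = 0" by (auto simp: bump_def flat_exp_def)
lemma bump_pos: "x : {0<..<1} ==> bump x > 0" by (auto simp: bump_def flat_exp_def)

lemma continuous_on_bump: "continuous_on A bump" by (rule continuous_at_imp_continuous_on)
  (use bump_smooth[of 0] in \<open>auto intro: differentiable_imp_continuous_within\<close>)

text \<open>A smooth step from \<open>0\<close> to a height \<open>Z\<close> that is only known to
  be positive, as the mass of \<open>bump\<close> has no convenient value. Positivity is the mean
  value theorem on \<open>[0, 1]\<close>.\<close>

lemma ex_bump_primitive: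
 obtains \<Phi> Z where "!!x. (\<Phi> has_real_derivative bump x) (at x)" "!!x. x <= 0 ==> \<Phi> x = 0"
  "!!x. x \<ge> 1 ==> \<Phi> x = Z" "Z > (0::real)"
proof -
 have "\<exists>g. \<forall>x. (g has_real_derivative bump x) (at x)"
 proof -
  \<comment> \<open>The lower limit moves with \<open>x\<close> but stays where \<open>bump\<close>
    vanishes, so near any point \<open>h\<close> agrees with a primitive of fixed lower
    limit.\<close>
  define h where "h = (%x. integral {-\<bar>x\<bar>-1..x} bump)"
  have i: "bump integrable_on {a..b}" for a b using continuous_on_bump integrable_continuous_real by blast
  have hz: "h x = integral {-n..x} bump" if "n \<ge> \<bar>x\<bar> + 1" for x n
  proof -
  have "integral {-n..-\<bar>x\<bar>-1} bump + integral {-\<bar>x\<bar>-1..x} bump = integral {-n..x} bump"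
  using that by (intro Henstock_Kurzweil_Integration.integral_combine i) auto
  moreover have "integral {-n..-\<bar>x\<bar>-1} bump = integral {-n..-\<bar>x\<bar>-1} (%_. 0)"
  by (rule Henstock_Kurzweil_Integration.integral_cong) (auto intro!: bump_zero)
  ultimately show ?thesis by (simp add: h_def)
  qed
  have "(h has_real_derivative bump x) (at x)" for x
  proof -
  define n where "n = \<bar>x\<bar> + 2"
  have "((%u. integral {-n..u} bump) has_real_derivative bump x) (at x within {-n..n})"
  by (rule integral_has_real_derivative) (auto simp: n_def continuous_on_bump)
  hence d: "((%u. integral {-n..u} bump) has_real_derivative bump x) (at x)" by (subst (asm) at_within_Icc_at) (auto simp: n_def)
  have ev: "eventually (%u. u : ball x 1) (nhds x)" by (rule eventually_nhds_in_open) auto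
  have "h u = integral {-n..u} bump" if "u : ball x 1" for u
  by (rule hz) (use that in \<open>auto simp: n_def dist_real_def\<close>)
  hence "eventually (%u. integral {-n..u} bump = h u) (nhds x)" by (intro eventually_mono[OF ev]) simp
  thus "(h has_real_derivative bump x) (at x)" using d DERIV_cong_ev[OF refl _ refl] by metis
  qed
  thus ?thesis by blast
 qed
 then obtain g where g: "!!x. (g has_real_derivative bump x) (at x)" by blast
 have cc: "\<exists>c. \<forall>x\<in>S. g x = c" if "convex S" "S \<inter> {0<..<1} = {}" for S
 proof (rule has_field_derivative_zero_constant[OF that(1)])
  fix x assume "x : S"
  hence "bump x = 0" using that by (intro bump_zero) auto
  thus "(g has_real_derivative 0) (at x within S)" using g[of x] has_field_derivative_at_within by metis
 qed
 obtain c0 where c0: "!!x. x <= 0 ==> g x = c0" using cc[of "{..0}"] by (force simp: disjoint_iff)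
 obtain c1 where c1: "!!x. x \<ge> 1 ==> g x = c1" using cc[of "{1..}"] by (force simp: disjoint_iff)
 obtain z where "0 < z" "z < 1" "g 1 - g 0 = (1 - 0) * bump z" using MVT2[of 0 1 g bump] g by auto
 hence "g 0 < g 1" using bump_pos[of z] by auto
 hence "c1 - c0 > 0" using c0[of 0] c1[of 1] by simp
 thus ?thesis by (intro that[of "%x. g x - c0" "c1 - c0"]) (auto intro!: derivative_eq_intros g simp: c0 c1)
qed

text \<open>Du Bois-Reymond: the function \<open>g\<close> obtained by subtracting the primitive of
  \<open>h\<close> from \<open>c\<close> is continuous with vanishing distributional derivative.
  Tested with the derivative of a smooth plateau whose edges lie at \<open>s\<close> and
  \<open>t\<close>, it yields \<open>g s = g t\<close>.\<close>

lemma ac_from_weak_derivative: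
 fixes c h :: "real => 'a::euclidean_space" assumes T: "T > 0" and c: "continuous_on {0..T} c" and h: "SI {0..T} h"
  and weak: "!!ph. ph : time_test T ==>
  (LBINT t:{0..T}. deriv ph t *R c t) = - (LBINT t:{0..T}. ph t *R h t)" and t: "t : {0..T}"
 shows "c t = c 0 + (LBINT s:{0..t}. h s)"
proof -
 obtain \<Phi> Z where \<Phi>: "!!x. (\<Phi> has_real_derivative bump x) (at x)" "!!x. x <= 0 ==> \<Phi> x = 0"
  "!!x. x \<ge> 1 ==> \<Phi> x = Z" "Z > (0::real)" by (rule ex_bump_primitive) metis
 have \<Phi>s: "smooth_upto n \<Phi>" for n
 proof (cases n)
  case 0 thus ?thesis using \<Phi>(1) real_differentiable_def by auto
 next
  case (Suc m)
  have "deriv \<Phi> = bump" by (rule deriv_real_eqI[OF \<Phi>(1)])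
  thus ?thesis using Suc \<Phi>(1) real_differentiable_def bump_smooth by auto
 qed
 define I where "I = (%t. LBINT s:{0..t}. h s)"
 have Ic: "continuous_on {0..T} I"
 proof -
  have "continuous_on {0..T} (%x. integral {0..x} h)"
  by (rule indefinite_integral_continuous_1[OF set_borel_integral_eq_integral(1)[OF h]])
  moreover have "integral {0..x} h = I x" if "x : {0..T}" for x
  unfolding I_def using set_borel_integral_eq_integral(2)[of "{0..x}" h]
  si_subset[OF h, of "{0..x}"] that by auto
  ultimately show ?thesis by (metis (no_types, lifting) continuous_on_eq)
 qed
 define g where "g = (%t. c t - I t)"
 have gc: "continuous_on {0..T} g" unfolding g_def by (intro continuous_on_diff c Ic)
 \<comment> \<open>The product rule for \<open>ph\<close> and \<open>I\<close>, with
   \<open>ph\<close> vanishing at both ends, moves the weak identity from \<open>c\<close> to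
   \<open>g\<close>.\<close>
 have key: "(LBINT t:{0..T}. deriv ph t *R g t) = 0" if ph: "ph : time_test T" and dc: "continuous_on UNIV (deriv ph)" for ph
 proof -
  have dph: "(ph has_real_derivative deriv ph x) (at x)" for x
  proof -
  have "((deriv ^^ 0) ph) differentiable (at x)" using ph unfolding time_test_def by blast
  thus ?thesis by (intro diff_deriv) simp
  qed
  have di: "SI {0..T} (deriv ph)" by (rule borel_integrable_atLeastAtMost') (rule continuous_on_subset[OF dc], simp)
  obtain a b where ab: "0 < a" "b < T" "!!t. t \<notin> {a..b} ==> ph t = 0" using ph by (auto simp: time_test_def)
  have ph0: "ph 0 = 0" and phT: "ph T = 0" using ab by auto
  have phi: "ph x = 0 + (LBINT s:{0..x}. deriv ph s)" if "x : {0..T}" for x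
  proof -
  have "(LINT s|lborel. deriv ph s * indicator {0..x} s) = ph x - ph 0"
  by (rule integral_FTC_Icc_real) (use that dph dc in \<open>auto simp: continuous_on_eq_continuous_at\<close>)
  thus ?thesis using ph0 by (simp add: sli_def mult.commute)
  qed
  note r = ac_product_rule[OF bounded_bilinear_scaleR di h phi, of I 0 T, unfolded I_def, simplified]
  have ci: "SI {0..T} (%t. deriv ph t *R c t)"
  by (rule borel_integrable_atLeastAtMost') (intro continuous_on_scaleR c continuous_on_subset[OF dc], simp)
  have Ii: "SI {0..T} (%t. deriv ph t *R I t)"
  by (rule borel_integrable_atLeastAtMost') (intro continuous_on_scaleR Ic continuous_on_subset[OF dc], simp)
  have i1: "SI {0..T} (%t. deriv ph t *R I t + ph t *R h t)" using r(1) T by (simp add: I_def)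
  have i2: "SI {0..T} (%t. ph t *R h t)" using set_integral_diff(1)[OF i1 Ii] by simp
  have "0 = (LBINT t:{0..T}. deriv ph t *R I t + ph t *R h t)" using r(2) T phT by (simp add: I_def)
  also have "... = (LBINT t:{0..T}. deriv ph t *R I t) + (LBINT t:{0..T}. ph t *R h t)" by (rule set_integral_add(2)[OF Ii i2])
  finally show ?thesis using weak[OF ph] set_integral_diff(2)[OF ci Ii]
  by (simp add: g_def scaleR_diff_right) (metis add.inverse_inverse add_eq_0_iff)
 qed
 have const: "g s = g t" if st: "0 < s" "s < t" "t < T" for s t
 proof (rule ccontr)
  assume "g s ~= g t"
  \<comment> \<open>A quarter of the gap: each of the two weighted averages below misses its value
    by at most \<open>d * Z\<close>, and together they cannot bridge
    \<open>4 * d * Z\<close>.\<close>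
  define d where "d = norm (g s - g t) / 4"
  have d: "d > 0" using \<open>g s ~= g t\<close> by (simp add: d_def)
  obtain e1 where e1: "e1 > 0" "!!x. x : {0..T} ==> dist x s < e1 ==> dist (g x) (g s) < d"
  proof -
  have "\<exists>e>0. \<forall>x\<in>{0..T}. dist x s < e --> dist (g x) (g s) < d"
  by (rule gc[unfolded continuous_on_iff, rule_format]) (use d st in auto)
  thus thesis using that by blast
  qed
  obtain e2 where e2: "e2 > 0" "!!x. x : {0..T} ==> dist x t < e2 ==> dist (g x) (g t) < d"
  proof -
  have "\<exists>e>0. \<forall>x\<in>{0..T}. dist x t < e --> dist (g x) (g t) < d"
  by (rule gc[unfolded continuous_on_iff, rule_format]) (use d st in auto)
  thus thesis using that by blast
  qed
  define e where "e = Min {e1, e2, T - t} / 2"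
  have e: "e > 0" "e < e1" "e < e2" "t + e < T" using e1(1) e2(1) st by (auto simp: e_def min_def field_simps)
  define a where "a = (%r x. bump ((1/e) * x + (- r / e)) / e)"
  \<comment> \<open>A rise by \<open>Z\<close> across \<open>[s, s + e]\<close> plus a fall by
    \<open>Z\<close> across \<open>[t, t + e]\<close>; the support lies in
    \<open>[s, t + e]\<close>, hence inside \<open>(0, T)\<close>.\<close>
  define ph where "ph = (%x. \<Phi> ((1/e) * x + (- s / e)) + (-1) * \<Phi> ((1/e) * x + (- t / e)))"
  have \<Phi>d: "((%x. \<Phi> ((1/e) * x + (- r / e))) has_real_derivative a r x) (at x)" for r x
  proof -
  have "((%x. \<Phi> ((1/e) * x + (- r / e))) has_real_derivative bump ((1/e) * x + (- r / e)) * (1/e)) (at x)"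
  by (rule DERIV_chain'[OF _ \<Phi>(1)]) (use e(1) in \<open>auto intro!: derivative_eq_intros\<close>)
  thus ?thesis by (simp add: a_def)
  qed
  have phsm: "smooth_upto n ph" for n unfolding ph_def
  by (intro smooth_upto_add smooth_upto_mult smooth_upto_const smooth_upto_affine \<Phi>s)
  have phz: "ph x = 0" if xn: "x \<notin> {s..t + e}" for x
  proof -
  consider "x < s" | "x > t + e" using xn by fastforce
  thus ?thesis
  proof cases
  case 1
  hence "(1/e) * x + (- s / e) <= 0" "(1/e) * x + (- t / e) <= 0" using e(1) st by (simp_all add: field_simps)
  thus ?thesis using \<Phi>(2) by (simp add: ph_def)
  next
  case 2
  hence "(1/e) * x + (- s / e) \<ge> 1" "(1/e) * x + (- t / e) \<ge> 1" using e(1) st by (simp_all add: field_simps)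
  thus ?thesis using \<Phi>(3) by (simp add: ph_def)
  qed
  qed
  have pht: "ph : time_test T" unfolding time_test_def
  proof (rule CollectI, rule conjI)
  show "\<forall>n t. (deriv ^^ n) ph differentiable at t" using smooth_upto_funpow[OF phsm] by simp
  show "\<exists>a b. 0 < a & b < T & (\<forall>t. t \<notin> {a..b} --> ph t = 0)"
  by (rule exI[of _ s], rule exI[of _ "t + e"]) (use phz st e in blast)
  qed
  have dph: "deriv ph = (%x. a s x - a t x)"
  proof (rule deriv_real_eqI)
  fix x
  have "(ph has_real_derivative a s x + (-1) * a t x) (at x)" unfolding ph_def by (intro DERIV_add DERIV_cmult \<Phi>d)
  thus "(ph has_real_derivative a s x - a t x) (at x)" by simp
  qed
  have ac: "continuous_on UNIV (a r)" for r unfolding a_def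
  by (intro continuous_intros continuous_on_compose2[OF continuous_on_bump[of UNIV]]) (use e in auto)
  have a0: "0 <= a r x" for r x using e by (simp add: a_def bump_nonneg)
  have az: "a r x = 0" if "x \<notin> {r..r + e}" for r x
  unfolding a_def using that e(1) by (subst bump_zero) (auto simp: field_simps)
  have ai: "SI {0..T} (a r)" for r by (rule borel_integrable_atLeastAtMost') (rule continuous_on_subset[OF ac], simp)
  have aZ: "(LBINT x:{0..T}. a r x) = Z" if r: "0 < r" "r + e < T" for r
  proof -
  have "(LINT x|lborel. a r x * indicator {0..T} x) = \<Phi> ((1/e) * T + (- r / e)) - \<Phi> ((1/e) * 0 + (- r / e))"
  by (rule integral_FTC_Icc_real) (use T in linarith, rule \<Phi>d, use ac in \<open>simp add: continuous_on_eq_continuous_at\<close>)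
  also have "\<Phi> ((1/e) * T + (- r / e)) = Z" using r e by (intro \<Phi>(3)) (simp add: field_simps)
  also have "\<Phi> ((1/e) * 0 + (- r / e)) = 0" using r e by (intro \<Phi>(2)) (simp add: field_simps)
  finally show ?thesis by (simp add: sli_def mult.commute)
  qed
  have agi: "SI {0..T} (%x. a r x *R g x)" for r
  by (rule borel_integrable_atLeastAtMost') (intro continuous_on_scaleR gc continuous_on_subset[OF ac], simp)
  have est: "norm ((LBINT x:{0..T}. a r x *R g x) - Z *R g r) <= d * Z"
  if r: "0 < r" "r + e < T" and c: "!!x. x : {0..T} ==> dist x r <= e ==> dist (g x) (g r) < d" for r
  proof -
  have ii: "SI {0..T} (%x. a r x *R g r)" by (rule set_integrable_scaleR_left) (rule ai)
  have "(LBINT x:{0..T}. a r x *R g r) = Z *R g r"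
  proof -
  have "(LBINT x:{0..T}. a r x *R g r) = (LINT x|lborel. (indicator {0..T} x *R a r x) *R g r)" by (simp add: sli_def)
  also have "... = (LINT x|lborel. indicator {0..T} x *R a r x) *R g r"
  by (rule integral_scaleR_left) (use ai[of r] in \<open>simp add: si_def\<close>)
  finally show ?thesis using aZ[OF r] by (simp add: sli_def)
  qed
  hence "(LBINT x:{0..T}. a r x *R g x) - Z *R g r = (LBINT x:{0..T}. a r x *R (g x - g r))"
  using set_integral_diff(2)[OF agi ii] by (simp add: scaleR_diff_right)
  also have "norm ... <= (LBINT x:{0..T}. norm (a r x *R (g x - g r)))"
  using set_integral_diff(1)[OF agi ii] by (intro set_integral_norm_bound) (simp add: scaleR_diff_right)
  also have "... <= (LBINT x:{0..T}. d * a r x)"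
  proof (rule set_integral_mono)
  show "SI {0..T} (%x. norm (a r x *R (g x - g r)))"
  using set_integral_diff(1)[OF agi ii] by (intro set_integrable_norm) (simp add: scaleR_diff_right)
  show "SI {0..T} (%x. d * a r x)" using ai by simp
  fix x assume x: "x : {0..T}"
  show "norm (a r x *R (g x - g r)) <= d * a r x"
  proof (cases "x : {r..r+e}")
  case True
  hence "dist (g x) (g r) < d" by (intro c x) (auto simp: dist_real_def)
  hence "a r x * norm (g x - g r) <= a r x * d" by (intro mult_lmono a0) (simp add: dist_norm)
  thus ?thesis using a0[of r x] by (simp add: mult.commute[of d])
  qed (simp add: az)
  qed
  also have "... = d * Z" using aZ[OF r] by simp
  finally show ?thesis .
  qed
  have E1: "norm ((LBINT x:{0..T}. a s x *R g x) - Z *R g s) <= d * Z" by (rule est) (use st e e1 in auto)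
  have E2: "norm ((LBINT x:{0..T}. a t x *R g x) - Z *R g t) <= d * Z" by (rule est) (use st e e2 in auto)
  have "(LBINT x:{0..T}. deriv ph x *R g x) = 0" by (rule key[OF pht]) (unfold dph, intro continuous_intros ac)
  hence "(LBINT x:{0..T}. a s x *R g x) = (LBINT x:{0..T}. a t x *R g x)"
  using set_integral_diff(2)[OF agi agi, of s t] by (simp add: dph scaleR_diff_left)
  hence "Z *R g s - Z *R g t = ((LBINT x:{0..T}. a t x *R g x) - Z *R g t) - ((LBINT x:{0..T}. a s x *R g x) - Z *R g s)" by simp
  moreover have "norm (((LBINT x:{0..T}. a t x *R g x) - Z *R g t)
  - ((LBINT x:{0..T}. a s x *R g x) - Z *R g s)) <= d * Z + d * Z"
  by (rule order_trans[OF norm_triangle_ineq4 add_mono[OF E2 E1]])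
  ultimately have "norm (Z *R g s - Z *R g t) <= d * Z + d * Z" by simp
  hence "Z * norm (g s - g t) <= 2 * d * Z" using \<Phi>(4) by (simp add: scaleR_diff_right[symmetric])
  thus False using d \<Phi>(4) by (simp add: d_def)
 qed
 \<comment> \<open>Constancy on the open interval extends to the end points by continuity.\<close>
 define k where "k = g (T / 2)"
 have k: "g x = k" if "x : {0<..<T}" for x
 proof -
  consider "x < T/2" | "x = T/2" | "T/2 < x" by linarith
  thus ?thesis
  proof cases
  case 1 show ?thesis unfolding k_def by (rule const) (use that 1 T in auto)
  next
  case 3 show ?thesis unfolding k_def by (rule const[symmetric]) (use that 3 T in auto)
  next
  case 2 thus ?thesis by (simp only: k_def)
  qed
 qed
 have cl: "closure {0<..<T} = {0..T}" by (rule closure_greaterThanLessThan[OF T])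
 have gk: "g x = k" if "x : {0..T}" for x by (rule continuous_constant_on_closure[of "{0<..<T}" g k x, unfolded cl, OF gc k that])
 have "g t = g 0" using gk[OF t] gk[of 0] T by simp
 moreover have "I 0 = 0"
 proof -
  have "AE x in lborel. indicator {0..0::real} x *R h x = 0" using AE_lborel_singleton[of "0::real"] by eventually_elim auto
  thus ?thesis unfolding I_def sli_def by (rule integral_eq_zero_AE)
 qed
 ultimately show ?thesis by (simp add: g_def I_def algebra_simps)
qed

section \<open>Sums over countable sets as integrals for the counting measure\<close>

abbreviation cs :: "'a measure" where "cs \<equiv> count_space UNIV"

lemma int_cs_summable:
 fixes f :: "'a => real" shows "integrable cs f <-> f summable_on UNIV"
 using summable_on_iff_abs_summable_on_real[of f UNIV] abs_summable_equivalent[of f UNIV] by (simp add: abs_summable_on_def)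

lemma integral_cs_eq_infsum:
 fixes f :: "'a => real" assumes "integrable cs f" shows "(LINT k|cs. f k) = (\<Sum>\<^sub>\<infinity>k. f k)"
 using infsetsum_infsum[of f UNIV] assms by (simp add: abs_summable_on_def infsetsum_def)

lemma int_cs_nn:
 fixes f :: "'a => real" assumes "!!k. 0 <= f k" shows "integrable cs f <-> (SN k. ennreal (f k)) < infy"
 using assms by (simp add: integrable_iff_bounded)

lemma sf_pair_cs:
 "pair_sigma_finite (count_space (UNIV :: 'a::countable set)) (count_space (UNIV :: 'b::countable set))"
 by (intro pair_sigma_finite.intro sigma_finite_measure_count_space)

lemma pair_cs: "count_space (UNIV :: 'a::countable set) <*M> count_space (UNIV :: 'b::countable set) = cs"
 by (simp add: pair_measure_countable)

lemma nn_integral_swap_cs: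
 fixes f :: "'a::countable => 'b::countable => ennreal"
 shows "(\<integral>\<^sup>+x. \<integral>\<^sup>+y. f x y \<partial>cs \<partial>cs) = (\<integral>\<^sup>+y. \<integral>\<^sup>+x. f x y \<partial>cs \<partial>cs)"
 by (rule pair_sigma_finite.Fubini'[OF sf_pair_cs]) (simp add: pair_cs)

lemma nn_integral_pair_cs:
 fixes f :: "'a::countable \<times> 'b::countable => ennreal"
 shows "(\<integral>\<^sup>+x. \<integral>\<^sup>+y. f (x, y) \<partial>cs \<partial>cs) = (SN z. f z)"
 using sigma_finite_measure.nn_integral_fst[OF sigma_finite_measure_count_space, of f "count_space UNIV"] by (simp add: pair_cs)

lemma bij_minus_left: "bij (%j::'a::group_add. k - j)" by (rule o_bij[of "%j. - j + k"]) (auto simp: fun_eq_iff algebra_simps)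

lemma bij_minus_right: "bij (%k::'a::group_add. k - j)" by (rule o_bij[of "%k. k + j"]) (auto simp: fun_eq_iff algebra_simps)

lemma nn_integral_cs_reflect: "(SN j. f (k - j)) = (SN j. f (j::'a::group_add))"
 by (rule nn_integral_bij_count_space[OF bij_minus_left])

lemma nn_integral_cs_shift: "(SN k. f (k - j)) = (SN k. f (k::'a::group_add))"
 by (rule nn_integral_bij_count_space[OF bij_minus_right])

lemma wave_0 [simp]: "wave L 0 = 0" by (simp add: wave_def vec_eq_iff)
lemma wave_add: "wave L (j + k) = wave L j + wave L k" by (simp add: wave_def vec_eq_iff algebra_simps)
lemma wave_diff: "wave L (j - k) = wave L j - wave L k" by (simp add: wave_def vec_eq_iff algebra_simps)
lemma wave_minus: "wave L (- k) = - wave L k" by (simp add: wave_def vec_eq_iff)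

section \<open>Weighted sequence spaces on the dual lattice and convolution\<close>

locale torus =
 fixes L :: real assumes L_pos: "0 < L"
begin

abbreviation K :: "int^3 => real" where "K k \<equiv> norm (wave L k)"

abbreviation "iwv k j == \<i> * complex_of_real (wave L k $ j)"
definition jap :: "int^3 => real" where "jap k = 1 + (K k)^2"

text \<open>The squared norm of the inhomogeneous space h^s. With values in \<open>ennreal\<close>
  the estimates are unconditional, and membership is the finiteness of the value.\<close>

definition hsq :: "nat => (int^3 => 'v::real_normed_vector) => ennreal" where
 "hsq s a = (SN k. ennreal (jap k ^ s * (norm (a k))^2))"

lemma jap_ge_1: "1 <= jap k" by (simp add: jap_def)
lemma jap_pos: "0 < jap k" using jap_ge_1[of k] by linarith
lemma K2_le_jap: "(K k)^2 <= jap k" by (simp add: jap_def)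

lemma jap_minus [simp]: "jap (- k) = jap k" by (simp add: jap_def wave_minus)

lemma K2_eq: "(K k)^2 = (2 * pi / L)^2 * (\<Sum>i\<in>UNIV. (of_int (k $ i))^2)"
proof -
 have "(K k)^2 = (\<Sum>i\<in>UNIV. (wave L k $ i)^2)" by (simp add: norm_vec_def L2_set_def sum_nonneg)
 thus ?thesis by (simp add: wave_def power_mult_distrib power_divide sum_distrib_left)
qed

lemma K_component: "\<bar>wave L k $ i\<bar> <= K k" by (rule component_le_norm_cart)

lemma K_lower: assumes "k ~= 0" shows "2 * pi / L <= K k"
proof -
 obtain i where "k $ i ~= 0" using assms by (auto simp: vec_eq_iff)
 hence "1 <= \<bar>k $ i\<bar>" by linarith
 hence "1 <= \<bar>real_of_int (k $ i)\<bar>" by linarith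
 hence "2 * pi / L * 1 <= 2 * pi / L * \<bar>real_of_int (k $ i)\<bar>" using L_pos by (intro mult_lmono) auto
 also have "... = \<bar>wave L k $ i\<bar>" using L_pos by (simp add: wave_def abs_mult)
 also have "... <= K k" by (rule K_component)
 finally show ?thesis by simp
qed

lemma K_pos: "k ~= 0 ==> 0 < K k" using K_lower[of k] L_pos by (smt (verit) divide_pos_pos pi_gt_zero)

text \<open>The Poincare constant: nonzero wave-numbers have length at least
  \<open>2 * pi / L\<close>, so away from the mode zero \<open>jap\<close> is at most
  \<open>Cp\<close> times the homogeneous weight.\<close>

definition Cp :: real where "Cp = 1 + (L / (2 * pi))^2"

lemma Cp_pos: "0 < Cp" by (simp add: Cp_def add_pos_nonneg)

lemma jap_le_K2: assumes "k ~= 0" shows "jap k <= Cp * (K k)^2"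
proof -
 have "(2 * pi / L)^2 <= (K k)^2" using K_lower[OF assms] L_pos by (intro power_mono) auto
 hence "(L / (2 * pi))^2 * (2 * pi / L)^2 <= (L / (2 * pi))^2 * (K k)^2" by (intro mult_lmono) auto
 also have "(L / (2 * pi))^2 * (2 * pi / L)^2 = 1" using L_pos by (simp add: power_mult_distrib[symmetric])
 finally show ?thesis by (simp add: jap_def Cp_def algebra_simps)
qed

definition latS :: ennreal where "latS = (SN k. ennreal (1 / (jap k)^2))"

text \<open>\<open>(1 + X + Y + Z) powr (-2)\<close> is the cube of the power \<open>-2/3\<close>,
  which is dominated by each of three one-dimensional factors; these decay like the power
  \<open>-4/3\<close> of the index and are summable. This is where dimension three enters.\<close>

lemma latS_finite: "latS < infy"
proof -
 define c where "c = (2 * pi / L)^2"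
 have c: "c > 0" using L_pos by (simp add: c_def)
 define g where "g = (%n::int. (1 + c * (of_int n)^2) powr (-2/3))"
 have g0: "0 <= g n" for n by (simp add: g_def)
 have "summable (%n::nat. (c powr (-2/3)) * (of_nat n powr (-4/3)))" by (intro summable_mult) (simp add: summable_real_powr_iff)
 hence "summable (%n. g (int n))"
 proof (rule summable_comparison_test_ev[rotated])
  show "eventually (%n. norm (g (int n)) <= (c powr (-2/3)) * (of_nat n powr (-4/3))) sequentially"
  proof (rule eventually_sequentiallyI[of 1])
  fix n :: nat assume n: "1 <= n"
  have "g (int n) <= (c * (of_nat n)^2) powr (-2/3)" unfolding g_def by (rule powr_mono2') (use n c in auto)
  also have "... = c powr (-2/3) * (of_nat n powr (-4/3))"
  using c n by (simp add: powr_mult powr_powr powr_realpow[symmetric] flip: powr_numeral)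
  finally show "norm (g (int n)) <= (c powr (-2/3)) * (of_nat n powr (-4/3))" using g0 by simp
  qed
 qed
 hence s1: "(%n. g (int n)) summable_on UNIV" using g0 by (simp add: summable_on_UNIV_nonneg_real_iff)
 have gs: "g (- n) = g n" for n by (simp add: g_def)
 have "summable (%n. g (int (Suc n)))" using \<open>summable (%n. g (int n))\<close> by (subst summable_Suc_iff)
 hence s2: "(%n. g (- int (Suc n))) summable_on UNIV"
  unfolding gs using g0 by (simp add: summable_on_UNIV_nonneg_real_iff del: of_nat_Suc)
 \<comment> \<open>The integers are split into \<open>0, 1, 2, ...\<close> and
   \<open>-1, -2, ...\<close>; the \<open>Suc\<close> keeps zero from being counted twice.\<close>
 have u: "(UNIV::int set) = range int \<union> range (%n. - int (Suc n))"
 proof (intro equalityI subsetI UNIV_I)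
  fix n :: int show "n : range int \<union> range (%n. - int (Suc n))" by (cases n) auto
 qed
 have "g summable_on UNIV" unfolding u
 proof (rule summable_on_Un_disjoint)
  show "g summable_on range int" using s1 by (subst summable_on_reindex) (auto simp: o_def)
  show "g summable_on range (%n. - int (Suc n))" using s2 by (subst summable_on_reindex) (auto simp: o_def inj_on_def)
  show "range int \<inter> range (%n. - int (Suc n)) = {}" by auto
 qed
 hence "integrable cs g" by (simp add: int_cs_summable)
 hence gf: "(SN n. ennreal (g n)) < infy" using g0 by (simp add: int_cs_nn)
 define ph where "ph = (%(a,b,c). vector [a,b,c] :: int^3)"
 have bij: "bij ph" by (rule o_bij[of "%v. (v $ 1, v $ 2, v $ 3)"]) (auto simp: ph_def fun_eq_iff vec_eq_iff forall_3)
 have le: "1 / (jap (ph (x,y,z)))^2 <= g x * (g y * g z)" for x y z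
 proof -
  let ?X = "c * (of_int x)^2" and ?Y = "c * (of_int y)^2" and ?Z = "c * (of_int z)^2"
  have j: "jap (ph (x,y,z)) = 1 + (?X + ?Y + ?Z)" by (simp add: jap_def ph_def K2_eq sum_3 c_def algebra_simps)
  let ?J = "1 + (?X + ?Y + ?Z)"
  have nn: "0 <= ?X" "0 <= ?Y" "0 <= ?Z" using c by auto
  have "?J powr (-2/3) <= g x" "?J powr (-2/3) <= g y" "?J powr (-2/3) <= g z"
  unfolding g_def by (intro powr_mono2'; use nn in linarith)+
  hence "?J powr (-2/3) * (?J powr (-2/3) * ?J powr (-2/3)) <= g x * (g y * g z)" by (intro mult_mono) (auto simp: g0)
  also have "?J powr (-2/3) * (?J powr (-2/3) * ?J powr (-2/3)) = ?J powr (-2)" by (simp add: powr_add[symmetric])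
  also have "... = 1 / ?J^2" using nn by (simp add: powr_minus_divide)
  finally show ?thesis unfolding j .
 qed
 have "latS = (SN w. ennreal (1 / (jap (ph w))^2))" unfolding latS_def by (rule nn_integral_bij_count_space[OF bij, symmetric])
 also have "... <= (SN w. (case w of (x,y,z) => ennreal (g x) * (ennreal (g y) * ennreal (g z))))"
  by (rule nn_integral_mono) (use le in \<open>auto simp: g0 ennreal_mult[symmetric] intro!: ennreal_leI\<close>)
 also have "... = (\<integral>\<^sup>+x. \<integral>\<^sup>+w. ennreal (g x) * (ennreal (g (fst w)) * ennreal (g (snd w))) \<partial>cs \<partial>cs)"
  by (subst nn_integral_pair_cs[symmetric]) (simp add: split_beta)
 also have "... = (\<integral>\<^sup>+x. \<integral>\<^sup>+y. \<integral>\<^sup>+z. ennreal (g x) * (ennreal (g y) * ennreal (g z)) \<partial>cs \<partial>cs \<partial>cs)"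
  by (subst nn_integral_pair_cs[symmetric]) simp
 also have "... = (SN n. ennreal (g n)) * ((SN n. ennreal (g n)) * (SN n. ennreal (g n)))"
  by (simp add: nn_integral_cmult nn_integral_multc mult.assoc)
 also have "... < infy" using gf by (simp add: mult_lt_top)
 finally show ?thesis .
qed

lemma hsq_mono_s: "s <= t ==> hsq s a <= hsq t a"
 unfolding hsq_def by (intro nn_integral_mono ennreal_leI mult_right_mono power_increasing jap_ge_1) auto

lemma hsq_mono_norm: "(!!k. norm (a k) <= norm (b k)) ==> hsq s a <= hsq s b" unfolding hsq_def using jap_pos
 by (intro nn_integral_mono ennreal_leI mult_lmono power_mono) (auto intro: less_imp_le)

lemma hsq_point: "ennreal ((norm (a k))^2) <= hsq s a"
proof -
 have "1 * (norm (a k))^2 <= jap k ^ s * (norm (a k))^2" by (intro mult_right_mono one_le_power jap_ge_1) auto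
 hence "ennreal ((norm (a k))^2) <= ennreal (jap k ^ s * (norm (a k))^2)" by (intro ennreal_leI) simp
 also have "... <= hsq s a" unfolding hsq_def by (rule nn_integral_ge_point) simp
 finally show ?thesis .
qed

lemma hsq_scaleR: "hsq s (%k. c *R a k) = ennreal (c^2) * hsq s a" unfolding hsq_def by (subst nn_integral_cmult[symmetric])
  (auto simp: ennreal_mult'[symmetric] power_mult_distrib mult_ac)

lemma hsq_add_le: "hsq s (%k. a k + b k) <= 2 * hsq s a + 2 * hsq s b"
proof -
 have p: "jap k ^ s * (norm (a k + b k))^2 <= 2 * (jap k ^ s * (norm (a k))^2) + 2 * (jap k ^ s * (norm (b k))^2)" for k
 proof -
  have "(norm (a k + b k))^2 <= (norm (a k) + norm (b k))^2" by (intro power_mono norm_triangle_ineq) auto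
  also have "... <= 2 * (norm (a k))^2 + 2 * (norm (b k))^2"
  using sum_squares_bound[of "norm (a k)" "norm (b k)"] by (simp add: power2_sum)
  finally have "jap k ^ s * (norm (a k + b k))^2 <= jap k ^ s * (2 * (norm (a k))^2 + 2 * (norm (b k))^2)"
  using jap_pos[of k] by (intro mult_lmono) auto
  thus ?thesis by (simp add: algebra_simps)
 qed
 have "hsq s (%k. a k + b k) <= (SN k. 2 * ennreal (jap k ^ s * (norm (a k))^2) + 2 * ennreal (jap k ^ s * (norm (b k))^2))"
  unfolding hsq_def
 proof (rule nn_integral_mono)
  fix k
  have "0 <= jap k" using jap_pos[of k] by simp
  thus "ennreal (jap k ^ s * (norm (a k + b k))^2) <= 2 * ennreal (jap k ^ s * (norm (a k))^2) + 2 * ennreal (jap k ^ s * (norm (b k))^2)"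
  using ennreal_leI[OF p[of k]] by (simp add: ennreal_mult')
 qed
 also have "... = 2 * hsq s a + 2 * hsq s b" unfolding hsq_def by (simp add: nn_integral_add nn_integral_cmult)
 finally show ?thesis .
qed

lemma hsq_uminus: "hsq s (%k. - a k) = hsq s a" by (simp add: hsq_def)

lemma hsq_minus_commute: "hsq s (%k. a k - b k) = hsq s (%k. b k - a k)" by (simp add: hsq_def norm_minus_commute)

lemma hsq_diff_le: "hsq s (%k. a k - b k) <= 2 * hsq s a + 2 * hsq s b"
 using hsq_add_le[of s a "%k. - b k"] by (simp add: hsq_uminus)

lemma hsq_vec: "hsq s (a :: int^3 => ('v::real_normed_vector)^3) = (\<Sum>i\<in>UNIV. hsq s (%k. a k $ i))"
proof -
 have "jap k ^ s * (norm (a k))^2 = (\<Sum>i\<in>UNIV. jap k ^ s * (norm (a k $ i))^2)" for k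
  by (simp add: norm_vec_def L2_set_def sum_nonneg sum_distrib_left)
 hence "ennreal (jap k ^ s * (norm (a k))^2) = (\<Sum>i\<in>UNIV. ennreal (jap k ^ s * (norm (a k $ i))^2))" for k
  using jap_pos[of k] by (simp only:) (rule sum_ennreal[symmetric], simp)
 thus ?thesis unfolding hsq_def by (simp add: nn_integral_sum)
qed

lemma hsq_comp_le: "hsq s (%k. a k $ i) <= hsq s (a :: int^3 => ('v::real_normed_vector)^3)"
 by (rule hsq_mono_norm) (rule Finite_Cartesian_Product.norm_nth_le)

text \<open>A Bochner sum, so it is zero where the series does not converge absolutely. The norm
  bounds hold in that case too, whereas linearity in either factor rests on
  \<open>conv_integrable\<close>.\<close>

definition conv :: "(int^3 => complex) => (int^3 => complex) => int^3 => complex" where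
 "conv a b k = (LINT j|cs. a j * b (k - j))"

lemma norm_int_bound:
 fixes f :: "'a => 'b::{banach, second_countable_topology}"
 shows "ennreal (norm (LINT x|M. f x)) <= (\<integral>\<^sup>+x. norm (f x) \<partial>M)"
 by (cases "integrable M f") (auto simp: integral_norm_bound_ennreal not_integrable_integral_eq)

text \<open>Cauchy-Schwarz with the weight \<open>jap j * jap (k - j)\<close>. The sum of the
  inverse weight is at most \<open>latS\<close> for every \<open>k\<close>, by the
  arithmetic-geometric mean inequality and reflection, and the remaining double sum factors into the
  two norms.\<close>

lemma convolution_nn_bound:
 fixes a b :: "int^3 => complex" shows "(SN k. (SN j. ennreal (norm (a j) * norm (b (k - j))))^2) <= latS * (hsq 1 a * hsq 1 b)"
proof -
 let ?A = "%j. ennreal (jap j * (norm (a j))^2)" and ?B = "%j. ennreal (jap j * (norm (b j))^2)"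
 have 1: "(SN j. ennreal (norm (a j) * norm (b (k - j))))^2 <= (SN j. ?A j * ?B (k - j)) * latS" for k
 proof -
  let ?f = "%j. ennreal (sqrt (jap j * jap (k-j)) * (norm (a j) * norm (b (k - j))))"
  let ?g = "%j. ennreal (1 / sqrt (jap j * jap (k-j)))"
  let ?h = "%j. ennreal (1/2 * (1 / (jap j)^2))"
  have jj: "0 < jap j * jap (k - j)" for j using jap_pos by simp
  have "(SN j. ennreal (norm (a j) * norm (b (k - j)))) = (SN j. ?f j * ?g j)"
  proof (rule nn_integral_cong)
  fix j
  have "sqrt (jap j * jap (k-j)) * (norm (a j) * norm (b (k - j))) * (1 / sqrt (jap j * jap (k-j))) = norm (a j) * norm (b (k - j))"
  using jap_pos[of j] jap_pos[of "k-j"] by simp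
  thus "ennreal (norm (a j) * norm (b (k - j))) = ?f j * ?g j"
  using jj[of j] by (subst ennreal_mult'[symmetric]) (auto simp: less_imp_le)
  qed
  hence "(SN j. ennreal (norm (a j) * norm (b (k - j))))^2 <= (SN j. (?f j)^2) * (SN j. (?g j)^2)"
  using Cauchy_Schwarz_nn_integral[of ?f "count_space UNIV" ?g] by simp
  also have "(SN j. (?f j)^2) = (SN j. ?A j * ?B (k - j))"
  proof (rule nn_integral_cong)
  fix j
  have "(sqrt (jap j * jap (k-j)) * (norm (a j) * norm (b (k - j))))^2
  = (jap j * (norm (a j))^2) * (jap (k-j) * (norm (b (k-j)))^2)"
  using jj[of j] by (simp add: power_mult_distrib less_imp_le mult_ac)
  thus "(?f j)^2 = ?A j * ?B (k - j)"
  using jap_pos[of j] jap_pos[of "k-j"] jj[of j] by (simp add: ennreal_power ennreal_mult[symmetric] less_imp_le)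
  qed
  also have "(SN j. (?g j)^2) <= (SN j. ?h j + ?h (k - j))"
  proof (rule nn_integral_mono)
  fix j
  have "(1 / sqrt (jap j * jap (k-j)))^2 = (1 / jap j) * (1 / jap (k - j))" using jj[of j] by (simp add: power_divide less_imp_le)
  also have "... <= 1/2 * (1 / (jap j)^2) + 1/2 * (1 / (jap (k - j))^2)"
  using sum_squares_bound[of "1 / jap j" "1 / jap (k - j)"] by (simp add: power_divide)
  finally have "ennreal ((1 / sqrt (jap j * jap (k-j)))^2) <= ennreal (1/2 * (1 / (jap j)^2) + 1/2 * (1 / (jap (k - j))^2))"
  by (rule ennreal_leI)
  also have "... = ?h j + ?h (k - j)" by (rule ennreal_plus) auto
  finally show "(?g j)^2 <= ?h j + ?h (k - j)" using jj[of j] by (simp add: ennreal_power less_imp_le)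
  qed
  also have "... = ennreal (1/2) * latS + ennreal (1/2) * latS"
  proof -
  have "(SN j. ?h j) = ennreal (1/2) * latS"
  unfolding latS_def by (subst nn_integral_cmult[symmetric], simp, subst ennreal_mult'[symmetric], simp_all)
  moreover have "(SN j. ?h j + ?h (k - j)) = (SN j. ?h j) + (SN j. ?h (k - j))" by (rule nn_integral_add) auto
  moreover have "(SN j. ?h (k - j)) = (SN j. ?h j)" by (rule nn_integral_cs_reflect)
  ultimately show ?thesis by (simp only:)
  qed
  also have "... = latS"
  proof -
  have "ennreal (1/2) + ennreal (1/2) = 1" by (subst ennreal_plus[symmetric]) simp_all
  thus ?thesis by (simp only: distrib_right[symmetric] mult_1)
  qed
  finally show ?thesis by (simp add: mult_lmono)
 qed
 have "(SN k. (SN j. ennreal (norm (a j) * norm (b (k - j))))^2) <= (SN k. (SN j. ?A j * ?B (k - j)) * latS)"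
  by (rule nn_integral_mono) (rule 1)
 also have "... = (\<integral>\<^sup>+k. \<integral>\<^sup>+j. ?A j * ?B (k - j) \<partial>cs \<partial>cs) * latS" by (rule nn_integral_multc) simp
 also have "(\<integral>\<^sup>+k. \<integral>\<^sup>+j. ?A j * ?B (k - j) \<partial>cs \<partial>cs) = (\<integral>\<^sup>+j. \<integral>\<^sup>+k. ?A j * ?B (k - j) \<partial>cs \<partial>cs)"
  by (rule nn_integral_swap_cs)
 also have "... = hsq 1 a * hsq 1 b" by (simp add: nn_integral_cmult nn_integral_multc nn_integral_cs_shift[of ?B] hsq_def)
 finally show ?thesis by (simp add: mult.commute)
qed

lemma conv_norm_le: "ennreal ((norm (conv a b k))^2) <= (SN j. ennreal (norm (a j) * norm (b (k - j))))^2"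
proof -
 have "ennreal (norm (conv a b k)) <= (SN j. ennreal (norm (a j) * norm (b (k - j))))"
  unfolding conv_def using norm_int_bound[of "count_space UNIV" "%j. a j * b (k - j)"] by (simp add: norm_mult)
 thus ?thesis by (simp add: ennreal_power[symmetric] power_mono)
qed

lemma conv_bound: "hsq 0 (conv a b) <= latS * (hsq 1 a * hsq 1 b)"
proof -
 have "hsq 0 (conv a b) <= (SN k. (SN j. ennreal (norm (a j) * norm (b (k - j))))^2)"
  unfolding hsq_def by (rule nn_integral_mono) (simp add: conv_norm_le)
 also note convolution_nn_bound
 finally show ?thesis .
qed

lemma hsq_0_integrable:
 "hsq s a < infy ==> integrable cs (%k. jap k ^ s * (norm (a k))^2)"
 unfolding hsq_def using jap_pos by (subst int_cs_nn) (auto simp: less_imp_le)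

lemma conv_integrable:
 fixes a b :: "int^3 => complex" assumes "hsq 0 a < infy" "hsq 0 b < infy" shows "integrable cs (%j. a j * b (k - j))"
proof -
 have a: "integrable cs (%j. (norm (a j))^2)" using hsq_0_integrable[OF assms(1)] by simp
 have b: "integrable cs (%j. (norm (b (k - j)))^2)"
  using hsq_0_integrable[OF assms(2)] integrable_bij_count_space[OF bij_minus_left, of "%j. (norm (b j))^2" k] by simp
 have "integrable cs (%j. norm (a j) * norm (b (k - j)))" by (rule int_norm2_mult[OF _ _ a b]) auto
 thus ?thesis by (rule bochnerI_bound) (auto simp: norm_mult)
qed

lemma conv_diff_left: assumes "hsq 0 a < infy" "hsq 0 a' < infy" "hsq 0 b < infy"
 shows "conv (%k. a k - a' k) b k = conv a b k - conv a' b k"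
 unfolding conv_def using conv_integrable[OF assms(1,3)] conv_integrable[OF assms(2,3)] by (simp add: left_diff_distrib)

lemma conv_diff_right: assumes "hsq 0 a < infy" "hsq 0 b < infy" "hsq 0 b' < infy"
 shows "conv a (%k. b k - b' k) k = conv a b k - conv a b' k"
 unfolding conv_def using conv_integrable[OF assms(1,2)] conv_integrable[OF assms(1,3)] by (simp add: right_diff_distrib)

lemma conv_hermitian: assumes "!!k. a (- k) = cnj (a k)" "!!k. b (- k) = cnj (b k)" shows "conv a b (- k) = cnj (conv a b k)"
proof -
 have bij: "bij (uminus :: int^3 => int^3)" by (rule o_bij[of uminus]) auto
 have "conv a b (- k) = (LINT j|cs. a (- j) * b (- k - - j))" unfolding conv_def
  by (rule integral_bij_count_space[OF bij, symmetric])
 also have "... = (LINT j|cs. cnj (a j * b (k - j)))"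
 proof (rule bint_cong)
  fix j
  have "b (- k - - j) = cnj (b (k - j))" using assms(2)[of "k - j"] by simp
  thus "a (- j) * b (- k - - j) = cnj (a j * b (k - j))" using assms(1) by simp
 qed simp
 also have "... = cnj (conv a b k)" unfolding conv_def by (rule Bochner_Integration.integral_cnj)
 finally show ?thesis .
qed

text \<open>The symbol of the divergence without the factor \<open>\<i>\<close>; bilinear, with no
  conjugation.\<close>

definition wdot :: "int^3 => complex^3 => complex" where
 "wdot k v = (\<Sum>j\<in>UNIV. complex_of_real (wave L k $ j) * v $ j)"

definition divfree :: "(int^3 => complex^3) => bool" where
 "divfree a <-> (\<forall>k. wdot k (a k) = 0)"

definition herm :: "(int^3 => complex^3) => bool" where
 "herm a <-> (\<forall>k i. a (- k) $ i = cnj (a k $ i))"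

text \<open>The Fourier coefficients of \<open>\<nabla> \<cdot> (b \<otimes> a)\<close>.\<close>

definition adv :: "(int^3 => complex^3) => (int^3 => complex^3) => int^3 => complex^3" where
 "adv a b k = (\<chi> i. \<Sum>j\<in>UNIV. iwv k j * conv (%k. b k $ i) (%k. a k $ j) k)"

lemma wdot_norm_le: "norm (wdot k v) <= K k * norm v"
proof -
 have "norm (wdot k v) <= (\<Sum>j\<in>UNIV. \<bar>wave L k $ j\<bar> * \<bar>norm (v $ j)\<bar>)"
  unfolding wdot_def by (rule sum_norm_le) (simp add: norm_mult)
 also have "... <= L2_set (%j. wave L k $ j) UNIV * L2_set (%j. norm (v $ j)) UNIV" by (rule L2_set_mult_ineq)
 finally show ?thesis by (simp add: norm_vec_def L2_set_def)
qed

lemma adv_comp_norm2: "(norm (adv a b k $ i))^2 <= (K k)^2 * (\<Sum>j\<in>UNIV. (norm (conv (%k. b k $ i) (%k. a k $ j) k))^2)"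
proof -
 let ?v = "\<chi> j. conv (%k. b k $ i) (%k. a k $ j) k"
 have "adv a b k $ i = \<i> * wdot k ?v" by (simp add: adv_def wdot_def sum_distrib_left mult_ac)
 hence "norm (adv a b k $ i) <= K k * norm ?v" using wdot_norm_le[of k ?v] by (simp add: norm_mult)
 hence "(norm (adv a b k $ i))^2 <= (K k * norm ?v)^2" by (intro power_mono) auto
 also have "... = (K k)^2 * (\<Sum>j\<in>UNIV. (norm (conv (%k. b k $ i) (%k. a k $ j) k))^2)"
  by (simp add: power_mult_distrib norm_vec_def L2_set_def sum_nonneg)
 finally show ?thesis .
qed

definition gsym :: "real => int^3 => real" where "gsym al k = 1 / (1 + al^2 * (K k)^2)"

definition Cg :: "real => real" where "Cg al = 1 + 1 / al^2"

lemma gsym_pos: "0 < gsym al k" by (simp add: gsym_def add_pos_nonneg)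
lemma gsym_le_1: "gsym al k <= 1" unfolding gsym_def by (subst divide_le_eq_1_pos) (auto intro: add_pos_nonneg)
lemma gsym_minus [simp]: "gsym al (- k) = gsym al k" by (simp add: gsym_def wave_minus)

lemma jap_gsym_le: assumes "al > 0" shows "jap k * gsym al k <= Cg al"
proof -
 have "jap k <= Cg al * (1 + al^2 * (K k)^2)" using assms by (simp add: jap_def Cg_def distrib_right distrib_left)
 moreover have "0 < 1 + al^2 * (K k)^2" by (simp add: add_pos_nonneg)
 ultimately show ?thesis by (simp add: gsym_def pos_divide_le_eq)
qed

text \<open>The divergence costs one factor \<open>K\<close>, the h^1 weight another, and
  \<open>gsym\<close> returns two: \<open>jap * gsym^2 * K^2\<close> is at most
  \<open>(jap * gsym)^2\<close>. What is left are l^2 norms of convolutions.\<close>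

lemma gsym_adv_bound: assumes "al > 0"
 shows "hsq 1 (%k. gsym al k *R adv a b k) <= ennreal ((Cg al)^2) * (latS * (hsq 1 a * hsq 1 b))"
proof -
 let ?c = "%i j. conv (%k. b k $ i) (%k. a k $ j)"
 have p: "jap k * (norm (gsym al k *R adv a b k $ i))^2 <= (Cg al)^2 * (\<Sum>j\<in>UNIV. (norm (?c i j k))^2)" for k i
 proof -
  have "jap k * (norm (gsym al k *R adv a b k $ i))^2 = jap k * (gsym al k)^2 * (norm (adv a b k $ i))^2"
  by (simp add: power_mult_distrib)
  also have "... <= jap k * (gsym al k)^2 * (jap k * (\<Sum>j\<in>UNIV. (norm (?c i j k))^2))" using jap_pos[of k] K2_le_jap[of k]
  by (intro mult_lmono order_trans[OF adv_comp_norm2] mult_right_mono) (auto intro: sum_nonneg)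
  also have "... = (jap k * gsym al k)^2 * (\<Sum>j\<in>UNIV. (norm (?c i j k))^2)" by (simp add: power2_eq_square mult_ac)
  also have "... <= (Cg al)^2 * (\<Sum>j\<in>UNIV. (norm (?c i j k))^2)"
  using jap_gsym_le[OF assms, of k] jap_pos[of k] gsym_pos[of al k] by (intro mult_right_mono power_mono) (auto intro: sum_nonneg)
  finally show ?thesis .
 qed
 have "hsq 1 (%k. gsym al k *R adv a b k) = (\<Sum>i\<in>UNIV. (SN k. ennreal (jap k * (norm (gsym al k *R adv a b k $ i))^2)))"
  by (subst hsq_vec) (simp add: hsq_def)
 also have "... <= (\<Sum>i\<in>UNIV. (SN k. ennreal ((Cg al)^2) * (\<Sum>j\<in>UNIV. ennreal ((norm (?c i j k))^2))))"
  using p by (intro sum_mono nn_integral_mono) (simp add: ennreal_mult'[symmetric] sum_ennreal ennreal_leI)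
 also have "... = ennreal ((Cg al)^2) * (\<Sum>i\<in>UNIV. \<Sum>j\<in>UNIV. hsq 0 (?c i j))"
  by (simp add: nn_integral_cmult nn_integral_sum hsq_def sum_distrib_left del: sum_ennreal)
 also have "... <= ennreal ((Cg al)^2) * (\<Sum>i\<in>UNIV. \<Sum>j\<in>UNIV. latS * (hsq 1 (%k. b k $ i) * hsq 1 (%k. a k $ j)))"
  by (intro mult_lmono sum_mono conv_bound) auto
 also have "(\<Sum>i\<in>UNIV. \<Sum>j\<in>UNIV. latS * (hsq 1 (%k. b k $ i) * hsq 1 (%k. a k $ j))) = latS * (hsq 1 b * hsq 1 a)"
 proof -
  have "hsq 1 b * hsq 1 a = (\<Sum>i\<in>UNIV. \<Sum>j\<in>UNIV. hsq 1 (%k. b k $ i) * hsq 1 (%k. a k $ j))"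
  by (subst hsq_vec[of 1 a], subst hsq_vec[of 1 b], rule sum_product)
  thus ?thesis by (simp only: sum_distrib_left)
 qed
 finally show ?thesis by (simp add: mult.commute)
qed

lemma adv_herm: assumes "herm a" "herm b" shows "herm (adv a b)"
 using assms conv_hermitian unfolding herm_def adv_def by (simp add: wave_minus)

lemma inner_complex_eq_Re: "(x::complex) <.> y = Re (x * cnj y)" by (simp add: inner_complex_def)

text \<open>Discrete counterpart of \<open>\<integral> (a \<cdot> \<nabla>) b \<cdot> c = - \<integral> (a \<cdot> \<nabla>) c \<cdot> b\<close> for solenoidal \<open>a\<close>.\<close>

lemma adv_inner_integrable_and_skew:
 assumes a: "hsq 1 a < infy" "herm a" "divfree a" and b: "hsq 1 b < infy" and c: "hsq 1 c < infy"
 shows "integrable cs (%k. adv a b k <.> c k)" and "(LINT k|cs. adv a b k <.> c k) = - (LINT k|cs. adv a c k <.> b k)"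
proof -
 \<comment> \<open>The whole form as one double series over the mode \<open>k\<close> of the test
   side and the mode \<open>l\<close> of \<open>b\<close>. Skew-symmetry is then an identity between
   single terms, once the order of summation may be exchanged.\<close>
 define S :: "(int^3 => complex^3) => (int^3 => complex^3) => (int^3) \<times> (int^3) => real"
  where "S = (%b c (k,l). \<Sum>i\<in>UNIV. \<Sum>j\<in>UNIV. Re (iwv k j * (b l $ i * a (k - l) $ j) * cnj (c k $ i)))"
 have key: "integrable cs (S b c)" "integrable cs (%k. adv a b k <.> c k)"
  "(LINT k|cs. adv a b k <.> c k) = (LINT z|cs. S b c z)"
  "(LINT k|cs. adv a b k <.> c k) = (LINT l|cs. (LINT k|cs. S b c (k,l)))" if b: "hsq 1 b < infy" and c: "hsq 1 c < infy" for b c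
 proof -
  let ?t = "%i j (k,l). Re (iwv k j * (b l $ i * a (k - l) $ j) * cnj (c k $ i))"
  have fin: "hsq 1 (%k. b k $ i) < infy" "hsq 1 (%k. a k $ i) < infy" for i using b a(1) le_less_trans[OF hsq_comp_le] by blast+
  have t: "integrable cs (?t i j)" for i j
  proof -
  have "(SN z. ennreal (norm (?t i j z))) <= (SN z. (case z of (k,l) => ennreal (K k * norm (c k)) * ennreal (norm (b l $ i) * norm (a (k - l) $ j))))"
  proof (rule nn_integral_mono)
  fix z :: "(int^3) \<times> (int^3)"
  obtain k l where z: "z = (k,l)" by (cases z)
  have "norm (?t i j z) <= norm (iwv k j * (b l $ i * a (k - l) $ j) * cnj (c k $ i))"
  unfolding z by (simp only: prod.case real_norm_def) (rule abs_Re_le_cmod)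
  also have "... = \<bar>wave L k $ j\<bar> * norm (c k $ i) * (norm (b l $ i) * norm (a (k - l) $ j))"
  by (simp add: norm_mult mult_ac)
  also have "... <= K k * norm (c k) * (norm (b l $ i) * norm (a (k - l) $ j))"
  by (intro mult_right_mono mult_mono K_component Finite_Cartesian_Product.norm_nth_le) auto
  finally have "ennreal (norm (?t i j z)) <= ennreal (K k * norm (c k) * (norm (b l $ i) * norm (a (k - l) $ j)))"
  by (rule ennreal_leI)
  thus "ennreal (norm (?t i j z)) <= (case z of (k,l) => ennreal (K k * norm (c k)) * ennreal (norm (b l $ i) * norm (a (k - l) $ j)))"
  unfolding z by (simp add: ennreal_mult)
  qed
  also have "... = (SN k. ennreal (K k * norm (c k)) * (SN l. ennreal (norm (b l $ i) * norm (a (k - l) $ j))))"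
  by (subst nn_integral_pair_cs[symmetric]) (simp add: nn_integral_cmult)
  \<comment> \<open>Absolute summability: \<open>K k * norm (c k)\<close> is square summable, and so
    is the convolution of the moduli.\<close>
  also have "... < infy"
  proof -
  let ?I = "(SN k. ennreal (K k * norm (c k)) * (SN l. ennreal (norm (b l $ i) * norm (a (k - l) $ j))))"
  have "?I^2 <= (SN k. (ennreal (K k * norm (c k)))^2) * (SN k. (SN l. ennreal (norm (b l $ i) * norm (a (k - l) $ j)))^2)"
  by (rule Cauchy_Schwarz_nn_integral) auto
  also have "... <= hsq 1 c * (latS * (hsq 1 (%k. b k $ i) * hsq 1 (%k. a k $ j)))"
  proof (rule mult_mono)
  show "(SN k. (ennreal (K k * norm (c k)))^2) <= hsq 1 c" unfolding hsq_def using K2_le_jap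
  by (intro nn_integral_mono) (auto simp: ennreal_power power_mult_distrib intro!: ennreal_leI mult_right_mono)
  qed (use convolution_nn_bound in auto)
  also have "... < infy" using c fin latS_finite by (simp add: mult_lt_top)
  finally show ?thesis by (simp add: power_less_top_ennreal)
  qed
  finally show ?thesis by (simp add: integrable_iff_bounded)
  qed
  have S: "S b c = (%z. \<Sum>i\<in>UNIV. \<Sum>j\<in>UNIV. ?t i j z)" by (auto simp: S_def fun_eq_iff)
  show iS: "integrable cs (S b c)" unfolding S by (intro bochnerI_sum t)
  have c0: "hsq 0 (%k. b k $ i) < infy" "hsq 0 (%k. a k $ i) < infy" for i
  by (rule le_less_trans[OF hsq_mono_s fin(1)], simp) (rule le_less_trans[OF hsq_mono_s fin(2)], simp)
  have inner: "adv a b k <.> c k = (LINT l|cs. S b c (k,l))" for k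
  proof -
  have ii: "integrable cs (%l. iwv k j * (b l $ i * a (k - l) $ j) * cnj (c k $ i))" for i j
  by (intro integrable_mult_left integrable_mult_right conv_integrable c0)
  have "(LINT l|cs. S b c (k,l)) = (\<Sum>i\<in>UNIV. \<Sum>j\<in>UNIV. (LINT l|cs. Re (iwv k j * (b l $ i * a (k - l) $ j) * cnj (c k $ i))))"
  proof -
  note rr = integrable_Re[OF ii]
  show ?thesis unfolding S_def prod.case by (subst bochner_sum, rule bochnerI_sum, rule rr)
  (rule sum.cong[OF refl], rule bochner_sum, rule rr)
  qed
  also have "... = (\<Sum>i\<in>UNIV. \<Sum>j\<in>UNIV. Re (iwv k j * conv (%k. b k $ i) (%k. a k $ j) k * cnj (c k $ i)))"
  proof (intro sum.cong refl)
  fix i j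
  have "(LINT l|cs. Re (iwv k j * (b l $ i * a (k - l) $ j) * cnj (c k $ i)))
  = Re (LINT l|cs. iwv k j * (b l $ i * a (k - l) $ j) * cnj (c k $ i))" by (rule integral_Re[OF ii])
  also have "(LINT l|cs. iwv k j * (b l $ i * a (k - l) $ j) * cnj (c k $ i))
  = iwv k j * conv (%k. b k $ i) (%k. a k $ j) k * cnj (c k $ i)"
  unfolding conv_def by (simp only: integral_mult_left_zero integral_mult_right_zero)
  finally show "(LINT l|cs. Re (iwv k j * (b l $ i * a (k - l) $ j) * cnj (c k $ i))) =
  Re (iwv k j * conv (%k. b k $ i) (%k. a k $ j) k * cnj (c k $ i))" .
  qed
  also have "... = adv a b k <.> c k" unfolding inner_vec_def adv_def inner_complex_eq_Re by (simp add: sum_distrib_right)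
  finally show ?thesis by simp
  qed
  show "integrable cs (%k. adv a b k <.> c k)"
  unfolding inner using pair_sigma_finite.integrable_fst'[OF sf_pair_cs, of "S b c"] iS by (simp add: pair_cs)
  show "(LINT k|cs. adv a b k <.> c k) = (LINT z|cs. S b c z)"
  unfolding inner using pair_sigma_finite.integral_fst'[OF sf_pair_cs, of "S b c"] iS by (simp add: pair_cs)
  thus "(LINT k|cs. adv a b k <.> c k) = (LINT l|cs. (LINT k|cs. S b c (k,l)))"
  using pair_sigma_finite.integral_snd[OF sf_pair_cs, of "%k l. S b c (k,l)"] iS by (simp add: pair_cs)
 qed
 have anti: "S c b (l,k) = - S b c (k,l)" for k l
 proof -
  \<comment> \<open>Solenoidality at the mode \<open>k - l\<close> lets the wave-number
    \<open>l\<close> replace \<open>k\<close>. Reality of \<open>a\<close> then conjugates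
    everything, and \<open>Re (\<i> * cnj z) = - Re (\<i> * z)\<close> gives the sign.\<close>
  have d: "(\<Sum>j\<in>UNIV. complex_of_real (wave L k $ j) * a (k - l) $ j) = (\<Sum>j\<in>UNIV. complex_of_real (wave L l $ j) * a (k - l) $ j)"
  proof -
  have "(\<Sum>j\<in>UNIV. complex_of_real (wave L (k - l) $ j) * a (k - l) $ j) = 0"
  using a(3) by (simp add: divfree_def wdot_def)
  thus ?thesis by (simp add: wave_diff left_diff_distrib sum_subtractf)
  qed
  have h: "a (l - k) $ j = cnj (a (k - l) $ j)" for j using a(2) minus_diff_eq[of k l] unfolding herm_def by metis
  have e: "S b c (k,l) = Re (\<i> * (\<Sum>j\<in>UNIV. of_real (wave L k $ j) * a (k - l) $ j) * (\<Sum>i\<in>UNIV. b l $ i * cnj (c k $ i)))" for b c k l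
  by (simp only: S_def prod.case sum_distrib_left sum_distrib_right Re_sum[symmetric] mult_ac)
  (subst sum.swap, rule refl)?
  let ?P = "\<Sum>j\<in>UNIV. complex_of_real (wave L k $ j) * a (k - l) $ j"
  let ?Q = "\<Sum>i\<in>UNIV. b l $ i * cnj (c k $ i)"
  have "S c b (l,k) = Re (\<i> * cnj ?P * cnj ?Q)" unfolding e[of c b l k] h unfolding d by (simp add: mult.commute)
  also have "... = - Re (\<i> * ?P * ?Q)"
  proof -
  have "Re (\<i> * cnj p * cnj q) = - Re (\<i> * p * q)" for p q by (simp add: algebra_simps)
  thus ?thesis .
  qed
  finally show ?thesis unfolding e[of b c k l] .
 qed
 show "integrable cs (%k. adv a b k <.> c k)" by (rule key(2)[OF b c])
 have "(LINT k|cs. adv a b k <.> c k) = (LINT l|cs. (LINT k|cs. S b c (k,l)))" by (rule key(4)[OF b c])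
 also have "... = (LINT l|cs. - (LINT k|cs. S c b (l,k)))" by (simp add: anti)
 also have "... = - (LINT l|cs. (LINT k|cs. S c b (l,k)))" by simp
 also have "(LINT l|cs. (LINT k|cs. S c b (l,k))) = (LINT k|cs. adv a c k <.> b k)"
  using key(1,3)[OF c b] pair_sigma_finite.integral_fst'[OF sf_pair_cs, of "S c b"] by (simp add: pair_cs)
 finally show "(LINT k|cs. adv a b k <.> c k) = - (LINT k|cs. adv a c k <.> b k)" .
qed

end

section \<open>The cell as a measure space, translations and characters\<close>

lemma lborel_translate:
 fixes g :: "'a::euclidean_space => 'b::{banach,second_countable_topology}" assumes [measurable]: "g : BM"
 shows "integrable lborel (%x. g (x + c)) <-> integrable lborel g" and "(LINT x|lborel. g (x + c)) = (LINT x|lborel. g x)"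
proof -
 have "integrable lborel g <-> integrable (distr lborel borel ((+) c)) g" by (simp add: lborel_distr_plus)
 also have "... <-> integrable lborel (%x. g (c + x))" by (rule integrable_distr_eq) auto
 finally show "integrable lborel (%x. g (x + c)) <-> integrable lborel g" by (simp add: add.commute)
 have "(LINT x|lborel. g x) = (LINT x|(distr lborel borel ((+) c)). g x)" by (simp add: lborel_distr_plus)
 also have "... = (LINT x|lborel. g (c + x))" by (rule integral_distr) auto
 finally show "(LINT x|lborel. g (x + c)) = (LINT x|lborel. g x)" by (simp add: add.commute)
qed

lemma bm_nth [measurable]: "(%x::'a::real_normed_vector^'n. x $ i) : BM" by (intro bm_cont continuous_intros)

context torus begin

text \<open>Makes \<open>torus_integral\<close> an integral against a finite measure, to which
  Fubini, dominated convergence and statements almost everywhere apply directly.\<close>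

definition tm :: "(real^3) measure" where "tm = restrict_space lborel (cell L)"
abbreviation nn_tm (binder "TN " 10) where "nn_tm f == integral\<^sup>N tm f"

lemma cell_sets [measurable, simp]: "cell L : sets borel" by (simp add: cell_def)

lemma cell_iff: "x : cell L <-> (\<forall>i. 0 <= x $ i & x $ i <= L)" by (simp add: cell_def mem_box_cart)

lemma integrable_tm:
 fixes f :: "real^3 => 'b::{banach,second_countable_topology}"
 shows "integrable tm f <-> integrable lborel (%x. indicator (cell L) x *R f x)"
 unfolding tm_def by (rule integrable_restrict_space) simp

lemma integral_tm:
 fixes f :: "real^3 => 'b::{banach,second_countable_topology}"
 shows "(LINT x|tm. f x) = (LINT x|lborel. indicator (cell L) x *R f x)" unfolding tm_def by (rule integral_restrict_space) simp

lemma tint_tm: "torus_integral L f = (LINT x|tm. f x)" by (simp add: torus_integral_def sli_def integral_tm)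

lemma si_tm:
 fixes f :: "real^3 => 'b::{banach,second_countable_topology}" shows "SI (cell L) f <-> integrable tm f"
 by (simp add: si_def integrable_tm)

lemma m_tm [measurable (raw)]: "f : BM ==> f : BMs tm" unfolding tm_def by (rule measurable_restrict_space1) simp

lemma AE_tm: "(AE x in tm. P x) <-> (AE x in lborel. x : cell L --> P x)" unfolding tm_def by (rule AE_restrict_space_iff) simp

lemma space_tm: "space tm = cell L" by (simp add: tm_def space_restrict_space)

lemma emeasure_tm: "emeasure tm (space tm) = ennreal (L ^ 3)"
proof -
 have "emeasure tm (space tm) = emeasure lborel (cell L)"
  unfolding space_tm unfolding tm_def by (rule emeasure_restrict_space) auto
 also have "... = ennreal (\<Prod>b\<in>Basis. ((\<chi> i. L) - 0 :: real^3) <.> b)" unfolding cell_def using L_pos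
  by (subst emeasure_lborel_cbox_eq) (auto simp: Basis_vec_def inner_axis)
 also have "(\<Prod>b\<in>Basis. ((\<chi> i. L) - 0 :: real^3) <.> b) = L ^ 3"
 proof -
  have "(\<Prod>b\<in>Basis. ((\<chi> i. L) - 0 :: real^3) <.> b) = (\<Prod>b\<in>(Basis::(real^3) set). L)"
  by (rule prod.cong) (auto simp: Basis_vec_def inner_axis)
  thus ?thesis by simp
 qed
 finally show ?thesis .
qed

lemma finite_tm: "finite_measure tm" by (rule finite_measureI) (simp add: emeasure_tm)

lemma measure_tm: "measure tm (space tm) = L ^ 3" using emeasure_tm L_pos by (simp add: measure_def)

lemma integrable_tm_bounded:
 fixes f :: "real^3 => 'b::{banach,second_countable_topology}" assumes "f : BM" "!!x. norm (f x) <= B" shows "integrable tm f"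
proof (rule finite_measure.integrable_const_bound[OF finite_tm])
 show "AE x in tm. norm (f x) <= B" by (rule AE_I2) (rule assms(2))
qed (rule m_tm[OF assms(1)])

lemma integrable_tm_const [simp]: "integrable tm (%x. c :: 'b::{banach,second_countable_topology})"
 by (rule finite_measure.integrable_const[OF finite_tm])

lemma AE_coord_neq: "AE x in lborel. (x::real^3) $ j ~= c"
proof -
 have "axis j 1 : (Basis :: (real^3) set)" by (auto simp: Basis_vec_def)
 from AE_lborel_inner_neq[OF this, of c] show ?thesis by (simp add: inner_axis)
qed

lemma periodicD: "periodic L f ==> f (x + axis i L) = f x" by (simp add: periodic_def)

text \<open>The shifted cell meets the cell in the slab \<open>A\<close>; the part that sticks out
  is carried back by one period onto the slab \<open>B\<close>. The face common to both slabs is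
  null.\<close>

lemma tm_shift:
 fixes f :: "real^3 => 'b::{banach,second_countable_topology}"
 assumes [measurable]: "f : BM" and per: "periodic L f" and int: "integrable tm f" and h: "0 <= h" "h <= L"
 shows "(LINT x|tm. f (x + axis j h)) = (LINT x|tm. f x)"
proof -
 define A where "A = {y : cell L. h <= y $ j}"
 define B where "B = {y : cell L. y $ j <= h}"
 have [measurable]: "A : sets borel" "B : sets borel" unfolding A_def B_def by measurable
 have fi: "integrable lborel (%x. indicator (cell L) x *R f x)" using int by (simp add: integrable_tm)
 have "integrable lborel (%x. indicator A x *R (indicator (cell L) x *R f x))" by (rule integrable_mult_indicator[OF _ fi]) auto
 hence A: "integrable lborel (%x. indicator A x *R f x)"
  by (rule bochnerI_cong[THEN iffD1, rotated 2]) (auto simp: A_def indicator_def)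
 have "integrable lborel (%x. indicator B x *R (indicator (cell L) x *R f x))" by (rule integrable_mult_indicator[OF _ fi]) auto
 hence B: "integrable lborel (%x. indicator B x *R f x)"
  by (rule bochnerI_cong[THEN iffD1, rotated 2]) (auto simp: B_def indicator_def)
 have "(LINT x|tm. f x) = (LINT x|lborel. indicator A x *R f x + indicator B x *R f x)" unfolding integral_tm
 proof (rule integral_cong_AE)
  show "AE x in lborel. indicator (cell L) x *R f x = indicator A x *R f x + indicator B x *R f x"
  using AE_coord_neq[of j h] by eventually_elim (auto simp: A_def B_def indicator_def)
 qed auto
 also have "... = (LINT x|lborel. indicator A x *R f x) + (LINT x|lborel. indicator B x *R f x)" by (rule bochner_add[OF A B])
 finally have 1: "(LINT x|tm. f x) = ..." .
 have "(LINT x|tm. f (x + axis j h)) = (LINT x|lborel. indicator A (x + axis j h) *R f (x + axis j h)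
  + indicator B (x + axis j (h - L)) *R f (x + axis j (h - L)))" unfolding integral_tm
 proof (rule integral_cong_AE)
  show "AE x in lborel. indicator (cell L) x *R f (x + axis j h) = indicator A (x + axis j h) *R f (x + axis j h)
  + indicator B (x + axis j (h - L)) *R f (x + axis j (h - L))" using AE_coord_neq[of j "L - h"]
  proof eventually_elim
  fix x :: "real^3" assume x: "x $ j ~= L - h"
  have "x + axis j h = (x + axis j (h - L)) + axis j L" by (simp add: vec_eq_iff axis_def)
  hence p: "f (x + axis j h) = f (x + axis j (h - L))" using periodicD[OF per] by metis
  have a: "x + axis j h : A <-> x : cell L & x $ j <= L - h"
  proof -
  have "(\<forall>i. 0 <= (x + axis j h) $ i & (x + axis j h) $ i <= L) & h <= (x + axis j h) $ j <->
  (\<forall>i. i ~= j --> 0 <= x $ i & x $ i <= L) & (0 <= x $ j & x $ j <= L - h)" using h by (auto simp: axis_def)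
  also have "... <-> (\<forall>i. 0 <= x $ i & x $ i <= L) & x $ j <= L - h"
  using h by (metis diff_le_eq le_add_same_cancel1 order_trans)
  finally show ?thesis by (simp add: A_def cell_iff)
  qed
  have b: "x + axis j (h - L) : B <-> x : cell L & L - h <= x $ j"
  proof -
  have "(\<forall>i. 0 <= (x + axis j (h-L)) $ i & (x + axis j (h-L)) $ i <= L) & (x + axis j (h-L)) $ j <= h <->
  (\<forall>i. i ~= j --> 0 <= x $ i & x $ i <= L) & (L - h <= x $ j & x $ j <= L)"
  using h by (auto simp: axis_def split: if_splits)
  also have "... <-> (\<forall>i. 0 <= x $ i & x $ i <= L) & L - h <= x $ j" using h by (metis diff_ge_0_iff_ge order_trans)
  finally show ?thesis by (simp add: B_def cell_iff)
  qed
  have "x : cell L ==> x $ j < L - h \<or> L - h < x $ j" using x by linarith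
  thus "indicator (cell L) x *R f (x + axis j h) = indicator A (x + axis j h) *R f (x + axis j h)
  + indicator B (x + axis j (h - L)) *R f (x + axis j (h - L))" unfolding p by (auto simp: indicator_def a b)
  qed
 qed auto
 also have "... = (LINT x|lborel. indicator A (x + axis j h) *R f (x + axis j h))
  + (LINT x|lborel. indicator B (x + axis j (h - L)) *R f (x + axis j (h - L)))" by (rule bochner_add)
  (use A B lborel_translate(1)[of "%x. indicator A x *R f x"] lborel_translate(1)[of "%x. indicator B x *R f x"] in simp_all)
 also have "... = (LINT x|tm. f x)"
  unfolding 1 using lborel_translate(2)[of "%x. indicator A x *R f x"] lborel_translate(2)[of "%x. indicator B x *R f x"] by simp
 finally show ?thesis .
qed

text \<open>The box of side \<open>2 * L\<close> contains the cell together with its translates by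
  at most \<open>L\<close> along an axis, the region met when a derivative is integrated over a
  period.\<close>

lemma continuous_periodic_bounded:
 fixes f :: "real^3 => 'b::real_normed_vector"
 assumes "continuous_on UNIV f" shows "\<exists>B. \<forall>x \<in> cbox (0::real^3) (\<chi> i. 2 * L). norm (f x) <= B"
proof -
 have "compact (f ` cbox (0::real^3) (\<chi> i. 2 * L))"
  by (rule compact_continuous_image[OF continuous_on_subset[OF assms]]) auto
 hence "bounded (f ` cbox (0::real^3) (\<chi> i. 2 * L))" by (rule compact_imp_bounded)
 then obtain B where "\<forall>y\<in>f ` cbox (0::real^3) (\<chi> i. 2 * L). norm y <= B" unfolding bounded_iff by (rule exE)
 hence "\<forall>x\<in>cbox (0::real^3) (\<chi> i. 2 * L). norm (f x) <= B" by (simp only: ball_simps)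
 thus ?thesis by (rule exI)
qed

lemma cell_subset_big: "cell L \<subseteq> cbox (0::real^3) (\<chi> i. 2 * L)"
proof
 fix x assume x: "x : cell L"
 have "0 <= x $ i & x $ i <= 2 * L" for i
 proof -
  have "0 <= x $ i" "x $ i <= L" using x by (auto simp: cell_iff)
  thus ?thesis using L_pos by linarith
 qed
 thus "x : cbox 0 (\<chi> i. 2 * L)" by (simp add: mem_box_cart)
qed

lemma integrable_tm_continuous:
 fixes f :: "real^3 => 'b::{banach,second_countable_topology}" assumes "continuous_on UNIV f" shows "integrable tm f"
proof -
 obtain B where "\<forall>x \<in> cbox (0::real^3) (\<chi> i. 2 * L). norm (f x) <= B" using continuous_periodic_bounded[OF assms] by (rule exE)
 hence "AE x in tm. norm (f x) <= B" using cell_subset_big by (intro AE_I2) (auto simp: space_tm)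
 thus ?thesis using bm_cont[OF assms] by (intro finite_measure.integrable_const_bound[OF finite_tm] m_tm)
qed

text \<open>The fundamental theorem along the axis over a full period gives zero by periodicity.
  Averaged over the cell, translation invariance turns the line integral into \<open>L\<close> times
  the integral of \<open>D\<close>.\<close>

lemma integral_tm_derivative:
 fixes g D :: "real^3 => 'b::euclidean_space" assumes gc: "continuous_on UNIV g" and Dc: "continuous_on UNIV D"
  and gp: "periodic L g" and Dp: "periodic L D" and d: "!!x. ((%t. g (x + axis j t)) has_vector_derivative D x) (at 0)"
 shows "(LINT x|tm. D x) = 0"
proof -
 have gm: "g : BM" and Dm[measurable]: "D : BM" using gc Dc by (auto intro: bm_cont)
 have gi: "integrable tm g" and Di: "integrable tm D" using gc Dc by (auto intro: integrable_tm_continuous)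
 obtain B where B: "!!x. x : cbox (0::real^3) (\<chi> i. 2 * L) ==> norm (D x) <= B"
  using continuous_periodic_bounded[OF Dc] by blast
 have axis_add: "axis j (s + t) = axis j s + (axis j t :: real^3)" for s t by (simp add: vec_eq_iff axis_def)
 have axc: "continuous_on UNIV (%t. axis j t :: real^3)" unfolding axis_def
 proof (rule continuous_on_vec_lambda)
  fix i show "continuous_on UNIV (%t::real. if i = j then t else 0)" by (cases "i = j") auto
 qed
 have axm[measurable]: "(%t. axis j t :: real^3) : BM" by (rule bm_cont[OF axc])
 have d': "((%t. g (x + axis j t)) has_vector_derivative D (x + axis j s)) (at s within S)" for x s S
 proof -
  have "((%t. g ((x + axis j s) + axis j t)) \<circ> (%t. t - s) has_vector_derivative 1 *R D (x + axis j s)) (at s)"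
  by (rule vector_diff_chain_at) (auto intro!: derivative_eq_intros d)
  moreover have "(%t. g ((x + axis j s) + axis j t)) \<circ> (%t. t - s) = (%t. g (x + axis j t))"
  by (auto simp: fun_eq_iff add.assoc axis_add[symmetric])
  ultimately show ?thesis by (simp add: has_vector_derivative_at_within)
 qed
 have ftc: "g (x + axis j L) - g x = (LINT t|lborel. indicator {0..L} t *R D (x + axis j t))" for x
 proof -
  have "(LINT t|lborel. indicator {0..L} t *R D (x + axis j t)) = g (x + axis j L) - g (x + axis j 0)"
  by (rule integral_FTC_Icc) (use L_pos d' in \<open>auto intro!: continuous_on_compose2[OF Dc] continuous_intros continuous_on_subset[OF axc]\<close>)
  moreover have "axis j 0 = (0::real^3)" by (simp add: vec_eq_iff axis_def)
  ultimately show ?thesis by simp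
 qed
 interpret tmf: finite_measure tm by (rule finite_tm)
 interpret pair_sigma_finite tm lborel by unfold_locales
 have DI: "integrable (tm <*M> lborel) (%(x,t). indicator {0..L} t *R D (x + axis j t))"
 proof (rule Fubini_integrable)
  have "(%z. x3) : BMs (tm <*M> lborel)" for x3 :: real by simp
  have f: "fst : BMs (tm <*M> lborel)" by (rule m_comp[OF measurable_fst]) (simp add: m_tm)
  have "snd : BMs (tm <*M> lborel)" by simp
  hence "(%z. D (fst z + axis j (snd z))) : BMs (tm <*M> lborel)"
  using f by (intro m_comp[OF _ Dm] borel_measurable_add m_comp[OF _ axm])
  thus m: "(%(x,t). indicator {0..L} t *R D (x + axis j t)) : BMs (tm <*M> lborel)" by (simp add: split_beta')
  have bd: "norm (indicator {0..L} t *R D (x + axis j t)) <= indicator {0..L} t * B" if "x : cell L" for x t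
  proof (cases "t : {0..L}")
  case True
  hence "x + axis j t : cbox 0 (\<chi> i. 2 * L)" using that L_pos
  by (auto simp: cell_iff mem_box_cart axis_def) (smt (verit, best))+
  thus ?thesis using B True by simp
  qed simp
  have mx: "(%t. indicator {0..L} t *R D (x + axis j t)) : BMs lborel" for x by simp
  have iB: "integrable lborel (%t. indicator {0..L} t * B)" by (intro integrable_mult_left integrable_real_indicator) (auto simp: emeasure_lborel_Icc_eq)
  show "AE x in tm. integrable lborel (%y. case (x, y) of (x,t) => indicator {0..L} t *R D (x + axis j t))"
  proof (rule AE_I2)
  fix x assume "x : space tm"
  hence x: "x : cell L" by (simp add: space_tm)
  show "integrable lborel (%y. case (x, y) of (x,t) => indicator {0..L} t *R D (x + axis j t))" unfolding prod.case
  by (rule bochnerI_bound[OF iB mx], rule AE_I2, unfold real_norm_def,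
  rule order_trans[OF bd[OF x] abs_ge_self])
  qed
  have m2: "(%x. (LINT t|lborel. norm (case (x,t) of (x,t) => indicator {0..L} t *R D (x + axis j t)))) : BMs tm"
  proof -
  have "(%(x,t). norm (indicator {0..L} t *R D (x + axis j t))) : BMs (tm <*M> lborel)"
  using m_comp[OF m borel_measurable_norm] by (simp only: split_beta')
  from lborel.borel_measurable_lebesgue_integral[OF this] show ?thesis by (simp only: prod.case)
  qed
  show "integrable tm (%x. (LINT t|lborel. norm (case (x,t) of (x,t) => indicator {0..L} t *R D (x + axis j t))))"
  proof (rule tmf.integrable_const_bound[where B="L * B"])
  show "AE x in tm. norm (LINT t|lborel. norm (case (x,t) of (x,t) => indicator {0..L} t *R D (x + axis j t))) <= L * B"
  proof (rule AE_I2)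
  fix x assume "x : space tm"
  hence x: "x : cell L" by (simp add: space_tm)
  have "(LINT t|lborel. norm (indicator {0..L} t *R D (x + axis j t))) <= (LINT t|lborel. indicator {0..L} t * B)"
  by (rule integral_mono'[OF iB bd[OF x] order_trans[OF norm_ge_zero bd[OF x]]])
  also have "... = L * B" using L_pos by simp
  finally have "(LINT t|lborel. norm (indicator {0..L} t *R D (x + axis j t))) <= L * B" .
  moreover have "0 <= (LINT t|lborel. norm (indicator {0..L} t *R D (x + axis j t)))" by (rule bochner_nonneg) (rule norm_ge_zero)
  ultimately show "norm (LINT t|lborel. norm (case (x,t) of (x,t) => indicator {0..L} t *R D (x + axis j t))) <= L * B"
  unfolding prod.case real_norm_def by linarith
  qed
  qed (rule m2)
 qed
 have "0 = (LINT x|tm. g (x + axis j L) - g x)" using periodicD[OF gp] by simp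
 also have "... = (LINT x|tm. (LINT t|lborel. indicator {0..L} t *R D (x + axis j t)))" by (simp add: ftc)
 also have "... = (LINT t|lborel. (LINT x|tm. indicator {0..L} t *R D (x + axis j t)))" using Fubini_integral[OF DI] by simp
 also have "... = (LINT t|lborel. indicator {0..L} t *R (LINT x|tm. D x))" by (rule bint_cong)
  (use tm_shift[OF Dm Dp Di] in \<open>auto simp: indicator_def\<close>)
 also have "... = L *R (LINT x|tm. D x)" using L_pos by simp
 finally show ?thesis using L_pos by simp
qed

definition ch :: "int^3 => real^3 => complex" where "ch n x = cis (wave L n <.> x)"

lemma ch_norm [simp]: "norm (ch n x) = 1" by (simp add: ch_def)
lemma ch_0 [simp]: "ch 0 x = 1" by (simp add: ch_def)
lemma ch_add: "ch (m + n) x = ch m x * ch n x" by (simp add: ch_def wave_add inner_add_left cis_mult)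
lemma ch_cnj: "cnj (ch n x) = ch (- n) x" by (simp add: ch_def wave_minus cis_cnj)
lemma ch_continuous: "continuous_on A (ch n)" unfolding ch_def cis_conv_exp by (intro continuous_intros)
lemma ch_measurable [measurable]: "ch n : BM" by (rule bm_cont[OF ch_continuous])

lemma wave_axis: "wave L n <.> axis i t = wave L n $ i * t" by (simp add: inner_axis)

lemma ch_shift: "ch n (x + axis i t) = ch n x * cis (wave L n $ i * t)" by (simp add: ch_def inner_add_right wave_axis cis_mult)

lemma ch_periodic: "periodic L (ch n)"
proof -
 have "cis (wave L n $ i * L) = 1" for i using L_pos by (simp add: wave_def complex_eq_iff)
 thus ?thesis by (simp add: periodic_def ch_shift)
qed

lemma ch_derivative: "((%t. ch n (x + axis j t)) has_vector_derivative iwv n j * ch n x) (at 0)"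
proof -
 have "((%t. exp (iwv n j * of_real t)) has_vector_derivative iwv n j) (at 0)"
  by (auto intro!: derivative_eq_intros has_vector_derivative_real_field)
 hence "((%t. ch n x * exp (iwv n j * of_real t)) has_vector_derivative ch n x * (iwv n j)) (at 0)"
  by (rule has_vector_derivative_mult_right)
 thus ?thesis by (simp add: ch_shift cis_conv_exp mult_ac)
qed

text \<open>A nonzero \<open>n\<close> has a nonzero component; the derivative of
  \<open>ch n\<close> in that direction is a nonzero multiple of \<open>ch n\<close> and integrates
  to zero.\<close>

lemma ch_integral: "(LINT x|tm. ch n x) = (if n = 0 then of_real (L ^ 3) else 0)"
proof (cases "n = 0")
 case True
 thus ?thesis using L_pos by (simp add: measure_tm scaleR_conv_of_real)
next
 case False
 then obtain j where "n $ j ~= 0" by (auto simp: vec_eq_iff)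
 hence w: "wave L n $ j ~= 0" using L_pos by (simp add: wave_def)
 have "(LINT x|tm. iwv n j * ch n x) = 0" by (rule integral_tm_derivative[OF ch_continuous _ ch_periodic _ ch_derivative])
  (use ch_periodic[of n] in \<open>auto intro!: continuous_intros ch_continuous simp: periodic_def\<close>)
 thus ?thesis using w False by simp
qed

section \<open>Fourier coefficients determine integrable functions\<close>

definition cf :: "(real^3 => complex) => int^3 => complex" where
 "cf f n = (LINT x|tm. f x * cnj (ch n x)) / of_real (L ^ 3)"

lemma ft_cf: "fourier L f n = cf (%x. of_real (f x)) n"
proof -
 have "cnj (ch n x) = exp (- \<i> * complex_of_real (wave L n <.> x))" for x
  by (simp only: ch_def cis_cnj) (simp add: cis_conv_exp)
 thus ?thesis by (simp add: fourier_def cf_def tint_tm)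
qed

inductive trig :: "(real^3 => complex) => bool" where
 trig_ch: "trig (%x. c * ch n x)"
| trig_add: "trig f ==> trig g ==> trig (%x. f x + g x)"

lemma trig_const: "trig (%x. c)" using trig_ch[of c 0] by simp

lemma trig_mult_ch: "trig f ==> trig (%x. c * ch n x * f x)"
proof (induction rule: trig.induct)
 case (trig_ch d m)
 have "(%x. c * ch n x * (d * ch m x)) = (%x. (c * d) * ch (n + m) x)" by (simp add: ch_add mult_ac)
 thus ?case by (simp only: trig.trig_ch)
next
 case (trig_add f g)
 thus ?case using trig.trig_add by (simp add: distrib_left)
qed

lemma trig_mult: "trig f ==> trig g ==> trig (%x. f x * g x)"
proof (induction rule: trig.induct)
 case (trig_ch d m)
 thus ?case by (rule trig_mult_ch)
next
 case (trig_add f h)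
 thus ?case using trig.trig_add by (simp add: distrib_right)
qed

lemma trig_sum: "finite A ==> (!!a. a : A ==> trig (f a)) ==> trig (%x. \<Sum>a\<in>A. f a x)"
 by (induction A rule: finite_induct) (auto intro: trig_const trig_add)

lemma trig_continuous: "trig f ==> continuous_on UNIV f"
 by (induction rule: trig.induct) (auto intro!: continuous_intros ch_continuous)

text \<open>Maps the torus into \<open>complex^3\<close>, with the compact image of a cell; there
  the Stone-Weierstrass theorem for polynomials applies.\<close>

definition circ :: "real^3 => complex^3" where "circ x = (\<chi> i. cis (2 * pi / L * x $ i))"

lemma circ_eq_ch: "circ x $ i = ch (axis i 1) x"
proof -
 have "wave L (axis i 1) <.> x = 2 * pi / L * x $ i"
 proof -
  have "wave L (axis i 1) = axis i (2 * pi / L)" by (simp add: wave_def vec_eq_iff axis_def)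
  thus ?thesis by (simp add: inner_axis inner_commute)
 qed
 thus ?thesis by (simp add: circ_def ch_def)
qed

lemma circ_continuous: "continuous_on A circ"
proof -
 have "circ = (%x. \<chi> i. ch (axis i 1) x)" by (auto simp: vec_eq_iff circ_eq_ch)
 thus ?thesis by (simp add: continuous_on_vec_lambda ch_continuous)
qed

lemma circ_measurable [measurable]: "circ : BM" by (rule bm_cont[OF circ_continuous])

text \<open>Real and imaginary parts of \<open>circ x $ i\<close> are combinations of a character
  and its conjugate, and products of characters are characters.\<close>

lemma trig_real_polynomial:
 "real_polynomial_function p ==> trig (%x. of_real (p (circ x)))"
proof (induction rule: real_polynomial_function.induct)
 case (linear f)
 then interpret bounded_linear f .
 have f: "f z = (\<Sum>i\<in>UNIV. Re (z $ i) * f (axis i 1) + Im (z $ i) * f (axis i \<i>))" for z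
 proof -
  have a: "Re (z $ i) *R axis i 1 + Im (z $ i) *R axis i \<i> = axis i (z $ i)" for i
  by (simp add: vec_eq_iff axis_def complex_eq_iff)
  have "z = (\<Sum>i\<in>UNIV. Re (z $ i) *R axis i 1 + Im (z $ i) *R axis i \<i>)"
  unfolding a by (simp add: vec_eq_iff axis_def sum_3 forall_3)
  hence "f z = f (\<Sum>i\<in>UNIV. Re (z $ i) *R axis i 1 + Im (z $ i) *R axis i \<i>)" by (rule arg_cong)
  thus ?thesis by (simp add: sum add scaleR)
 qed
 have "complex_of_real (f (circ x)) = (\<Sum>i\<in>UNIV.
  (of_real (f (axis i 1)) / 2 + of_real (f (axis i \<i>)) / (2 * \<i>)) * ch (axis i 1) x
  + (of_real (f (axis i 1)) / 2 - of_real (f (axis i \<i>)) / (2 * \<i>)) * ch (- axis i 1) x)" for x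
 proof -
  have "complex_of_real (Re c * a + Im c * b) = (of_real a / 2 + of_real b / (2 * \<i>)) * c + (of_real a / 2 - of_real b / (2 * \<i>)) * cnj c" for a b c
  by (simp add: complex_eq_iff field_simps)
  thus ?thesis unfolding f[of "circ x"] of_real_sum circ_eq_ch ch_cnj[symmetric] by simp
 qed
 thus ?case by (simp only:) (intro trig_sum trig_add trig_ch finite)
next
 case (const c)
 show ?case by (rule trig_const)
next
 case (add f g)
 thus ?case using trig_add by simp
next
 case (mult f g)
 thus ?case using trig_mult by simp
qed

text \<open>A Borel inverse of \<open>circ\<close> up to lattice translations; through it every
  Borel periodic function is a Borel function of \<open>circ x\<close>.\<close>

definition uncirc :: "complex^3 => real^3" where "uncirc z = (\<chi> i. L / (2 * pi) * Arg2pi (z $ i))"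

lemma Arg2pi_measurable [measurable]: "Arg2pi : BM"
proof -
 have "(%z. indicator (- \<real>\<^sub>\<ge>\<^sub>0) z *R Arg2pi z) : BM" by (rule borel_measurable_continuous_on_indicator)
  (auto intro!: continuous_at_imp_continuous_on continuous_at_Arg2pi borel_open simp: open_Compl closed_nonneg_Reals_complex)
 moreover have "(%z. indicator (- \<real>\<^sub>\<ge>\<^sub>0) z *R Arg2pi z) = Arg2pi"
 proof
  fix z show "indicator (- \<real>\<^sub>\<ge>\<^sub>0) z *R Arg2pi z = Arg2pi z"
  by (cases "z : \<real>\<^sub>\<ge>\<^sub>0") (auto simp: Arg2pi_eq_0 complex_nonneg_Reals_iff complex_is_Real_iff)
 qed
 ultimately show ?thesis by simp
qed

lemma uncirc_measurable [measurable]: "uncirc : BM"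
proof -
 have "(%z. uncirc z <.> b) : BM" if b: "b : Basis" for b
 proof -
  obtain i where "b = axis i 1" using b by (auto simp: Basis_vec_def)
  hence "(%z. uncirc z <.> b) = (%z. L / (2 * pi) * Arg2pi (z $ i))" by (auto simp: uncirc_def inner_axis)
  thus ?thesis by simp
 qed
 thus ?thesis by (subst borel_measurable_euclidean_space) blast
qed

lemma axis_0: "axis i 0 = (0::real^3)" by (simp add: vec_eq_iff axis_def)

lemma periodic_int: "periodic L f ==> f (x + axis i (L * of_int m)) = f x"
proof (induction m arbitrary: x rule: int_induct[where k=0])
 case base
 show ?case by (simp add: axis_0)
next
 case (step1 m)
 have "x + axis i (L * of_int (m + 1)) = (x + axis i L) + axis i (L * of_int m)" by (simp add: vec_eq_iff axis_def algebra_simps)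
 thus ?case using step1 periodicD by metis
next
 case (step2 m)
 have "(x + axis i (L * of_int (m - 1))) + axis i L = x + axis i (L * of_int m)" by (simp add: vec_eq_iff axis_def algebra_simps)
 thus ?case using step2 periodicD by metis
qed

lemma periodic_lattice: assumes "periodic L f" shows "f (x + (\<chi> i. L * of_int (m $ i))) = f x"
proof -
 have e: "x + (\<chi> i. L * of_int (m $ i)) = x + axis 1 (L * of_int (m $ 1)) + axis 2 (L * of_int (m $ 2)) + axis 3 (L * of_int (m $ 3))"
  by (simp add: vec_eq_iff axis_def forall_3)
 show ?thesis unfolding e by (simp only: periodic_int[OF assms])
qed

lemma periodic_uncirc: assumes "periodic L f" shows "f (uncirc (circ x)) = f x"
proof -
 have "\<exists>m::int. x $ i = uncirc (circ x) $ i + L * of_int m" for i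
 proof -
  let ?th = "2 * pi / L * x $ i"
  have "cis (Arg2pi (cis ?th)) = cis ?th" using Arg2pi_eq[of "cis ?th"] by (simp add: cis_conv_exp)
  hence "sin ?th = sin (Arg2pi (cis ?th)) & cos ?th = cos (Arg2pi (cis ?th))" by (simp add: complex_eq_iff)
  then obtain m :: int where m: "?th = Arg2pi (cis ?th) + 2 * pi * m" using sin_cos_eq_iff by blast
  have "x $ i = L / (2 * pi) * ?th" using L_pos by simp
  also have "... = L / (2 * pi) * (Arg2pi (cis ?th) + 2 * pi * m)" by (rule arg_cong[OF m])
  also have "... = L / (2 * pi) * Arg2pi (cis ?th) + L * m" using L_pos by (simp add: distrib_left)
  also have "L / (2 * pi) * Arg2pi (cis ?th) = uncirc (circ x) $ i" by (simp add: uncirc_def circ_def)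
  finally show ?thesis by (rule exI)
 qed
 hence "\<forall>i. \<exists>m::int. x $ i = uncirc (circ x) $ i + L * of_int m" by blast
 from choice[OF this] obtain m where m: "!!i. x $ i = uncirc (circ x) $ i + L * of_int (m i)" by blast
 have e: "uncirc (circ x) + (\<chi> i. L * of_int ((\<chi> i. m i) $ i)) = x"
 proof (rule vec_eq_iff[THEN iffD2], rule allI)
  fix i show "(uncirc (circ x) + (\<chi> i. L * of_int ((\<chi> i. m i) $ i))) $ i = x $ i"
  unfolding vector_add_component vec_lambda_beta by (rule m[symmetric])
 qed
 from periodic_lattice[OF assms, of "uncirc (circ x)" "\<chi> i. m i"]
 have "f x = f (uncirc (circ x))" by (subst (asm) e)
 thus ?thesis by (rule sym)
qed

text \<open>The exceptional points lie in the countably many lattice translates of one null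
  set.\<close>

lemma AE_periodic: assumes "periodic L P" and "AE x in tm. P x" shows "AE x in lborel. P x"
proof -
 have "AE x in lborel. x : cell L --> P x" using assms(2) by (simp only: AE_tm)
 then obtain N where N: "N : null_sets lborel" "!!x. x : cell L ==> x \<notin> N ==> P x" unfolding eventually_ae_filter by auto
 have "AE x in lborel. x - (\<chi> i. L * of_int (m $ i)) \<notin> N" for m :: "int^3"
  using AE_not_in[OF null_sets_translation[OF N(1), of "\<chi> i. L * of_int (m $ i)"]] by (simp only: mem_Collect_eq)
 hence "AE x in lborel. \<forall>m::int^3. x - (\<chi> i. L * of_int (m $ i)) \<notin> N" by (simp add: AE_all_countable)
 thus ?thesis
 proof eventually_elim
  fix x assume x: "\<forall>m::int^3. x - (\<chi> i. L * of_int (m $ i)) \<notin> N"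
  define m :: "int^3" where "m = (\<chi> i. \<lfloor>x $ i / L\<rfloor>)"
  have "x - (\<chi> i. L * of_int (m $ i)) : cell L"
  proof -
  have "0 <= x $ i - L * of_int (m $ i) & x $ i - L * of_int (m $ i) <= L" for i
  proof -
  have "of_int (m $ i) <= x $ i / L" "x $ i / L <= of_int (m $ i) + 1" by (auto simp: m_def)
  thus ?thesis using L_pos by (auto simp: field_simps)
  qed
  thus ?thesis by (simp add: cell_iff)
  qed
  hence "P (x - (\<chi> i. L * of_int (m $ i)))" using N(2) x by blast
  thus "P x" using periodic_lattice[OF assms(1), of "x - (\<chi> i. L * of_int (m $ i))" m] by simp
 qed
qed

lemma int_mult_bdd:
 fixes g :: "real^3 => 'b::{real_normed_algebra,banach,second_countable_topology}"
 assumes g: "integrable tm g" and m: "f : BM" and b: "!!x. x : cell L ==> norm (f x) <= B" shows "integrable tm (%x. g x * f x)"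
proof (rule bochnerI_bound)
 show "integrable tm (%x. B * norm (g x))" using g by (intro integrable_mult_right integrable_norm)
 show "(%x. g x * f x) : BMs tm" by (rule borel_measurable_times[OF borel_measurable_integrable[OF g] m_tm[OF m]])
 show "AE x in tm. norm (g x * f x) <= norm (B * norm (g x))"
 proof (rule AE_I2)
  fix x assume "x : space tm"
  hence "norm (f x) <= B" using b by (simp add: space_tm)
  hence "norm (g x) * norm (f x) <= norm (g x) * B" by (intro mult_lmono) auto
  thus "norm (g x * f x) <= norm (B * norm (g x))" using norm_mult_ineq[of "g x" "f x"] by (simp add: mult.commute)
 qed
qed

lemma integrable_mult_ch: "integrable tm g ==> integrable tm (%x. g x * (c * ch n x))"
 by (rule int_mult_bdd[where B="norm c"]) (auto simp: norm_mult)

lemma trig_bounded: "trig f ==> \<exists>B. \<forall>x. norm (f x) <= B"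
proof (induction rule: trig.induct)
 case (trig_ch c n) show ?case by (rule exI[of _ "norm c"]) (simp add: norm_mult)
next
 case (trig_add f g)
 then obtain A B where "!!x. norm (f x) <= A" "!!x. norm (g x) <= B" by blast
 hence "norm (f x + g x) <= A + B" for x using norm_triangle_mono by blast
 thus ?case by blast
qed

lemma trig_measurable: "trig f ==> f : BM" by (rule bm_cont[OF trig_continuous])

lemma integral_mult_trig_eq_0: assumes g: "integrable tm g" and z: "!!n. cf g n = 0" and f: "trig f"
 shows "(LINT x|tm. g x * f x) = 0" using f
proof (induction rule: trig.induct)
 case (trig_ch c n)
 have "(LINT x|tm. g x * cnj (ch (- n) x)) = 0" using z[of "- n"] L_pos by (simp add: cf_def)
 hence "(LINT x|tm. c * (g x * ch n x)) = 0" by (simp add: ch_cnj)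
 thus ?case by (simp add: mult_ac)
next
 case (trig_add f h)
 obtain A B where "!!x. norm (f x) <= A" "!!x. norm (h x) <= B" using trig_add trig_bounded by meson
 hence "integrable tm (%x. g x * f x)" "integrable tm (%x. g x * h x)"
  using trig_add trig_measurable by (auto intro!: int_mult_bdd[OF g])
 thus ?case using trig_add by (simp add: distrib_left)
qed

lemma compact_circ: "compact (circ ` cell L)" by (rule compact_continuous_image[OF circ_continuous]) (simp add: cell_def)

text \<open>Stone-Weierstrass on the image of \<open>circ\<close>: replacing \<open>h\<close> by a
  polynomial changes the integral by at most \<open>e\<close> times the L^1 norm of
  \<open>u\<close>, and polynomials in \<open>circ x\<close> are trigonometric, so \<open>u\<close>
  integrates to zero against them.\<close>

lemma integral_mult_continuous_circ_eq_0:
 fixes u :: "real^3 => real" assumes u: "integrable tm u" and z: "!!n. cf (%x. of_real (u x)) n = 0"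
  and h: "continuous_on UNIV (h :: complex^3 => real)" shows "(LINT x|tm. u x * h (circ x)) = 0"
proof -
 let ?I = "(LINT x|tm. norm (u x))"
 have hm: "(%x. h (circ x)) : BM" by (rule m_comp[OF circ_measurable bm_cont[OF h]])
 have bdd: "\<exists>B. \<forall>x\<in>cell L. norm (p (circ x)) <= B" if "continuous_on UNIV p" for p :: "complex^3 => real"
 proof -
  have "compact (p ` circ ` cell L)" by (rule compact_continuous_image[OF continuous_on_subset[OF that] compact_circ]) simp
  hence "bounded (p ` circ ` cell L)" by (rule compact_imp_bounded)
  then obtain B where "\<forall>y\<in>p ` circ ` cell L. norm y <= B" unfolding bounded_iff by (rule exE)
  hence "\<forall>x\<in>cell L. norm (p (circ x)) <= B" by (simp only: ball_simps)
  thus ?thesis by (rule exI)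
 qed
 have "norm (LINT x|tm. u x * h (circ x)) <= e * ?I" if e: "e > 0" for e
 proof -
  obtain p where p: "real_polynomial_function p" "!!z. z : circ ` cell L ==> \<bar>h z - p z\<bar> < e"
  by (rule Stone_Weierstrass_real_polynomial_function[OF compact_circ continuous_on_subset[OF h subset_UNIV] e]) (rule that)
  have pc: "continuous_on UNIV p" using p(1) unfolding real_polynomial_function_eq by (rule continuous_on_polymonial_function)
  have pm: "(%x. p (circ x)) : BM" by (rule m_comp[OF circ_measurable bm_cont[OF pc]])
  obtain A where "\<forall>x\<in>cell L. norm (h (circ x)) <= A" using bdd[OF h] by (rule exE)
  moreover obtain B where "\<forall>x\<in>cell L. norm (p (circ x)) <= B" using bdd[OF pc] by (rule exE)
  ultimately have AB: "!!x. x : cell L ==> norm (h (circ x)) <= A" "!!x. x : cell L ==> norm (p (circ x)) <= B" by simp_all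
  have ih: "integrable tm (%x. u x * h (circ x))" by (rule int_mult_bdd[OF u hm AB(1)])
  have ip: "integrable tm (%x. u x * p (circ x))" by (rule int_mult_bdd[OF u pm AB(2)])
  have "(LINT x|tm. complex_of_real (u x) * of_real (p (circ x))) = 0"
  by (rule integral_mult_trig_eq_0[OF _ z trig_real_polynomial[OF p(1)]]) (rule integrable_of_real[OF u])
  hence "complex_of_real (LINT x|tm. u x * p (circ x)) = 0" by (simp flip: of_real_mult integral_of_real)
  hence "(LINT x|tm. u x * h (circ x)) = (LINT x|tm. u x * h (circ x) - u x * p (circ x))" using ih ip by simp
  also have "norm ... <= (LINT x|tm. norm (u x * h (circ x) - u x * p (circ x)))" by (rule integral_norm_bound)
  also have "... <= (LINT x|tm. e * norm (u x))"
  proof (rule integral_mono)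
  show "integrable tm (%x. norm (u x * h (circ x) - u x * p (circ x)))" using ih ip by simp
  show "integrable tm (%x. e * norm (u x))" using u by simp
  fix x assume "x : space tm"
  hence "\<bar>h (circ x) - p (circ x)\<bar> <= e" using p(2)[of "circ x"] by (simp add: space_tm less_imp_le)
  hence "\<bar>u x\<bar> * \<bar>h (circ x) - p (circ x)\<bar> <= \<bar>u x\<bar> * e" by (intro mult_lmono) auto
  thus "norm (u x * h (circ x) - u x * p (circ x)) <= e * norm (u x)"
  by (simp add: right_diff_distrib[symmetric] abs_mult mult.commute)
  qed
  finally show ?thesis by simp
 qed
 note b = this
 show ?thesis
 proof (rule ccontr)
  assume n: "(LINT x|tm. u x * h (circ x)) ~= 0"
  let ?N = "norm (LINT x|tm. u x * h (circ x))"
  have I0: "0 <= ?I" by (rule bochner_nonneg) (rule norm_ge_zero)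
  have contr: False if N: "(0::real) < N" and I: "0 <= I" and bb: "!!e. 0 < e ==> N <= e * I" for N I
  proof (cases "I = 0")
  case True thus False using bb[of 1] N by simp
  next
  case False
  hence "N <= N / (2 * I) * I" using N I by (intro bb) simp
  thus False using False N by simp
  qed
  show False by (rule contr[OF _ I0 b]) (use n in simp)
 qed
qed

text \<open>The indicator of an open set is the pointwise limit of the continuous functions
  \<open>min 1 (n * infdist z (- U))\<close>.\<close>

lemma integral_mult_indicator_circ_eq_0:
 fixes u :: "real^3 => real" assumes u: "integrable tm u" and z: "!!n. cf (%x. of_real (u x)) n = 0" and U: "open U"
 shows "(LINT x|tm. u x * indicator U (circ x)) = 0"
\<comment> \<open>\<open>infdist\<close> to the empty set is \<open>0\<close> by convention, so the
  approximation used in the other case would give zero here.\<close>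
proof (cases "U = UNIV")
 case True
 have "continuous_on UNIV (%z::complex^3. 1::real)" by simp
 from integral_mult_continuous_circ_eq_0[OF u z this] show ?thesis using True by simp
next
 case False
 define h :: "nat => complex^3 => real" where "h = (%n z. min 1 (real n * infdist z (- U)))"
 have hc: "continuous_on UNIV (h n)" for n unfolding h_def by (intro continuous_intros continuous_on_infdist)
 have [measurable]: "h n : BM" for n by (rule bm_cont[OF hc])
 have [measurable]: "U : sets borel" using U by simp
 have um: "u : BMs tm" using u by auto
 have h01: "0 <= h n z" "h n z <= 1" for n z by (auto simp: h_def infdist_nonneg)
 have hl: "(%n. h n z) ----> indicator U z" for z
 proof (cases "z : U")
  case True
  have "z \<notin> closure (- U)" using True U by (simp add: closed_Compl closure_closed)
  hence "infdist z (- U) ~= 0" using in_closure_iff_infdist_zero[of "- U" z] False by auto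
  hence d: "infdist z (- U) > 0" using infdist_nonneg[of z "- U"] by linarith
  obtain n0 :: nat where n0: "1 / infdist z (- U) < n0" using reals_Archimedean2 by blast
  have "h n z = 1" if "n \<ge> n0" for n
  proof -
  have "1 / infdist z (- U) <= real n" using n0 that by (simp add: less_le_trans less_imp_le order_trans)
  hence "1 <= real n * infdist z (- U)" using d by (simp add: field_simps)
  thus ?thesis by (simp add: h_def)
  qed
  hence "eventually (%n. h n z = 1) sequentially" by (auto simp: eventually_sequentially)
  thus ?thesis using True by (simp add: tendsto_eventually)
 next
  case False
  hence "infdist z (- U) = 0" by (simp add: infdist_zero)
  thus ?thesis using False by (simp add: h_def)
 qed
 have "(%n. (LINT x|tm. u x * h n (circ x))) ----> (LINT x|tm. u x * indicator U (circ x))"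
 proof (rule integral_dominated_convergence[where w="%x. norm (u x)"])
  show "(%x. u x * indicator U (circ x)) : BMs tm" by (intro borel_measurable_times um m_tm) measurable
  show "(%x. u x * h n (circ x)) : BMs tm" for n by (intro borel_measurable_times um m_tm) measurable
  show "AE x in tm. (%n. u x * h n (circ x)) ----> u x * indicator U (circ x)" by (intro AE_I2 tendsto_mult tendsto_const hl)
  show "AE x in tm. norm (u x * h n (circ x)) <= norm (u x)" for n
  proof (rule AE_I2)
  fix x show "norm (u x * h n (circ x)) <= norm (u x)" using h01[of n "circ x"] by (simp add: abs_mult mult_left_le)
  qed
 qed (use u in simp)
 thus ?thesis using integral_mult_continuous_circ_eq_0[OF u z hc] by (simp add: LIMSEQ_const_iff)
qed

text \<open>The positive and negative parts of \<open>u\<close>, carried to \<open>complex^3\<close>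
  by \<open>circ\<close>, are finite measures that agree on open sets, hence on all Borel sets.
  Since \<open>u\<close> is a Borel function of \<open>circ x\<close>, the sets where it is positive
  or negative are preimages of Borel sets, and the L^1 norm of \<open>u\<close> vanishes.\<close>

lemma fourier_unique_real:
 fixes u :: "real^3 => real" assumes um[measurable]: "u : BM" and per: "periodic L u" and u: "integrable tm u"
  and z: "!!n. cf (%x. of_real (u x)) n = 0" shows "AE x in tm. u x = 0"
proof -
 define P where "P = distr (density tm (%x. ennreal (u x))) borel circ"
 define Q where "Q = distr (density tm (%x. ennreal (- u x))) borel circ"
 have cm: "circ : measurable (density tm f) borel" for f by (simp add: m_tm)
 have em: "emeasure P A = (TN x. ennreal (u x) * indicator A (circ x))"
  "emeasure Q A = (TN x. ennreal (- u x) * indicator A (circ x))" if A[measurable]: "A : sets borel" for A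
 proof -
  have "circ -` A \<inter> space tm : sets tm" by (rule measurable_sets[OF m_tm[OF circ_measurable] A])
  thus "emeasure P A = (TN x. ennreal (u x) * indicator A (circ x))"
  "emeasure Q A = (TN x. ennreal (- u x) * indicator A (circ x))" unfolding P_def Q_def using m_tm[OF um]
  by (auto simp: emeasure_distr cm emeasure_density intro!: nn_integral_cong split: split_indicator)
 qed
 have fin: "emeasure P UNIV < infy"
 proof -
  have "emeasure P UNIV <= (TN x. norm (u x))" by (subst em) (auto intro!: nn_integral_mono ennreal_leI)
  also have "... < infy" using u by (simp add: integrable_iff_bounded)
  finally show ?thesis .
 qed
 have ui: "integrable tm (%x. u x * indicator A (circ x))" if [measurable]: "A : sets borel" for A
  by (rule int_mult_bdd[OF u, where B=1]) (auto simp: indicator_def)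
 have diff: "emeasure P A = emeasure Q A <-> (LINT x|tm. u x * indicator A (circ x)) = 0" if [measurable]: "A : sets borel" for A
 proof -
  let ?f = "%x. u x * indicator A (circ x)"
  have e1: "emeasure P A = (TN x. ennreal (?f x))" unfolding em[OF that] by (rule nn_integral_cong) (auto split: split_indicator)
  have e2: "emeasure Q A = (TN x. ennreal (- ?f x))" unfolding em[OF that]
  by (rule nn_integral_cong) (auto split: split_indicator)
  have f: "emeasure P A < top" "emeasure Q A < top"
  proof -
  have "(TN x. norm (?f x)) < infy" using ui[OF that] by (simp add: integrable_iff_bounded)
  moreover have "emeasure P A <= (TN x. norm (?f x))" "emeasure Q A <= (TN x. norm (?f x))"
  unfolding e1 e2 by (auto intro!: nn_integral_mono ennreal_leI)
  ultimately show "emeasure P A < top" "emeasure Q A < top" by (auto simp: top_unique[symmetric] less_top intro: le_less_trans)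
  qed
  have "(LINT x|tm. ?f x) = enn2real (emeasure P A) - enn2real (emeasure Q A)"
  unfolding e1 e2 by (rule real_lebesgue_integral_def[OF ui[OF that]])
  thus ?thesis using f by (metis ennreal_enn2real diff_self right_minus_eq)
 qed
 have PQ: "P = Q"
 proof (rule measure_eqI_generator_eq[where E="{S. open S}" and \<Omega>=UNIV and A="%_. UNIV"])
  show "Int_stable {S::(complex^3) set. open S}" by (auto simp: Int_stable_def)
  show "sets P = sigma_sets UNIV {S. open S}" "sets Q = sigma_sets UNIV {S. open S}" by (simp_all add: P_def Q_def borel_def)
  fix X :: "(complex^3) set" assume "X : {S. open S}"
  thus "emeasure P X = emeasure Q X" using integral_mult_indicator_circ_eq_0[OF u z] by (subst diff) auto
 qed (use fin in auto)
 have zero: "(LINT x|tm. u x * indicator A (circ x)) = 0" if "A : sets borel" for A using diff[OF that] PQ by simp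
 have pu: "u (uncirc (circ x)) = u x" for x by (rule periodic_uncirc[OF per])
 define A where "A = {z. 0 < u (uncirc z)}"
 define B where "B = {z. u (uncirc z) < 0}"
 have [measurable]: "A : sets borel" "B : sets borel" unfolding A_def B_def by measurable
 have "(LINT x|tm. norm (u x)) = (LINT x|tm. u x * indicator A (circ x) - u x * indicator B (circ x))"
  by (rule bint_cong) (auto simp: A_def B_def pu indicator_def)
 also have "... = 0" using zero[of A] zero[of B] ui[of A] ui[of B] by simp
 finally have "(LINT x|tm. norm (u x)) = 0" .
 hence "AE x in tm. norm (u x) = 0" by (subst (asm) integral_nonneg_eq_0_iff_AE) (use u in auto)
 thus ?thesis by eventually_elim simp
qed

definition P1 :: "(real^3 => complex) => bool" where
 "P1 f <-> f : BM & periodic L f & integrable tm f"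

lemma cf_integrable: "P1 f ==> integrable tm (%x. f x * cnj (ch n x))"
 using integrable_mult_ch[of f 1 "- n"] by (simp add: P1_def ch_cnj)

lemma cf_add: "P1 f ==> P1 g ==> cf (%x. f x + g x) n = cf f n + cf g n"
 using cf_integrable[of f n] cf_integrable[of g n] by (simp add: cf_def distrib_right add_divide_distrib)

lemma cf_diff: "P1 f ==> P1 g ==> cf (%x. f x - g x) n = cf f n - cf g n"
 using cf_integrable[of f n] cf_integrable[of g n] by (simp add: cf_def left_diff_distrib diff_divide_distrib)

lemma cf_cmult: "cf (%x. c * f x) n = c * cf f n" by (simp add: cf_def mult.assoc)

lemma cf_cnj: "cf (%x. cnj (f x)) n = cnj (cf f (- n))"
proof -
 have "(LINT x|tm. cnj (f x) * cnj (ch n x)) = (LINT x|tm. cnj (f x * ch n x))" by simp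
 also have "... = cnj (LINT x|tm. f x * ch n x)" by (rule Bochner_Integration.integral_cnj)
 finally show ?thesis by (simp add: cf_def ch_cnj)
qed

lemma cnj_measurable: "f : BMs M ==> (%x. cnj (f x)) : BMs M" by (rule m_comp[OF _ bm_cont]) (auto intro: continuous_intros)

lemma P1_add: "P1 f ==> P1 g ==> P1 (%x. f x + g x)" by (auto simp: P1_def periodic_def)
lemma P1_diff: "P1 f ==> P1 g ==> P1 (%x. f x - g x)" by (auto simp: P1_def periodic_def)
lemma P1_cmult: "P1 f ==> P1 (%x. c * f x)" by (auto simp: P1_def periodic_def)
lemma P1_cnj: "P1 f ==> P1 (%x. cnj (f x))" by (auto simp: P1_def periodic_def cnj_measurable)

lemma cf_Re: assumes "P1 f" shows "cf (%x. of_real (Re (f x))) n = (cf f n + cnj (cf f (- n))) / 2"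
proof -
 have "(%x. complex_of_real (Re (f x))) = (%x. (1/2) * (f x + cnj (f x)))" by (simp add: complex_add_cnj)
 thus ?thesis using assms by (simp only: cf_cmult cf_add P1_cnj cf_cnj) simp
qed

lemma cf_Im: assumes "P1 f" shows "cf (%x. of_real (Im (f x))) n = (cf f n - cnj (cf f (- n))) / (2 * \<i>)"
proof -
 have "(%x. complex_of_real (Im (f x))) = (%x. (1 / (2 * \<i>)) * (f x - cnj (f x)))" by (auto simp: fun_eq_iff complex_eq_iff)
 thus ?thesis using assms by (simp only: cf_cmult cf_diff P1_cnj cf_cnj) simp
qed

lemma fourier_unique: assumes f: "P1 f" and z: "!!n. cf f n = 0" shows "AE x in tm. f x = 0"
proof -
 have m[measurable]: "f : BM" and p: "periodic L f" and i: "integrable tm f" using f by (auto simp: P1_def)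
 have "AE x in tm. Re (f x) = 0"
  by (rule fourier_unique_real) (use p i cf_Re[OF f] z in \<open>auto simp: periodic_def intro: integrable_Re\<close>)
 moreover have "AE x in tm. Im (f x) = 0"
  by (rule fourier_unique_real) (use p i cf_Im[OF f] z in \<open>auto simp: periodic_def intro: integrable_Im\<close>)
 ultimately show ?thesis by eventually_elim (simp add: complex_eq_iff)
qed

lemma fourier_unique_eq: assumes f: "P1 f" and g: "P1 g" and z: "!!n. cf f n = cf g n" shows "AE x in lborel. f x = g x"
proof (rule AE_periodic)
 show "periodic L (%x. f x = g x)" using f g by (simp add: P1_def periodic_def)
 have "AE x in tm. f x - g x = 0" by (rule fourier_unique[OF P1_diff[OF f g]]) (simp add: cf_diff f g z)
 thus "AE x in tm. f x = g x" by eventually_elim simp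
qed

end

section \<open>Square-integrable functions: Bessel, Riesz-Fischer, Parseval\<close>

context torus begin

definition P2 :: "(real^3 => complex) => bool" where
 "P2 f <-> f : BM & periodic L f & integrable tm (%x. (norm (f x))^2)"

definition nrm2 :: "(real^3 => complex) => real" where "nrm2 f = (LINT x|tm. (norm (f x))^2)"

lemma P2_measurable: "P2 f ==> f : BM" by (simp add: P2_def)
lemma P2_tm_measurable: "P2 f ==> f : BMs tm" by (rule m_tm[OF P2_measurable])
lemma P2_periodic: "P2 f ==> periodic L f" by (simp add: P2_def)
lemma P2_integrable2: "P2 f ==> integrable tm (%x. (norm (f x))^2)" by (simp add: P2_def)

lemma P2_integrable_norm_mult: assumes "P2 f" "P2 g" shows "integrable tm (%x. norm (f x) * norm (g x))"
 by (rule int_norm2_mult) (use assms in \<open>auto intro: P2_tm_measurable P2_integrable2\<close>)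

lemma P2_integrable_mult: assumes "P2 f" "P2 g" shows "integrable tm (%x. f x * g x)"
proof (rule bochnerI_bound[OF P2_integrable_norm_mult[OF assms]])
 show "(%x. f x * g x) : BMs tm" by (rule borel_measurable_times) (use assms P2_tm_measurable in auto)
 show "AE x in tm. norm (f x * g x) <= norm (norm (f x) * norm (g x))" by (rule AE_I2) (simp add: norm_mult)
qed

lemma periodic_mult: "periodic L f ==> periodic L g ==> periodic L (%x. f x * (g x :: 'a::times))" by (simp add: periodic_def)

lemma P2_bounded: assumes "f : BM" "periodic L f" "!!x. norm (f x) <= B" shows "P2 f"
proof -
 have "integrable tm (%x. (norm (f x))^2)"
  by (rule integrable_tm_bounded[where B="B^2"]) (use assms in \<open>auto intro!: power_mono\<close>)
 thus ?thesis using assms by (simp add: P2_def)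
qed

lemma P2_ch: "P2 (ch n)" by (rule P2_bounded[OF ch_measurable ch_periodic, of n 1]) simp
lemma P2_const: "P2 (%x. c)" by (rule P2_bounded[where B="norm c"]) (auto simp: periodic_def)

lemma P2_mult_bounded: assumes f: "P2 f" and g: "g : BM" "periodic L g" "!!x. norm (g x) <= B" shows "P2 (%x. f x * g x)"
proof -
 have "integrable tm (%x. (norm (f x * g x))^2)"
 proof (rule bochnerI_bound)
  show "integrable tm (%x. B^2 * (norm (f x))^2)" using P2_integrable2[OF f] by simp
  show "(%x. (norm (f x * g x))^2) : BMs tm" using P2_measurable[OF f] g(1) by (intro m_tm) measurable
  show "AE x in tm. norm ((norm (f x * g x))^2) <= norm (B^2 * (norm (f x))^2)"
  proof (rule AE_I2)
  fix x
  have "(norm (g x))^2 <= B^2" using g(3) by (intro power_mono) auto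
  hence "(norm (f x))^2 * (norm (g x))^2 <= (norm (f x))^2 * B^2" by (intro mult_lmono) auto
  thus "norm ((norm (f x * g x))^2) <= norm (B^2 * (norm (f x))^2)" by (simp add: norm_mult power_mult_distrib mult.commute)
  qed
 qed
 thus ?thesis using f g P2_measurable[OF f] by (simp add: P2_def periodic_mult)
qed

lemma P2_cmult: "P2 f ==> P2 (%x. c * f x)" using P2_mult_bounded[of f "%x. c" "norm c"] by (simp add: mult.commute periodic_def)

lemma P2_add: assumes "P2 f" "P2 g" shows "P2 (%x. f x + g x)"
proof -
 have "integrable tm (%x. (norm (f x + g x))^2)"
 proof (rule bochnerI_bound)
  show "integrable tm (%x. 2 * (norm (f x))^2 + 2 * (norm (g x))^2)" using assms P2_integrable2 by simp
  show "(%x. (norm (f x + g x))^2) : BMs tm"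
  using P2_measurable[OF assms(1)] P2_measurable[OF assms(2)] by (intro m_tm) measurable
  show "AE x in tm. norm ((norm (f x + g x))^2) <= norm (2 * (norm (f x))^2 + 2 * (norm (g x))^2)"
  proof (rule AE_I2)
  fix x
  have "(norm (f x + g x))^2 <= (norm (f x) + norm (g x))^2" by (intro power_mono norm_triangle_ineq) auto
  thus "norm ((norm (f x + g x))^2) <= norm (2 * (norm (f x))^2 + 2 * (norm (g x))^2)"
  using sum_squares_bound[of "norm (f x)" "norm (g x)"] by (simp add: power2_sum)
  qed
 qed
 thus ?thesis using assms by (simp add: P2_def periodic_def borel_measurable_add)
qed

lemma P2_diff: "P2 f ==> P2 g ==> P2 (%x. f x - g x)" using P2_add[of f "%x. (-1) * g x"] P2_cmult[of g "-1"] by simp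

lemma P2_cnj: "P2 f ==> P2 (%x. cnj (f x))" by (simp add: P2_def periodic_def cnj_measurable)

lemma P2_Re: assumes "P2 f" shows "P2 (%x. of_real (Re (f x)))"
proof -
 have "(%x. complex_of_real (Re (f x))) = (%x. (1/2) * (f x + cnj (f x)))" by (simp add: complex_add_cnj)
 thus ?thesis using P2_cmult[OF P2_add[OF assms P2_cnj[OF assms]]] by metis
qed

lemma P2_sum: "finite A ==> (!!a. a : A ==> P2 (f a)) ==> P2 (%x. \<Sum>a\<in>A. f a x)"
 by (induction A rule: finite_induct) (auto intro: P2_const P2_add)

lemma P2_imp_P1: assumes "P2 f" shows "P1 f" using P2_integrable_mult[OF assms P2_const[of 1]] assms by (simp add: P1_def P2_def)

lemma L1_le_nrm2: assumes "P2 f" shows "(LINT x|tm. norm (f x)) <= sqrt (L ^ 3 * nrm2 f)"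
proof -
 have "(LINT x|tm. norm (f x) * norm (1::complex))^2 <= (LINT x|tm. (norm (f x))^2) * (LINT x|tm. (norm (1::complex))^2)"
  by (rule integral_norm2_CS) (use assms in \<open>auto intro: P2_tm_measurable P2_integrable2\<close>)
 hence "(LINT x|tm. norm (f x))^2 <= L ^ 3 * nrm2 f" by (simp add: measure_tm nrm2_def mult.commute)
 thus ?thesis by (rule real_le_rsqrt)
qed

lemma cf_norm_le: assumes "P2 f" shows "norm (cf f n) <= sqrt (nrm2 f / L ^ 3)"
proof -
 have L3: "0 < L ^ 3" using L_pos by simp
 have "norm (LINT x|tm. f x * cnj (ch n x)) <= (LINT x|tm. norm (f x * cnj (ch n x)))" by (rule integral_norm_bound)
 also have "... = (LINT x|tm. norm (f x))" by (simp add: norm_mult)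
 also have "... <= sqrt (L ^ 3 * nrm2 f)" by (rule L1_le_nrm2[OF assms])
 finally have "norm (cf f n) <= sqrt (L ^ 3 * nrm2 f) / L ^ 3"
  using L3 by (simp add: cf_def norm_divide divide_right_mono norm_power)
 also have "... = sqrt ((L ^ 3 * nrm2 f) / (L ^ 3)^2)" using L3 by (simp only: real_sqrt_divide real_sqrt_abs abs_of_pos)
 also have "(L ^ 3 * nrm2 f) / (L ^ 3)^2 = nrm2 f / L ^ 3"
 proof -
  have "(a * b) / a^2 = b / a" if "0 < a" for a b :: real using that by (simp add: power2_eq_square)
  thus ?thesis using L3 by blast
 qed
 finally show ?thesis .
qed

definition ps :: "(int^3) set => (int^3 => complex) => real^3 => complex" where
 "ps F c x = (\<Sum>k\<in>F. c k * ch k x)"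

lemma P2_ps: "finite F ==> P2 (ps F c)" unfolding ps_def by (intro P2_sum P2_cmult P2_ch)

lemma integral_mult_cnj_ps: assumes "P1 f" "finite F"
 shows "(LINT x|tm. f x * cnj (ps F c x)) = of_real (L ^ 3) * (\<Sum>k\<in>F. cf f k * cnj (c k))"
proof -
 have e: "f x * cnj (ps F c x) = (\<Sum>k\<in>F. cnj (c k) * (f x * cnj (ch k x)))" for x
  by (simp add: ps_def sum_distrib_left mult_ac)
 have "(LINT x|tm. f x * cnj (ps F c x)) = (\<Sum>k\<in>F. (LINT x|tm. cnj (c k) * (f x * cnj (ch k x))))"
  unfolding e by (rule bochner_sum) (intro integrable_mult_right cf_integrable assms)
 also have "... = (\<Sum>k\<in>F. of_real (L ^ 3) * (cf f k * cnj (c k)))" using L_pos by (intro sum.cong) (auto simp: cf_def)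
 finally show ?thesis by (simp add: sum_distrib_left)
qed

lemma cf_ch: "cf (%x. ch k x) n = (if k = n then 1 else 0)"
proof -
 have "(LINT x|tm. ch k x * cnj (ch n x)) = (LINT x|tm. ch (k - n) x)" using ch_add[of k "- n"] by (simp add: ch_cnj)
 thus ?thesis using L_pos by (simp add: cf_def ch_integral)
qed

lemma cf_ps: assumes "finite F" shows "cf (ps F c) n = (if n : F then c n else 0)" using assms
proof (induction F rule: finite_induct)
 case empty
 thus ?case by (simp add: cf_def ps_def)
next
 case (insert k F)
 have "cf (ps (insert k F) c) n = cf (%x. c k * ch k x + ps F c x) n"
 proof -
  have "ps (insert k F) c = (%x. c k * ch k x + ps F c x)" using insert(1,2) by (auto simp: ps_def)
  thus ?thesis by (simp only:)
 qed
 also have "... = cf (%x. c k * ch k x) n + cf (ps F c) n"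
  using P2_imp_P1[OF P2_ps[OF insert(1)]] P2_imp_P1[OF P2_cmult[OF P2_ch]] by (intro cf_add)
 finally show ?case using insert by (auto simp: cf_cmult cf_ch)
qed

lemma nrm2_complex: "of_real (nrm2 f) = (LINT x|tm. f x * cnj (f x))"
 unfolding nrm2_def complex_norm_square[symmetric] by (rule integral_complex_of_real[symmetric])

lemma nrm2_nonneg: "0 <= nrm2 f" unfolding nrm2_def by (rule bochner_nonneg) simp

lemma nrm2_ps: assumes "finite F" shows "nrm2 (ps F c) = L ^ 3 * (\<Sum>k\<in>F. (norm (c k))^2)"
proof -
 have "complex_of_real (nrm2 (ps F c)) = of_real (L ^ 3) * (\<Sum>k\<in>F. cf (ps F c) k * cnj (c k))"
  unfolding nrm2_complex by (rule integral_mult_cnj_ps[OF P2_imp_P1[OF P2_ps[OF assms]] assms])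
 also have "(\<Sum>k\<in>F. cf (ps F c) k * cnj (c k)) = of_real (\<Sum>k\<in>F. (norm (c k))^2)"
  using assms by (simp add: cf_ps complex_norm_square[symmetric])
 finally show ?thesis by (simp only: of_real_mult[symmetric] of_real_eq_iff)
qed

lemma nrm2_diff_ps: assumes f: "P2 f" and F: "finite F"
 shows "nrm2 (%x. f x - ps F (cf f) x) = nrm2 f - L ^ 3 * (\<Sum>k\<in>F. (norm (cf f k))^2)"
proof -
 let ?p = "ps F (cf f)"
 have p: "P2 ?p" by (rule P2_ps[OF F])
 have "complex_of_real (nrm2 (%x. f x - ?p x)) = (LINT x|tm. f x * cnj (f x) - f x * cnj (?p x) - cnj (f x * cnj (?p x)) + ?p x * cnj (?p x))"
  unfolding nrm2_complex by (simp add: algebra_simps)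
 also have "... = (LINT x|tm. f x * cnj (f x)) - (LINT x|tm. f x * cnj (?p x)) - (LINT x|tm. cnj (f x * cnj (?p x))) + (LINT x|tm. ?p x * cnj (?p x))"
 proof -
  have i: "integrable tm (%x. f x * cnj (f x))" "integrable tm (%x. f x * cnj (?p x))" "integrable tm (%x. ?p x * cnj (?p x))"
  using f p by (auto intro: P2_integrable_mult P2_cnj)
  have i2: "integrable tm (%x. cnj (f x * cnj (?p x)))" by (rule integrable_cnj[OF i(2)])
  show ?thesis using i i2 by (subst bochner_add, simp, simp, subst bochner_diff, simp, simp,
  subst bochner_diff) simp_all
 qed
 also have "(LINT x|tm. cnj (f x * cnj (?p x))) = cnj (LINT x|tm. f x * cnj (?p x))" by (rule Bochner_Integration.integral_cnj)
 also have "(LINT x|tm. f x * cnj (?p x)) = of_real (L ^ 3 * (\<Sum>k\<in>F. (norm (cf f k))^2))"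
  unfolding integral_mult_cnj_ps[OF P2_imp_P1[OF f] F] by (simp add: complex_norm_square[symmetric])
 also have "(LINT x|tm. f x * cnj (f x)) = of_real (nrm2 f)" by (rule nrm2_complex[symmetric])
 also have "(LINT x|tm. ?p x * cnj (?p x)) = of_real (L ^ 3 * (\<Sum>k\<in>F. (norm (cf f k))^2))"
  unfolding nrm2_complex[symmetric] nrm2_ps[OF F] by (rule refl)
 finally have "complex_of_real (nrm2 (%x. f x - ?p x)) = of_real (nrm2 f - L ^ 3 * (\<Sum>k\<in>F. (norm (cf f k))^2))" by simp
 thus ?thesis by (simp only: of_real_eq_iff)
qed

lemma bessel_finite: assumes f: "P2 f" and F: "finite F" shows "(\<Sum>k\<in>F. (norm (cf f k))^2) <= nrm2 f / L ^ 3"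
proof -
 have "0 <= nrm2 f - L ^ 3 * (\<Sum>k\<in>F. (norm (cf f k))^2)"
  using nrm2_nonneg[of "%x. f x - ps F (cf f) x"] unfolding nrm2_diff_ps[OF assms] .
 thus ?thesis using L_pos by (simp add: pos_le_divide_eq mult.commute)
qed

lemma integrable_csI:
 fixes a :: "'i => real" assumes "!!k. 0 <= a k" "!!F. finite F ==> (\<Sum>k\<in>F. a k) <= B"
 shows "integrable cs a" "(LINT k|cs. a k) <= B"
proof -
 have s: "a summable_on UNIV" by (rule nonneg_bdd_above_summable_on) (use assms in \<open>auto intro!: bdd_aboveI2\<close>)
 thus i: "integrable cs a" by (simp add: int_cs_summable)
 show "(LINT k|cs. a k) <= B" unfolding integral_cs_eq_infsum[OF i] by (rule infsum_le_finite_sums[OF s]) (use assms in auto)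
qed

lemma sum_le_integral_cs:
 fixes a :: "'i => real" assumes "integrable cs a" "!!k. 0 <= a k" "finite F" shows "(\<Sum>k\<in>F. a k) <= (LINT k|cs. a k)"
 unfolding integral_cs_eq_infsum[OF assms(1)]
 by (rule finite_sum_le_infsum) (use assms in \<open>auto simp: int_cs_summable\<close>)

lemma bessel: assumes f: "P2 f" shows "integrable cs (%k. (norm (cf f k))^2)" "(LINT k|cs. (norm (cf f k))^2) <= nrm2 f / L ^ 3"
 using integrable_csI[of "%k. (norm (cf f k))^2", OF _ bessel_finite[OF f]] by auto

definition modes :: "nat => (int^3) set" where "modes n = {k. \<forall>i. \<bar>k $ i\<bar> <= int n}"

lemma finite_modes: "finite (modes n)"
proof (rule finite_subset)
 let ?I = "{- int n..int n}"
 show "modes n \<subseteq> (%(a,b,c). vector [a,b,c]) ` (?I \<times> ?I \<times> ?I)"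
 proof
  fix k assume k: "k : modes n"
  have "k = (%(a,b,c). vector [a,b,c]) (k $ 1, k $ 2, k $ 3)" by (simp add: vec_eq_iff forall_3)
  moreover have "k $ i : ?I" for i
  proof -
  have "\<bar>k $ i\<bar> <= int n" using k by (simp add: modes_def)
  thus ?thesis by auto
  qed
  ultimately show "k : (%(a,b,c). vector [a,b,c]) ` (?I \<times> ?I \<times> ?I)" by (intro image_eqI[of _ _ "(k $ 1, k $ 2, k $ 3)"]) auto
 qed
qed simp

lemma modes_mono: "m <= n ==> modes m \<subseteq> modes n" by (auto simp: modes_def intro: order_trans)

lemma modes_exhaust: "\<exists>n. k : modes n"
proof -
 have "\<bar>k $ i\<bar> <= int (nat (\<Sum>i\<in>UNIV. \<bar>k $ i\<bar>))" for i
  using member_le_sum[of i UNIV "%i. \<bar>k $ i\<bar>"] by (simp add: sum_nonneg)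
 hence "k : modes (nat (\<Sum>i\<in>UNIV. \<bar>k $ i\<bar>))" unfolding modes_def by blast
 thus ?thesis by (rule exI)
qed

definition tail2 :: "nat => (int^3 => complex) => real" where
 "tail2 n c = (LINT k|cs. indicator (- modes n) k * (norm (c k))^2)"

lemma tail2_integrable:
 "integrable cs (%k. (norm (c k))^2) ==> integrable cs (%k. indicator (- modes n) k * (norm (c k))^2)"
 using integrable_mult_indicator[of "- modes n" "count_space UNIV" "%k. (norm (c k))^2"] by simp

lemma tail2_tendsto_0: assumes "integrable cs (%k. (norm (c k))^2)" shows "(%n. tail2 n c) ----> 0"
proof -
 have "(%n. tail2 n c) ----> (\<integral>k. 0 \<partial>(count_space (UNIV :: (int^3) set)))" unfolding tail2_def
 proof (rule integral_dominated_convergence[OF _ _ assms])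
  show "AE k in cs. (%n. indicator (- modes n) k * (norm (c k))^2) ----> 0"
  proof (rule AE_I2)
  fix k
  obtain m where "k : modes m" using modes_exhaust by blast
  hence "indicator (- modes n) k * (norm (c k))^2 = 0" if "n \<ge> m" for n using modes_mono[OF that] by auto
  hence "eventually (%n. indicator (- modes n) k * (norm (c k))^2 = 0) sequentially" unfolding eventually_sequentially by blast
  thus "(%n. indicator (- modes n) k * (norm (c k))^2) ----> 0" by (rule tendsto_eventually)
  qed
 qed (auto simp: indicator_def)
 thus ?thesis by simp
qed

text \<open>Tails of size \<open>4^-j\<close> put successive partial sums within \<open>2^-j\<close>
  of each other in L^1, up to the factor \<open>L^3\<close>. As a least index it depends measurably
  on the coefficients.\<close>

definition cutN :: "nat => (int^3 => complex) => nat" where "cutN j c = (LEAST n. tail2 n c <= (1/4) ^ j)"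

text \<open>
 The cut-offs are chosen so that the partial sums converge almost everywhere; the explicit choice
 makes the limit depend measurably on the coefficients.
\<close>

definition rf :: "(int^3 => complex) => real^3 => complex" where
 "rf c x = lim (%j. ps (modes (cutN j c)) c x)"

lemma cutN_tail: assumes "integrable cs (%k. (norm (c k))^2)" shows "tail2 (cutN j c) c <= (1/4) ^ j"
proof -
 have "eventually (%n. tail2 n c < (1/4) ^ j) sequentially" by (rule order_tendstoD(2)[OF tail2_tendsto_0[OF assms]]) simp
 then obtain n where "tail2 n c < (1/4) ^ j" by (auto simp: eventually_sequentially)
 hence "tail2 n c <= (1/4) ^ j" by simp
 thus ?thesis unfolding cutN_def by (rule LeastI)
qed

lemma cutN_mono: assumes "integrable cs (%k. (norm (c k))^2)" "i <= j" shows "cutN i c <= cutN j c"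
proof -
 have "tail2 (cutN j c) c <= (1/4) ^ i" by (rule order_trans[OF cutN_tail[OF assms(1)] power_decreasing[OF assms(2)]]) simp_all
 thus ?thesis unfolding cutN_def[of i] by (rule Least_le)
qed

lemma nrm2_ps_modes_diff: assumes c: "integrable cs (%k. (norm (c k))^2)" and mn: "m <= n"
 shows "nrm2 (%x. ps (modes n) c x - ps (modes m) c x) <= L ^ 3 * tail2 m c"
proof -
 have "ps (modes n) c x - ps (modes m) c x = ps (modes n - modes m) c x" for x
  unfolding ps_def using finite_modes modes_mono[OF mn] by (simp add: sum_diff)
 hence "nrm2 (%x. ps (modes n) c x - ps (modes m) c x) = L ^ 3 * (\<Sum>k\<in>modes n - modes m. (norm (c k))^2)"
  by (simp add: nrm2_ps finite_modes)
 also have "(\<Sum>k\<in>modes n - modes m. (norm (c k))^2) = (\<Sum>k\<in>modes n - modes m. indicator (- modes m) k * (norm (c k))^2)"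
  by (rule sum.cong) auto
 also have "L ^ 3 * ... <= L ^ 3 * tail2 m c" unfolding tail2_def
  using L_pos by (intro mult_lmono sum_le_integral_cs tail2_integrable c) (auto simp: finite_modes)
 finally show ?thesis .
qed

text \<open>The L^1 norms of the increments are summable, so the telescoping series converges
  absolutely almost everywhere.\<close>

lemma rf_AE_convergent: assumes c: "integrable cs (%k. (norm (c k))^2)"
 shows "AE x in tm. (%j. ps (modes (cutN j c)) c x) ----> rf c x"
proof -
 let ?v = "%j. ps (modes (cutN j c)) c"
 have v: "P2 (?v j)" for j by (rule P2_ps[OF finite_modes])
 have d: "P2 (%x. ?v (Suc j) x - ?v j x)" for j by (rule P2_diff[OF v v])
 have L3: "0 < L ^ 3" using L_pos by simp
 have b: "(LINT x|tm. norm (?v (Suc j) x - ?v j x)) <= L ^ 3 * (1/2) ^ j" for j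
 proof -
  have "(LINT x|tm. norm (?v (Suc j) x - ?v j x)) <= sqrt (L ^ 3 * nrm2 (%x. ?v (Suc j) x - ?v j x))" by (rule L1_le_nrm2[OF d])
  also have "... <= sqrt ((L ^ 3 * (1/2) ^ j)^2)"
  proof (rule real_sqrt_le_mono)
  have "nrm2 (%x. ?v (Suc j) x - ?v j x) <= L ^ 3 * tail2 (cutN j c) c" by (rule nrm2_ps_modes_diff[OF c cutN_mono[OF c]]) simp
  also have "... <= L ^ 3 * (1/4) ^ j" using L3 by (intro mult_lmono cutN_tail c) auto
  finally have "L ^ 3 * nrm2 (%x. ?v (Suc j) x - ?v j x) <= L ^ 3 * (L ^ 3 * (1/4) ^ j)" using L3 by (intro mult_lmono) auto
  also have "... = (L ^ 3 * (1/2) ^ j)^2"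
  proof -
  have "(1/4::real) ^ j = ((1/2) ^ j)^2" by (simp add: power2_eq_square power_mult_distrib[symmetric])
  thus ?thesis by (simp only: power_mult_distrib power2_eq_square mult_ac)
  qed
  finally show "L ^ 3 * nrm2 (%x. ?v (Suc j) x - ?v j x) <= (L ^ 3 * (1/2) ^ j)^2" .
  qed
  also have "... = L ^ 3 * (1/2) ^ j" using L3 by simp
  finally show ?thesis .
 qed
 have dm: "(%x. ?v (Suc j) x - ?v j x) : BMs tm" for j by (rule P2_tm_measurable[OF d])
 have di: "integrable tm (%x. ?v (Suc j) x - ?v j x)" for j using P2_imp_P1[OF d[of j]] by (simp add: P1_def)
 have "(TN x. (\<Sum>j. ennreal (norm (?v (Suc j) x - ?v j x)))) = (\<Sum>j. \<integral>\<^sup>+x. ennreal (norm (?v (Suc j) x - ?v j x)) \<partial>tm)"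
  by (rule nn_integral_suminf) (use dm in simp)
 also have "... = (\<Sum>j. ennreal (LINT x|tm. norm (?v (Suc j) x - ?v j x)))"
  by (intro suminf_cong nn_integral_eq_integral integrable_norm di) simp
 also have "... <= (\<Sum>j. ennreal (L ^ 3 * (1/2) ^ j))" by (intro suminf_le ennreal_leI b) auto
 also have "... < infy"
 proof -
  have "summable (%j. L ^ 3 * (1/2) ^ j)" by (intro summable_mult summable_geometric) simp
  hence "(\<Sum>j. ennreal (L ^ 3 * (1/2) ^ j)) ~= top" using L3 by (intro ennreal_suminf_neq_top) auto
  thus ?thesis by (simp add: less_top)
 qed
 finally have "AE x in tm. (\<Sum>j. ennreal (norm (?v (Suc j) x - ?v j x))) ~= \<infinity>"
  using dm by (intro nn_integral_PInf_AE) auto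
 thus ?thesis
 proof eventually_elim
  fix x assume "(\<Sum>j. ennreal (norm (?v (Suc j) x - ?v j x))) ~= \<infinity>"
  hence "summable (%j. norm (?v (Suc j) x - ?v j x))" by (intro summable_suminf_not_top) auto
  hence "summable (%j. ?v (Suc j) x - ?v j x)" by (rule summable_norm_cancel)
  hence "convergent (%n. \<Sum>j<n. ?v (Suc j) x - ?v j x)" by (simp add: summable_iff_convergent)
  moreover have "(\<Sum>j<n. ?v (Suc j) x - ?v j x) = ?v n x - ?v 0 x" for n by (rule sum_lessThan_telescope[of "%j. ?v j x"])
  ultimately have "convergent (%n. ?v n x - ?v 0 x)" by (simp only:)
  hence "convergent (%n. (?v n x - ?v 0 x) + ?v 0 x)" by (rule convergent_add[OF _ convergent_const])
  thus "(%j. ?v j x) ----> rf c x" unfolding rf_def by (simp add: convergent_LIMSEQ_iff)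
 qed
qed

lemma rf_measurable: "rf c : BM"
 unfolding rf_def[abs_def] by (rule borel_measurable_lim_metric) (rule P2_measurable[OF P2_ps[OF finite_modes]])

lemma rf_periodic: "periodic L (rf c)"
proof -
 have "ps F c (x + axis i L) = ps F c x" for F x i using ch_periodic by (simp add: ps_def periodic_def)
 thus ?thesis by (simp add: periodic_def rf_def)
qed

lemma fatou_nrm2: assumes v: "!!j. P2 (v j)" and lim: "AE x in tm. (%j. v j x) ----> f x"
  and f: "f : BM" "periodic L f" and b: "!!j. j \<ge> i ==> nrm2 (v j) <= B" shows "P2 f" "nrm2 f <= B"
proof -
 have B: "0 <= B" using b[of i] nrm2_nonneg[of "v i"] by simp
 have "(TN x. ennreal ((norm (f x))^2)) = (TN x. liminf (%j. ennreal ((norm (v j x))^2)))"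
 proof (rule nn_integral_cong_AE)
  show "AE x in tm. ennreal ((norm (f x))^2) = liminf (%j. ennreal ((norm (v j x))^2))" using lim
  proof eventually_elim
  fix x assume "(%j. v j x) ----> f x"
  hence "(%j. ennreal ((norm (v j x))^2)) ----> ennreal ((norm (f x))^2)" by (intro tendsto_ennrealI tendsto_power tendsto_norm)
  thus "ennreal ((norm (f x))^2) = liminf (%j. ennreal ((norm (v j x))^2))" by (intro lim_imp_Liminf[symmetric]) auto
  qed
 qed
 also have "... <= liminf (%j. \<integral>\<^sup>+x. ennreal ((norm (v j x))^2) \<partial>tm)"
  by (rule nn_integral_liminf) (use P2_tm_measurable[OF v] in simp)
 also have "... = liminf (%j. ennreal (nrm2 (v j)))" using P2_integrable2[OF v] by (simp add: nn_integral_eq_integral nrm2_def)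
 also have "... <= ennreal B"
 proof (rule Liminf_le)
  show "eventually (%j. ennreal (nrm2 (v j)) <= ennreal B) sequentially"
  unfolding eventually_sequentially using b by (intro exI[of _ i]) (auto intro: ennreal_leI)
 qed simp
 finally have le: "(TN x. ennreal ((norm (f x))^2)) <= ennreal B" .
 have i: "integrable tm (%x. (norm (f x))^2)"
  using le m_tm[OF f(1)] by (simp add: integrable_iff_bounded le_less_trans[OF _ ennreal_less_top])
 thus "P2 f" using f by (simp add: P2_def)
 show "nrm2 f <= B" using le B unfolding nn_integral_eq_integral[OF i zero_le_power2[THEN AE_I2]] by (simp add: nrm2_def)
qed

text \<open>The Riesz-Fischer theorem. The coefficient at \<open>n\<close> is found through the
  \<open>i\<close>-th partial sum: by Fatou's lemma its coefficient is within \<open>2^-i\<close> of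
  that of \<open>rf c\<close>, and by the choice of the cut-off within \<open>2^-i\<close> of
  \<open>c n\<close>.\<close>

lemma rf_P2: assumes c: "integrable cs (%k. (norm (c k))^2)"
 shows "P2 (rf c)" "nrm2 (rf c) <= L ^ 3 * (LINT k|cs. (norm (c k))^2)"
  "cf (rf c) n = c n"
proof -
 let ?v = "%j. ps (modes (cutN j c)) c"
 have L3: "0 < L ^ 3" using L_pos by simp
 have v: "P2 (?v j)" for j by (rule P2_ps[OF finite_modes])
 have "nrm2 (?v j) <= L ^ 3 * (LINT k|cs. (norm (c k))^2)" for j unfolding nrm2_ps[OF finite_modes] using L3
  by (intro mult_lmono sum_le_integral_cs c) (auto simp: finite_modes)
 from fatou_nrm2[OF v rf_AE_convergent[OF c] rf_measurable rf_periodic this]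
 show r: "P2 (rf c)" "nrm2 (rf c) <= L ^ 3 * (LINT k|cs. (norm (c k))^2)" by auto
 have est: "norm (cf (rf c) n - c n) <= 2 * (1/2) ^ i" for i
 proof -
  have "nrm2 (%x. rf c x - ?v i x) <= L ^ 3 * (1/4) ^ i"
  proof (rule fatou_nrm2(2)[where v="%j x. ?v j x - ?v i x" and i=i])
  show "P2 (%x. ?v j x - ?v i x)" for j by (rule P2_diff[OF v v])
  show "AE x in tm. (%j. ?v j x - ?v i x) ----> rf c x - ?v i x"
  using rf_AE_convergent[OF c] by eventually_elim (intro tendsto_diff tendsto_const)
  show "(%x. rf c x - ?v i x) : BM" by (rule P2_measurable[OF P2_diff[OF r(1) v]])
  show "periodic L (%x. rf c x - ?v i x)" by (rule P2_periodic[OF P2_diff[OF r(1) v]])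
  fix j assume "i <= j"
  hence "nrm2 (%x. ?v j x - ?v i x) <= L ^ 3 * tail2 (cutN i c) c" by (intro nrm2_ps_modes_diff[OF c] cutN_mono[OF c])
  also have "... <= L ^ 3 * (1/4) ^ i" using L3 by (intro mult_lmono cutN_tail c) auto
  finally show "nrm2 (%x. ?v j x - ?v i x) <= L ^ 3 * (1/4) ^ i" .
  qed
  hence "nrm2 (%x. rf c x - ?v i x) / L ^ 3 <= (1/4) ^ i" using L3 by (simp add: pos_divide_le_eq mult.commute)
  hence "sqrt (nrm2 (%x. rf c x - ?v i x) / L ^ 3) <= sqrt ((1/4) ^ i)" by (rule real_sqrt_le_mono)
  moreover have s: "sqrt ((1/4) ^ i) = (1/2) ^ i" by (simp add: real_sqrt_power real_sqrt_divide)
  moreover have "norm (cf (%x. rf c x - ?v i x) n) <= sqrt (nrm2 (%x. rf c x - ?v i x) / L ^ 3)"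
  by (rule cf_norm_le[OF P2_diff[OF r(1) v]])
  ultimately have 1: "norm (cf (rf c) n - cf (?v i) n) <= (1/2) ^ i"
  using P2_imp_P1[OF r(1)] P2_imp_P1[OF v[of i]] by (simp add: cf_diff)
  have 2: "norm (cf (?v i) n - c n) <= (1/2) ^ i"
  proof (cases "n : modes (cutN i c)")
  case True thus ?thesis by (simp add: cf_ps finite_modes)
  next
  case False
  \<comment> \<open>An omitted mode belongs to the tail, whose size bounds it.\<close>
  have "(\<Sum>k\<in>{n}. indicator (- modes (cutN i c)) k * (norm (c k))^2) <= tail2 (cutN i c) c"
  unfolding tail2_def by (rule sum_le_integral_cs[OF tail2_integrable[OF c]]) auto
  hence "(norm (c n))^2 <= (1/4) ^ i" using False cutN_tail[OF c, of i] by simp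
  hence "norm (c n) <= sqrt ((1/4) ^ i)" by (rule real_le_rsqrt)
  thus ?thesis using False s by (simp add: cf_ps finite_modes)
  qed
  show ?thesis using norm_triangle_mono[OF 1 2] by simp
 qed
 have "norm (cf (rf c) n - c n) <= 0"
 proof (rule LIMSEQ_le_const)
  show "(%i. 2 * (1/2) ^ i :: real) ----> 0" using tendsto_mult[OF tendsto_const[of 2] LIMSEQ_power_zero[of "1/2::real"]] by simp
  show "\<exists>N. \<forall>i\<ge>N. norm (cf (rf c) n - c n) <= 2 * (1/2) ^ i" using est by blast
 qed
 thus "cf (rf c) n = c n" by simp
qed

text \<open>Uniqueness identifies \<open>f\<close> with the reconstruction from its coefficients,
  whose norm they bound from above; Bessel's inequality is the other half.\<close>

lemma parseval_nrm2: assumes f: "P2 f" shows "nrm2 f = L ^ 3 * (LINT k|cs. (norm (cf f k))^2)"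
proof (rule antisym)
 note b = bessel[OF f]
 have "AE x in lborel. f x = rf (cf f) x"
  by (rule fourier_unique_eq[OF P2_imp_P1[OF f] P2_imp_P1[OF rf_P2(1)[OF b(1)]]]) (simp add: rf_P2(3)[OF b(1)])
 hence "AE x in tm. f x = rf (cf f) x" unfolding AE_tm by eventually_elim simp
 hence "AE x in tm. (norm (f x))^2 = (norm (rf (cf f) x))^2" by eventually_elim simp
 hence "nrm2 f = nrm2 (rf (cf f))" unfolding nrm2_def using P2_tm_measurable[OF f] P2_tm_measurable[OF rf_P2(1)[OF b(1)]]
  by (intro integral_cong_AE) auto
 thus "nrm2 f <= L ^ 3 * (LINT k|cs. (norm (cf f k))^2)" using rf_P2(2)[OF b(1)] by simp
 show "L ^ 3 * (LINT k|cs. (norm (cf f k))^2) <= nrm2 f" using b(2) L_pos by (simp add: pos_le_divide_eq mult.commute)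
qed

lemma polarization4: "4 * (a * cnj b) = of_real ((norm (a + b))^2) - of_real ((norm (a - b))^2)
 + \<i> * of_real ((norm (a + \<i> * b))^2) - \<i> * of_real ((norm (a - \<i> * b))^2)"
 unfolding complex_norm_square by (simp add: algebra_simps)

lemma integral_lincomb4:
 fixes A B C D :: "'a => complex" assumes "integrable M A" "integrable M B" "integrable M C" "integrable M D"
 shows "(LINT x|M. A x - B x + c * C x - c * D x) = (LINT x|M. A x) - (LINT x|M. B x) + c * (LINT x|M. C x) - c * (LINT x|M. D x)"
 using assms by simp

lemma cf_l2_integrable_mult:
 fixes a b :: "int^3 => complex" assumes "integrable cs (%k. (norm (a k))^2)" "integrable cs (%k. (norm (b k))^2)"
 shows "integrable cs (%k. a k * cnj (b k))"
proof (rule bochnerI_bound)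
 show "integrable cs (%k. norm (a k) * norm (b k))" by (rule int_norm2_mult) (use assms in simp_all)
 show "AE k in cs. norm (a k * cnj (b k)) <= norm (norm (a k) * norm (b k))" by (rule AE_I2) (simp add: norm_mult)
qed simp

lemma parseval: assumes f: "P2 f" and g: "P2 g"
 shows "(LINT x|tm. f x * cnj (g x)) = of_real (L ^ 3) * (LINT k|cs. cf f k * cnj (cf g k))"
proof -
 have ig: "P2 (%x. \<i> * g x)" by (rule P2_cmult[OF g])
 let ?h1 = "%x. f x + g x" and ?h2 = "%x. f x - g x" and ?h3 = "%x. f x + \<i> * g x" and ?h4 = "%x. f x - \<i> * g x"
 have h: "P2 ?h1" "P2 ?h2" "P2 ?h3" "P2 ?h4" using f g ig by (auto intro: P2_add P2_diff)
 have c: "cf ?h1 k = cf f k + cf g k" "cf ?h2 k = cf f k - cf g k" "cf ?h3 k = cf f k + \<i> * cf g k" "cf ?h4 k = cf f k - \<i> * cf g k" for k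
  using f g ig by (simp_all add: cf_add cf_diff P2_imp_P1 cf_cmult)
 have oi: "(LINT x|tm. complex_of_real ((norm (h x))^2)) = of_real (nrm2 h)" for h
  unfolding nrm2_def by (rule integral_complex_of_real)
 have "4 * (LINT x|tm. f x * cnj (g x)) = (LINT x|tm. 4 * (f x * cnj (g x)))" by simp
 also have "... = of_real (nrm2 ?h1) - of_real (nrm2 ?h2) + \<i> * of_real (nrm2 ?h3) - \<i> * of_real (nrm2 ?h4)"
  unfolding polarization4 oi[symmetric] by (rule integral_lincomb4; rule integrable_of_real; rule P2_integrable2; rule h)
 also have "... = of_real (L ^ 3) * (of_real (LINT k|cs. (norm (cf ?h1 k))^2) - of_real (LINT k|cs. (norm (cf ?h2 k))^2)
  + \<i> * of_real (LINT k|cs. (norm (cf ?h3 k))^2) - \<i> * of_real (LINT k|cs. (norm (cf ?h4 k))^2))"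
  unfolding parseval_nrm2[OF h(1)] parseval_nrm2[OF h(2)] parseval_nrm2[OF h(3)] parseval_nrm2[OF h(4)]
  by (simp only: of_real_mult right_diff_distrib distrib_left mult.left_commute)
 also have "of_real (LINT k|cs. (norm (cf ?h1 k))^2) - of_real (LINT k|cs. (norm (cf ?h2 k))^2)
  + \<i> * of_real (LINT k|cs. (norm (cf ?h3 k))^2) - \<i> * of_real (LINT k|cs. (norm (cf ?h4 k))^2)
  = (LINT k|cs. 4 * (cf f k * cnj (cf g k)))" unfolding polarization4 c[symmetric] integral_complex_of_real[symmetric]
  by (rule integral_lincomb4[symmetric]; rule integrable_of_real; rule bessel(1); rule h)
 also have "... = 4 * (LINT k|cs. cf f k * cnj (cf g k))" by simp
 finally show ?thesis by simp
qed

text \<open>Parseval's identity for \<open>f\<close> against \<open>cnj g * ch k\<close>, whose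
  coefficient at \<open>j\<close> is the conjugate of \<open>cf g (k - j)\<close>.\<close>

lemma cf_mult_conv: assumes f: "P2 f" and g: "P2 g" shows "cf (%x. f x * g x) k = conv (cf f) (cf g) k"
proof -
 let ?h = "%x. cnj (g x) * ch k x"
 have h: "P2 ?h" using P2_mult_bounded[OF P2_cnj[OF g] ch_measurable ch_periodic, of k 1] by simp
 have ch: "cf ?h j = cnj (cf g (k - j))" for j
 proof -
  have "cnj (g x) * ch k x * cnj (ch j x) = cnj (g x * cnj (ch (k - j) x))" for x using ch_add[of k "- j" x] by (simp add: ch_cnj)
  hence "(LINT x|tm. cnj (g x) * ch k x * cnj (ch j x)) = cnj (LINT x|tm. g x * cnj (ch (k - j) x))"
  by (simp only: Bochner_Integration.integral_cnj)
  thus ?thesis by (simp add: cf_def)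
 qed
 have "(LINT x|tm. f x * g x * cnj (ch k x)) = (LINT x|tm. f x * cnj (?h x))" by (simp add: mult.assoc)
 also have "... = of_real (L ^ 3) * (LINT j|cs. cf f j * cf g (k - j))" unfolding parseval[OF f h] ch by simp
 finally show ?thesis using L_pos unfolding cf_def[of "%x. f x * g x"] conv_def by simp
qed

end

section \<open>Weak derivatives, Sobolev spaces and filters as Fourier multipliers\<close>

context torus begin

abbreviation ft :: "(real^3 => real) => int^3 => complex" where "ft \<equiv> fourier L"

lemma L3_pos: "0 < L ^ 3" using L_pos by simp

lemma of_real_borel_iff: "(%x. complex_of_real (f x)) : BMs M <-> f : BMs M"
proof
 assume "(%x. complex_of_real (f x)) : BMs M"
 hence "(%x. Re (complex_of_real (f x))) : BMs M" by measurable
 thus "f : BMs M" by simp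
qed simp

lemma L2_torus_iff: "f : L2_torus L <-> P2 (%x. of_real (f x))"
 by (simp add: L2_torus_def P2_def of_real_borel_iff si_tm periodic_def)

lemma L1_torus_iff: "f : L1_torus L <-> P1 (%x. of_real (f x))"
proof -
 have "complex_integrable tm (%x. of_real (f x)) <-> integrable tm f"
  using integrable_Re[of tm "%x. of_real (f x)"] integrable_of_real[of tm f] by auto
 thus ?thesis by (simp add: L1_torus_def P1_def of_real_borel_iff si_tm periodic_def)
qed

lemma L2_imp_L1: "f : L2_torus L ==> f : L1_torus L" by (simp add: L2_torus_iff L1_torus_iff P2_imp_P1)

lemma ft_minus: "ft f (- k) = cnj (ft f k)" using cf_cnj[of "%x. of_real (f x)" "- k"] by (simp add: ft_cf)

lemma hsq_0_iff: "hsq 0 (a :: int^3 => 'v::{banach,second_countable_topology}) < infy <-> integrable cs (%k. (norm (a k))^2)"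
 unfolding hsq_def by (subst int_cs_nn) auto

lemma ft_hsq0: "f : L2_torus L ==> hsq 0 (ft f) < infy"
 unfolding hsq_0_iff L2_torus_iff using bessel(1) by (simp add: ft_cf[abs_def])

lemma integrable_cs_inner:
 fixes a b :: "int^3 => 'v::euclidean_space" assumes "hsq 0 a < infy" "hsq 0 b < infy" shows "integrable cs (%k. a k <.> b k)"
proof (rule bochnerI_bound)
 show "integrable cs (%k. norm (a k) * norm (b k))"
  by (rule int_norm2_mult[OF _ _ assms(1)[unfolded hsq_0_iff] assms(2)[unfolded hsq_0_iff]]) simp_all
 show "AE k in cs. norm (a k <.> b k) <= norm (norm (a k) * norm (b k))" by (rule AE_I2) (use Cauchy_Schwarz_ineq2 in auto)
qed simp

lemma torus_parseval: assumes f: "f : L2_torus L" and g: "g : L2_torus L" shows "integrable tm (%x. f x * g x)"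
  and "(LINT x|tm. f x * g x) = L ^ 3 * (LINT k|cs. ft f k <.> ft g k)"
proof -
 have P: "P2 (%x. of_real (f x))" "P2 (%x. of_real (g x))" using f g by (simp_all add: L2_torus_iff)
 have "complex_integrable tm (%x. of_real (f x) * of_real (g x))" by (rule P2_integrable_mult[OF P])
 from integrable_Re[OF this] show "integrable tm (%x. f x * g x)" by simp
 have i: "integrable cs (%k. cf (%x. of_real (f x)) k * cnj (cf (%x. of_real (g x)) k))"
  by (rule cf_l2_integrable_mult) (use P bessel(1) in auto)
 have "complex_of_real (LINT x|tm. f x * g x) = (LINT x|tm. of_real (f x) * cnj (of_real (g x)))" by (simp flip: of_real_mult)
 also have "... = of_real (L ^ 3) * (LINT k|cs. ft f k * cnj (ft g k))" using parseval[OF P] by (simp add: ft_cf)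
 finally have "Re (complex_of_real (LINT x|tm. f x * g x)) = Re (of_real (L ^ 3) * (LINT k|cs. ft f k * cnj (ft g k)))"
  by (rule arg_cong)
 hence "(LINT x|tm. f x * g x) = L ^ 3 * Re (LINT k|cs. ft f k * cnj (ft g k))" by (simp del: of_real_power)
 also have "Re (LINT k|cs. ft f k * cnj (ft g k)) = (LINT k|cs. Re (ft f k * cnj (ft g k)))"
  using i by (intro integral_Re[symmetric]) (simp add: ft_cf)
 finally show "(LINT x|tm. f x * g x) = L ^ 3 * (LINT k|cs. ft f k <.> ft g k)" by (simp only: inner_complex_eq_Re)
qed

text \<open>Taking the real part does not alter hermitian coefficients and makes the reconstruction
  real at every point.\<close>

definition rr :: "(int^3 => complex) => real^3 => real" where "rr c x = Re (rf c x)"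

lemma rr_L2: assumes h: "!!k. c (- k) = cnj (c k)" and c: "hsq 0 c < infy" shows "rr c : L2_torus L" "ft (rr c) k = c k"
proof -
 have i: "integrable cs (%k. (norm (c k))^2)" using c by (simp only: hsq_0_iff)
 show "rr c : L2_torus L" unfolding L2_torus_iff rr_def by (rule P2_Re[OF rf_P2(1)[OF i]])
 show "ft (rr c) k = c k" unfolding ft_cf rr_def by (simp add: cf_Re[OF P2_imp_P1[OF rf_P2(1)[OF i]]] rf_P2(3)[OF i] h)
qed

lemma ft_unique: assumes "f : L1_torus L" "g : L1_torus L" "!!k. ft f k = ft g k" shows "AE x in lborel. f x = g x"
proof -
 have "AE x in lborel. complex_of_real (f x) = of_real (g x)"
  by (rule fourier_unique_eq) (use assms in \<open>simp_all add: L1_torus_iff ft_cf\<close>)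
 thus ?thesis by simp
qed

lemma ft_cong_AE: assumes "f : BM" "g : BM" "AE x in lborel. f x = g x" shows "ft f k = ft g k"
proof -
 have "AE x in tm. f x = g x" using assms(3) unfolding AE_tm by eventually_elim simp
 hence "(LINT x|tm. of_real (f x) * cnj (ch k x)) = (LINT x|tm. of_real (g x) * cnj (ch k x))" using assms(1,2)
  by (intro integral_cong_AE m_tm borel_measurable_times cnj_measurable ch_measurable borel_measurable_of_real) auto
 thus ?thesis by (simp add: ft_cf cf_def)
qed

text \<open>Such a function agrees almost everywhere with the reconstruction from its coefficients.
  This upgrades weak derivatives and products, which are known a priori only to be
  integrable.\<close>

lemma L1_ell2_imp_L2: assumes f: "f : L1_torus L" and h: "hsq 0 (ft f) < infy" shows "f : L2_torus L"
proof -
 note r = rr_L2[OF ft_minus h]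
 have "AE x in lborel. f x = rr (ft f) x" by (rule ft_unique[OF f L2_imp_L1[OF r(1)]]) (simp add: r(2))
 hence ae: "AE x in tm. (rr (ft f) x)^2 = (f x)^2" unfolding AE_tm by eventually_elim simp
 have fm: "f : BM" "periodic L f" using f by (auto simp: L1_torus_def)
 have "integrable tm (%x. (f x)^2) <-> integrable tm (%x. (rr (ft f) x)^2)"
  using r(1) fm(1) ae by (intro integrable_cong_AE) (auto simp: L2_torus_def intro!: m_tm)
 thus ?thesis using r(1) fm by (simp add: L2_torus_def si_tm)
qed

lemma L1_torus_lincomb: "f : L1_torus L ==> g : L1_torus L ==> (%x. f x + c * g x) : L1_torus L"
 using P1_add[of "%x. of_real (f x)" "%x. of_real c * of_real (g x)"] P1_cmult[of "%x. of_real (g x)" "of_real c"]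
 by (simp add: L1_torus_iff)

lemma ft_lincomb: "f : L1_torus L ==> g : L1_torus L ==> ft (%x. f x + c * g x) k = ft f k + of_real c * ft g k"
 using cf_add[of "%x. of_real (f x)" "%x. of_real c * of_real (g x)" k] P1_cmult[of "%x. of_real (g x)" "of_real c"]
 by (simp add: L1_torus_iff ft_cf cf_cmult)

lemma L2_torus_lincomb: "f : L2_torus L ==> g : L2_torus L ==> (%x. f x + c * g x) : L2_torus L"
 using P2_add[of "%x. of_real (f x)" "%x. of_real c * of_real (g x)"] P2_cmult[of "%x. of_real (g x)" "of_real c"]
 by (simp add: L2_torus_iff)

lemma L2_torus_diff: "f : L2_torus L ==> g : L2_torus L ==> (%x. f x - g x) : L2_torus L"
 using L2_torus_lincomb[of f g "-1"] by simp

lemma ft_diff: "f : L2_torus L ==> g : L2_torus L ==> ft (%x. f x - g x) k = ft f k - ft g k"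
 using ft_lincomb[of f g "-1" k] by (simp add: L2_imp_L1)

lemma L2_torus_zero: "(%x. 0) : L2_torus L" by (simp add: L2_torus_iff P2_const[of 0, simplified])
lemma ft_zero [simp]: "ft (%x. 0) k = 0" by (simp add: ft_cf cf_def)

lemma L2_torus_add: "f : L2_torus L ==> g : L2_torus L ==> (%x. f x + g x) : L2_torus L" using L2_torus_lincomb[of f g 1] by simp

lemma ft_add: "f : L2_torus L ==> g : L2_torus L ==> ft (%x. f x + g x) k = ft f k + ft g k"
 using ft_lincomb[of f g 1 k] by (simp add: L2_imp_L1)

lemma L2_torus_sum: "finite A ==> (!!a. a : A ==> f a : L2_torus L) ==> (%x. \<Sum>a\<in>A. f a x) : L2_torus L"
 by (induction A rule: finite_induct) (auto intro: L2_torus_zero L2_torus_add)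

lemma ft_sum: "finite A ==> (!!a. a : A ==> f a : L2_torus L) ==> ft (%x. \<Sum>a\<in>A. f a x) k = (\<Sum>a\<in>A. ft (f a) k)"
 by (induction A rule: finite_induct) (auto simp: ft_add L2_torus_sum)

lemma sobolev_iff: "f : sobolev L (real s) <-> f : L2_torus L & hsq s (ft f) < infy"
proof -
 have "(1 + (K k)^2) powr real s = jap k ^ s" for k using powr_realpow[OF jap_pos, of k s] by (simp add: jap_def)
 moreover have "integrable cs (%k. jap k ^ s * (cmod (ft f k))^2) <-> hsq s (ft f) < infy"
  unfolding hsq_def using jap_pos by (subst int_cs_nn) (auto simp: less_imp_le)
 ultimately show ?thesis by (simp add: sobolev_def int_cs_summable)
qed

lemma enn2real_hsq: assumes "hsq s a < infy" shows "enn2real (hsq s a) = (LINT k|cs. jap k ^ s * (norm (a k))^2)"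
 unfolding hsq_def using jap_pos hsq_0_integrable[OF assms]
 by (subst nn_integral_eq_integral) (auto simp: less_imp_le intro!: bochner_nonneg)

lemma sobolev_norm2: assumes "hsq s (ft f) < infy" shows "(sobolev_norm L (real s) f)^2 = enn2real (hsq s (ft f))"
proof -
 have "(1 + (K k)^2) powr real s = jap k ^ s" for k using powr_realpow[OF jap_pos, of k s] by (simp add: jap_def)
 moreover have "0 <= (LINT k|cs. jap k ^ s * (norm (ft f k))^2)" using jap_pos by (intro bochner_nonneg) (auto simp: less_imp_le)
 ultimately show ?thesis
  unfolding enn2real_hsq[OF assms] sobolev_norm_def integral_cs_eq_infsum[OF hsq_0_integrable[OF assms]] by simp
qed

text \<open>Real trigonometric test functions; pairing with them for all complex \<open>z\<close>
  reads off the coefficient at \<open>n\<close>.\<close>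

definition tt :: "complex => int^3 => real^3 => real" where "tt z n x = Re (z * ch n x)"

lemma tt_has_derivative: "(tt z n has_derivative (%h. Re (\<i> * z * ch n x) * (wave L n <.> h))) (at x)"
proof -
 have "tt z n = (%x. Re z * cos (wave L n <.> x) - Im z * sin (wave L n <.> x))" by (auto simp: tt_def ch_def)
 thus ?thesis by (auto intro!: derivative_eq_intros simp: ch_def algebra_simps)
qed

lemma partial_tt: "partial j (tt z n) = tt (iwv n j * z) n"
proof
 fix x
 have "partial j (tt z n) x = Re (\<i> * z * ch n x) * (wave L n <.> axis j 1)"
  unfolding partial_def by (subst frechet_derivative_at[OF tt_has_derivative, symmetric]) simp
 thus "partial j (tt z n) x = tt (iwv n j * z) n x" by (simp add: tt_def inner_axis algebra_simps)
qed

lemma Ck_tt: "Ck k (tt z n)"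
proof (induction k arbitrary: z)
 case 0
 have "continuous_on UNIV (%x. Re (z * ch n x))" by (intro continuous_intros ch_continuous)
 thus ?case by (simp add: tt_def[abs_def])
next
 case (Suc k)
 thus ?case using tt_has_derivative unfolding Ck.simps partial_tt differentiable_def by blast
qed

lemma tt_test: "tt z n : torus_test L" using ch_periodic[of n] Ck_tt by (simp add: torus_test_def periodic_def tt_def)

lemma tt_integral: assumes "f : L1_torus L" shows "(LINT x|tm. f x * tt z n x) = L ^ 3 * (ft f n <.> z)"
proof -
 have i: "complex_integrable tm (%x. of_real (f x) * ch n x)"
  using integrable_mult_ch[of "%x. of_real (f x)" 1 n] assms by (simp add: L1_torus_iff P1_def)
 have "(LINT x|tm. f x * tt z n x) = (LINT x|tm. Re (z * (of_real (f x) * ch n x)))" by (simp add: tt_def algebra_simps)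
 also have "... = Re (LINT x|tm. z * (of_real (f x) * ch n x))" by (rule integral_Re) (intro integrable_mult_right i)
 also have "... = Re (z * (LINT x|tm. of_real (f x) * ch n x))" by simp
 also have "(LINT x|tm. of_real (f x) * ch n x) = cnj (of_real (L ^ 3) * ft f n)"
  using L_pos ft_minus[of f "- n"] by (simp add: ft_cf cf_def ch_cnj)
 finally show ?thesis by (simp add: inner_complex_def algebra_simps)
qed

lemma Ck_1D: assumes "\<forall>k. Ck k ph"
 shows "ph differentiable (at x)" "continuous_on UNIV ph" "continuous_on UNIV (partial j ph)"
proof -
 have "Ck (Suc 0) ph" "Ck 0 ph" using assms by blast+
 thus "ph differentiable (at x)" "continuous_on UNIV ph" "continuous_on UNIV (partial j ph)" by auto
qed

lemma partial_line: assumes "ph differentiable (at x)"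
 shows "((%t. ph (x + axis j t)) has_vector_derivative partial j ph x) (at 0)"
proof -
 have "(ph has_derivative frechet_derivative ph (at x)) (at x)" using assms frechet_derivative_works by blast
 hence d: "(ph has_derivative frechet_derivative ph (at x)) (at (x + 0 *R axis j 1))" by simp
 have "((%t. x + t *R axis j 1) has_vector_derivative axis j 1) (at 0)" by (auto intro!: derivative_eq_intros)
 from vector_derivative_diff_chain_within[OF this, of ph "frechet_derivative ph (at x)"]
 have "(ph \<circ> (%t. x + t *R axis j 1) has_vector_derivative frechet_derivative ph (at x) (axis j 1)) (at 0)"
  using has_derivative_at_withinI[OF d] by simp
 moreover have "(ph \<circ> (%t. x + t *R axis j 1)) = (%t. ph (x + axis j t))"
  by (auto simp: fun_eq_iff vec_eq_iff axis_def intro!: arg_cong[of _ _ ph])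
 ultimately show ?thesis by (simp add: partial_def)
qed

lemma partial_periodic: assumes p: "periodic L ph" and d: "!!x. ph differentiable (at x)" shows "periodic L (partial j ph)"
 unfolding periodic_def
proof (intro allI)
 fix x i
 have "((%t. ph ((x + axis i L) + axis j t)) has_vector_derivative partial j ph (x + axis i L)) (at 0)"
  by (rule partial_line[OF d])
 moreover have "ph ((x + axis i L) + axis j t) = ph (x + axis j t)" for t
  using periodicD[OF p, of "x + axis j t" i] by (simp add: algebra_simps)
 ultimately have "((%t. ph (x + axis j t)) has_vector_derivative partial j ph (x + axis i L)) (at 0)" by simp
 thus "partial j ph (x + axis i L) = partial j ph x" using partial_line[OF d] vector_derivative_unique_at by metis
qed

lemma continuous_periodic_L2: assumes c: "continuous_on UNIV ph" and p: "periodic L ph" shows "ph : L2_torus L"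
proof -
 have "integrable tm (%x. (ph x)^2)" by (rule integrable_tm_continuous) (intro continuous_intros c)
 thus ?thesis using p bm_cont[OF c] by (simp add: L2_torus_def si_tm)
qed

lemma test_L2: assumes "ph : torus_test L"
 shows "ph : L2_torus L" "partial j ph : L2_torus L" "ft (partial j ph) k = iwv k j * ft ph k"
proof -
 have p: "periodic L ph" and C: "\<forall>k. Ck k ph" using assms by (auto simp: torus_test_def)
 note D = Ck_1D[OF C]
 have pp: "periodic L (partial j ph)" by (rule partial_periodic[OF p D(1)])
 show ph: "ph : L2_torus L" by (rule continuous_periodic_L2[OF D(2) p])
 show ph': "partial j ph : L2_torus L" by (rule continuous_periodic_L2[OF D(3) pp])
 let ?w = "\<i> * complex_of_real (wave L k $ j)"
 let ?g = "%x. of_real (ph x) * ch (- k) x"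
 let ?D = "%x. of_real (ph x) * (iwv (- k) j * ch (- k) x) + of_real (partial j ph x) * ch (- k) x"
 \<comment> \<open>\<open>?D\<close> is the derivative of \<open>ph * ch (- k)\<close>, so this is
   integration by parts.\<close>
 have "(LINT x|tm. ?D x) = 0"
 proof (rule integral_tm_derivative)
  show "continuous_on UNIV ?g" "continuous_on UNIV ?D" by (intro continuous_intros D ch_continuous)+
  show "periodic L ?g" "periodic L ?D" using p pp ch_periodic[of "- k"] by (auto simp: periodic_def)
  fix x
  have "((%t. complex_of_real (ph (x + axis j t))) has_vector_derivative of_real (partial j ph x)) (at 0)"
  by (rule has_vector_derivative_of_real) (use partial_line[OF D(1)] in \<open>simp add: has_real_derivative_iff_has_vector_derivative\<close>)
  from has_vector_derivative_mult[OF this ch_derivative]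
  show "((%t. ?g (x + axis j t)) has_vector_derivative ?D x) (at 0)" by (simp add: axis_0)
 qed
 moreover have "integrable tm (%x. of_real (ph x) * (iwv (- k) j * ch (- k) x))"
  "integrable tm (%x. of_real (partial j ph x) * ch (- k) x)"
  by (rule integrable_tm_continuous, intro continuous_intros D ch_continuous)+
 ultimately have "(LINT x|tm. of_real (partial j ph x) * ch (- k) x) = - (LINT x|tm. of_real (ph x) * (iwv (- k) j * ch (- k) x))"
  by (simp add: eq_neg_iff_add_eq_0 add.commute)
 also have "(LINT x|tm. of_real (ph x) * (iwv (- k) j * ch (- k) x)) = (LINT x|tm. - ?w * (of_real (ph x) * ch (- k) x))"
  by (simp add: wave_minus mult_ac)
 also have "... = - ?w * (LINT x|tm. of_real (ph x) * ch (- k) x)" by (rule integral_mult_right_zero)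
 finally show "ft (partial j ph) k = ?w * ft ph k" by (simp add: ft_cf cf_def ch_cnj)
qed

lemma inner_imult: "(\<i> * of_real r * a) <.> b = - (a <.> (\<i> * of_real r * b))"
 by (simp add: inner_complex_def algebra_simps)

lemma weak_partial_ft: assumes "weak_partial L j f g" shows "ft g k = iwv k j * ft f k"
proof -
 have fg: "f : L1_torus L" "g : L1_torus L" using assms by (auto simp: weak_partial_def)
 have "ft g k <.> z = (iwv k j * ft f k) <.> z" for z
 proof -
  have "torus_integral L (%x. f x * partial j (tt z k) x) = - torus_integral L (%x. g x * tt z k x)"
  using assms tt_test by (simp add: weak_partial_def)
  hence "L ^ 3 * (ft f k <.> (iwv k j * z)) = L ^ 3 * - (ft g k <.> z)"
  unfolding tint_tm partial_tt tt_integral[OF fg(1)] tt_integral[OF fg(2)] by simp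
  hence "ft f k <.> (iwv k j * z) = - (ft g k <.> z)" using L3_pos by (simp only: mult_cancel_left) auto
  thus ?thesis using inner_imult[of "wave L k $ j" "ft f k" z] by simp
 qed
 thus ?thesis by (metis vector_eq_rdot)
qed

lemma weak_partialI: assumes f: "f : L2_torus L" and g: "g : L2_torus L" and e: "!!k. ft g k = iwv k j * ft f k"
 shows "weak_partial L j f g" unfolding weak_partial_def
proof (intro conjI ballI L2_imp_L1 f g)
 fix ph assume ph: "ph : torus_test L"
 note t = test_L2[OF ph]
 have "ft f k <.> ft (partial j ph) k = - (ft g k <.> ft ph k)" for k
  unfolding t(3) e using inner_imult[of "wave L k $ j" "ft f k" "ft ph k"] by simp
 thus "torus_integral L (%x. f x * partial j ph x) = - torus_integral L (%x. g x * ph x)"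
  unfolding tint_tm torus_parseval(2)[OF f t(2)] torus_parseval(2)[OF g t(1)] by simp
qed

lemma hsq_wave_le: "hsq s (%k. iwv k j * a k) <= hsq (Suc s) a" unfolding hsq_def
proof (intro nn_integral_mono ennreal_leI)
 fix k
 have "(wave L k $ j)^2 <= (K k)^2" using K_component[of k j] by (simp add: abs_le_square_iff[symmetric])
 hence "(wave L k $ j)^2 <= jap k" using K2_le_jap order_trans by blast
 hence "jap k ^ s * ((wave L k $ j)^2 * (norm (a k))^2) <= jap k ^ s * (jap k * (norm (a k))^2)"
  using jap_pos[of k] by (intro mult_lmono mult_right_mono) auto
 thus "jap k ^ s * (norm (iwv k j * a k))^2 <= jap k ^ Suc s * (norm (a k))^2" by (simp add: norm_mult power_mult_distrib mult_ac)
qed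

text \<open>Reconstruction from the multiplied coefficients provides one weak derivative, so the
  choice in \<open>wpartial\<close> is not void. Whichever weak derivative is chosen, its
  coefficients are forced, and square integrability follows from them.\<close>

lemma wpartial_L2: assumes f: "f : L2_torus L" and h: "hsq 1 (ft f) < infy"
 shows "wpartial L j f : L2_torus L" "ft (wpartial L j f) k = iwv k j * ft f k"
proof -
 let ?c = "%k. iwv k j * ft f k"
 have c: "hsq 0 ?c < infy" by (rule le_less_trans[OF hsq_wave_le]) (use h in simp)
 have "?c (- k) = cnj (?c k)" for k by (simp add: ft_minus wave_minus)
 note r = rr_L2[OF this c]
 have "weak_partial L j f (rr ?c)" by (rule weak_partialI[OF f r])
 hence w: "weak_partial L j f (wpartial L j f)" unfolding wpartial_def by (rule someI[of "weak_partial L j f"])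
 show e: "ft (wpartial L j f) k = ?c k" for k by (rule weak_partial_ft[OF w])
 show "wpartial L j f : L2_torus L"
 proof (rule L1_ell2_imp_L2)
  show "wpartial L j f : L1_torus L" using w by (simp add: weak_partial_def)
  have "ft (wpartial L j f) = ?c" by (rule ext) (rule e)
  thus "hsq 0 (ft (wpartial L j f)) < infy" using c by (simp only:)
 qed
qed

lemma gsym_hsq2:
 fixes a :: "int^3 => 'v::real_normed_vector" assumes "al > 0"
 shows "hsq (s + 2) (%k. gsym al k *R a k) <= ennreal ((Cg al)^2) * hsq s a"
proof -
 have "jap k ^ (s + 2) * (norm (gsym al k *R a k))^2 <= (Cg al)^2 * (jap k ^ s * (norm (a k))^2)" for k
 proof -
  have "(jap k * gsym al k)^2 <= (Cg al)^2"
  using jap_gsym_le[OF assms, of k] jap_pos[of k] gsym_pos[of al k] by (intro power_mono) auto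
  hence "(jap k * gsym al k)^2 * (jap k ^ s * (norm (a k))^2) <= (Cg al)^2 * (jap k ^ s * (norm (a k))^2)"
  using jap_pos[of k] by (intro mult_right_mono) auto
  moreover have "jap k ^ (s + 2) * (norm (gsym al k *R a k))^2 = (jap k * gsym al k)^2 * (jap k ^ s * (norm (a k))^2)"
  by (simp add: power_mult_distrib power_add power2_eq_square mult_ac)
  ultimately show ?thesis by (simp only:)
 qed
 hence "hsq (s + 2) (%k. gsym al k *R a k) <= (SN k. ennreal ((Cg al)^2) * ennreal (jap k ^ s * (norm (a k))^2))"
  unfolding hsq_def by (intro nn_integral_mono) (simp add: ennreal_mult'[symmetric] ennreal_leI)
 thus ?thesis by (simp add: nn_integral_cmult hsq_def)
qed

lemma wlaplacian_L2: assumes f: "f : L2_torus L" and h: "hsq 2 (ft f) < infy"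
 shows "wlaplacian L f : L2_torus L" "ft (wlaplacian L f) k = - of_real ((K k)^2) * ft f k"
proof -
 have h1: "hsq 1 (ft f) < infy" by (rule le_less_trans[OF hsq_mono_s h]) simp
 note a = wpartial_L2[OF f h1]
 have "hsq 1 (ft (wpartial L j f)) < infy" for j
  unfolding a(2)[abs_def] by (rule le_less_trans[OF hsq_wave_le]) (use h in \<open>simp add: numeral_2_eq_2\<close>)
 note b = wpartial_L2[OF a(1) this]
 have e: "wlaplacian L f = (%x. \<Sum>j\<in>UNIV. wpartial L j (wpartial L j f) x)" by (auto simp: wlaplacian_def)
 show "wlaplacian L f : L2_torus L" unfolding e by (intro L2_torus_sum b) simp
 have "ft (wlaplacian L f) k = (\<Sum>j\<in>UNIV. iwv k j * (iwv k j * ft f k))" unfolding e by (subst ft_sum) (auto simp: b a)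
 also have "... = (\<Sum>j\<in>UNIV. - (of_real ((wave L k $ j)^2) * ft f k))"
  by (rule sum.cong) (simp_all add: power2_eq_square algebra_simps)
 also have "... = - of_real (\<Sum>j\<in>UNIV. (wave L k $ j)^2) * ft f k" by (simp add: sum_distrib_right sum_negf)
 also have "(\<Sum>j\<in>UNIV. (wave L k $ j)^2) = (K k)^2" by (simp add: norm_vec_def L2_set_def sum_nonneg)
 finally show "ft (wlaplacian L f) k = - of_real ((K k)^2) * ft f k" .
qed

lemma gsym_inverse: "complex_of_real (gsym al k) * of_real (1 + al^2 * (K k)^2) = 1"
proof -
 have "0 < 1 + al^2 * (K k)^2" by (simp add: add_pos_nonneg)
 hence "gsym al k * (1 + al^2 * (K k)^2) = 1" by (simp add: gsym_def)
 thus ?thesis by (metis of_real_mult of_real_1)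
qed

text \<open>As for \<open>wpartial\<close>: one solution of the Helmholtz equation is built from the
  symbol \<open>gsym\<close>, and the coefficients of the chosen solution are forced by the
  equation.\<close>

lemma helmholtz_inv_L2: assumes f: "f : L2_torus L" and al: "al > 0"
 shows "helmholtz_inv L al f : L2_torus L" "hsq 2 (ft (helmholtz_inv L al f)) < infy"
  "ft (helmholtz_inv L al f) k = of_real (gsym al k) * ft f k"
proof -
 have hh: "helmholtz L al u : L2_torus L" "ft (helmholtz L al u) k = of_real (1 + al^2 * (K k)^2) * ft u k"
  if u: "u : L2_torus L" "hsq 2 (ft u) < infy" for u k
 proof -
  note w = wlaplacian_L2[OF u]
  have e: "helmholtz L al u = (%x. u x + (- (al^2)) * wlaplacian L u x)" by (auto simp: helmholtz_def)
  show "helmholtz L al u : L2_torus L" unfolding e by (rule L2_torus_lincomb[OF u(1) w(1)])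
  show "ft (helmholtz L al u) k = of_real (1 + al^2 * (K k)^2) * ft u k"
  unfolding e ft_lincomb[OF L2_imp_L1[OF u(1)] L2_imp_L1[OF w(1)]] w(2) by (simp add: algebra_simps)
 qed
 let ?c = "%k. of_real (gsym al k) * ft f k"
 have c2: "hsq 2 ?c < infy"
 proof -
  have "hsq 2 ?c <= ennreal ((Cg al)^2) * hsq 0 (ft f)"
  using gsym_hsq2[OF al, of 0 "ft f"] by (simp add: scaleR_conv_of_real numeral_2_eq_2)
  also have "... < infy" using ft_hsq0[OF f] by (simp add: mult_lt_top)
  finally show ?thesis .
 qed
 have c0: "hsq 0 ?c < infy" by (rule le_less_trans[OF hsq_mono_s c2]) simp
 have "?c (- k) = cnj (?c k)" for k by (simp add: ft_minus)
 note r = rr_L2[OF this c0]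
 have r2: "hsq 2 (ft (rr ?c)) < infy" using c2 by (simp add: r(2)[abs_def])
 have "AE x in lborel. helmholtz L al (rr ?c) x = f x"
 proof (rule ft_unique[OF L2_imp_L1[OF hh(1)[OF r(1) r2]] L2_imp_L1[OF f]])
  fix k show "ft (helmholtz L al (rr ?c)) k = ft f k" unfolding hh(2)[OF r(1) r2] r(2) mult.assoc[symmetric]
  by (subst mult.commute[of "of_real (1 + al^2 * (K k)^2)"], subst gsym_inverse) simp
 qed
 moreover have "rr ?c : sobolev L 2" using sobolev_iff[of "rr ?c" 2] r(1) r2 by simp
 ultimately have "rr ?c : sobolev L 2 & (AE x in lborel. helmholtz L al (rr ?c) x = f x)" by (rule conjI[rotated])
 from someI[of "%u. u : sobolev L 2 & (AE x in lborel. helmholtz L al u x = f x)", OF this]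
 have q: "helmholtz_inv L al f : sobolev L 2 & (AE x in lborel. helmholtz L al (helmholtz_inv L al f) x = f x)"
  unfolding helmholtz_inv_def .
 hence s: "helmholtz_inv L al f : L2_torus L" "hsq 2 (ft (helmholtz_inv L al f)) < infy"
  and ae: "AE x in lborel. helmholtz L al (helmholtz_inv L al f) x = f x"
  using sobolev_iff[of "helmholtz_inv L al f" 2] by simp_all
 show "helmholtz_inv L al f : L2_torus L" "hsq 2 (ft (helmholtz_inv L al f)) < infy" by (fact s)+
 have "ft (helmholtz L al (helmholtz_inv L al f)) k = ft f k"
  by (rule ft_cong_AE) (use hh(1)[OF s] f ae in \<open>auto simp: L2_torus_def\<close>)
 hence "of_real (1 + al^2 * (K k)^2) * ft (helmholtz_inv L al f) k = ft f k" unfolding hh(2)[OF s] .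
 hence "of_real (gsym al k) * (of_real (1 + al^2 * (K k)^2) * ft (helmholtz_inv L al f) k) = of_real (gsym al k) * ft f k" by (rule arg_cong)
 moreover note gsym_inverse
 ultimately show "ft (helmholtz_inv L al f) k = of_real (gsym al k) * ft f k" by (simp only: mult.assoc[symmetric] mult_1)
qed

definition Dsym :: "real => nat => int^3 => real" where "Dsym al N k = (\<Sum>n\<le>N. (1 - gsym al k) ^ n)"

lemma Dsym_ge_1: "1 <= Dsym al N k"
proof -
 have "(\<Sum>n\<in>{0}. (1 - gsym al k) ^ n) <= Dsym al N k"
  unfolding Dsym_def by (rule sum_mono2) (use gsym_le_1[of al k] in auto)
 thus ?thesis by simp
qed

lemma Dsym_le: "Dsym al N k <= real (Suc N)"
proof -
 have "Dsym al N k <= (\<Sum>n\<le>N. 1)" unfolding Dsym_def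
  using gsym_le_1[of al k] gsym_pos[of al k] by (intro sum_mono power_le_one) auto
 thus ?thesis by simp
qed

lemma Dsym_minus [simp]: "Dsym al N (- k) = Dsym al N k" by (simp add: Dsym_def)

lemma deconv_L2: assumes f: "f : L2_torus L" and al: "al > 0"
 shows "deconv L al N f : L2_torus L" "ft (deconv L al N f) k = of_real (Dsym al N k) * ft f k"
proof -
 let ?T = "%g y. g y - helmholtz_inv L al g y"
 have p: "(?T ^^ n) f : L2_torus L & (\<forall>k. ft ((?T ^^ n) f) k = of_real ((1 - gsym al k) ^ n) * ft f k)" for n
 proof (induction n)
  case (Suc n)
  let ?g = "(?T ^^ n) f"
  have g: "?g : L2_torus L" "!!k. ft ?g k = of_real ((1 - gsym al k) ^ n) * ft f k" using Suc by auto
  note h = helmholtz_inv_L2[OF g(1) al]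
  have "(?T ^^ Suc n) f = (%y. ?g y - helmholtz_inv L al ?g y)" by simp
  thus ?case using L2_torus_diff[OF g(1) h(1)] ft_diff[OF g(1) h(1)] by (simp add: h(3) g(2) algebra_simps)
 qed (use f in simp)
 have e: "deconv L al N f = (%x. \<Sum>n\<le>N. (?T ^^ n) f x)" by (auto simp: deconv_def)
 show "deconv L al N f : L2_torus L" unfolding e by (rule L2_torus_sum) (use p in auto)
 show "ft (deconv L al N f) k = of_real (Dsym al N k) * ft f k"
  unfolding e by (subst ft_sum) (use p in \<open>auto simp: Dsym_def sum_distrib_right\<close>)
qed

text \<open>h^1 sequences convolve to l^2, so the product of two H^1 functions, integrable a priori,
  is square integrable.\<close>

lemma mult_L2: assumes f: "f : L2_torus L" "hsq 1 (ft f) < infy" and g: "g : L2_torus L" "hsq 1 (ft g) < infy"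
 shows "(%x. f x * g x) : L2_torus L" "ft (%x. f x * g x) k = conv (ft f) (ft g) k"
proof -
 have P: "P2 (%x. of_real (f x))" "P2 (%x. of_real (g x))" using f g by (simp_all add: L2_torus_iff)
 show e: "ft (%x. f x * g x) k = conv (ft f) (ft g) k" for k using cf_mult_conv[OF P] by (simp add: ft_cf[abs_def])
 have "(%x. f x * g x) : L1_torus L"
  using torus_parseval(1)[OF f(1) g(1)] f(1) g(1) by (auto simp: L1_torus_def L2_torus_def si_tm periodic_def)
 moreover have "hsq 0 (ft (%x. f x * g x)) < infy" unfolding e[abs_def] using conv_bound[of "ft f" "ft g"] f(2) g(2) latS_finite
  by (auto simp: mult_lt_top elim: le_less_trans)
 ultimately show "(%x. f x * g x) : L2_torus L" by (rule L1_ell2_imp_L2)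
qed

definition vft :: "(real^3 => real^3) => int^3 => complex^3" where "vft w k = (\<chi> i. ft (%x. w x $ i) k)"

definition vL2 :: "(real^3 => real^3) => bool" where "vL2 w <-> (\<forall>i. (%x. w x $ i) : L2_torus L)"

lemma vft_nth [simp]: "vft w k $ i = ft (%x. w x $ i) k" by (simp add: vft_def)

lemma vft_herm: "herm (vft w)" by (simp add: herm_def ft_minus)

lemma sum_inner_wave: "(\<Sum>j\<in>UNIV. (v $ j) <.> (iwv k j * z)) = - ((\<i> * wdot k v) <.> z)"
proof -
 have "(v $ j) <.> (iwv k j * z) = - ((iwv k j * v $ j) <.> z)" for j using inner_imult[of "wave L k $ j" "v $ j" z] by simp
 thus ?thesis by (simp add: sum_negf inner_sum_left[symmetric] wdot_def sum_distrib_left mult.assoc)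
qed

text \<open>Trigonometric tests give the condition on each single mode; conversely Parseval's
  identity sums it against an arbitrary test function.\<close>

lemma weak_div_free_iff: assumes w: "vL2 w" shows "weak_div_free L w <-> divfree (vft w)"
proof
 have wL: "(%x. w x $ j) : L2_torus L" for j using w by (simp add: vL2_def)
 {
  assume d: "weak_div_free L w"
  show "divfree (vft w)" unfolding divfree_def
  proof
  fix k
  have z: "(\<i> * wdot k (vft w k)) <.> z = 0" for z
  proof -
  have i: "integrable tm (%x. w x $ j * partial j (tt z k) x)" for j by (rule torus_parseval(1)[OF wL test_L2(2)[OF tt_test]])
  have "0 = torus_integral L (%x. \<Sum>j\<in>UNIV. w x $ j * partial j (tt z k) x)"
  using d tt_test by (simp add: weak_div_free_def)
  also have "... = (\<Sum>j\<in>UNIV. (LINT x|tm. w x $ j * partial j (tt z k) x))"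
  unfolding tint_tm by (rule bochner_sum) (rule i)
  also have "... = (\<Sum>j\<in>UNIV. L ^ 3 * (vft w k $ j <.> (iwv k j * z)))"
  unfolding partial_tt by (simp add: tt_integral[OF L2_imp_L1[OF wL]])
  also have "... = - (L ^ 3) * ((\<i> * wdot k (vft w k)) <.> z)" unfolding sum_distrib_left[symmetric] sum_inner_wave by simp
  finally show ?thesis using L3_pos by simp
  qed
  from z[of "\<i> * wdot k (vft w k)"] show "wdot k (vft w k) = 0" by simp
  qed
 next
  assume d: "divfree (vft w)"
  show "weak_div_free L w" unfolding weak_div_free_def
  proof
  fix ph assume ph: "ph : torus_test L"
  note t = test_L2[OF ph]
  have ic: "integrable cs (%k. ft (%x. w x $ j) k <.> ft (partial j ph) k)" for j
  by (rule integrable_cs_inner[OF ft_hsq0[OF wL] ft_hsq0[OF t(2)]])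
  have "torus_integral L (%x. \<Sum>j\<in>UNIV. w x $ j * partial j ph x) = (\<Sum>j\<in>UNIV. (LINT x|tm. w x $ j * partial j ph x))"
  unfolding tint_tm by (rule bochner_sum) (rule torus_parseval(1)[OF wL t(2)])
  also have "... = L ^ 3 * (\<Sum>j\<in>UNIV. (LINT k|cs. ft (%x. w x $ j) k <.> ft (partial j ph) k))"
  by (simp add: torus_parseval(2)[OF wL t(2)] sum_distrib_left)
  also have "(\<Sum>j\<in>UNIV. (LINT k|cs. ft (%x. w x $ j) k <.> ft (partial j ph) k))
  = (LINT k|cs. (\<Sum>j\<in>UNIV. vft w k $ j <.> (iwv k j * ft ph k)))"
  using ic by (subst bochner_sum[symmetric]) (auto simp: t(3))
  also have "... = 0" unfolding sum_inner_wave using d by (simp add: divfree_def)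
  finally show "torus_integral L (%x. \<Sum>j\<in>UNIV. w x $ j * partial j ph x) = 0" by simp
  qed
 }
qed

lemma ft_0: "ft f 0 = of_real ((LINT x|tm. f x) / L ^ 3)" by (simp add: ft_cf cf_def)

lemma vL2_integrable: "vL2 w ==> integrable tm w"
proof -
 assume w: "vL2 w"
 have "integrable tm (%x. w x $ i)" for i using w L2_imp_L1 by (simp add: vL2_def L1_torus_def si_tm)
 hence "integrable tm (%x. \<Sum>i\<in>UNIV. w x $ i *R (axis i 1 :: real^3))" by (intro bochnerI_sum integrable_scaleR_left)
 moreover have "(%x. \<Sum>i\<in>UNIV. w x $ i *R axis i 1) = w" by (auto simp: fun_eq_iff vec_eq_iff axis_def sum_3 forall_3)
 ultimately show "integrable tm w" by (simp only:)
qed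

lemma mean_iff: assumes w: "vL2 w" shows "torus_integral L w = 0 <-> vft w 0 = 0"
proof -
 have "(LINT x|tm. w x) $ i = (LINT x|tm. w x $ i)" for i
  using integral_bounded_linear[OF bounded_linear_vec_nth vL2_integrable[OF w], of i] by simp
 thus ?thesis using L_pos by (simp add: tint_tm vec_eq_iff ft_0)
qed

lemma Hsol_iff:
 "w : Hsol L (real s) <-> vL2 w & hsq s (vft w) < infy & divfree (vft w) & vft w 0 = 0"
proof -
 have "(\<forall>i. hsq s (ft (%x. w x $ i)) < infy) <-> hsq s (vft w) < infy"
  unfolding hsq_vec[of s "vft w"] by (simp add: sum_3 forall_3 less_top)
 hence "(\<forall>i. (%x. w x $ i) : sobolev L (real s)) <-> vL2 w & hsq s (vft w) < infy" by (auto simp: sobolev_iff vL2_def)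
 thus ?thesis using weak_div_free_iff mean_iff by (auto simp: Hsol_def)
qed

text \<open>The square of \<open>Hsol_norm\<close>: homogeneous weight, mode zero left out. For
  fields of mean zero it is equivalent to \<open>hsq\<close>, with constant
  \<open>Cp ^ s\<close>.\<close>

definition ksq :: "nat => (int^3 => complex^3) => ennreal" where
 "ksq s a = (SN k. ennreal (indicator (- {0}) k * (K k ^ (2 * s) * (norm (a k))^2)))"

lemma ksq_le_hsq: "ksq s a <= hsq s a" unfolding ksq_def hsq_def
proof (intro nn_integral_mono ennreal_leI)
 fix k
 have "K k ^ (2 * s) <= jap k ^ s" unfolding power_mult by (rule power_mono[OF K2_le_jap]) simp
 hence "K k ^ (2 * s) * (norm (a k))^2 <= jap k ^ s * (norm (a k))^2" by (rule mult_right_mono) simp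
 thus "indicator (- {0}) k * (K k ^ (2 * s) * (norm (a k))^2) <= jap k ^ s * (norm (a k))^2"
  using jap_pos[of k] by (auto simp: indicator_def)
qed

lemma hsq_le_ksq: assumes "a 0 = 0" shows "hsq s a <= ennreal (Cp ^ s) * ksq s a"
proof -
 have "jap k ^ s * (norm (a k))^2 <= Cp ^ s * (indicator (- {0}) k * (K k ^ (2 * s) * (norm (a k))^2))" for k
 proof (cases "k = 0")
  case False
  have "jap k ^ s <= (Cp * (K k)^2) ^ s" by (rule power_mono[OF jap_le_K2[OF False]]) (simp add: jap_pos less_imp_le)
  hence "jap k ^ s * (norm (a k))^2 <= (Cp * (K k)^2) ^ s * (norm (a k))^2" by (rule mult_right_mono) simp
  thus ?thesis using False by (simp add: power_mult_distrib power_mult[symmetric] mult_ac)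
 qed (use assms in simp)
 hence "hsq s a <= (SN k. ennreal (Cp ^ s) * ennreal (indicator (- {0}) k * (K k ^ (2 * s) * (norm (a k))^2)))"
  unfolding hsq_def using Cp_pos by (intro nn_integral_mono) (simp add: ennreal_mult'[symmetric] ennreal_leI)
 thus ?thesis by (simp add: nn_integral_cmult ksq_def)
qed

lemma Hsol_norm2: assumes "hsq s (vft w) < infy" shows "(Hsol_norm L (real s) w)^2 = enn2real (ksq s (vft w))"
proof -
 let ?g = "%k. indicator (- {0}) k * (K k ^ (2 * s) * (norm (vft w k))^2)"
 have g0: "0 <= ?g k" for k by simp
 have "ksq s (vft w) < infy" by (rule le_less_trans[OF ksq_le_hsq assms])
 hence i: "integrable cs ?g" unfolding ksq_def by (rule int_cs_nn[of ?g, OF g0, THEN iffD2])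
 have p: "norm (wave L k) powr (2 * real s) * (norm (\<chi> i. ft (%x. w x $ i) k))^2 = ?g k" if "k : UNIV - {0}" for k
 proof -
  have "norm (wave L k) powr (2 * real s) = K k ^ (2 * s)" using powr_realpow[of "K k" "2 * s"] K_pos[of k] that by simp
  thus ?thesis using that by (simp add: vft_def)
 qed
 have "(\<Sum>\<^sub>\<infinity>k\<in>UNIV - {0}. norm (wave L k) powr (2 * real s) * (norm (\<chi> i. ft (%x. w x $ i) k))^2) = (\<Sum>\<^sub>\<infinity>k\<in>UNIV - {0}. ?g k)"
  by (rule infsum_cong) (rule p)
 also have "... = (\<Sum>\<^sub>\<infinity>k. ?g k)" by (rule infsum_cong_neutral) auto
 also have "... = (LINT k|cs. ?g k)" by (rule integral_cs_eq_infsum[OF i, symmetric])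
 finally have e: "(\<Sum>\<^sub>\<infinity>k\<in>UNIV - {0}. norm (wave L k) powr (2 * real s) * (norm (\<chi> i. ft (%x. w x $ i) k))^2) = (LINT k|cs. ?g k)" .
 have n: "0 <= (LINT k|cs. ?g k)" by (rule bochner_nonneg) simp
 have "ksq s (vft w) = ennreal (LINT k|cs. ?g k)" unfolding ksq_def by (rule nn_integral_eq_integral[OF i]) simp
 thus ?thesis unfolding Hsol_norm_def e using n by simp
qed

end

section \<open>The MHD nonlinearity on Fourier coefficients\<close>

locale mhd = torus L for L :: real +
 fixes T nu mu a1 a2 :: real and N1 N2 :: nat
 assumes T_pos: "0 < T" and nu_pos: "0 < nu" and mu_pos: "0 < mu" and a1_pos: "0 < a1" and a2_pos: "0 < a2"
begin

abbreviation ae_time (binder "AET " 10) where "ae_time P \<equiv> AE t\<in>{0..T} in lborel. P t"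

text \<open>One Fourier mode of the pair of velocity and magnetic field; carrying both together
  turns the system into a single equation.\<close>

type_synonym mode = "(complex^3) \<times> (complex^3)"

text \<open>Division by zero being zero, this is the identity at \<open>k = 0\<close>.\<close>

definition leray :: "int^3 => complex^3 => complex^3" where
 "leray k v = (\<chi> i. v $ i - wdot k v * of_real (wave L k $ i) / of_real ((K k)^2))"

lemma wdot_add: "wdot k (v + w) = wdot k v + wdot k w" by (simp add: wdot_def distrib_left sum.distrib)
lemma wdot_diff: "wdot k (v - w) = wdot k v - wdot k w" by (simp add: wdot_def right_diff_distrib sum_subtractf)
lemma wdot_scaleR: "wdot k (r *R v) = of_real r * wdot k v" by (simp add: wdot_def sum_distrib_left scaleR_cx mult_ac)
lemma wdot_uminus: "wdot k (- v) = - wdot k v" by (simp add: wdot_def sum_negf)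

lemma leray_diff: "leray k (v - w) = leray k v - leray k w"
 by (simp add: leray_def vec_eq_iff wdot_diff left_diff_distrib diff_divide_distrib)
lemma leray_scaleR: "leray k (r *R v) = r *R leray k v"
proof -
 have "leray k (r *R v) $ i = (r *R leray k v) $ i" for i unfolding leray_def wdot_scaleR by (simp add: scaleR_cx algebra_simps)
 thus ?thesis by (simp add: vec_eq_iff)
qed

lemma sum_wave2: "(\<Sum>j\<in>UNIV. complex_of_real (wave L k $ j) * of_real (wave L k $ j)) = of_real ((K k)^2)"
proof -
 have "(\<Sum>j\<in>UNIV. (wave L k $ j) * (wave L k $ j)) = (K k)^2"
  by (simp add: norm_vec_def L2_set_def sum_nonneg power2_eq_square)
 thus ?thesis by (metis (no_types, lifting) of_real_mult of_real_sum sum.cong)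
qed

lemma wdot_leray: "wdot k (leray k v) = 0"
proof (cases "k = 0")
 case True thus ?thesis by (simp add: wdot_def)
next
 case False
 define c where "c = wdot k v / of_real ((K k)^2)"
 have "wdot k (leray k v) = (\<Sum>j\<in>UNIV. of_real (wave L k $ j) * (v $ j - c * of_real (wave L k $ j)))"
  unfolding wdot_def[of k "leray k v"] by (rule sum.cong) (simp_all add: leray_def c_def)
 also have "... = wdot k v - c * (\<Sum>j\<in>UNIV. complex_of_real (wave L k $ j) * of_real (wave L k $ j))"
  by (simp add: right_diff_distrib sum_subtractf sum_distrib_left wdot_def mult_ac)
 also have "... = 0" unfolding sum_wave2 using K_pos[OF False] by (simp add: c_def)
 finally show ?thesis .
qed

lemma sum_wave_inner: "(\<Sum>j\<in>UNIV. (c * of_real (wave L k $ j)) <.> (z $ j)) = c <.> wdot k z"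
proof -
 have "(c * of_real (wave L k $ j)) <.> (z $ j) = c <.> (of_real (wave L k $ j) * z $ j)" for j
  by (simp add: inner_complex_def algebra_simps)
 thus ?thesis by (simp add: wdot_def inner_sum_right)
qed

lemma leray_inner: assumes "wdot k z = 0" shows "leray k v <.> z = v <.> z"
proof -
 have "leray k v <.> z = (\<Sum>j\<in>UNIV. (v $ j) <.> (z $ j)) - (\<Sum>j\<in>UNIV. (wdot k v / of_real ((K k)^2) * of_real (wave L k $ j)) <.> (z $ j))"
  by (simp add: inner_vec_def leray_def inner_diff_left sum_subtractf)
 thus ?thesis unfolding sum_wave_inner assms by (simp add: inner_vec_def)
qed

lemma leray_norm: "norm (leray k v) <= norm v"
proof -
 have "(norm (leray k v))^2 = leray k v <.> leray k v" by (rule power2_norm_eq_inner)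
 also have "... = v <.> leray k v" by (rule leray_inner[OF wdot_leray])
 also have "... <= norm v * norm (leray k v)" by (rule norm_cauchy_schwarz)
 finally show ?thesis by (cases "norm (leray k v) = 0") (simp, simp add: power2_eq_square)
qed

lemma leray_0: "leray 0 v = v" by (simp add: leray_def vec_eq_iff)

lemma wdot_cnj: "(!!i. w $ i = cnj (v $ i)) ==> wdot (- k) w = - cnj (wdot k v)" by (simp add: wdot_def wave_minus sum_negf)

lemma leray_cnj: assumes "!!i. w $ i = cnj (v $ i)" shows "leray (- k) w $ i = cnj (leray k v $ i)"
 unfolding leray_def using wdot_cnj[OF assms, of k] by (simp add: assms wave_minus)

text \<open>Coefficients of the deconvolved velocity; \<open>Hc\<close> is the magnetic
  counterpart.\<close>

definition Wc :: "(int^3 => mode) => int^3 => complex^3" where "Wc u k = Dsym a1 N1 k *R fst (u k)"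
definition Hc :: "(int^3 => mode) => int^3 => complex^3" where "Hc u k = Dsym a2 N2 k *R snd (u k)"

text \<open>\<open>X1\<close> and \<open>X2\<close> are the filtered nonlinear terms as they stand
  on the left of the two equations, before any projection.\<close>

definition X1 :: "(int^3 => mode) => int^3 => complex^3" where
 "X1 u k = gsym a1 k *R (adv (Wc u) (Wc u) k - adv (Hc u) (Hc u) k)"
definition X2 :: "(int^3 => mode) => int^3 => complex^3" where
 "X2 u k = gsym a2 k *R (adv (Wc u) (Hc u) k - adv (Hc u) (Wc u) k)"

text \<open>The nonlinear terms moved to the right-hand side, hence the signs. Only the velocity
  part is projected: the magnetic part is solenoidal by itself, see \<open>wdot_X2\<close>.\<close>

definition NN :: "(int^3 => mode) => int^3 => mode" where
 "NN u k = (- leray k (X1 u k), - X2 u k)"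

text \<open>Real, solenoidal pairs of mean zero. The nonlinearity, Duhamel's formula and limits of
  single modes all stay in this class.\<close>

definition good :: "(int^3 => mode) => bool" where
 "good u <-> herm (%k. fst (u k)) & herm (%k. snd (u k)) & divfree (%k. fst (u k)) & divfree (%k. snd (u k)) & u 0 = 0"

lemma hsq_prod: "hsq s (u :: int^3 => 'a::real_normed_vector \<times> 'b::real_normed_vector) = hsq s (%k. fst (u k)) + hsq s (%k. snd (u k))"
proof -
 have "ennreal (jap k ^ s * (norm (u k))^2) = ennreal (jap k ^ s * (norm (fst (u k)))^2) + ennreal (jap k ^ s * (norm (snd (u k)))^2)" for k
  using jap_pos[of k] by (subst ennreal_plus[symmetric]) (auto simp: norm_prod_def algebra_simps less_imp_le)
 thus ?thesis unfolding hsq_def by (simp add: nn_integral_add)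
qed

lemma hsq_fst_le: "hsq s (%k. fst (u k)) <= hsq s (u :: int^3 => 'a::real_normed_vector \<times> 'b::real_normed_vector)"
 unfolding hsq_prod[of s u] by simp
lemma hsq_snd_le: "hsq s (%k. snd (u k)) <= hsq s (u :: int^3 => 'a::real_normed_vector \<times> 'b::real_normed_vector)"
 unfolding hsq_prod[of s u] by simp

lemma hsq_mono_scaled: assumes "!!k. norm (a k) <= c * norm (b k)" "0 <= c" shows "hsq s a <= ennreal (c^2) * hsq s b"
proof -
 have "hsq s a <= hsq s (%k. c *R b k)" by (rule hsq_mono_norm) (use assms in simp)
 thus ?thesis by (simp add: hsq_scaleR)
qed

definition ND :: real where "ND = real (Suc N1) + real (Suc N2)"

lemma ND_ge_1: "1 <= ND" by (simp add: ND_def)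

lemma Dsym_abs: "\<bar>Dsym a1 N1 k\<bar> <= ND" "\<bar>Dsym a2 N2 k\<bar> <= ND"
 using Dsym_ge_1[of a1 N1 k] Dsym_le[of a1 N1 k] Dsym_ge_1[of a2 N2 k] Dsym_le[of a2 N2 k] by (simp_all add: ND_def)

lemma hsq_W: "hsq s (Wc u) <= ennreal (ND^2) * hsq s u"
proof -
 have "hsq s (Wc u) <= ennreal (ND^2) * hsq s (%k. fst (u k))"
 proof (rule hsq_mono_scaled)
  show "norm (Wc u k) <= ND * norm (fst (u k))" for k unfolding Wc_def norm_scaleR by (rule mult_right_mono[OF Dsym_abs(1)]) simp
  show "0 <= ND" using ND_ge_1 by linarith
 qed
 also have "... <= ennreal (ND^2) * hsq s u" by (rule mult_lmono[OF hsq_fst_le]) simp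
 finally show ?thesis .
qed

lemma hsq_H: "hsq s (Hc u) <= ennreal (ND^2) * hsq s u"
proof -
 have "hsq s (Hc u) <= ennreal (ND^2) * hsq s (%k. snd (u k))"
 proof (rule hsq_mono_scaled)
  show "norm (Hc u k) <= ND * norm (snd (u k))" for k unfolding Hc_def norm_scaleR by (rule mult_right_mono[OF Dsym_abs(2)]) simp
  show "0 <= ND" using ND_ge_1 by linarith
 qed
 also have "... <= ennreal (ND^2) * hsq s u" by (rule mult_lmono[OF hsq_snd_le]) simp
 finally show ?thesis .
qed

lemma W_diff: "(%k. Wc u k - Wc v k) = Wc (%k. u k - v k)" by (simp add: Wc_def fun_eq_iff scaleR_diff_right)
lemma H_diff: "(%k. Hc u k - Hc v k) = Hc (%k. u k - v k)" by (simp add: Hc_def fun_eq_iff scaleR_diff_right)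

lemma adv_diff: assumes "hsq 0 a < infy" "hsq 0 a' < infy" "hsq 0 b < infy" "hsq 0 b' < infy"
 shows "adv a b k - adv a' b' k = adv (%k. a k - a' k) b k + adv a' (%k. b k - b' k) k"
proof -
 have f: "hsq 0 (%k. c k $ i) < infy" if "hsq 0 c < infy" for c :: "int^3 => complex^3" and i
  by (rule le_less_trans[OF hsq_comp_le that])
 have "conv (%k. b k $ i) (%k. a k $ j) k - conv (%k. b' k $ i) (%k. a' k $ j) k
  = conv (%k. b k $ i) (%k. a k $ j - a' k $ j) k + conv (%k. b k $ i - b' k $ i) (%k. a' k $ j) k" for i j
  using conv_diff_left[OF f f f, OF assms(3,4,2), of i i j k] conv_diff_right[OF f f f, OF assms(3,1,2), of i j j k] by simp
 thus ?thesis unfolding adv_def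
  by (simp add: vec_eq_iff sum_subtractf[symmetric] sum.distrib[symmetric] right_diff_distrib[symmetric] distrib_left[symmetric])
qed

definition CQ :: ennreal where "CQ = 2 * (ennreal ((Cg a1)^2) + ennreal ((Cg a2)^2)) * latS"

lemma CQ_finite: "CQ < infy" unfolding CQ_def using latS_finite by (simp add: mult_lt_top)

lemma Q_lip: assumes al: "al = a1 \<or> al = a2" and f: "hsq 1 a < infy" "hsq 1 a' < infy" "hsq 1 b < infy" "hsq 1 b' < infy"
 shows "hsq 1 (%k. gsym al k *R adv a b k - gsym al k *R adv a' b' k)
  <= CQ * (hsq 1 (%k. a k - a' k) * hsq 1 b + hsq 1 a' * hsq 1 (%k. b k - b' k))"
proof -
 have p: "al > 0" using al a1_pos a2_pos by auto
 have f0: "hsq 0 a < infy" "hsq 0 a' < infy" "hsq 0 b < infy" "hsq 0 b' < infy"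
  using f by (auto intro: le_less_trans[OF hsq_mono_s[of 0 1]])
 let ?c = "ennreal ((Cg al)^2) * latS"
 have "hsq 1 (%k. gsym al k *R adv a b k - gsym al k *R adv a' b' k)
  = hsq 1 (%k. gsym al k *R adv (%k. a k - a' k) b k + gsym al k *R adv a' (%k. b k - b' k) k)"
  using adv_diff[OF f0] by (simp add: scaleR_diff_right[symmetric] scaleR_add_right[symmetric])
 also have "... <= 2 * hsq 1 (%k. gsym al k *R adv (%k. a k - a' k) b k) + 2 * hsq 1 (%k. gsym al k *R adv a' (%k. b k - b' k) k)"
  by (rule hsq_add_le)
 also have "... <= 2 * (?c * (hsq 1 (%k. a k - a' k) * hsq 1 b)) + 2 * (?c * (hsq 1 a' * hsq 1 (%k. b k - b' k)))"
  using gsym_adv_bound[OF p] by (intro add_mono mult_lmono) (simp_all add: mult.assoc)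
 also have "... = 2 * ?c * (hsq 1 (%k. a k - a' k) * hsq 1 b + hsq 1 a' * hsq 1 (%k. b k - b' k))"
  by (simp add: distrib_left mult.assoc)
 also have "... <= CQ * (hsq 1 (%k. a k - a' k) * hsq 1 b + hsq 1 a' * hsq 1 (%k. b k - b' k))"
  unfolding CQ_def mult.assoc[symmetric] using al by (intro mult_right_mono mult_lmono) auto
 finally show ?thesis .
qed

text \<open>The \<open>8\<close> counts two components with two filtered terms each, every term
  doubled by \<open>(x + y)^2 <= 2 x^2 + 2 y^2\<close>. Each \<open>ND^2\<close> pays for one
  deconvolution.\<close>

definition CN :: ennreal where "CN = 8 * CQ * ennreal (ND^2) * ennreal (ND^2)"

lemma CN_finite: "CN < infy" unfolding CN_def using CQ_finite by (simp add: mult_lt_top)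

text \<open>Being quadratic, \<open>NN\<close> is bounded by a Lipschitz constant that grows with
  the norms; this growth is the reason for the cutoff.\<close>

lemma NN_lip: assumes u: "hsq 1 u < infy" and v: "hsq 1 v < infy"
 shows "hsq 1 (%k. NN u k - NN v k) <= CN * ((hsq 1 u + hsq 1 v) * hsq 1 (%k. u k - v k))"
proof -
 define d where "d = hsq 1 (%k. u k - v k)"
 define m where "m = ennreal (ND^2)"
 have m: "m < infy" by (simp add: m_def)
 have fW: "hsq 1 (Wc x) < infy" "hsq 1 (Hc x) < infy" if "hsq 1 x < infy" for x
  using le_less_trans[OF hsq_W] le_less_trans[OF hsq_H] that by (auto simp: mult_lt_top)
 have Q: "hsq 1 (%k. gsym al k *R adv (A u) (B u) k - gsym al k *R adv (A v) (B v) k) <= CQ * (m * m * ((hsq 1 u + hsq 1 v) * d))"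
  if al: "al = a1 \<or> al = a2" and A: "A = Wc \<or> A = Hc" and B: "B = Wc \<or> B = Hc" for al A B
 proof -
  have fA: "hsq 1 (A x) <= m * hsq 1 x" "(%k. A x k - A y k) = A (%k. x k - y k)" for x y
  using A hsq_W hsq_H W_diff H_diff unfolding m_def by blast+
  have fB: "hsq 1 (B x) <= m * hsq 1 x" "(%k. B x k - B y k) = B (%k. x k - y k)" for x y
  using B hsq_W hsq_H W_diff H_diff unfolding m_def by blast+
  have fin: "hsq 1 (A u) < infy" "hsq 1 (A v) < infy" "hsq 1 (B u) < infy" "hsq 1 (B v) < infy"
  using A B fW[OF u] fW[OF v] by auto
  have "hsq 1 (%k. gsym al k *R adv (A u) (B u) k - gsym al k *R adv (A v) (B v) k)
  <= CQ * (hsq 1 (A (%k. u k - v k)) * hsq 1 (B u) + hsq 1 (A v) * hsq 1 (B (%k. u k - v k)))"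
  using Q_lip[OF al fin] unfolding fA(2) fB(2) .
  also have "... <= CQ * ((m * d) * (m * hsq 1 u) + (m * hsq 1 v) * (m * d))"
  unfolding d_def by (intro mult_lmono add_mono mult_mono fA(1) fB(1)) auto
  also have "... = CQ * (m * m * ((hsq 1 u + hsq 1 v) * d))" by (simp add: distrib_left distrib_right mult_ac)
  finally show ?thesis .
 qed
 let ?q = "CQ * (m * m * ((hsq 1 u + hsq 1 v) * d))"
 have "hsq 1 (%k. X1 u k - X1 v k) <= 2 * ?q + 2 * ?q"
 proof -
  have "(%k. X1 u k - X1 v k) = (%k. (gsym a1 k *R adv (Wc u) (Wc u) k - gsym a1 k *R adv (Wc v) (Wc v) k)
  - (gsym a1 k *R adv (Hc u) (Hc u) k - gsym a1 k *R adv (Hc v) (Hc v) k))"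
  by (simp add: X1_def fun_eq_iff scaleR_diff_right algebra_simps)
  thus ?thesis by (simp only:) (rule order_trans[OF hsq_diff_le], intro add_mono mult_lmono Q; simp)
 qed
 hence 1: "hsq 1 (%k. - leray k (X1 u k) - - leray k (X1 v k)) <= 2 * ?q + 2 * ?q"
 proof (rule order_trans[rotated])
  show "hsq 1 (%k. - leray k (X1 u k) - - leray k (X1 v k)) <= hsq 1 (%k. X1 u k - X1 v k)"
  proof (rule hsq_mono_norm)
  fix k
  have "norm (- leray k (X1 u k) - - leray k (X1 v k)) = norm (leray k (X1 u k - X1 v k))"
  unfolding leray_diff by (simp add: norm_minus_commute)
  thus "norm (- leray k (X1 u k) - - leray k (X1 v k)) <= norm (X1 u k - X1 v k)" using leray_norm by simp
  qed
 qed
 have 2: "hsq 1 (%k. - X2 u k - - X2 v k) <= 2 * ?q + 2 * ?q"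
 proof -
  have "(%k. - X2 u k - - X2 v k) = (%k. (gsym a2 k *R adv (Hc u) (Wc u) k - gsym a2 k *R adv (Hc v) (Wc v) k)
  - (gsym a2 k *R adv (Wc u) (Hc u) k - gsym a2 k *R adv (Wc v) (Hc v) k))"
  by (simp add: X2_def fun_eq_iff scaleR_diff_right algebra_simps)
  thus ?thesis by (simp only:) (rule order_trans[OF hsq_diff_le], intro add_mono mult_lmono Q; simp)
 qed
 have "hsq 1 (%k. NN u k - NN v k) = hsq 1 (%k. - leray k (X1 u k) - - leray k (X1 v k)) + hsq 1 (%k. - X2 u k - - X2 v k)"
  by (subst hsq_prod) (simp add: NN_def)
 also have "... <= (2 * ?q + 2 * ?q) + (2 * ?q + 2 * ?q)" by (rule add_mono[OF 1 2])
 also have "... = (2 + 2 + 2 + 2) * ?q" by (simp only: distrib_right add.assoc)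
 also have "... = CN * ((hsq 1 u + hsq 1 v) * hsq 1 (%k. u k - v k))" by (simp add: CN_def m_def d_def mult_ac)
 finally show ?thesis .
qed

lemma conv_0: "conv (%k. 0) b k = 0" "conv a (%k. 0) k = 0" by (simp_all add: conv_def)

lemma NN_0: "NN (%k. 0) k = 0"
 by (simp add: NN_def X1_def X2_def Wc_def Hc_def adv_def conv_0 leray_def wdot_def zero_prod_def vec_eq_iff)

lemma hsq_zero: "hsq s (%k. 0) = 0" by (simp add: hsq_def)

lemma NN_bound: assumes "hsq 1 u < infy" shows "hsq 1 (NN u) <= CN * (hsq 1 u * hsq 1 u)"
 using NN_lip[OF assms, of "%k. 0"] by (simp add: NN_0 hsq_zero)

lemma good_WH: assumes "good u" shows "herm (Wc u)" "divfree (Wc u)" "herm (Hc u)" "divfree (Hc u)" "Wc u 0 = 0" "Hc u 0 = 0"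
 using assms by (auto simp: good_def herm_def divfree_def Wc_def Hc_def wdot_scaleR scaleR_cx)

lemma adv_mode_0: "adv a b 0 = 0" by (simp add: adv_def vec_eq_iff)

text \<open>The double contraction with \<open>k\<close> is symmetric and convolution is
  commutative, so both advection terms have the same divergence. This is why the induction equation
  carries no pressure.\<close>

lemma wdot_X2: assumes "good u" shows "wdot k (X2 u k) = 0"
proof -
 have c: "conv a b k = conv b a k" for a b
  unfolding conv_def using integral_bij_count_space[OF bij_minus_left, of "%j. a j * b (k - j)" k] by (simp add: mult.commute)
 have e: "wdot k (adv a b k) = (\<Sum>i\<in>UNIV. \<Sum>j\<in>UNIV. iwv k i * of_real (wave L k $ j) * conv (%k. b k $ i) (%k. a k $ j) k)" for a b
  unfolding wdot_def adv_def vec_lambda_beta sum_distrib_left by (intro sum.cong refl) (simp only: mult_ac)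
 have "wdot k (adv (Wc u) (Hc u) k) = wdot k (adv (Hc u) (Wc u) k)"
  unfolding e by (subst sum.swap, intro sum.cong refl) (subst c, simp only: mult_ac)
 thus ?thesis by (simp add: X2_def wdot_scaleR wdot_diff)
qed

lemma NN_good: assumes "good u" shows "good (NN u)"
proof -
 note g = good_WH[OF assms]
 have X: "herm (X1 u)" "herm (X2 u)"
  using adv_herm[OF g(1) g(1)] adv_herm[OF g(3) g(3)] adv_herm[OF g(1) g(3)] adv_herm[OF g(3) g(1)]
  by (auto simp: herm_def X1_def X2_def scaleR_cx)
 have "herm (%k. leray k (X1 u k))" unfolding herm_def by (intro allI leray_cnj) (use X in \<open>simp add: herm_def\<close>)
 hence h: "herm (%k. fst (NN u k))" "herm (%k. snd (NN u k))" using X by (auto simp: NN_def herm_def)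
 have d: "divfree (%k. fst (NN u k))" "divfree (%k. snd (NN u k))"
  using wdot_X2[OF assms] by (auto simp: NN_def divfree_def wdot_uminus wdot_leray)
 have "NN u 0 = 0" by (simp add: NN_def X1_def X2_def adv_mode_0 leray_0 zero_prod_def)
 thus ?thesis using h d by (simp add: good_def)
qed

text \<open>The symbol of the operator \<open>A_1 D_1\<close>, since \<open>gsym\<close> is the
  symbol of the inverse of \<open>A_1\<close>.\<close>

definition m1 :: "int^3 => real" where "m1 k = Dsym a1 N1 k / gsym a1 k"
definition m2 :: "int^3 => real" where "m2 k = Dsym a2 N2 k / gsym a2 k"

definition Mw :: "int^3 => mode => mode" where "Mw k z = (m1 k *R fst z, m2 k *R snd z)"

lemma m_gsym: "m1 k * gsym a1 k = Dsym a1 N1 k" "m2 k * gsym a2 k = Dsym a2 N2 k"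
 using gsym_pos[of a1 k] gsym_pos[of a2 k] by (simp_all add: m1_def m2_def)

text \<open>The nonlinear terms cancel in the energy balance of \<open>(A\<^sub>1 D\<^sub>1 w, w) + (A\<^sub>2 D\<^sub>2 b, b)\<close>.\<close>

lemma energy_cancel: assumes g: "good u" and f: "hsq 1 u < infy"
 shows "integrable cs (%k. Mw k (u k) <.> NN u k)" "(LINT k|cs. Mw k (u k) <.> NN u k) = 0"
proof -
 note wh = good_WH[OF g]
 have fW: "hsq 1 (Wc u) < infy" "hsq 1 (Hc u) < infy"
  using le_less_trans[OF hsq_W] le_less_trans[OF hsq_H] f by (auto simp: mult_lt_top)
 let ?W = "Wc u" and ?H = "Hc u"
 note s = adv_inner_integrable_and_skew
 \<comment> \<open>The multiplier undoes the filter and leaves \<open>Wc\<close> and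
   \<open>Hc\<close> as test functions; the projection disappears because the velocity is
   solenoidal.\<close>
 have e: "Mw k (u k) <.> NN u k = - (adv ?W ?W k <.> ?W k) + adv ?H ?H k <.> ?W k - adv ?W ?H k <.> ?H k + adv ?H ?W k <.> ?H k" for k
 proof -
  have dW: "wdot k (fst (u k)) = 0" using g by (simp add: good_def divfree_def)
  have "Mw k (u k) <.> NN u k = - (m1 k * (leray k (X1 u k) <.> fst (u k))) - m2 k * (X2 u k <.> snd (u k))"
  by (simp add: Mw_def NN_def inner_prod_def inner_commute)
  also have "leray k (X1 u k) <.> fst (u k) = gsym a1 k * ((adv ?W ?W k - adv ?H ?H k) <.> fst (u k))"
  unfolding leray_inner[OF dW] by (simp add: X1_def)
  also have "m1 k * (gsym a1 k * ((adv ?W ?W k - adv ?H ?H k) <.> fst (u k))) = (adv ?W ?W k - adv ?H ?H k) <.> ?W k"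
  unfolding mult.assoc[symmetric] m_gsym by (simp add: Wc_def)
  also have "m2 k * (X2 u k <.> snd (u k)) = (adv ?W ?H k - adv ?H ?W k) <.> ?H k"
  unfolding X2_def inner_scaleR_left mult.assoc[symmetric] m_gsym by (simp add: Hc_def)
  finally show ?thesis by (simp add: inner_diff_left)
 qed
 have i: "integrable cs (%k. adv ?W ?W k <.> ?W k)" "integrable cs (%k. adv ?H ?H k <.> ?W k)"
  "integrable cs (%k. adv ?W ?H k <.> ?H k)" "integrable cs (%k. adv ?H ?W k <.> ?H k)" by (intro s(1) fW wh)+
 show "integrable cs (%k. Mw k (u k) <.> NN u k)" unfolding e using i by (intro bochnerI_add bochnerI_diff integrable_minus)
 \<comment> \<open>Skew-symmetry makes a term vanish when the advected field is also the test field;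
   it makes the remaining two, which exchange velocity and magnetic field, opposite to each
   other.\<close>
 have z: "(LINT k|cs. adv ?W ?W k <.> ?W k) = 0" "(LINT k|cs. adv ?W ?H k <.> ?H k) = 0"
  using s(2)[OF fW(1) wh(1,2) fW(1) fW(1)] s(2)[OF fW(1) wh(1,2) fW(2) fW(2)] by simp_all
 have c: "(LINT k|cs. adv ?H ?H k <.> ?W k) = - (LINT k|cs. adv ?H ?W k <.> ?H k)" by (rule s(2)[OF fW(2) wh(3,4) fW(2) fW(1)])
 show "(LINT k|cs. Mw k (u k) <.> NN u k) = 0" unfolding e using i z c by simp
qed

section \<open>The radial cutoff in h^1\<close>

definition hn :: "(int^3 => 'v::real_normed_vector) => real" where "hn u = sqrt (enn2real (hsq 1 u))"

lemma hn2: "(hn u)^2 = enn2real (hsq 1 u)" by (simp add: hn_def)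

lemma hn_nonneg: "0 <= hn u" by (simp add: hn_def)

lemma hsq_hn: "hsq 1 u < infy ==> hsq 1 u = ennreal ((hn u)^2)" by (simp add: hn_def)

lemma hn_le: assumes "0 <= r" "hsq 1 u <= ennreal (r^2)" shows "hn u <= r"
proof -
 have "enn2real (hsq 1 u) <= r^2" using assms by (simp add: enn2real_leI)
 thus ?thesis unfolding hn_def using assms(1) by (rule real_le_lsqrt[rotated])
qed

lemma hsq_le_finite_sums: assumes "!!F. finite F ==> (\<Sum>k\<in>F. jap k ^ s * (norm (a k))^2) <= B"
 shows "hsq s a <= ennreal B"
proof -
 have n: "0 <= jap k ^ s * (norm (a k))^2" for k using jap_pos[of k] by simp
 have i: "integrable cs (%k. jap k ^ s * (norm (a k))^2)" "(LINT k|cs. jap k ^ s * (norm (a k))^2) <= B"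
  by (rule integrable_csI, rule n, erule assms)+
 have "hsq s a = ennreal (LINT k|cs. jap k ^ s * (norm (a k))^2)"
  unfolding hsq_def by (rule nn_integral_eq_integral[OF i(1)], rule AE_I2, rule n)
 thus ?thesis using i(2) by (simp add: ennreal_leI)
qed

lemma hsq_sum_le: assumes "hsq 1 a < infy" "finite F" shows "(\<Sum>k\<in>F. jap k * (norm (a k))^2) <= (hn a)^2"
proof -
 have n: "0 <= jap k * (norm (a k))^2" for k using jap_pos[of k] by simp
 have "(\<Sum>k\<in>F. jap k * (norm (a k))^2) <= (LINT k|cs. jap k * (norm (a k))^2)"
  by (rule sum_le_integral_cs) (use hsq_0_integrable[OF assms(1)] n assms in auto)
 thus ?thesis unfolding hn2 enn2real_hsq[OF assms(1)] by simp
qed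

lemma hn_triangle: assumes a: "hsq 1 a < infy" and b: "hsq 1 b < infy" shows "hn (%k. a k + b k) <= hn a + hn b"
proof (rule hn_le)
 show "0 <= hn a + hn b" using hn_nonneg[of a] hn_nonneg[of b] by simp
 show "hsq 1 (%k. a k + b k) <= ennreal ((hn a + hn b)^2)"
 proof (rule hsq_le_finite_sums)
  fix F :: "(int^3) set" assume F: "finite F"
  have s: "sqrt (\<Sum>k\<in>F. jap k * (norm (c k))^2) <= hn c" if "hsq 1 c < infy" for c :: "int^3 => 'v::real_normed_vector"
  by (rule real_le_lsqrt[OF _ hsq_sum_le[OF that F]]) (rule hn_nonneg)
  have L: "sqrt (\<Sum>k\<in>F. jap k * (norm (c k))^2) = L2_set (%k. sqrt (jap k) * norm (c k)) F" for c :: "int^3 => 'v::real_normed_vector"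
  using jap_pos by (simp add: L2_set_def power_mult_distrib less_imp_le)
  have "sqrt (\<Sum>k\<in>F. jap k * (norm (a k + b k))^2) <= L2_set (%k. sqrt (jap k) * norm (a k) + sqrt (jap k) * norm (b k)) F"
  unfolding L using jap_pos
  by (intro L2_set_mono) (auto simp: distrib_left[symmetric] less_imp_le intro!: mult_lmono norm_triangle_ineq)
  also have "... <= L2_set (%k. sqrt (jap k) * norm (a k)) F + L2_set (%k. sqrt (jap k) * norm (b k)) F"
  by (rule L2_set_triangle_ineq)
  also have "... <= hn a + hn b" unfolding L[symmetric] by (rule add_mono[OF s[OF a] s[OF b]])
  finally have "sqrt (\<Sum>k\<in>F. jap k * (norm (a k + b k))^2) <= hn a + hn b" .
  thus "(\<Sum>k\<in>F. jap k ^ 1 * (norm (a k + b k))^2) <= (hn a + hn b)^2" using sqrt_le_D by simp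
 qed
qed

lemma hn_scaleR: "hsq 1 a < infy ==> hn (%k. c *R a k) = \<bar>c\<bar> * hn a"
 unfolding hn_def hsq_scaleR by (simp add: enn2real_mult real_sqrt_mult)

lemma hn_minus_commute: "hn (%k. a k - b k) = hn (%k. b k - a k)" unfolding hn_def by (subst hsq_minus_commute) (rule refl)

lemma hsq_diff_finite: "hsq s a < infy ==> hsq s b < infy ==> hsq s (%k. a k - b k) < infy"
 by (rule le_less_trans[OF hsq_diff_le]) (simp add: mult_lt_top)

text \<open>The factor of the radial retraction onto the ball of radius \<open>R\<close>. Being a
  real scalar, it commutes with the energy multiplier and preserves reality, solenoidality and zero
  mean.\<close>

definition lam :: "real => (int^3 => mode) => real" where "lam R u = (if hn u <= R then 1 else R / hn u)"

definition PP :: "real => (int^3 => mode) => int^3 => mode" where "PP R u k = lam R u *R u k"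

lemma lam_bounds: assumes "R > 0" shows "0 < lam R u" "lam R u <= 1" "lam R u * hn u <= R"
 using assms hn_nonneg[of u] by (auto simp: lam_def field_simps)

lemma PP_finite: "hsq 1 u < infy ==> hsq 1 (PP R u) < infy" unfolding PP_def[abs_def] hsq_scaleR by (simp add: mult_lt_top)

lemma PP_bound: assumes "R > 0" "hsq 1 u < infy" shows "hsq 1 (PP R u) <= ennreal (R^2)"
proof -
 have "hn (PP R u) = lam R u * hn u" unfolding PP_def[abs_def] using hn_scaleR[OF assms(2)] lam_bounds[OF assms(1), of u] by simp
 also have "... <= R" by (rule lam_bounds[OF assms(1)])
 finally have "(hn (PP R u))^2 <= R^2" by (intro power_mono hn_nonneg)
 thus ?thesis unfolding hsq_hn[OF PP_finite[OF assms(2)]] by (rule ennreal_leI)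
qed

text \<open>For \<open>hn v <= hn u\<close> the difference is
  \<open>lam u (u - v) + (lam u - lam v) v\<close>, and the second term has norm at most
  \<open>hn u - hn v\<close>. So the retraction is 2-Lipschitz in \<open>hn\<close>, and the
  \<open>4\<close> appears on squaring.\<close>

lemma PP_lip: assumes R: "R > 0" and u: "hsq 1 u < infy" and v: "hsq 1 v < infy"
 shows "hsq 1 (%k. PP R u k - PP R v k) <= 4 * hsq 1 (%k. u k - v k)"
proof -
 have key: "hn (%k. PP R u k - PP R v k) <= 2 * hn (%k. u k - v k)"
  if u: "hsq 1 u < infy" and v: "hsq 1 v < infy" and uv: "hn v <= hn u" for u v
 proof -
  have d: "hsq 1 (%k. u k - v k) < infy" by (rule hsq_diff_finite[OF u v])
  have tri: "hn u <= hn (%k. u k - v k) + hn v" using hn_triangle[OF d v] by simp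
  have "(%k. PP R u k - PP R v k) = (%k. lam R u *R (u k - v k) + (lam R u - lam R v) *R v k)"
  by (simp add: PP_def fun_eq_iff algebra_simps)
  hence "hn (%k. PP R u k - PP R v k) <= hn (%k. lam R u *R (u k - v k)) + hn (%k. (lam R u - lam R v) *R v k)"
  using d v by (simp only:) (rule hn_triangle; simp add: hsq_scaleR mult_lt_top)
  also have "... = lam R u * hn (%k. u k - v k) + \<bar>lam R u - lam R v\<bar> * hn v"
  using hn_scaleR[OF d] hn_scaleR[OF v] lam_bounds[OF R, of u] by simp
  also have "lam R u * hn (%k. u k - v k) <= 1 * hn (%k. u k - v k)" by (intro mult_right_mono lam_bounds R hn_nonneg)
  also have "\<bar>lam R u - lam R v\<bar> * hn v <= hn u - hn v"
  proof -
  consider "hn u <= R" | "hn v <= R" "R < hn u" | "R < hn v" using uv by linarith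
  thus ?thesis
  proof cases
  case 1 thus ?thesis using uv by (simp add: lam_def)
  next
  case 2
  have "\<bar>lam R u - lam R v\<bar> = 1 - R / hn u" using 2 R by (simp add: lam_def)
  moreover have "(1 - R / hn u) * hn v <= (1 - R / hn u) * hn u" using 2 R uv by (intro mult_lmono) auto
  moreover have "(1 - R / hn u) * hn u = hn u - R" using 2 R by (simp add: field_simps)
  ultimately have "\<bar>lam R u - lam R v\<bar> * hn v <= hn u - R" by simp
  moreover have "(1 - R / hn u) * hn v <= (1 - hn v / hn u) * hn u"
  proof -
  have "(1 - R / hn u) * hn v <= (1 - hn v / hn u) * hn v"
  using 2 R hn_nonneg[of v] by (intro mult_right_mono) (auto simp: divide_right_mono)
  also have "... <= (1 - hn v / hn u) * hn u" using 2 R uv by (intro mult_lmono) auto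
  finally show ?thesis .
  qed
  ultimately show ?thesis using 2 R \<open>\<bar>lam R u - lam R v\<bar> = 1 - R / hn u\<close> by (simp add: left_diff_distrib)
  next
  case 3
  have "R / hn u <= R / hn v" using 3 uv R by (intro divide_left_mono) auto
  hence "\<bar>lam R u - lam R v\<bar> * hn v = (R / hn v - R / hn u) * hn v" using 3 uv by (simp add: lam_def)
  also have "... = R * (hn u - hn v) / hn u" using 3 uv R by (simp add: field_simps)
  also have "... <= hn u * (hn u - hn v) / hn u" using 3 uv R by (intro divide_right_mono mult_right_mono) auto
  also have "... = hn u - hn v" using 3 uv R by simp
  finally show ?thesis .
  qed
  qed
  finally show ?thesis using tri by simp
 qed
 have "hn (%k. PP R u k - PP R v k) <= 2 * hn (%k. u k - v k)"
 proof (cases "hn v <= hn u")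
  case True thus ?thesis by (rule key[OF u v])
 next
  case False
  hence "hn (%k. PP R v k - PP R u k) <= 2 * hn (%k. v k - u k)" using key[OF v u] by simp
  thus ?thesis unfolding hn_minus_commute[of v u] hn_minus_commute[of "PP R v"] .
 qed
 hence "(hn (%k. PP R u k - PP R v k))^2 <= (2 * hn (%k. u k - v k))^2" by (intro power_mono hn_nonneg)
 hence "ennreal ((hn (%k. PP R u k - PP R v k))^2) <= ennreal (4 * (hn (%k. u k - v k))^2)"
  by (intro ennreal_leI) (simp add: power_mult_distrib)
 thus ?thesis using hsq_hn[OF hsq_diff_finite[OF PP_finite[OF u] PP_finite[OF v]]] hsq_hn[OF hsq_diff_finite[OF u v]]
  by (simp add: ennreal_mult')
qed

lemma good_scaleR: "good u ==> good (%k. c *R u k)" by (simp add: good_def herm_def divfree_def wdot_scaleR scaleR_cx)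

lemma good_PP: "good u ==> good (PP R u)" unfolding PP_def[abs_def] by (rule good_scaleR)

text \<open>The cut-off field is a positive multiple of \<open>u\<close>, so testing with
  \<open>Mw\<close> of \<open>u\<close> instead of \<open>Mw\<close> of the cut-off field only
  divides by \<open>lam R u\<close>.\<close>

lemma energy_cancel_PP: assumes R: "R > 0" and g: "good u" and f: "hsq 1 u < infy"
 shows "(LINT k|cs. Mw k (u k) <.> NN (PP R u) k) = 0"
proof -
 have "Mw k (PP R u k) = lam R u *R Mw k (u k)" for k by (simp add: Mw_def PP_def)
 hence "lam R u * (LINT k|cs. Mw k (u k) <.> NN (PP R u) k) = 0"
  using energy_cancel(2)[OF good_PP[OF g, of R] PP_finite[OF f, of R]] by simp
 thus ?thesis using lam_bounds(1)[OF R, of u] by simp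
qed

section \<open>Measurability of the coefficients in time\<close>

lemma cs_joint:
 fixes f :: "'t => 'i::countable => 'b" assumes "!!k. (%t. f t k) : measurable M N"
 shows "(%(t,k). f t k) : measurable (M <*M> count_space UNIV) N"
proof -
 have "(%z. f (fst z) k) : measurable (M <*M> count_space UNIV) N" for k by (rule m_comp[OF measurable_fst assms])
 from measurable_compose_countable[OF this measurable_snd] show ?thesis by (simp add: split_beta')
qed

lemma hsq_measurable:
 fixes a :: "'t => int^3 => 'v::{real_normed_vector,second_countable_topology}" assumes [measurable]: "!!k. (%t. a t k) : BMs M"
 shows "(%t. hsq s (a t)) : BMs M" unfolding hsq_def
 by (rule sigma_finite_measure.borel_measurable_nn_integral[OF sigma_finite_measure_count_space])
  (rule cs_joint, measurable)

lemma conv_measurable: assumes [measurable]: "!!k. (%t. a t k) : BMs M" "!!k. (%t. b t k) : BMs M"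
 shows "(%t. conv (a t) (b t) k) : BMs M" unfolding conv_def by (rule bm_cs_integral)
  (rule cs_joint, measurable)

lemma vec3_measurable:
 fixes f :: "'t => 'v::euclidean_space^3" assumes "!!i. (%t. f t $ i) : BMs M" shows "f : BMs M"
proof -
 have c: "continuous_on UNIV (%x. axis i x :: 'v^3)" for i unfolding axis_def
 proof (rule continuous_on_vec_lambda)
  fix j show "continuous_on UNIV (%x::'v. if j = i then x else 0)" by (cases "j = i") auto
 qed
 have "(%t. \<Sum>i\<in>UNIV. axis i (f t $ i)) : BMs M" by (intro borel_measurable_sum m_comp[OF assms bm_cont[OF c]])
 moreover have "(%t. \<Sum>i\<in>UNIV. axis i (f t $ i)) = f" by (auto simp: fun_eq_iff vec_eq_iff axis_def sum_3 forall_3)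
 ultimately show ?thesis by simp
qed

lemma adv_measurable: assumes "!!k. (%t. a t k) : BMs M" "!!k. (%t. b t k) : BMs M" shows "(%t. adv (a t) (b t) k) : BMs M"
proof (rule vec3_measurable)
 fix i
 have "(%t. c t k $ i) : BMs M" if "!!k. (%t. c t k) : BMs M" for c :: "'a => int^3 => complex^3" and k i
  by (rule m_comp[OF that bm_nth])
 thus "(%t. adv (a t) (b t) k $ i) : BMs M"
  unfolding adv_def vec_lambda_beta using assms by (intro borel_measurable_sum borel_measurable_times conv_measurable) auto
qed

lemma leray_measurable [measurable]: "leray k : BM"
proof (rule bm_cont)
 have "linear (leray k)"
 proof (rule linearI)
  show "leray k (a + b) = leray k a + leray k b" for a b
  by (simp add: leray_def vec_eq_iff wdot_add distrib_right add_divide_distrib)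
 qed (rule leray_scaleR)
 thus "continuous_on UNIV (leray k)" by (rule linear_continuous_on[OF linear_conv_bounded_linear[THEN iffD1]])
qed

lemma fst_snd_measurable:
 fixes u :: "'t => 'a::euclidean_space \<times> 'b::euclidean_space" assumes "u : BMs M"
 shows "(%t. fst (u t)) : BMs M" "(%t. snd (u t)) : BMs M" by (rule m_comp[OF assms bm_cont], intro continuous_intros)+

lemma NN_measurable: assumes "!!k. (%t. u t k) : BMs M" shows "(%t. NN (u t) k) : BMs M"
proof -
 have W: "(%t. Wc (u t) k) : BMs M" "(%t. Hc (u t) k) : BMs M" for k
  unfolding Wc_def Hc_def using fst_snd_measurable[OF assms] by (auto intro: borel_measurable_scaleR)
 have "(%t. X1 (u t) k) : BMs M" "(%t. X2 (u t) k) : BMs M"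
  unfolding X1_def X2_def by (intro borel_measurable_scaleR borel_measurable_diff adv_measurable W borel_measurable_const)+
 thus ?thesis unfolding NN_def by (intro borel_measurable_Pair borel_measurable_uminus m_comp[OF _ leray_measurable])
qed

lemma PP_measurable: assumes "!!k. (%t. u t k) : BMs M" shows "(%t. PP R (u t) k) : BMs M"
proof -
 have [measurable]: "(%t. hn (u t)) : BMs M" unfolding hn_def using hsq_measurable[of u M 1, OF assms] by measurable
 have "(%t. lam R (u t)) : BMs M" unfolding lam_def by measurable
 thus ?thesis unfolding PP_def using assms by (intro borel_measurable_scaleR)
qed

end

section \<open>Duhamel integrals and Gronwall's lemma\<close>

lemma integral_pair:
 fixes f :: "'t => 'a::{banach,second_countable_topology}" and g :: "'t => 'b::{banach,second_countable_topology}"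
 assumes f: "integrable M f" and g: "integrable M g"
 shows "integrable M (%x. (f x, g x))" "(LINT x|M. (f x, g x)) = ((LINT x|M. f x), (LINT x|M. g x))"
proof -
 have l: "bounded_linear (%x::'a. (x, 0::'b))" "bounded_linear (%y::'b. (0::'a, y))"
  by (intro bounded_linear_Pair bounded_linear_ident bounded_linear_zero)+
 have e: "(%x. (f x, g x)) = (%x. (f x, 0) + (0, g x))" by auto
 have i: "integrable M (%x. (f x, 0::'b))" "integrable M (%x. (0::'a, g x))"
  using integrable_bounded_linear[OF l(1) f] integrable_bounded_linear[OF l(2) g] by auto
 show "integrable M (%x. (f x, g x))" unfolding e using i by (rule bochnerI_add)
 show "(LINT x|M. (f x, g x)) = ((LINT x|M. f x), (LINT x|M. g x))" unfolding e bochner_add[OF i]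
  using integral_bounded_linear[OF l(1) f] integral_bounded_linear[OF l(2) g] by simp
qed

lemma continuous_indefinite_integral:
 fixes h :: "real => 'a::euclidean_space" assumes h: "SI {0..T} h" shows "continuous_on {0..T} (%t. LBINT s:{0..t}. h s)"
proof -
 have "continuous_on {0..T} (%x. integral {0..x} h)"
  by (rule indefinite_integral_continuous_1[OF set_borel_integral_eq_integral(1)[OF h]])
 moreover have "integral {0..x} h = (LBINT s:{0..x}. h s)" if "x : {0..T}" for x
  using set_borel_integral_eq_integral(2)[of "{0..x}" h] si_subset[OF h, of "{0..x}"] that by auto
 ultimately show ?thesis by (metis (no_types, lifting) continuous_on_eq)
qed

lemma duhamel_bounded_linear: assumes f: "bounded_linear f" and N: "SI {0..t} N"
 shows "f (duhamel ka c0 N t) = duhamel ka (f c0) (%s. f (N s)) t"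
proof -
 interpret bounded_linear f by (rule f)
 have "SI {0..t} (%s. exp (ka * s) *R N s)"
 proof (rule si_scaleR[OF N, where C="exp (\<bar>ka\<bar> * t)"])
  fix x assume "x : {0..t}"
  hence "ka * x <= \<bar>ka\<bar> * t" by (intro mult_mono) auto
  thus "\<bar>exp (ka * x)\<bar> <= exp (\<bar>ka\<bar> * t)" by simp
 qed auto
 hence i: "integrable lborel (%s. indicator {0..t} s *R exp (ka * s) *R N s)" by (simp add: si_def)
 show ?thesis unfolding duhamel_def sli_def scaleR add using integral_bounded_linear[OF f i] by (simp add: scaleR)
qed

lemma nn_exp_integral: assumes "0 < l" "0 <= A" "0 <= t"
 shows "(NI {0..t} (%s. ennreal (A * exp (l * s)))) <= ennreal (A * exp (l * t) / l)"
proof -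
 have "(NI {0..t} (%s. ennreal (A * exp (l * s)))) = ennreal (A * exp (l * t) / l - A * exp (l * 0) / l)"
  by (rule nn_integral_FTC_Icc) (use assms in \<open>auto intro!: derivative_eq_intros\<close>)
 also have "... <= ennreal (A * exp (l * t) / l)" using assms by (intro ennreal_leI) simp
 finally show ?thesis .
qed

lemma two_ennreal: "0 <= x ==> 0 <= y ==> 2 * ennreal x + 2 * ennreal y = ennreal (2 * x + 2 * y)"
 by (simp add: ennreal_plus ennreal_mult')

text \<open>Against the weight \<open>exp (4 * C * t)\<close> each application of the integral
  inequality gains a factor \<open>1/4\<close>, uniformly on \<open>[0, T]\<close> and without any
  smallness of \<open>T\<close>. The same step drives uniqueness and the Picard iteration.\<close>

lemma gronwall_step:
 fixes T C A t :: real and D E :: "real => ennreal" assumes D: "!!t. t : {0..T} ==> D t <= ennreal C * (NI {0..t} (%s. E s))"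
  and E: "!!s. s : {0..T} ==> E s <= ennreal (A * exp (4 * C * s))" and C: "0 < C" "0 <= A" and t: "t : {0..T}"
 shows "D t <= ennreal (A / 4 * exp (4 * C * t))"
proof -
 have "(NI {0..t} (%s. E s)) <= (NI {0..t} (%s. ennreal (A * exp (4 * C * s))))"
  by (intro nn_integral_mono) (use E t in \<open>auto simp: indicator_def\<close>)
 also have "... <= ennreal (A * exp (4 * C * t) / (4 * C))" by (rule nn_exp_integral) (use C t in auto)
 finally have "ennreal C * (NI {0..t} (%s. E s)) <= ennreal C * ennreal (A * exp (4 * C * t) / (4 * C))" by (rule mult_lmono) simp
 also have "... = ennreal (C * (A * exp (4 * C * t) / (4 * C)))" using C by (intro ennreal_mult[symmetric]) auto
 also have "C * (A * exp (4 * C * t) / (4 * C)) = A / 4 * exp (4 * C * t)" using C by simp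
 finally show ?thesis using D[OF t] by (rule order_trans[rotated])
qed

text \<open>Iterating \<open>gronwall_step\<close> from the crude bound on \<open>D\<close> gives a
  bound of order \<open>4^-n\<close> for every \<open>n\<close>.\<close>

lemma gronwall_zero:
 fixes T C A t :: real and D :: "real => ennreal" assumes D: "!!t. t : {0..T} ==> D t <= ennreal C * (NI {0..t} (%s. D s))"
  and B: "!!t. t : {0..T} ==> D t <= ennreal A" and C: "0 < C" "0 <= A" and t: "t : {0..T}" shows "D t = 0"
proof -
 have "\<forall>t\<in>{0..T}. D t <= ennreal (A * (1/4) ^ n * exp (4 * C * t))" for n
 proof (induction n)
  case 0
  show ?case
  proof
  fix t assume t: "t : {0..T}"
  have "A * 1 <= A * exp (4 * C * t)" using C t by (intro mult_lmono) auto
  thus "D t <= ennreal (A * (1/4) ^ 0 * exp (4 * C * t))" using B[OF t] by (simp add: order_trans[OF _ ennreal_leI])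
  qed
 next
  case (Suc n)
  show ?case
  proof
  fix t assume t: "t : {0..T}"
  have "D t <= ennreal (A * (1/4) ^ n / 4 * exp (4 * C * t))" by (rule gronwall_step[OF D _ C(1) _ t]) (use Suc C in auto)
  thus "D t <= ennreal (A * (1/4) ^ Suc n * exp (4 * C * t))" by (simp add: mult.commute mult.left_commute)
  qed
 qed
 hence le: "D t <= ennreal (A * (1/4) ^ n * exp (4 * C * t))" for n using t by blast
 have "(%n. ennreal (A * (1/4) ^ n * exp (4 * C * t))) ----> ennreal (A * 0 * exp (4 * C * t))"
  by (intro tendsto_ennrealI tendsto_mult tendsto_const LIMSEQ_power_zero) simp
 hence "D t <= ennreal (A * 0 * exp (4 * C * t))" using le by (intro LIMSEQ_le_const) auto
 thus ?thesis by simp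
qed

section \<open>The linear evolution and its smoothing\<close>

context mhd begin

definition Lam :: "int^3 => mode => mode" where
 "Lam k z = ((nu * (K k)^2) *R fst z, (mu * (K k)^2) *R snd z)"

lemma Lam_diff: "Lam k (x - y) = Lam k x - Lam k y" by (simp add: Lam_def scaleR_diff_right)

lemma Lam_coercive: "min nu mu * (K k)^2 * (norm z)^2 <= z <.> Lam k z"
proof -
 have "min nu mu * (K k)^2 * (norm z)^2 = min nu mu * (K k)^2 * (norm (fst z))^2 + min nu mu * (K k)^2 * (norm (snd z))^2"
  by (simp add: norm_prod_def distrib_left)
 also have "... <= nu * (K k)^2 * (norm (fst z))^2 + mu * (K k)^2 * (norm (snd z))^2" by (intro add_mono mult_right_mono) auto
 also have "... = z <.> Lam k z" by (simp add: Lam_def inner_prod_def power2_norm_eq_inner)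
 finally show ?thesis .
qed

lemma Lam_bounded_linear: "bounded_linear (Lam k)" unfolding Lam_def[abs_def]
 by (intro bounded_linear_Pair bounded_linear_compose[OF bounded_linear_scaleR_right] bounded_linear_fst bounded_linear_snd)

lemma Lam_norm: "norm (Lam k z) <= (nu + mu) * (K k)^2 * norm z"
proof -
 have "norm (Lam k z) <= norm ((nu * (K k)^2) *R fst z) + norm ((mu * (K k)^2) *R snd z)" unfolding Lam_def by (rule norm_Pair_le)
 also have "... <= (nu * (K k)^2) * norm z + (mu * (K k)^2) * norm z"
  using nu_pos mu_pos norm_fst_le[of "fst z" "snd z"] norm_snd_le[of "snd z" "fst z"] by (intro add_mono) (auto intro!: mult_lmono)
 finally show ?thesis by (simp add: algebra_simps)
qed

text \<open>The integrated equation with the source as a parameter: the nonlinear problem is the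
  case where \<open>N\<close> is computed from \<open>c\<close>, while Picard steps and differences
  of solutions have a given source.\<close>

definition sol :: "(int^3 => mode) => (real => int^3 => mode) => (real => int^3 => mode) => bool" where
 "sol c0 N c <-> (\<forall>k. SI {0..T} (%s. - Lam k (c s k) + N s k) \<and>
  (\<forall>t\<in>{0..T}. c t k = c0 k + (LBINT s:{0..t}. - Lam k (c s k) + N s k)))"

lemma solD: assumes "sol c0 N c" shows "SI {0..T} (%s. - Lam k (c s k) + N s k)"
  and "t : {0..T} ==> c t k = c0 k + (LBINT s:{0..t}. - Lam k (c s k) + N s k)" using assms unfolding sol_def by blast+

lemma sol_diff: assumes a: "sol c0 N c" and b: "sol c0' N' c'"
 shows "sol (%k. c0 k - c0' k) (%s k. N s k - N' s k) (%s k. c s k - c' s k)" unfolding sol_def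
proof (intro allI conjI ballI)
 fix k
 have e: "- Lam k (c s k - c' s k) + (N s k - N' s k) = (- Lam k (c s k) + N s k) - (- Lam k (c' s k) + N' s k)" for s
  by (simp add: Lam_diff)
 note i = solD(1)[OF a, of k] solD(1)[OF b, of k]
 show "SI {0..T} (%s. - Lam k (c s k - c' s k) + (N s k - N' s k))" unfolding e by (rule set_integral_diff(1)[OF i])
 fix t assume t: "t : {0..T}"
 have sub: "{0..t} \<subseteq> {0..T}" using t by auto
 have i': "SI {0..t} (%s. - Lam k (c s k) + N s k)" "SI {0..t} (%s. - Lam k (c' s k) + N' s k)"
  by (rule si_subset[OF i(1) _ sub], simp) (rule si_subset[OF i(2) _ sub], simp)
 show "c t k - c' t k = c0 k - c0' k + (LBINT s:{0..t}. - Lam k (c s k - c' s k) + (N s k - N' s k))"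
  unfolding e set_integral_diff(2)[OF i'] using solD(2)[OF a t, of k] solD(2)[OF b t, of k] by simp
qed

definition CL :: real where "CL = Cp / (2 * min nu mu)"

lemma CL_pos: "0 < CL" using Cp_pos nu_pos mu_pos by (simp add: CL_def)

lemma nn_time_swap:
 fixes N :: "real => int^3 => 'v::{real_normed_vector,second_countable_topology}" assumes [measurable]: "!!k. (%s. N s k) : BM"
 shows "(SN k. (NI {0..t} (%s. ennreal (jap k ^ p * (norm (N s k))^2)))) = (NI {0..t} (%s. hsq p (N s)))"
proof -
 have ps: "pair_sigma_finite (lborel :: real measure) (count_space (UNIV :: (int^3) set))"
  by (intro pair_sigma_finite.intro sigma_finite_lborel sigma_finite_measure_count_space)
 have m: "(%(s,k). ennreal (jap k ^ p * (norm (N s k))^2) * indicator {0..t} s) : BMs (lborel <*M> count_space (UNIV :: (int^3) set))"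
  by (rule cs_joint) measurable
 have "(SN k. (NI {0..t} (%s. ennreal (jap k ^ p * (norm (N s k))^2))))
  = (LN s. (SN k. ennreal (jap k ^ p * (norm (N s k))^2) * indicator {0..t} s))" by (rule pair_sigma_finite.Fubini'[OF ps m])
 also have "... = (NI {0..t} (%s. hsq p (N s)))" unfolding hsq_def by (intro nn_integral_cong nn_integral_multc) simp
 finally show ?thesis .
qed

lemma sol_mode_bound: assumes s: "sol c0 N c" and t: "t : {0..T}" and k: "k ~= 0" and m: "(%s. N s k) : BM"
 shows "ennreal ((norm (c t k))^2) <= ennreal ((norm (c0 k))^2) +
  ennreal (1 / (2 * min nu mu * (K k)^2)) * (NI {0..t} (%s. ennreal ((norm (N s k))^2)))"
proof (cases "(NI {0..t} (%s. ennreal ((norm (N s k))^2))) < infy")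
 case True
 let ?ka = "min nu mu * (K k)^2"
 have ka: "0 < ?ka" using nu_pos mu_pos K_pos[OF k] by simp
 have e: "ennreal (norm (indicator {0..t} s *R (norm (N s k))^2)) = ennreal ((norm (N s k))^2) * indicator {0..t} s" for s
  by (simp add: indicator_def)
 have Ni: "SI {0..t} (%s. (norm (N s k))^2)" unfolding si_def integrable_iff_bounded e using True m by simp
 have sub: "{0..t} \<subseteq> {0..T}" using t by auto
 have "(norm (c t k))^2 <= (norm (c0 k))^2 + 1 / (2 * ?ka) * (LBINT s:{0..t}. (norm (N s k))^2)"
 proof (rule dissipative_ode_bound[OF _ _ _ ka Lam_coercive Ni])
  show "SI {0..t} (%s. - Lam k (c s k) + N s k)" by (rule si_subset[OF solD(1)[OF s] _ sub]) simp
  show "c t' k = c0 k + (LBINT s:{0..t'}. - Lam k (c s k) + N s k)" if "t' : {0..t}" for t'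
  by (rule solD(2)[OF s]) (use that t in auto)
 qed (use t in auto)
 hence "ennreal ((norm (c t k))^2) <= ennreal ((norm (c0 k))^2) + ennreal (1 / (2 * ?ka)) * ennreal (LBINT s:{0..t}. (norm (N s k))^2)" (is ?goal)
 proof -
  let ?J = "LBINT s:{0..t}. (norm (N s k))^2"
  have J: "0 <= ?J" unfolding sli_def by (intro bochner_nonneg) simp
  assume "(norm (c t k))^2 <= (norm (c0 k))^2 + 1 / (2 * ?ka) * ?J"
  hence "ennreal ((norm (c t k))^2) <= ennreal ((norm (c0 k))^2 + 1 / (2 * ?ka) * ?J)" by (rule ennreal_leI)
  also have "... = ennreal ((norm (c0 k))^2) + ennreal (1 / (2 * ?ka) * ?J)" using ka J by (intro ennreal_plus) auto
  also have "ennreal (1 / (2 * ?ka) * ?J) = ennreal (1 / (2 * ?ka)) * ennreal ?J" using ka J by (intro ennreal_mult) auto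
  finally show ?goal .
 qed
 also have "ennreal (LBINT s:{0..t}. (norm (N s k))^2) = (NI {0..t} (%s. ennreal ((norm (N s k))^2)))"
  using Ni unfolding sli_def si_def
  by (subst nn_integral_eq_integral[symmetric]) (auto intro!: nn_integral_cong simp: indicator_def)
 finally show ?thesis by (simp add: mult.assoc)
next
 \<comment> \<open>The infinite integral has a positive coefficient, so the right-hand side is
   infinite.\<close>
 case False
 have "0 < 1 / (2 * min nu mu * (K k)^2)" using nu_pos mu_pos K_pos[OF k] by simp
 hence "ennreal (1 / (2 * min nu mu * (K k)^2)) ~= 0" by (simp only: ennreal_eq_0_iff not_le)
 thus ?thesis using False by (simp only: less_top[symmetric] not_not infinity_ennreal_def ennreal_mult_top if_False) simp
qed

text \<open>Dissipation gives \<open>1 / K^2\<close>, which the Poincare constant trades for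
  \<open>1 / jap\<close>: a source in L^2 of time with values in h^p controls the h^(p+1) norm at
  every time. Mode zero is not damped and has to vanish.\<close>

lemma sol_bound: assumes s: "sol c0 N c" and t: "t : {0..T}" and z: "c t 0 = 0" and m: "!!k. (%s. N s k) : BM"
 shows "hsq (Suc p) (c t) <= hsq (Suc p) c0 + ennreal CL * (NI {0..t} (%s. hsq p (N s)))"
proof -
 have pt: "ennreal (jap k ^ Suc p * (norm (c t k))^2) <= ennreal (jap k ^ Suc p * (norm (c0 k))^2)
  + ennreal CL * (NI {0..t} (%s. ennreal (jap k ^ p * (norm (N s k))^2)))" for k
 proof (cases "k = 0")
  case False
  let ?I = "\<integral>\<^sup>+s\<in>{0..t}. ennreal ((norm (N s k))^2) \<partial>lborel"
  have j: "0 <= jap k ^ n" for n using jap_pos[of k] by simp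
  have mn: "0 < min nu mu" using nu_pos mu_pos by simp
  have "ennreal (jap k ^ Suc p * (norm (c t k))^2) = ennreal (jap k ^ Suc p) * ennreal ((norm (c t k))^2)"
  by (rule ennreal_mult[OF j]) simp
  also have "... <= ennreal (jap k ^ Suc p) * (ennreal ((norm (c0 k))^2) + ennreal (1 / (2 * min nu mu * (K k)^2)) * ?I)"
  by (intro mult_lmono sol_mode_bound[OF s t False m]) simp
  also have "... = ennreal (jap k ^ Suc p * (norm (c0 k))^2) + ennreal (jap k ^ Suc p * (1 / (2 * min nu mu * (K k)^2))) * ?I"
  unfolding ennreal_mult[OF j zero_le_power2] distrib_left mult.assoc[symmetric] by (subst ennreal_mult[OF j]) (use mn in auto)
  also have "ennreal (jap k ^ Suc p * (1 / (2 * min nu mu * (K k)^2))) <= ennreal (CL * jap k ^ p)"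
  proof (rule ennreal_leI)
  have K: "0 < (K k)^2" using K_pos[OF False] by simp
  have "jap k ^ p * (jap k / (2 * min nu mu * (K k)^2)) <= jap k ^ p * (Cp * (K k)^2 / (2 * min nu mu * (K k)^2))"
  using jap_le_K2[OF False] mn K by (intro mult_lmono divide_right_mono j) auto
  also have "Cp * (K k)^2 / (2 * min nu mu * (K k)^2) = CL" using K unfolding CL_def by simp
  finally show "jap k ^ Suc p * (1 / (2 * min nu mu * (K k)^2)) <= CL * jap k ^ p" by (simp add: mult_ac)
  qed
  also have "ennreal (CL * jap k ^ p) * ?I = ennreal CL * (ennreal (jap k ^ p) * ?I)"
  using CL_pos j by (simp add: ennreal_mult mult.assoc)
  also have "ennreal (jap k ^ p) * ?I = (NI {0..t} (%s. ennreal (jap k ^ p * (norm (N s k))^2)))"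
  using m j by (subst nn_integral_cmult[symmetric]) (auto simp: ennreal_mult mult.assoc)
  finally show ?thesis by (simp add: add_left_mono mult_right_mono)
 qed (use z in simp)
 have "hsq (Suc p) (c t) <= (SN k. ennreal (jap k ^ Suc p * (norm (c0 k))^2)
  + ennreal CL * (NI {0..t} (%s. ennreal (jap k ^ p * (norm (N s k))^2))))"
  unfolding hsq_def[of "Suc p" "c t"] by (rule nn_integral_mono) (rule pt)
 also have "... = hsq (Suc p) c0 + ennreal CL * (SN k. (NI {0..t} (%s. ennreal (jap k ^ p * (norm (N s k))^2))))"
  unfolding hsq_def by (subst nn_integral_add) (simp_all add: nn_integral_cmult)
 finally show ?thesis unfolding nn_time_swap[OF m] .
qed

lemma nn_time_mono: assumes "!!s. s : {0..t} ==> f s <= (g s :: ennreal)" shows "(NI {0..t} (%s. f s)) <= (NI {0..t} (%s. g s))"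
 by (intro nn_integral_mono) (use assms in \<open>auto simp: indicator_def\<close>)

lemma nn_time_mono_set:
 assumes "t <= T'" shows "(NI {0..t} (%s. f s)) <= (\<integral>\<^sup>+s\<in>{0..T'}. f s \<partial>(lborel :: real measure))"
 by (intro nn_integral_mono mult_lmono) (use assms in \<open>auto simp: indicator_def\<close>)

text \<open>\<open>sol_bound\<close> for the difference of two solutions, which starts from zero.
  The added \<open>1\<close> keeps the constant positive, as the Gronwall lemmas ask.\<close>

lemma sol_lip: assumes a: "sol c0 N a" and b: "sol c0 N' b" and z: "a t 0 = b t 0" and t: "t : {0..T}" and Q: "0 <= Q"
  and m: "!!k. (%s. N s k) : BM" "!!k. (%s. N' s k) : BM" "e : BM" and l: "!!s. hsq 0 (%k. N s k - N' s k) <= ennreal Q * e s"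
 shows "hsq 1 (%k. a t k - b t k) <= ennreal (CL * Q + 1) * (NI {0..t} (%s. e s))"
proof -
 have d: "sol (%k. 0) (%s k. N s k - N' s k) (%s k. a s k - b s k)" using sol_diff[OF a b] by simp
 have "hsq 1 (%k. a t k - b t k) <= hsq (Suc 0) (%k. 0::mode) + ennreal CL * (NI {0..t} (%s. hsq 0 (%k. N s k - N' s k)))"
  unfolding One_nat_def by (rule sol_bound[OF d t]) (use z m(1,2) in auto)
 also have "... <= ennreal CL * (NI {0..t} (%s. (ennreal Q * e s)))"
  unfolding hsq_zero add_0_left by (intro mult_lmono nn_time_mono l) simp
 also have "... = ennreal CL * (ennreal Q * (NI {0..t} (%s. e s)))" using m(3) by (simp add: nn_integral_cmult mult.assoc)
 also have "... = ennreal (CL * Q) * (NI {0..t} (%s. e s))" using CL_pos Q by (simp add: ennreal_mult mult.assoc)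
 also have "... <= ennreal (CL * Q + 1) * (NI {0..t} (%s. e s))" by (intro mult_right_mono ennreal_leI) simp_all
 finally show ?thesis .
qed

lemma NN_lip_bounded: assumes u: "hsq 1 u <= ennreal A" and v: "hsq 1 v <= ennreal A" and A: "0 <= A"
 shows "hsq 0 (%k. NN u k - NN v k) <= ennreal (enn2real CN * (2 * A)) * hsq 1 (%k. u k - v k)"
proof -
 have fin: "hsq 1 u < infy" "hsq 1 v < infy" by (rule le_less_trans[OF u], simp, rule le_less_trans[OF v], simp)
 have "hsq 0 (%k. NN u k - NN v k) <= hsq 1 (%k. NN u k - NN v k)" by (rule hsq_mono_s) simp
 also have "... <= CN * ((hsq 1 u + hsq 1 v) * hsq 1 (%k. u k - v k))" by (rule NN_lip[OF fin])
 also have "... <= ennreal (enn2real CN) * (ennreal (2 * A) * hsq 1 (%k. u k - v k))"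
 proof (intro mult_mono mult_right_mono)
  have "hsq 1 u + hsq 1 v <= ennreal A + ennreal A" by (rule add_mono[OF u v])
  also have "... = ennreal (2 * A)" using A by (subst ennreal_plus[symmetric]) auto
  finally show "hsq 1 u + hsq 1 v <= ennreal (2 * A)" .
 qed (use CN_finite in \<open>auto simp: less_top\<close>)
 finally show ?thesis using A by (simp add: ennreal_mult mult.assoc)
qed

text \<open>On bounded sets the nonlinearity is Lipschitz and the common forcing drops out of the
  difference, so the squared h^1 distance satisfies a linear integral inequality with no initial
  term.\<close>

lemma sol_unique: assumes a: "sol c0 (%s k. NN (a s) k + F s k) a" and b: "sol c0 (%s k. NN (b s) k + F s k) b"
  and m: "!!k. (%s. a s k) : BM" "!!k. (%s. b s k) : BM"
  "!!k. (%s. F s k) : BM" and B: "!!t. hsq 1 (a t) <= ennreal A" "!!t. hsq 1 (b t) <= ennreal A" and A: "0 <= A"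
  and z: "!!t. a t 0 = 0" "!!t. b t 0 = 0" and t: "t : {0..T}" shows "a t = b t"
proof -
 define D where "D = (%t. hsq 1 (%k. a t k - b t k))"
 define Q where "Q = enn2real CN * (2 * A)"
 have Q: "0 <= Q" using A by (simp add: Q_def)
 have Dm: "D : BM" unfolding D_def by (rule hsq_measurable) (use m in measurable)
 have "D t <= ennreal (CL * Q + 1) * (NI {0..t} (%s. D s))" if t: "t : {0..T}" for t unfolding D_def
 proof (rule sol_lip[OF a b _ t Q _ _ Dm[unfolded D_def]])
  show "hsq 0 (%k. NN (a s) k + F s k - (NN (b s) k + F s k)) <= ennreal Q * hsq 1 (%k. a s k - b s k)" for s
  using NN_lip_bounded[OF B(1) B(2) A] by (simp add: Q_def)
  show "a t 0 = b t 0" using z by simp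
  show "(%s. NN (a s) k + F s k) : BM" "(%s. NN (b s) k + F s k) : BM" for k by (intro borel_measurable_add NN_measurable m)+
 qed
 moreover have "D t <= ennreal (4 * A)" for t
 proof -
  have "D t <= 2 * hsq 1 (a t) + 2 * hsq 1 (b t)" unfolding D_def by (rule hsq_diff_le)
  also have "... <= 2 * ennreal A + 2 * ennreal A" by (intro add_mono mult_lmono B) auto
  also have "... = ennreal (4 * A)" using two_ennreal[OF A A] by simp
  finally show ?thesis .
 qed
 moreover have "0 < CL * Q + 1" using CL_pos Q by (simp add: add_nonneg_pos)
 ultimately have "D t = 0" using gronwall_zero[of T D "CL * Q + 1" "4 * A" t] t A by auto
 hence "ennreal ((norm (a t k - b t k))^2) <= 0" for k using hsq_point[of "%k. a t k - b t k" k 1] by (simp add: D_def)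
 thus ?thesis by (auto simp: fun_eq_iff)
qed

text \<open>Duhamel's formula in both components, set to zero outside \<open>[0, T]\<close> so that
  it is Borel on the whole line and \<open>good\<close> at every time.\<close>

definition LL :: "(int^3 => mode) => (real => int^3 => mode) => real => int^3 => mode" where
 "LL c0 N t k = indicator {0..T} t *R
  (duhamel (nu * (K k)^2) (fst (c0 k)) (%s. fst (N s k)) t, duhamel (mu * (K k)^2) (snd (c0 k)) (%s. snd (N s k)) t)"

lemma set_integrable_fst_snd:
 fixes N :: "real => 'a::{banach,second_countable_topology} \<times> 'b::{banach,second_countable_topology}" assumes "SI A N"
 shows "SI A (%s. fst (N s))" "SI A (%s. snd (N s))" using integrable_bounded_linear[OF bounded_linear_fst assms[unfolded si_def]]
  integrable_bounded_linear[OF bounded_linear_snd assms[unfolded si_def]] by (simp_all add: si_def)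

lemma LL_sol: assumes N: "!!k. SI {0..T} (%s. N s k)" shows "sol c0 N (LL c0 N)" unfolding sol_def
proof (intro allI conjI ballI)
 fix k
 let ?f = "duhamel (nu * (K k)^2) (fst (c0 k)) (%s. fst (N s k))"
 let ?g = "duhamel (mu * (K k)^2) (snd (c0 k)) (%s. snd (N s k))"
 have e: "LL c0 N s k = (?f s, ?g s)" if "s : {0..T}" for s using that by (simp add: LL_def)
 have d: "SI {0..t} (%s. - Lam k (LL c0 N s k) + N s k)"
  "(LBINT s:{0..t}. - Lam k (LL c0 N s k) + N s k) = (?f t, ?g t) - c0 k" if t: "t : {0..T}" for t
 proof -
  note f = duhamel_ode[OF set_integrable_fst_snd(1)[OF N[of k]] t, where ka="nu * (K k)^2" and ?c0.0="fst (c0 k)"]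
  note g = duhamel_ode[OF set_integrable_fst_snd(2)[OF N[of k]] t, where ka="mu * (K k)^2" and ?c0.0="snd (c0 k)"]
  let ?F = "%s. indicator {0..t} s *R (- (nu * (K k)^2) *R ?f s + fst (N s k))"
  let ?G = "%s. indicator {0..t} s *R (- (mu * (K k)^2) *R ?g s + snd (N s k))"
  have FG: "indicator {0..t} s *R (- Lam k (LL c0 N s k) + N s k) = (?F s, ?G s)" for s
  proof (cases "s : {0..t}")
  case True
  hence "s : {0..T}" using t by auto
  thus ?thesis by (simp add: e Lam_def prod_eq_iff)
  qed (simp add: zero_prod_def)
  have i: "integrable lborel ?F" "integrable lborel ?G" using f(1) g(1) by (simp_all add: si_def)
  show "SI {0..t} (%s. - Lam k (LL c0 N s k) + N s k)" unfolding si_def FG by (rule integral_pair(1)[OF i])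
  have "(LBINT s:{0..t}. - Lam k (LL c0 N s k) + N s k) = ((LINT s|lborel. ?F s), (LINT s|lborel. ?G s))"
  unfolding sli_def FG by (rule integral_pair(2)[OF i])
  also have "... = (?f t - fst (c0 k), ?g t - snd (c0 k))" using f(2) g(2) by (simp add: sli_def algebra_simps)
  finally show "(LBINT s:{0..t}. - Lam k (LL c0 N s k) + N s k) = (?f t, ?g t) - c0 k" by (simp add: minus_prod_def)
 qed
 show "SI {0..T} (%s. - Lam k (LL c0 N s k) + N s k)" by (rule d(1)) (use T_pos in auto)
 fix t assume t: "t : {0..T}"
 show "LL c0 N t k = c0 k + (LBINT s:{0..t}. - Lam k (LL c0 N s k) + N s k)" unfolding d(2)[OF t] e[OF t] by simp
qed

lemma sol_continuous: assumes "sol c0 N c" shows "continuous_on {0..T} (%t. c t k)"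
proof -
 have "continuous_on {0..T} (%t. c0 k + (LBINT s:{0..t}. - Lam k (c s k) + N s k))"
  by (intro continuous_intros continuous_indefinite_integral solD(1)[OF assms])
 thus ?thesis by (rule continuous_on_eq) (rule solD(2)[OF assms, symmetric])
qed

lemma LL_measurable: assumes N: "!!k. SI {0..T} (%s. N s k)" shows "(%t. LL c0 N t k) : BM"
proof -
 have "(%t. indicator {0..T} t *R LL c0 N t k) : BM"
  by (rule borel_measurable_continuous_on_indicator[OF _ sol_continuous[OF LL_sol[OF N]]]) simp
 moreover have "(%t. indicator {0..T} t *R LL c0 N t k) = (%t. LL c0 N t k)" by (auto simp: LL_def indicator_def)
 ultimately show ?thesis by simp
qed

lemma wdot_bounded_linear: "bounded_linear (wdot k)"
proof -
 have "linear (wdot k)" by (rule linearI) (simp_all add: wdot_add wdot_scaleR scaleR_cx)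
 thus ?thesis by (simp add: linear_conv_bounded_linear)
qed

definition cnjv :: "complex^3 => complex^3" where "cnjv v = (\<chi> i. cnj (v $ i))"

lemma cnjv_bounded_linear: "bounded_linear cnjv"
proof -
 have "linear cnjv" by (rule linearI) (simp_all add: cnjv_def vec_eq_iff)
 thus ?thesis by (simp add: linear_conv_bounded_linear)
qed

lemma herm_cnjv: "herm a <-> (\<forall>k. a (- k) = cnjv (a k))" by (simp add: herm_def cnjv_def vec_eq_iff)

lemma duhamel_0: "duhamel ka 0 (%s. 0) t = 0" by (simp add: duhamel_def sli_def)

text \<open>Each condition in \<open>good\<close> is a real-linear equation in the coefficients, and
  bounded linear maps pass through Duhamel's formula. For reality it matters that the decay rates at
  \<open>k\<close> and \<open>- k\<close> coincide.\<close>

lemma LL_good: assumes N: "!!k. SI {0..T} (%s. N s k)" and g: "good c0" "!!s. good (N s)" shows "good (LL c0 N t)"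
proof (cases "t : {0..T}")
 case False
 hence "LL c0 N t = (%k. 0)" by (simp add: LL_def fun_eq_iff zero_prod_def)
 thus ?thesis by (simp add: good_def herm_def divfree_def wdot_def)
next
 case True
 have N': "SI {0..t} (%s. N s k)" for k by (rule si_subset[OF N]) (use True in auto)
 note Nc = set_integrable_fst_snd[OF N']
 have Kk: "K (- k) = K k" for k by (simp add: wave_minus)
 have h: "herm (%k. fst (LL c0 N t k))" "herm (%k. snd (LL c0 N t k))" using g True unfolding herm_cnjv good_def LL_def
  by (simp_all add: Kk duhamel_bounded_linear[OF cnjv_bounded_linear Nc(1)] duhamel_bounded_linear[OF cnjv_bounded_linear Nc(2)])
 have d: "divfree (%k. fst (LL c0 N t k))" "divfree (%k. snd (LL c0 N t k))" using g True unfolding divfree_def good_def LL_def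
  by (simp_all add: duhamel_bounded_linear[OF wdot_bounded_linear Nc(1)] duhamel_bounded_linear[OF wdot_bounded_linear Nc(2)] duhamel_0)
 have "LL c0 N t 0 = 0" using g True by (simp add: good_def LL_def duhamel_0 zero_prod_def)
 thus ?thesis using h d by (simp add: good_def)
qed

lemma nn_time_si:
 fixes N :: "real => int^3 => 'v::euclidean_space" assumes m: "!!k. (%s. N s k) : BM"
  and f: "(NI {0..T} (%s. hsq p (N s))) < infy" shows "SI {0..T} (%s. (norm (N s k))^2)" "SI {0..T} (%s. N s k)"
proof -
 have "(NI {0..T} (%s. ennreal ((norm (N s k))^2))) <= (NI {0..T} (%s. hsq p (N s)))" by (rule nn_time_mono) (rule hsq_point)
 hence fin: "(NI {0..T} (%s. ennreal ((norm (N s k))^2))) < infy" using f by (rule le_less_trans)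
 have e: "ennreal (norm (indicator {0..T} s *R (norm (N s k))^2)) = ennreal ((norm (N s k))^2) * indicator {0..T} s" for s
  by (simp add: indicator_def)
 show i2: "SI {0..T} (%s. (norm (N s k))^2)" unfolding si_def integrable_iff_bounded e using fin m by simp
 have one: "integrable lborel (%s. indicator {0..T} s *R (1::real))"
  using borel_integrable_atLeastAtMost'[of 0 T "%_. 1::real"] by (simp add: si_def)
 show "SI {0..T} (%s. N s k)" unfolding si_def
 proof (rule bochnerI_bound)
  show "integrable lborel (%s. indicator {0..T} s *R (1::real) + indicator {0..T} s *R (norm (N s k))^2)"
  using one i2 by (simp add: si_def)
  show "(%s. indicator {0..T} s *R N s k) : BMs lborel" using m by simp
  show "AE s in lborel. norm (indicator {0..T} s *R N s k) <= norm (indicator {0..T} s *R (1::real) + indicator {0..T} s *R (norm (N s k))^2)"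
  proof (rule AE_I2)
  fix s
  have "norm (N s k) <= 1 + (norm (N s k))^2"
  using sum_squares_bound[of 1 "norm (N s k)"] norm_ge_zero[of "N s k"] unfolding mult_1_right one_power2 by linarith
  thus "norm (indicator {0..T} s *R N s k) <= norm (indicator {0..T} s *R (1::real) + indicator {0..T} s *R (norm (N s k))^2)"
  by (simp add: indicator_def)
  qed
 qed
qed

lemma time_sum_swap:
 fixes f :: "real => 'i::countable => real" assumes m: "!!k. (%s. f s k) : BM"
  and fin: "(LN s. (SN k. ennreal \<bar>f s k\<bar>)) < infy"
 shows "integrable lborel (%s. f s k)" "integrable cs (%k. (LINT s|lborel. f s k))"
  "(LINT k|cs. (LINT s|lborel. f s k)) = (LINT s|lborel. (LINT k|cs. f s k))"
proof -
 interpret ps: pair_sigma_finite "lborel :: real measure" "count_space (UNIV :: 'i set)"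
  by (intro pair_sigma_finite.intro sigma_finite_lborel sigma_finite_measure_count_space)
 have m': "(%(s,k). f s k) : BMs (lborel <*M> count_space (UNIV :: 'i set))" by (rule cs_joint) (use m in simp)
 have m'': "(%(s,k). ennreal \<bar>f s k\<bar>) : BMs (lborel <*M> count_space (UNIV :: 'i set))"
  by (rule cs_joint) (use m in measurable)
 have i: "integrable (lborel <*M> count_space (UNIV :: 'i set)) (%(s,k). f s k)"
 proof (rule integrableI_bounded[OF m'])
  have "(\<integral>\<^sup>+z. ennreal (norm (case z of (s,k) => f s k)) \<partial>(lborel <*M> count_space (UNIV :: 'i set)))
  = (\<integral>\<^sup>+z. (%(s,k). ennreal \<bar>f s k\<bar>) z \<partial>(lborel <*M> count_space (UNIV :: 'i set)))"
  by (intro nn_integral_cong) auto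
  also have "... = (LN s. (SN k. ennreal \<bar>f s k\<bar>))" using ps.M2.nn_integral_fst[OF m''] by simp
  finally show "(\<integral>\<^sup>+z. ennreal (norm (case z of (s,k) => f s k)) \<partial>(lborel <*M> count_space (UNIV :: 'i set))) < infy"
  using fin by simp
 qed
 show "integrable lborel (%s. f s k)"
 proof (rule integrableI_bounded)
  have "(LN s. ennreal (norm (f s k))) <= (LN s. (SN k. ennreal \<bar>f s k\<bar>))"
  by (intro nn_integral_mono) (use nn_integral_ge_point[of k UNIV "%k. ennreal \<bar>f _ k\<bar>"] in simp)
  thus "(LN s. ennreal (norm (f s k))) < infy" using fin by (rule le_less_trans)
 qed (use m in simp)
 show "integrable cs (%k. (LINT s|lborel. f s k))" using ps.integrable_snd[OF i] .
 show "(LINT k|cs. (LINT s|lborel. f s k)) = (LINT s|lborel. (LINT k|cs. f s k))" using ps.Fubini_integral[OF i] .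
qed

lemma good_limit: assumes l: "!!k. (%n. a n k) ----> b k" and g: "!!n. good (a n)" shows "good b"
proof -
 have f: "(%n. fst (a n k)) ----> fst (b k)" "(%n. snd (a n k)) ----> snd (b k)" for k by (intro tendsto_fst tendsto_snd l)+
 note c = bounded_linear.tendsto[OF cnjv_bounded_linear] and w = bounded_linear.tendsto[OF wdot_bounded_linear]
 have h: "fst (a n (- k)) = cnjv (fst (a n k))" "snd (a n (- k)) = cnjv (snd (a n k))"
  "wdot k (fst (a n k)) = 0" "wdot k (snd (a n k)) = 0" "a n 0 = 0" for n k
  using g[of n] by (auto simp: good_def herm_cnjv divfree_def)
 have "fst (b (- k)) = cnjv (fst (b k))" "snd (b (- k)) = cnjv (snd (b k))" for k
  using LIMSEQ_unique[OF f(1)[of "- k", unfolded h] c[OF f(1)[of k]]] LIMSEQ_unique[OF f(2)[of "- k", unfolded h] c[OF f(2)[of k]]]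
  by simp_all
 moreover have "wdot k (fst (b k)) = 0" "wdot k (snd (b k)) = 0" for k
  using LIMSEQ_unique[OF w[OF f(1)[of k], of k, unfolded h] tendsto_const] LIMSEQ_unique[OF w[OF f(2)[of k], of k, unfolded h] tendsto_const]
  by simp_all
 moreover have "b 0 = 0" using LIMSEQ_unique[OF l[of 0, unfolded h] tendsto_const] by simp
 ultimately show ?thesis by (simp add: good_def herm_cnjv divfree_def)
qed

text \<open>Lower semicontinuity of the norm under convergence of the single modes, seen on finite
  partial sums.\<close>

lemma hsq_1_limit:
 fixes a :: "nat => int^3 => 'v::real_normed_vector"
 assumes l: "!!k. (%n. a n k) ----> b k" and B: "!!n. hsq 1 (a n) <= ennreal B" and "0 <= B" shows "hsq 1 b <= ennreal B"
proof (rule hsq_le_finite_sums)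
 fix F :: "(int^3) set" assume F: "finite F"
 have "(\<Sum>k\<in>F. jap k ^ 1 * (norm (a n k))^2) <= B" for n
 proof -
  have fin: "hsq 1 (a n) < infy" by (rule le_less_trans[OF B]) simp
  have "(hn (a n))^2 <= B" unfolding hn2 by (rule enn2real_leI[OF assms(3) B])
  thus ?thesis using hsq_sum_le[OF fin F] by simp
 qed
 moreover have "(%n. \<Sum>k\<in>F. jap k ^ 1 * (norm (a n k))^2) ----> (\<Sum>k\<in>F. jap k ^ 1 * (norm (b k))^2)"
  by (intro tendsto_intros l)
 ultimately show "(\<Sum>k\<in>F. jap k ^ 1 * (norm (b k))^2) <= B" by (intro LIMSEQ_le_const2) auto
qed

end

section \<open>Picard iteration for the cut-off equation and the energy bound\<close>

locale mhd_data = mhd L T nu mu a1 a2 N1 N2 for L T nu mu a1 a2 :: real and N1 N2 :: nat +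
 fixes u0 :: "int^3 => mode" and ph :: "real => int^3 => complex^3" assumes u0_good: "good u0" and u0_h2: "hsq 2 u0 < infy"
  and ph_meas: "!!k. (%t. ph t k) : BM" and ph_good: "!!t. good (%k. (ph t k, 0))"
  and ph_L2: "(NI {0..T} (%s. hsq 0 (ph s))) < infy"
begin

definition Ff :: "real => int^3 => mode" where "Ff s k = (gsym a1 k *R ph s k, 0)"

lemma Ff_meas: "(%s. Ff s k) : BM"
 unfolding Ff_def using ph_meas[of k] by (intro borel_measurable_Pair borel_measurable_scaleR borel_measurable_const)

lemma Ff_good: "good (Ff s)"
 using ph_good[of s] by (simp add: good_def Ff_def herm_def divfree_def wdot_scaleR scaleR_cx zero_prod_def)

lemma Ff_hsq: "hsq 1 (Ff s) <= ennreal ((Cg a1)^2) * hsq 0 (ph s)"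
proof -
 have "hsq 1 (Ff s) = hsq 1 (%k. gsym a1 k *R ph s k)" by (subst hsq_prod) (simp add: Ff_def hsq_zero)
 also have "... <= hsq (0 + 2) (%k. gsym a1 k *R ph s k)" by (rule hsq_mono_s) simp
 also have "... <= ennreal ((Cg a1)^2) * hsq 0 (ph s)" by (rule gsym_hsq2[OF a1_pos])
 finally show ?thesis .
qed

definition adm :: "(real => int^3 => mode) => bool" where
 "adm v <-> (\<forall>k. (%t. v t k) : BM) & (\<forall>t. good (v t)) & (\<forall>t. hsq 1 (v t) < infy)"

lemma admD: "adm v ==> (%t. v t k) : BM" "adm v ==> good (v t)" "adm v ==> hsq 1 (v t) < infy" unfolding adm_def by blast+

definition BB :: "real => (real => int^3 => mode) => real => int^3 => mode" where
 "BB R v s k = NN (PP R (v s)) k + Ff s k"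

definition Phi :: "real => (real => int^3 => mode) => real => int^3 => mode" where
 "Phi R v = LL u0 (BB R v)"

text \<open>Bounds the time integral of the source for every admissible \<open>v\<close>: after the
  cutoff the nonlinear part is controlled by \<open>R\<close> alone. All Picard iterates therefore
  obey the same bounds.\<close>

definition JJ :: "real => ennreal" where
 "JJ R = 2 * (CN * (ennreal (R^2) * ennreal (R^2))) * ennreal T + 2 * ennreal ((Cg a1)^2) * (NI {0..T} (%s. hsq 0 (ph s)))"

lemma JJ_finite: "JJ R < infy" unfolding JJ_def using ph_L2 CN_finite by (simp add: mult_lt_top)

lemma BB_meas: "adm v ==> (%s. BB R v s k) : BM"
 unfolding BB_def by (intro borel_measurable_add NN_measurable PP_measurable Ff_meas admD(1))

lemma good_add: assumes "good u" "good v" shows "good (%k. u k + v k)"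
 using assms by (simp add: good_def herm_def divfree_def wdot_add)

lemma BB_good: "adm v ==> good (BB R v s)" unfolding BB_def[abs_def] by (intro good_add NN_good good_PP Ff_good admD(2))

lemma NN_PP_bound: assumes "R > 0" "hsq 1 v < infy" shows "hsq 1 (NN (PP R v)) <= CN * (ennreal (R^2) * ennreal (R^2))"
 by (rule order_trans[OF NN_bound[OF PP_finite[OF assms(2)]]]) (intro mult_lmono mult_mono PP_bound assms; simp)

lemma BB_time: assumes R: "R > 0" and v: "adm v" shows "(NI {0..T} (%s. hsq 1 (BB R v s))) <= JJ R"
proof -
 let ?b = "2 * (CN * (ennreal (R^2) * ennreal (R^2)))"
 have p: "hsq 1 (BB R v s) <= ?b + 2 * ennreal ((Cg a1)^2) * hsq 0 (ph s)" for s
 proof -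
  have "hsq 1 (BB R v s) <= 2 * hsq 1 (NN (PP R (v s))) + 2 * hsq 1 (Ff s)" unfolding BB_def[abs_def] by (rule hsq_add_le)
  also have "... <= ?b + 2 * (ennreal ((Cg a1)^2) * hsq 0 (ph s))"
  by (intro add_mono mult_lmono NN_PP_bound[OF R] Ff_hsq admD(3)[OF v]) auto
  finally show ?thesis by (simp add: mult.assoc)
 qed
 have m: "(%s. hsq 0 (ph s)) : BMs lborel" using hsq_measurable[of ph borel 0, OF ph_meas] by simp
 have "(NI {0..T} (%s. hsq 1 (BB R v s)))
  <= (LN s. ?b * indicator {0..T} s + 2 * ennreal ((Cg a1)^2) * (hsq 0 (ph s) * indicator {0..T} s))"
  by (intro nn_integral_mono) (use p in \<open>auto simp: indicator_def\<close>)
 also have "... = ?b * (LN s. indicator {0..T} s) + 2 * ennreal ((Cg a1)^2) * (NI {0..T} (%s. hsq 0 (ph s)))"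
  using m by (subst nn_integral_add) (simp_all add: nn_integral_cmult)
 also have "... = JJ R" using T_pos by (simp add: JJ_def)
 finally show ?thesis .
qed

lemma BB_int: assumes R: "R > 0" and v: "adm v" shows "SI {0..T} (%s. BB R v s k)"
proof (rule nn_time_si(2)[of "BB R v"])
 show "(NI {0..T} (%s. hsq 1 (BB R v s))) < infy" by (rule le_less_trans[OF BB_time[OF R v] JJ_finite])
qed (rule BB_meas[OF v])

lemma Phi_sol: "R > 0 ==> adm v ==> sol u0 (BB R v) (Phi R v)" unfolding Phi_def by (rule LL_sol) (rule BB_int)

text \<open>\<open>p = 0\<close> serves the iteration and the energy estimate. \<open>p = 1\<close>
  gives the h^2 bound of the solution; it is finite because the initial data, being filtered, lie in
  h^2.\<close>

definition MM :: "nat => real => ennreal" where "MM p R = hsq (Suc p) u0 + ennreal CL * JJ R"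

lemma MM_finite: "p <= 1 ==> MM p R < infy"
 unfolding MM_def using JJ_finite[of R] le_less_trans[OF hsq_mono_s[of "Suc p" 2 u0] u0_h2] by (auto simp: mult_lt_top)

lemma sol_MM: assumes R: "R > 0" and v: "adm v" and s: "sol u0 (BB R v) c" and z: "c t 0 = 0" and t: "t : {0..T}" and p: "p <= 1"
 shows "hsq (Suc p) (c t) <= MM p R"
proof -
 have "hsq (Suc p) (c t) <= hsq (Suc p) u0 + ennreal CL * (NI {0..t} (%s. hsq p (BB R v s)))"
  by (rule sol_bound[where c=c and t=t, OF s t z BB_meas[OF v]])
 also have "(NI {0..t} (%s. hsq p (BB R v s))) <= (NI {0..t} (%s. hsq 1 (BB R v s)))" by (intro nn_time_mono hsq_mono_s p)
 also have "... <= (NI {0..T} (%s. hsq 1 (BB R v s)))" by (rule nn_time_mono_set) (use t in simp)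
 also have "... <= JJ R" by (rule BB_time[OF R v])
 finally show ?thesis by (simp add: MM_def add_left_mono mult_lmono)
qed

lemma Phi_outside: "t \<notin> {0..T} ==> Phi R v t = (%k. 0)" by (simp add: Phi_def LL_def fun_eq_iff zero_prod_def)

lemma Phi_good: "R > 0 ==> adm v ==> good (Phi R v t)" unfolding Phi_def by (rule LL_good[OF BB_int u0_good BB_good])

lemma good_zero: "good u ==> u 0 = 0" by (simp add: good_def)

lemma Phi_hsq: assumes R: "R > 0" and v: "adm v" and p: "p <= 1" shows "hsq (Suc p) (Phi R v t) <= MM p R"
proof (cases "t : {0..T}")
 case True
 thus ?thesis by (rule sol_MM[OF R v Phi_sol[OF R v] good_zero[OF Phi_good[OF R v]] _ p])
qed (simp add: Phi_outside hsq_zero)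

lemma Phi_adm: assumes R: "R > 0" and v: "adm v" shows "adm (Phi R v)" unfolding adm_def
proof (intro conjI allI)
 show "(%t. Phi R v t k) : BM" for k unfolding Phi_def by (rule LL_measurable[OF BB_int[OF R v]])
 show "good (Phi R v t)" for t by (rule Phi_good[OF R v])
 show "hsq 1 (Phi R v t) < infy" for t unfolding One_nat_def by (rule le_less_trans[OF Phi_hsq[OF R v] MM_finite]) auto
qed

text \<open>\<open>2 * R^2\<close> is the growth of the quadratic term on the ball of radius
  \<open>R\<close>, the \<open>4\<close> comes from \<open>PP_lip\<close>, and the \<open>1\<close>
  from \<open>sol_lip\<close>.\<close>

definition QQ :: "real => real" where "QQ R = CL * (enn2real CN * (2 * R^2) * 4) + 1"

lemma QQ_pos: "0 < QQ R" using CL_pos by (simp add: QQ_def add_nonneg_pos)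

lemma Phi_lip: assumes R: "R > 0" and v: "adm v" "adm v'" and t: "t : {0..T}"
 shows "hsq 1 (%k. Phi R v t k - Phi R v' t k) <= ennreal (QQ R) * (NI {0..t} (%s. hsq 1 (%k. v s k - v' s k)))" unfolding QQ_def
proof (rule sol_lip[OF Phi_sol[OF R v(1)] Phi_sol[OF R v(2)] _ t _ BB_meas[OF v(1)] BB_meas[OF v(2)]])
 show "Phi R v t 0 = Phi R v' t 0" using good_zero[OF Phi_good[OF R]] v by simp
 show "(%s. hsq 1 (%k. v s k - v' s k)) : BM" by (rule hsq_measurable) (intro borel_measurable_diff admD(1) v)
 fix s
 have e: "(%k. BB R v s k - BB R v' s k) = (%k. NN (PP R (v s)) k - NN (PP R (v' s)) k)" by (simp add: BB_def)
 have "hsq 0 (%k. BB R v s k - BB R v' s k) <= ennreal (enn2real CN * (2 * R^2)) * hsq 1 (%k. PP R (v s) k - PP R (v' s) k)"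
  unfolding e by (intro NN_lip_bounded PP_bound R admD(3) v) simp
 also have "... <= ennreal (enn2real CN * (2 * R^2)) * (4 * hsq 1 (%k. v s k - v' s k))"
  by (intro mult_lmono PP_lip R admD(3) v) simp
 also have "... = ennreal (enn2real CN * (2 * R^2) * 4) * hsq 1 (%k. v s k - v' s k)" by (simp add: ennreal_mult mult_ac)
 finally show "hsq 0 (%k. BB R v s k - BB R v' s k) <= ennreal (enn2real CN * (2 * R^2) * 4) * hsq 1 (%k. v s k - v' s k)" .
qed simp

primrec UU :: "real => nat => real => int^3 => mode" where
 "UU R 0 = (%t k. 0)" | "UU R (Suc m) = Phi R (UU R m)"

lemma UU_adm: assumes "R > 0" shows "adm (UU R m)"
proof (induction m)
 case 0
 have "good (%k. 0 :: mode)" by (simp add: good_def herm_def divfree_def wdot_def)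
 thus ?case by (simp add: adm_def hsq_zero)
next
 case (Suc m) thus ?case using Phi_adm[OF assms] by simp
qed

text \<open>\<open>gronwall_step\<close> along the iteration: the squared increments decay like
  \<open>4^-m\<close>, uniformly in time once the exponential weight is replaced by its value at
  \<open>T\<close>.\<close>

lemma UU_step: assumes R: "R > 0"
 obtains A where "0 <= A" "!!m t. hsq 1 (%k. UU R (Suc m) t k - UU R m t k) <= ennreal (A * (1/4) ^ m)"
proof -
 define a where "a = enn2real (MM 0 R)"
 have a: "MM 0 R = ennreal a" using MM_finite[of 0 R] by (simp add: a_def)
 have a0: "0 <= a" by (simp add: a_def)
 have "\<forall>t\<in>{0..T}. hsq 1 (%k. UU R (Suc m) t k - UU R m t k) <= ennreal (a * (1/4)^m * exp (4 * QQ R * t))" for m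
 proof (induction m)
  case 0
  show ?case
  proof
  fix t assume t: "t : {0..T}"
  have "a * 1 <= a * exp (4 * QQ R * t)" using t a0 QQ_pos[of R] by (intro mult_lmono) auto
  hence le: "ennreal a <= ennreal (a * (1/4)^0 * exp (4 * QQ R * t))" by (intro ennreal_leI) simp
  have "hsq 1 (%k. UU R (Suc 0) t k - UU R 0 t k) <= ennreal a" using Phi_hsq[OF R UU_adm[OF R, of 0], of 0 t] by (simp add: a)
  thus "hsq 1 (%k. UU R (Suc 0) t k - UU R 0 t k) <= ennreal (a * (1/4)^0 * exp (4 * QQ R * t))" using le by (rule order_trans)
  qed
 next
  case (Suc m)
  show ?case
  proof
  fix t assume t: "t : {0..T}"
  have "hsq 1 (%k. UU R (Suc (Suc m)) t k - UU R (Suc m) t k) <= ennreal (a * (1/4)^m / 4 * exp (4 * QQ R * t))"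
  proof (rule gronwall_step[OF _ _ QQ_pos _ t])
  show "hsq 1 (%k. UU R (Suc (Suc m)) t k - UU R (Suc m) t k)
  <= ennreal (QQ R) * (NI {0..t} (%s. hsq 1 (%k. UU R (Suc m) s k - UU R m s k)))" if t: "t : {0..T}" for t
  using Phi_lip[OF R UU_adm[OF R, of "Suc m"] UU_adm[OF R, of m] t] by simp
  show "hsq 1 (%k. UU R (Suc m) s k - UU R m s k) <= ennreal (a * (1/4)^m * exp (4 * QQ R * s))" if "s : {0..T}" for s
  by (rule Suc.IH[THEN bspec, OF that])
  qed (use a0 in simp)
  also have "a * (1/4)^m / 4 * exp (4 * QQ R * t) = a * (1/4)^Suc m * exp (4 * QQ R * t)" by simp
  finally show "hsq 1 (%k. UU R (Suc (Suc m)) t k - UU R (Suc m) t k) <= ennreal (a * (1/4)^Suc m * exp (4 * QQ R * t))" .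
  qed
 qed note b = this[THEN bspec]
 have "hsq 1 (%k. UU R (Suc m) t k - UU R m t k) <= ennreal (a * exp (4 * QQ R * T) * (1/4)^m)" for m t
 proof (cases "t : {0..T}")
  case True
  have "a * (1/4)^m * exp (4 * QQ R * t) <= a * (1/4)^m * exp (4 * QQ R * T)"
  using True a0 QQ_pos[of R] by (intro mult_lmono) auto
  hence "a * (1/4)^m * exp (4 * QQ R * t) <= a * exp (4 * QQ R * T) * (1/4)^m" by (simp only: mult_ac)
  thus ?thesis by (rule order_trans[OF b[OF True] ennreal_leI])
 next
  case False
  have "UU R n t = (%k. 0)" for n using False Phi_outside by (cases n) auto
  thus ?thesis by (simp add: hsq_zero del: UU.simps)
 qed
 thus ?thesis by (rule that[rotated]) (use a0 in simp)
qed

text \<open>The constant \<open>4 * A\<close> solves \<open>x = 2 * (x / 4) + 2 * A\<close>, where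
  the factors \<open>2\<close> come from \<open>hsq_add_le\<close>.\<close>

lemma UU_diff: assumes A: "0 <= A" "!!m t. hsq 1 (%k. UU R (Suc m) t k - UU R m t k) <= ennreal (A * (1/4) ^ m)"
 shows "hsq 1 (%k. UU R (m + j) t k - UU R m t k) <= ennreal (4 * A * (1/4) ^ m)"
proof (induction j arbitrary: m)
 case 0 thus ?case by (simp add: hsq_zero)
next
 case (Suc j)
 have "hsq 1 (%k. UU R (m + Suc j) t k - UU R m t k)
  = hsq 1 (%k. (UU R (Suc m + j) t k - UU R (Suc m) t k) + (UU R (Suc m) t k - UU R m t k))" by simp
 also have "... <= 2 * ennreal (4 * A * (1/4) ^ Suc m) + 2 * ennreal (A * (1/4) ^ m)"
  by (rule order_trans[OF hsq_add_le]) (intro add_mono mult_lmono Suc.IH A; simp)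
 also have "... = ennreal (2 * (4 * A * (1/4) ^ Suc m) + 2 * (A * (1/4) ^ m))" using A(1) by (intro two_ennreal) auto
 also have "2 * (4 * A * (1/4) ^ Suc m) + 2 * (A * (1/4) ^ m) = 4 * A * (1/4) ^ m" by simp
 finally show ?case .
qed

text \<open>The limit is taken mode by mode as the sum of the increments, which gives measurability
  and \<open>good\<close>. The h^1 estimate passes to it by semicontinuity, and the Lipschitz bound
  of \<open>Phi\<close> identifies it as a fixed point.\<close>

lemma cutoff_solution: assumes R: "R > 0"
 obtains u where "adm u" "Phi R u = u"
proof -
 obtain A where A: "0 <= A" "!!m t. hsq 1 (%k. UU R (Suc m) t k - UU R m t k) <= ennreal (A * (1/4) ^ m)"
  by (rule UU_step[OF R]) blast
 define u where "u = (%t k. suminf (%m. UU R (Suc m) t k - UU R m t k))"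
 have lim: "(%m. UU R m t k) ----> u t k" for t k
 proof -
  have "summable (%m. UU R (Suc m) t k - UU R m t k)"
  proof (rule summable_comparison_test)
  show "\<exists>N. \<forall>n\<ge>N. norm (UU R (Suc n) t k - UU R n t k) <= sqrt A * (1/2) ^ n"
  proof (intro exI allI impI)
  fix n
  have h: "((1/2::real) ^ n)^2 = (1/4) ^ n" by (simp add: power2_eq_square flip: power_mult_distrib)
  have "ennreal ((norm (UU R (Suc n) t k - UU R n t k))^2) <= ennreal (A * (1/4) ^ n)"
  by (rule order_trans[OF hsq_point[of "%k. UU R (Suc n) t k - UU R n t k" k 1] A(2)])
  hence "(norm (UU R (Suc n) t k - UU R n t k))^2 <= A * (1/4) ^ n" using A(1) by (simp add: ennreal_le_iff)
  also have "... = (sqrt A * (1/2) ^ n)^2" using A(1) h by (simp add: power_mult_distrib)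
  finally show "norm (UU R (Suc n) t k - UU R n t k) <= sqrt A * (1/2) ^ n" by (rule power2_le_imp_le) (use A(1) in simp)
  qed
  show "summable (%n. sqrt A * (1/2) ^ n)" by (intro summable_mult summable_geometric) simp
  qed
  hence "(%n. \<Sum>m<n. UU R (Suc m) t k - UU R m t k) ----> u t k" unfolding u_def by (rule summable_LIMSEQ)
  thus ?thesis unfolding sum_lessThan_telescope[of "%m. UU R m t k"] UU.simps(1) diff_zero .
 qed
 have diff: "hsq 1 (%k. u t k - UU R m t k) <= ennreal (4 * A * (1/4) ^ m)" for t m
 proof (rule hsq_1_limit)
  show "(%n. UU R (m + n) t k - UU R m t k) ----> u t k - UU R m t k" for k
  using LIMSEQ_ignore_initial_segment[OF lim[of t k], of m] by (intro tendsto_intros) (simp add: add.commute)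
 qed (use UU_diff[OF A] A(1) in auto)
 have "adm u" unfolding adm_def
 proof (intro conjI allI)
  show "(%t. u t k) : BM" for k by (rule borel_measurable_LIMSEQ_metric[OF admD(1)[OF UU_adm[OF R]] lim])
  show "good (u t)" for t by (rule good_limit[OF lim admD(2)[OF UU_adm[OF R]]])
  show "hsq 1 (u t) < infy" for t using le_less_trans[OF diff[of t 0]] by simp
 qed
 moreover have "Phi R u t k = u t k" for t k
 proof (cases "t : {0..T}")
  case True
  \<comment> \<open>The iterate \<open>Suc m\<close> mediates: it is \<open>Phi\<close> of the
    iterate \<open>m\<close>, hence close to \<open>Phi\<close> of the limit, and it is close to the
    limit itself.\<close>
  have "(norm (Phi R u t k - u t k))^2 <= 2 * (QQ R * (4 * A * T)) * (1/4)^m + 2 * (4 * A * (1/4) ^ Suc m)" for m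
  proof -
  have "hsq 1 (%k. Phi R u t k - UU R (Suc m) t k) <= ennreal (QQ R) * (NI {0..t} (%s. hsq 1 (%k. u s k - UU R m s k)))"
  using Phi_lip[OF R \<open>adm u\<close> UU_adm[OF R, of m] True] by simp
  also have "... <= ennreal (QQ R) * (NI {0..t} (%s. ennreal (4 * A * (1/4) ^ m)))" by (intro mult_lmono nn_time_mono diff) simp
  also have "(NI {0..t} (%s. ennreal (4 * A * (1/4) ^ m))) <= (NI {0..T} (%s. ennreal (4 * A * (1/4) ^ m)))"
  by (rule nn_time_mono_set) (use True in simp)
  also have "... = ennreal (4 * A * (1/4) ^ m) * ennreal T" using T_pos by (simp add: nn_integral_cmult)
  also have "ennreal (QQ R) * (ennreal (4 * A * (1/4) ^ m) * ennreal T) = ennreal (QQ R * (4 * A * (1/4) ^ m * T))"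
  using QQ_pos[of R] A(1) T_pos by (simp add: ennreal_mult)
  finally have 1: "hsq 1 (%k. Phi R u t k - UU R (Suc m) t k) <= ennreal (QQ R * (4 * A * (1/4) ^ m * T))"
  by (simp add: mult_lmono)
  have "ennreal ((norm (Phi R u t k - u t k))^2) <= hsq 1 (%k. Phi R u t k - u t k)" by (rule hsq_point)
  also have "... = hsq 1 (%k. (Phi R u t k - UU R (Suc m) t k) - (u t k - UU R (Suc m) t k))" by simp
  also have "... <= 2 * ennreal (QQ R * (4 * A * (1/4) ^ m * T)) + 2 * ennreal (4 * A * (1/4) ^ Suc m)"
  by (rule order_trans[OF hsq_diff_le]) (intro add_mono mult_lmono 1 diff; simp)
  also have "... = ennreal (2 * (QQ R * (4 * A * (1/4) ^ m * T)) + 2 * (4 * A * (1/4) ^ Suc m))"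
  using A(1) QQ_pos[of R] T_pos by (intro two_ennreal) auto
  finally have "(norm (Phi R u t k - u t k))^2 <= 2 * (QQ R * (4 * A * (1/4) ^ m * T)) + 2 * (4 * A * (1/4) ^ Suc m)"
  using A(1) QQ_pos[of R] T_pos by (subst (asm) ennreal_le_iff) auto
  thus ?thesis by (simp add: mult_ac)
  qed
  moreover have "(%m. 2 * (QQ R * (4 * A * T)) * (1/4)^m + 2 * (4 * A * (1/4) ^ Suc m)) ----> 2 * (QQ R * (4 * A * T)) * 0 + 2 * (4 * A * 0)"
  by (intro tendsto_intros LIMSEQ_Suc LIMSEQ_power_zero) simp_all
  ultimately have "(norm (Phi R u t k - u t k))^2 <= 2 * (QQ R * (4 * A * T)) * 0 + 2 * (4 * A * 0)"
  by (intro LIMSEQ_le_const) auto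
  thus ?thesis by simp
 next
  case False
  have "UU R n t k = 0" for n using False Phi_outside by (cases n) auto
  hence "u t k = 0" by (simp add: u_def del: UU.simps)
  thus ?thesis using Phi_outside[OF False] by simp
 qed
 ultimately show ?thesis by (intro that[of u]) (auto simp: fun_eq_iff)
qed

text \<open>\<open>cm * jap\<close> and \<open>Cm * jap\<close> enclose both energy weights, and
  \<open>Cf\<close> is what Young's inequality leaves of the forcing in
  \<open>energy_rate\<close>.\<close>

definition Cm :: real where "Cm = ND * (1 + a1^2 + a2^2)"
definition cm :: real where "cm = min 1 (min (a1^2) (a2^2))"
definition Cf :: real where "Cf = ND * Cp / (2 * nu)"

lemma Cf_nonneg: "0 <= Cf" using ND_ge_1 Cp_pos nu_pos by (simp add: Cf_def)
lemma cm_pos: "0 < cm" using a1_pos a2_pos by (simp add: cm_def)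
lemma Cm_pos: "0 < Cm" using ND_ge_1 by (simp add: Cm_def add_pos_nonneg)

lemma m_bounds: "m1 k <= Cm * jap k" "cm * jap k <= m1 k" "m2 k <= Cm * jap k" "cm * jap k <= m2 k"
proof -
 have u: "D * (1 + al^2 * (K k)^2) <= Cm * jap k" if "D <= ND" "0 <= D" "al = a1 \<or> al = a2" for D al
 proof -
  have "al^2 <= 1 + a1^2 + a2^2" using that(3) by auto
  hence "al^2 * (K k)^2 <= (1 + a1^2 + a2^2) * (K k)^2" by (rule mult_right_mono) simp
  moreover have "(1 + a1^2 + a2^2) * jap k = (1 + a1^2 + a2^2) + (1 + a1^2 + a2^2) * (K k)^2" by (simp add: jap_def distrib_left)
  ultimately have "1 + al^2 * (K k)^2 <= (1 + a1^2 + a2^2) * jap k" using zero_le_power2[of a1] zero_le_power2[of a2] by linarith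
  thus ?thesis unfolding Cm_def mult.assoc using that(1,2) ND_ge_1 by (intro mult_mono) auto
 qed
 have l: "cm * jap k <= D * (1 + al^2 * (K k)^2)" if "1 <= D" "al = a1 \<or> al = a2" for D al
 proof -
  have "cm * (K k)^2 <= al^2 * (K k)^2" using that(2) by (intro mult_right_mono) (auto simp: cm_def)
  moreover have "cm <= 1" by (simp add: cm_def)
  ultimately have "cm * jap k <= 1 * (1 + al^2 * (K k)^2)" by (simp add: jap_def distrib_left)
  also have "... <= D * (1 + al^2 * (K k)^2)" using that(1) by (intro mult_right_mono) auto
  finally show ?thesis .
 qed
 have m: "m1 k = Dsym a1 N1 k * (1 + a1^2 * (K k)^2)" "m2 k = Dsym a2 N2 k * (1 + a2^2 * (K k)^2)"
  by (simp_all add: m1_def m2_def gsym_def)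
 show "m1 k <= Cm * jap k" "cm * jap k <= m1 k" "m2 k <= Cm * jap k" "cm * jap k <= m2 k"
  unfolding m using Dsym_abs[of k] Dsym_ge_1[of a1 N1 k] Dsym_ge_1[of a2 N2 k] by (intro u l; simp)+
qed

lemma Mw_norm: "norm (Mw k z) <= Cm * jap k * norm z"
proof -
 have m: "0 <= m1 k" "0 <= m2 k" "0 <= Cm * jap k" using m_bounds(2,4)[of k] cm_pos Cm_pos jap_pos[of k] by (simp_all add: order_trans[rotated])
 have "(norm (Mw k z))^2 = (m1 k * norm (fst z))^2 + (m2 k * norm (snd z))^2" using m by (simp add: Mw_def norm_prod_def)
 also have "... <= (Cm * jap k * norm (fst z))^2 + (Cm * jap k * norm (snd z))^2"
  using m by (intro add_mono power_mono mult_right_mono m_bounds) auto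
 also have "... = (Cm * jap k * norm z)^2" by (simp add: norm_prod_def power_mult_distrib distrib_left)
 finally show ?thesis by (rule power2_le_imp_le) (use m in simp)
qed

lemma Mw_coercive: "cm * (jap k * (norm z)^2) <= z <.> Mw k z"
proof -
 have "cm * (jap k * (norm z)^2) = cm * jap k * (norm (fst z))^2 + cm * jap k * (norm (snd z))^2"
  by (simp add: norm_prod_def distrib_left mult.assoc)
 also have "... <= m1 k * (norm (fst z))^2 + m2 k * (norm (snd z))^2" by (intro add_mono mult_right_mono m_bounds) auto
 also have "... = z <.> Mw k z" by (simp add: Mw_def inner_prod_def power2_norm_eq_inner)
 finally show ?thesis .
qed

lemma Mw_bounded_linear: "bounded_linear (Mw k)" unfolding Mw_def[abs_def]
 by (intro bounded_linear_Pair bounded_linear_compose[OF bounded_linear_scaleR_right] bounded_linear_fst bounded_linear_snd)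

lemma Mw_sym: "x <.> Mw k y = Mw k x <.> y" by (simp add: Mw_def inner_prod_def)

lemma Mw_inner_bound: "\<bar>Mw k x <.> y\<bar> <= Cm * (jap k * (norm x)^2) + Cm * (jap k * (norm y)^2)"
proof -
 have p: "0 <= Cm * jap k" using Cm_pos jap_pos[of k] by simp
 have "\<bar>Mw k x <.> y\<bar> <= norm (Mw k x) * norm y" by (rule Cauchy_Schwarz_ineq2)
 also have "... <= (Cm * jap k) * norm x * norm y" by (rule mult_right_mono[OF Mw_norm]) simp
 also have "... = (Cm * jap k) * (norm x * norm y)" by (simp add: mult.assoc)
 also have "... <= (Cm * jap k) * ((norm x)^2 + (norm y)^2)"
 proof (rule mult_lmono[OF _ p])
  have "0 <= norm x * norm y" by simp
  thus "norm x * norm y <= (norm x)^2 + (norm y)^2" using sum_squares_bound[of "norm x" "norm y"] by linarith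
 qed
 finally show ?thesis by (simp add: distrib_left mult.assoc)
qed

text \<open>The forcing meets the weight as \<open>m1 * gsym = D\<close>, so Young's inequality
  against the dissipation \<open>m1 * nu * K^2\<close> leaves
  \<open>D * gsym / (2 * nu * K^2)\<close>, bounded by \<open>Cf\<close> through the Poincare
  inequality. The magnetic dissipation has a favourable sign.\<close>

lemma energy_rate: assumes "k = 0 ==> z = 0"
 shows "(- Lam k z + (n + (gsym a1 k *R p, 0))) <.> Mw k z + z <.> Mw k (- Lam k z + (n + (gsym a1 k *R p, 0)))
  <= 2 * (Mw k z <.> n) + Cf * (norm p)^2"
proof (cases "k = 0")
 case True
 have "Lam k 0 = 0" "Mw k 0 = 0" by (simp_all add: Lam_def Mw_def zero_prod_def)
 moreover have "0 <= Cf" using ND_ge_1 Cp_pos nu_pos by (simp add: Cf_def)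
 ultimately show ?thesis using assms True by simp
next
 case False
 define D where "D = Dsym a1 N1 k"
 define M where "M = m1 k * nu * (K k)^2"
 have K: "0 < (K k)^2" using K_pos[OF False] by simp
 have D: "1 <= D" "D <= ND" using Dsym_ge_1[of a1 N1 k] Dsym_abs(1)[of k] by (simp_all add: D_def)
 have m: "0 < m1 k" "0 < m2 k" using m_bounds(2,4)[of k] mult_pos_pos[OF cm_pos jap_pos[of k]] by linarith+
 have M: "0 < M" using m(1) nu_pos K by (simp add: M_def)
 have g: "m1 k * gsym a1 k = D" by (simp add: m_gsym D_def)
 define a where "a = norm (fst z)"
 have "(- Lam k z + (n + (gsym a1 k *R p, 0))) <.> Mw k z + z <.> Mw k (- Lam k z + (n + (gsym a1 k *R p, 0)))
  = 2 * (Mw k z <.> n) + 2 * (Mw k z <.> (gsym a1 k *R p, 0)) - 2 * (Mw k z <.> Lam k z)"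
  unfolding Mw_sym[of z] inner_commute[of _ "Mw k z"] by (simp add: inner_diff_right inner_add_right)
 moreover have "Mw k z <.> Lam k z \<ge> M * a^2"
  using m(2) mu_pos by (simp add: Mw_def Lam_def inner_prod_def M_def a_def power2_norm_eq_inner mult_ac)
 moreover have "Mw k z <.> (gsym a1 k *R p, 0) <= D * (a * norm p)"
 proof -
  have "Mw k z <.> (gsym a1 k *R p, 0) = D * (fst z <.> p)" by (simp add: Mw_def inner_prod_def g[symmetric])
  also have "... <= D * (a * norm p)" unfolding a_def using D by (intro mult_lmono norm_cauchy_schwarz) auto
  finally show ?thesis .
 qed
 moreover have "2 * (D * (a * norm p)) <= 2 * (M * a^2) + Cf * (norm p)^2"
 proof -
  have "0 <= (2 * M * a - D * norm p)^2" by simp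
  hence "2 * M * (2 * (D * (a * norm p))) <= 2 * M * (2 * (M * a^2) + D^2 / (2 * M) * (norm p)^2)"
  using M by (simp add: power2_eq_square algebra_simps)
  hence "2 * (D * (a * norm p)) <= 2 * (M * a^2) + D^2 / (2 * M) * (norm p)^2"
  using M by (simp only: mult_le_cancel_left_pos[of "2 * M"] mult_pos_pos zero_less_numeral)
  moreover have "D^2 / (2 * M) * (norm p)^2 <= Cf * (norm p)^2"
  proof (rule mult_right_mono)
  have "D^2 / (2 * M) = D * gsym a1 k / (2 * nu * (K k)^2)"
  using m(1) nu_pos K unfolding M_def power2_eq_square[of D] by (simp add: g[symmetric] field_simps)
  also have "... <= ND * 1 / (2 * nu * (K k)^2)"
  using D gsym_le_1[of a1 k] gsym_pos[of a1 k] nu_pos K by (intro divide_right_mono mult_mono) auto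
  also have "... <= ND * (Cp * (K k)^2) / (2 * nu * (K k)^2)"
  using jap_le_K2[OF False] jap_ge_1[of k] ND_ge_1 nu_pos K by (intro divide_right_mono mult_lmono) auto
  also have "... = Cf" using K by (simp add: Cf_def)
  finally show "D^2 / (2 * M) <= Cf" .
  qed simp
  ultimately show ?thesis by linarith
 qed
 ultimately show ?thesis by linarith
qed

text \<open>The initial energy plus the contribution of the forcing, converted to the h^1 norm by
  \<open>cm\<close>. It does not involve \<open>R\<close>, which is the gain from the
  cancellation.\<close>

definition EE :: real where
 "EE = ((LINT k|cs. u0 k <.> Mw k (u0 k)) + Cf * (LINT k|cs. (LBINT s:{0..T}. (norm (ph s k))^2))) / cm"

lemma Mw_integrable: assumes "hsq 1 a < infy" shows "integrable cs (%k. a k <.> Mw k (a k))"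
proof (rule bochnerI_bound)
 show "integrable cs (%k. Cm * (jap k * (norm (a k))^2) + Cm * (jap k * (norm (a k))^2))"
  using hsq_0_integrable[OF assms] unfolding power_one_right by (intro bochnerI_add integrable_mult_right)
 show "AE k in cs. norm (a k <.> Mw k (a k)) <= norm (Cm * (jap k * (norm (a k))^2) + Cm * (jap k * (norm (a k))^2))"
  unfolding Mw_sym real_norm_def by (intro AE_I2 order_trans[OF Mw_inner_bound abs_ge_self])
qed simp

text \<open>The balance of each mode is integrated in time and then summed. The nonlinear
  contributions cancel only in the sum over the modes, so sum and time integral are exchanged, which
  asks for absolute summability.\<close>

lemma energy_bound: assumes R: "R > 0" and u: "adm u" "Phi R u = u" and t: "t : {0..T}" shows "hsq 1 (u t) <= ennreal EE"
proof -
 have s: "sol u0 (BB R u) u" using Phi_sol[OF R u(1)] u(2) by simp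
 have z: "u s 0 = 0" for s by (rule good_zero[OF admD(2)[OF u(1)]])
 have sub: "{0..t} \<subseteq> {0..T}" using t by auto
 define f where "f = (%s k. indicator {0..t} s * (2 * (Mw k (u s k) <.> NN (PP R (u s)) k)))"
 define Ph where "Ph = (%k. LBINT s:{0..T}. (norm (ph s k))^2)"
 have mN: "(%s. NN (PP R (u s)) k) : BM" for k by (intro NN_measurable PP_measurable admD(1)[OF u(1)])
 have mM: "(%s. Mw k (u s k)) : BM" for k
  by (rule m_comp[OF admD(1)[OF u(1)] bm_cont[OF linear_continuous_on[OF Mw_bounded_linear]]])
 have fm: "(%s. f s k) : BM" for k unfolding f_def using mN[of k] mM[of k] by measurable
 \<comment> \<open>\<open>Z\<close> depends on \<open>R\<close>, but it serves only to justify the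
   exchange and does not enter the final bound.\<close>
 have fin: "(LN s. (SN k. ennreal \<bar>f s k\<bar>)) < infy"
 proof -
  define Z where "Z = ennreal (2 * Cm) * MM 0 R + ennreal (2 * Cm) * (CN * (ennreal (R^2) * ennreal (R^2)))"
  have Z: "Z < infy" unfolding Z_def using MM_finite[of 0 R] CN_finite by (simp add: mult_lt_top)
  have "(SN k. ennreal \<bar>f s k\<bar>) <= Z * indicator {0..t} s" for s
  proof (cases "s : {0..t}")
  case True
  have Cm2: "0 <= 2 * Cm" using Cm_pos by simp
  have "(SN k. ennreal \<bar>f s k\<bar>) <= (SN k. ennreal (2 * Cm) * ennreal (jap k ^ 1 * (norm (u s k))^2) + ennreal (2 * Cm) * ennreal (jap k ^ 1 * (norm (NN (PP R (u s)) k))^2))"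
  proof (rule nn_integral_mono)
  fix k
  have j: "0 <= jap k ^ 1 * (norm x)^2" for x :: mode using jap_pos[of k] by simp
  have "\<bar>f s k\<bar> <= 2 * Cm * (jap k ^ 1 * (norm (u s k))^2) + 2 * Cm * (jap k ^ 1 * (norm (NN (PP R (u s)) k))^2)"
  using True Mw_inner_bound[of k "u s k" "NN (PP R (u s)) k"] by (simp add: f_def abs_mult)
  hence "ennreal \<bar>f s k\<bar> <= ennreal (2 * Cm * (jap k ^ 1 * (norm (u s k))^2) + 2 * Cm * (jap k ^ 1 * (norm (NN (PP R (u s)) k))^2))" by (rule ennreal_leI)
  also have "... = ennreal (2 * Cm) * ennreal (jap k ^ 1 * (norm (u s k))^2) + ennreal (2 * Cm) * ennreal (jap k ^ 1 * (norm (NN (PP R (u s)) k))^2)"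
  using Cm2 j by (simp only: ennreal_plus mult_nonneg_nonneg ennreal_mult)
  finally show "ennreal \<bar>f s k\<bar> <= ennreal (2 * Cm) * ennreal (jap k ^ 1 * (norm (u s k))^2) + ennreal (2 * Cm) * ennreal (jap k ^ 1 * (norm (NN (PP R (u s)) k))^2)" .
  qed
  also have "... = ennreal (2 * Cm) * hsq 1 (u s) + ennreal (2 * Cm) * hsq 1 (NN (PP R (u s)))"
  unfolding hsq_def by (simp add: nn_integral_add nn_integral_cmult)
  also have "... <= Z" unfolding Z_def using Phi_hsq[OF R u(1), of 0 s] unfolding u(2)
  by (intro add_mono mult_lmono NN_PP_bound R admD(3)[OF u(1)]) simp_all
  finally show ?thesis using True by simp
  qed (simp add: f_def)
  hence "(LN s. (SN k. ennreal \<bar>f s k\<bar>)) <= (NI {0..t} (%s. Z))" by (rule nn_integral_mono)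
  also have "... = Z * ennreal t" using t by (simp add: nn_integral_cmult)
  also have "... < infy" using Z by (simp add: mult_lt_top)
  finally show ?thesis .
 qed
 note fi = time_sum_swap[OF fm fin]
 \<comment> \<open>At each time the sum over the modes is the trilinear form that cancels.\<close>
 have f0: "(LINT k|cs. (LINT s|lborel. f s k)) = 0"
 proof -
  have "(LINT k|cs. f s k) = 0" for s unfolding f_def using energy_cancel_PP[OF R admD(2)[OF u(1)] admD(3)[OF u(1)]] by simp
  thus ?thesis unfolding fi(3) by simp
 qed
 have phi_i: "SI {0..T} (%s. (norm (ph s k))^2)" for k by (rule nn_time_si(1)[OF ph_meas ph_L2])
 have Ph_i: "integrable cs Ph"
 proof (rule int_cs_nn[THEN iffD2])
  show p: "0 <= Ph k" for k unfolding Ph_def sli_def by (intro bochner_nonneg) simp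
  have "ennreal (Ph k) = (NI {0..T} (%s. ennreal (jap k ^ 0 * (norm (ph s k))^2)))" for k
  using phi_i[of k] unfolding Ph_def sli_def si_def
  by (subst nn_integral_eq_integral[symmetric]) (auto intro!: nn_integral_cong simp: indicator_def)
  thus "(SN k. ennreal (Ph k)) < infy" using nn_time_swap[of ph 0 T, OF ph_meas] ph_L2 by simp
 qed
 \<comment> \<open>The form \<open>x <.> Mw k y\<close> is bounded bilinear, so the product rule
   gives the balance of the mode, and \<open>energy_rate\<close> bounds its integrand.\<close>
 have mode: "u t k <.> Mw k (u t k) <= u0 k <.> Mw k (u0 k) + ((LINT s|lborel. f s k) + Cf * Ph k)" for k
 proof -
  let ?d = "%s. - Lam k (u s k) + BB R u s k"
  have bb: "bounded_bilinear (%x y. x <.> Mw k y)"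
  by (rule bounded_bilinear.comp[OF bounded_bilinear_inner bounded_linear_ident Mw_bounded_linear])
  have c: "u t k = u0 k + (LBINT s:{0..t}. ?d s)" if "t : {0..T}" for t by (rule solD(2)[OF s that])
  note pr = ac_product_rule[OF bb solD(1)[OF s, of k] solD(1)[OF s, of k] c c t]
  have i1: "SI {0..t} (%s. 2 * (Mw k (u s k) <.> NN (PP R (u s)) k))" using fi(1)[of k] by (simp add: si_def f_def)
  have i2: "SI {0..t} (%s. Cf * (norm (ph s k))^2)"
  using si_subset[OF phi_i[of k] _ sub] by (intro set_integrable_mult_right) simp
  have "(LBINT s:{0..t}. ?d s <.> Mw k (u s k) + u s k <.> Mw k (?d s))
  <= (LBINT s:{0..t}. 2 * (Mw k (u s k) <.> NN (PP R (u s)) k) + Cf * (norm (ph s k))^2)"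
  by (rule set_integral_mono[OF pr(1) set_integral_add(1)[OF i1 i2]])
  (assumption, assumption, unfold BB_def Ff_def, rule energy_rate, simp add: z)
  also have "... = (LINT s|lborel. f s k) + Cf * (LBINT s:{0..t}. (norm (ph s k))^2)"
  unfolding set_integral_add(2)[OF i1 i2] by (simp add: sli_def f_def mult.left_commute[of "indicator _ _" 2])
  also have "(LBINT s:{0..t}. (norm (ph s k))^2) <= Ph k" unfolding Ph_def sli_def
  using si_subset[OF phi_i[of k] _ sub] phi_i[of k] sub by (intro bochner_mono) (auto simp: si_def indicator_def)
  finally have i: "(LBINT s:{0..t}. ?d s <.> Mw k (u s k) + u s k <.> Mw k (?d s)) <= (LINT s|lborel. f s k) + Cf * Ph k"
  using Cf_nonneg by (simp add: mult_lmono)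
  have "u t k <.> Mw k (u t k) = u0 k <.> Mw k (u0 k) + (LBINT s:{0..t}. ?d s <.> Mw k (u s k) + u s k <.> Mw k (?d s))"
  by (rule pr(2))
  with i show ?thesis by linarith
 qed
 have u0f: "hsq 1 u0 < infy" by (rule le_less_trans[OF hsq_mono_s u0_h2]) simp
 note ui = admD(3)[OF u(1), of t]
 have "(LINT k|cs. cm * (jap k ^ 1 * (norm (u t k))^2)) <= (LINT k|cs. u0 k <.> Mw k (u0 k) + ((LINT s|lborel. f s k) + Cf * Ph k))"
 proof (rule bochner_mono)
  show "integrable cs (%k. cm * (jap k ^ 1 * (norm (u t k))^2))" using hsq_0_integrable[OF ui] by simp
  show "integrable cs (%k. u0 k <.> Mw k (u0 k) + ((LINT s|lborel. f s k) + Cf * Ph k))"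
  by (intro bochnerI_add Mw_integrable[OF u0f] fi(2) integrable_mult_right Ph_i)
  show "cm * (jap k ^ 1 * (norm (u t k))^2) <= u0 k <.> Mw k (u0 k) + ((LINT s|lborel. f s k) + Cf * Ph k)" for k
  using Mw_coercive[of k "u t k"] mode[of k] by simp
 qed
 also have "... = (LINT k|cs. u0 k <.> Mw k (u0 k)) + Cf * (LINT k|cs. Ph k)" using Mw_integrable[OF u0f] fi(2) Ph_i f0 by simp
 finally have "(LINT k|cs. jap k ^ 1 * (norm (u t k))^2) <= EE"
  using cm_pos by (simp add: EE_def Ph_def pos_le_divide_eq mult.commute)
 hence "enn2real (hsq 1 (u t)) <= EE" unfolding enn2real_hsq[OF ui] .
 thus ?thesis using ui by (metis ennreal_enn2real ennreal_leI infinity_ennreal_def)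
qed

lemma solution_exists:
 obtains u Bd where "!!k. (%t. u t k) : BM" "!!t. good (u t)" "0 <= Bd" "!!t. hsq 2 (u t) <= ennreal Bd"
  "sol u0 (%s k. NN (u s) k + Ff s k) u"
proof -
 \<comment> \<open>Exceeds the square root of the energy bound, which is the same for every radius;
   hence \<open>lam\<close> equals \<open>1\<close> along the solution.\<close>
 define R where "R = 1 + sqrt (max EE 0)"
 have R: "R > 0" by (simp add: R_def add_pos_nonneg)
 obtain u where u: "adm u" "Phi R u = u" by (rule cutoff_solution[OF R]) blast
 have "hn (u t) <= R" for t
 proof (cases "t : {0..T}")
  case True
  have "hsq 1 (u t) <= ennreal (max EE 0)" using energy_bound[OF R u True] by (rule order_trans) (simp add: ennreal_leI)
  hence "enn2real (hsq 1 (u t)) <= max EE 0" by (intro enn2real_leI) auto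
  hence "hn (u t) <= sqrt (max EE 0)" unfolding hn_def by (rule real_sqrt_le_mono)
  thus ?thesis by (simp add: R_def)
 next
  case False
  hence "u t = (%k. 0)" using Phi_outside[OF False, of R u] u(2) by simp
  thus ?thesis using R by (simp add: hn_def hsq_zero)
 qed
 hence "PP R (u t) = u t" for t by (simp add: PP_def fun_eq_iff lam_def)
 hence "sol u0 (%s k. NN (u s) k + Ff s k) u" using Phi_sol[OF R u(1)] unfolding u(2) by (simp add: BB_def[abs_def])
 moreover have "hsq 2 (u t) <= ennreal (enn2real (MM 1 R))" for t
  using Phi_hsq[OF R u(1), of 1 t] MM_finite[of 1 R] unfolding u(2) by (simp add: numeral_2_eq_2)
 ultimately show ?thesis by (intro that[of u "enn2real (MM 1 R)"]) (use admD[OF u(1)] in auto)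
qed

end

section \<open>Time-dependent fields and their coefficients\<close>

lemma lebesgue_set_integral:
 fixes g G :: "real => 'a::euclidean_space"
 assumes e: "AE t in lborel. t : A --> g t = G t" and G: "G : BM" and A: "A : sets borel"
 shows "set_integrable lebesgue A g <-> SI A G" and "(LINT t:A|lebesgue. g t) = (LINT t:A|lborel. G t)"
proof -
 let ?F = "%t. indicator A t *R G t" and ?f = "%t. indicator A t *R g t"
 have F: "?F : BMs lborel" using G A by simp
 have FL: "?F : BMs lebesgue" by (rule measurable_completion[OF F])
 have ae: "AE t in lebesgue. ?F t = ?f t" unfolding AE_completion_iff using e by eventually_elim (auto simp: indicator_def)
 have fL: "?f : BMs lebesgue" by (rule borel_measurable_AE[OF FL ae])
 show "set_integrable lebesgue A g <-> SI A G"
  unfolding si_def integrable_cong_AE[OF FL fL ae, symmetric] by (rule integrable_completion[OF F])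
 show "(LINT t:A|lebesgue. g t) = (LINT t:A|lborel. G t)"
  unfolding sli_def integral_cong_AE[OF FL fL ae, symmetric] by (rule integral_completion[OF F])
qed

lemma vec_nth_integral:
 fixes f :: "'t => 'a::euclidean_space^3"
 assumes "integrable M f" shows "integrable M (%t. f t $ i)" "(LINT t|M. f t) $ i = (LINT t|M. f t $ i)"
 using integrable_bounded_linear[OF bounded_linear_vec_nth assms] integral_bounded_linear[OF bounded_linear_vec_nth assms, of i] by auto

context mhd begin

lemma tm_sigma: "sigma_finite_measure tm" by (rule finite_measure.axioms(1)[OF finite_tm])

lemma joint_tm:
 fixes g :: "'t::second_countable_topology \<times> (real^3) => 'b::topological_space" assumes "g : BM"
 shows "g : BMs (borel <*M> tm)"
proof -
 have "(%p::'t \<times> (real^3). (fst p, snd p)) : measurable (borel <*M> tm) (borel <*M> borel)"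
  by (intro measurable_Pair measurable_fst m_comp[OF measurable_snd m_tm] measurable_ident_sets refl)
 from m_comp[OF this[unfolded borel_prod] assms] show ?thesis by simp
qed

lemma joint_ltm:
 fixes g :: "real \<times> (real^3) => 'b::topological_space" assumes "g : BM" shows "g : BMs (lborel <*M> tm)"
proof -
 have "sets (lborel <*M> tm) = sets ((borel :: real measure) <*M> tm)" by (rule sets_pair_measure_cong) simp_all
 thus ?thesis using joint_tm[OF assms] by (subst measurable_cong_sets) auto
qed

text \<open>For a fixed cut-off the partial sums are jointly measurable; the cut-off index takes
  countably many values and depends measurably on \<open>t\<close>, so inserting it keeps joint
  measurability.\<close>

lemma rf_joint: assumes c: "!!k. (%t. c t k) : BMs M" shows "(%p. rf (c (fst p)) (snd p)) : BMs (M <*M> borel)" unfolding rf_def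
proof (rule borel_measurable_lim_metric)
 fix j
 have t: "(%t. tail2 n (c t)) : BMs M" for n unfolding tail2_def by (rule bm_cs_integral)
  (rule cs_joint, use c in measurable)
 have N: "(%t. cutN j (c t)) : measurable M (count_space UNIV)"
  unfolding cutN_def by (rule measurable_Least) (use t in measurable)
 have ps: "(%p. ps (modes n) (c (fst p)) (snd p)) : BMs (M <*M> borel)" for n unfolding ps_def
  by (intro borel_measurable_sum borel_measurable_times m_comp[OF measurable_fst c]
  m_comp[OF measurable_snd ch_measurable])
 show "(%p. ps (modes (cutN j (c (fst p)))) (c (fst p)) (snd p)) : BMs (M <*M> borel)"
  by (rule measurable_compose_countable[OF ps m_comp[OF measurable_fst N]])
qed

lemma rr_joint: assumes "!!k. (%t. c t k) : BMs (borel :: real measure)" shows "(%p. rr (c (fst p)) (snd p)) : BM"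
 unfolding rr_def borel_prod[symmetric] by (rule m_comp[OF rf_joint[OF assms] borel_measurable_Re])

lemma rr_periodic: "periodic L (rr c)" using rf_periodic[of c] unfolding periodic_def rr_def by simp

lemma L2_nn: assumes "f : L2_torus L" shows "(TN x. ennreal ((f x)^2)) = ennreal (L ^ 3) * hsq 0 (ft f)"
proof -
 note p = torus_parseval[OF assms assms]
 have f: "hsq 0 (ft f) < infy" by (rule ft_hsq0[OF assms])
 have "(TN x. ennreal ((f x)^2)) = ennreal (LINT x|tm. f x * f x)"
  by (subst nn_integral_eq_integral[symmetric]) (use p(1) in \<open>auto simp: power2_eq_square\<close>)
 also have "... = ennreal (L ^ 3 * enn2real (hsq 0 (ft f)))" unfolding p(2) enn2real_hsq[OF f] by (simp add: power2_norm_eq_inner)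
 finally show ?thesis using f L3_pos by (simp add: ennreal_mult less_imp_le)
qed

lemma L1_le_L2:
 assumes "f : L2_torus L" shows "(TN x. ennreal \<bar>f x\<bar>) <= ennreal (L ^ 3) + ennreal (L ^ 3) * hsq 0 (ft f)"
proof -
 have m: "f : BMs tm" using assms by (intro m_tm) (simp add: L2_torus_def)
 have "(TN x. ennreal \<bar>f x\<bar>) <= (TN x. 1 + ennreal ((f x)^2))"
 proof (rule nn_integral_mono)
  fix x
  have "\<bar>f x\<bar> <= 1 + (f x)^2" using sum_squares_bound[of 1 "\<bar>f x\<bar>"] abs_ge_zero[of "f x"] by simp
  hence "ennreal \<bar>f x\<bar> <= ennreal (1 + (f x)^2)" by (rule ennreal_leI)
  thus "ennreal \<bar>f x\<bar> <= 1 + ennreal ((f x)^2)" by (simp add: ennreal_plus)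
 qed
 also have "... = emeasure tm (space tm) + (TN x. ennreal ((f x)^2))" using m by (subst nn_integral_add) auto
 finally show ?thesis unfolding emeasure_tm L2_nn[OF assms] .
qed

lemma vft_diff: "vL2 v ==> vL2 w ==> vft (%x. v x - w x) k = vft v k - vft w k" by (simp add: vec_eq_iff ft_diff vL2_def)

lemma vL2_diff: "vL2 v ==> vL2 w ==> vL2 (%x. v x - w x)" by (simp add: vL2_def L2_torus_diff)

lemma vft_unique: assumes "vL2 v" "vL2 w" "!!k. vft v k = vft w k" shows "AE x in lborel. v x = w x"
proof -
 have "AE x in lborel. v x $ i = w x $ i" for i
  by (rule ft_unique) (use assms in \<open>auto simp: vL2_def vft_def vec_eq_iff intro: L2_imp_L1\<close>)
 hence "AE x in lborel. \<forall>i. v x $ i = w x $ i" by (simp add: AE_all_countable)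
 thus ?thesis by eventually_elim (simp add: vec_eq_iff)
qed

definition vrr :: "(int^3 => complex^3) => real^3 => real^3" where "vrr c x = (\<chi> i. rr (%k. c k $ i) x)"

lemma vrr_L2: assumes h: "herm c" and c: "hsq 0 c < infy" shows "vL2 (vrr c)" "vft (vrr c) k = c k"
proof -
 note r = rr_L2[of "%k. c k $ i" for i, OF _ le_less_trans[OF hsq_comp_le c]]
 show "vL2 (vrr c)" "vft (vrr c) k = c k" using r h by (auto simp: vL2_def vrr_def herm_def vec_eq_iff)
qed

lemma vrr_joint: assumes "!!k. (%t. c t k) : BMs (borel :: real measure)" shows "(%p. vrr (c (fst p)) (snd p)) : BM"
 by (rule vec3_measurable) (simp add: vrr_def, rule rr_joint, rule m_comp[OF assms bm_nth])

lemma ksq_measurable: assumes [measurable]: "!!k. (%t. a t k) : BMs M" shows "(%t. ksq s (a t)) : BMs M" unfolding ksq_def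
 by (rule sigma_finite_measure.borel_measurable_nn_integral[OF sigma_finite_measure_count_space])
  (rule cs_joint, measurable)

text \<open>Cut to \<open>[0, T]\<close>, the interval on which the fields are jointly measurable,
  so that the coefficients are Borel functions on the whole line.\<close>

definition sc :: "(real => real^3 => real) => real => int^3 => complex" where
 "sc u t k = indicator {0..T} t *R ft (u t) k"

definition vc :: "(real => real^3 => real^3) => real => int^3 => complex^3" where
 "vc u t k = indicator {0..T} t *R vft (u t) k"

lemma vc_nth: "vc u t k $ i = sc (%t x. u t x $ i) t k" by (simp add: vc_def sc_def)

lemma vc_in: "t : {0..T} ==> vc u t = vft (u t)" and vc_out: "t \<notin> {0..T} ==> vc u t = (%k. 0)"
 by (simp_all add: vc_def fun_eq_iff)

lemma sc_in: "t : {0..T} ==> sc u t = ft (u t)" and sc_out: "t \<notin> {0..T} ==> sc u t = (%k. 0)"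
 by (simp_all add: sc_def fun_eq_iff)

lemma vc_herm: "herm (vc u t)" by (simp add: vc_nth sc_def herm_def ft_minus)

lemma jm_iff: "jointly_measurable T u <-> (%p. indicator {0..T} (fst p) *R u (fst p) (snd p)) : BM"
proof -
 have "indicator ({0..T} \<times> UNIV) p = (indicator {0..T} (fst p) :: real)" for p :: "real \<times> (real^3)" by (cases p) (simp add: indicator_def)
 thus ?thesis by (simp add: jointly_measurable_def set_borel_measurable_def)
qed

lemma jm_nth: assumes "jointly_measurable T (u :: real => real^3 => real^3)" shows "jointly_measurable T (%t x. u t x $ i)"
 using m_comp[OF assms[unfolded jm_iff] bm_nth[of i]] unfolding jm_iff by simp

lemma sc_measurable: assumes "jointly_measurable T u" shows "(%t. sc u t k) : BM"
proof -
 let ?g = "%p. complex_of_real (indicator {0..T} (fst p) *R u (fst p) (snd p)) * cnj (ch k (snd p))"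
 have g: "?g : BM" by (intro borel_measurable_times m_comp[OF assms[unfolded jm_iff] borel_measurable_of_real]
  cnj_measurable m_comp[OF _ ch_measurable] bm_cont continuous_intros)
 have "(%t. (LINT x|tm. complex_of_real (indicator {0..T} t *R u t x) * cnj (ch k x)) / of_real (L ^ 3)) : BM"
  by (intro borel_measurable_divide borel_measurable_const sigma_finite_measure.borel_measurable_lebesgue_integral[OF tm_sigma])
  (use joint_tm[OF g] in \<open>simp add: split_beta'\<close>)
 moreover have "(LINT x|tm. complex_of_real (indicator {0..T} t *R u t x) * cnj (ch k x)) / of_real (L ^ 3) = sc u t k" for t
  unfolding sc_def ft_cf cf_def by (cases "t : {0..T}") simp_all
 ultimately show ?thesis by simp
qed

lemma vc_measurable: assumes "!!i. jointly_measurable T (%t x. u t x $ i)" shows "(%t. vc u t k) : BM"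
 by (rule vec3_measurable) (unfold vc_nth, rule sc_measurable[OF assms])

text \<open>The coefficient side of \<open>L2_time\<close>: Borel modes and the measure
  \<open>lborel\<close> in place of the completed measure.\<close>

definition L2h :: "nat => (real => int^3 => 'v::{real_normed_vector,second_countable_topology}) => bool" where
 "L2h s a <-> (\<forall>k. (%t. a t k) : BM) & (NI {0..T} (%t. hsq s (a t))) < infy"

lemma L2hD: "L2h s a ==> (%t. a t k) : BM" "L2h s a ==> (NI {0..T} (%t. hsq s (a t))) < infy" unfolding L2h_def by blast+

lemma L2h_AE: assumes "L2h s a" shows "AET t. hsq s (a t) < infy"
proof -
 have "AE t in lborel. hsq s (a t) * indicator {0..T} t ~= \<infinity>"
  by (rule nn_integral_PInf_AE) (use hsq_measurable[of a borel s, OF L2hD(1)[OF assms]] L2hD(2)[OF assms] in auto)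
 thus ?thesis by eventually_elim (auto simp: less_top)
qed

lemma L2h_scaled: assumes b: "!!k. (%t. b t k) : BM" and le: "AET t. hsq r (b t) <= ennreal C * hsq s (a t)" and a: "L2h s a"
 shows "L2h r b"
proof -
 have m: "(%t. hsq s (a t)) : BM" by (rule hsq_measurable[OF L2hD(1)[OF a]])
 have "(NI {0..T} (%t. hsq r (b t))) <= (LN t. ennreal C * (hsq s (a t) * indicator {0..T} t))"
 proof (rule nn_integral_mono_AE)
  show "AE t in lborel. hsq r (b t) * indicator {0..T} t <= ennreal C * (hsq s (a t) * indicator {0..T} t)"
  using le by eventually_elim (auto simp: indicator_def)
 qed
 also have "... = ennreal C * (NI {0..T} (%t. hsq s (a t)))" using m by (intro nn_integral_cmult) simp
 also have "... < infy" using L2hD(2)[OF a] by (simp add: mult_lt_top)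
 finally show ?thesis using b by (simp add: L2h_def)
qed

lemma L2h_bounded: assumes b: "!!k. (%t. b t k) : BM" and le: "!!t. hsq r (b t) <= B" and B: "B < infy" shows "L2h r b"
proof -
 have "(NI {0..T} (%t. hsq r (b t))) <= (NI {0..T} (%t. B))" by (intro nn_integral_mono mult_right_mono le) simp
 also have "... = B * ennreal T" using T_pos by (simp add: nn_integral_cmult)
 also have "... < infy" using B by (simp add: mult_lt_top)
 finally show ?thesis using b by (simp add: L2h_def)
qed

lemma L2h_add: assumes a: "L2h s a" and b: "L2h s b" shows "L2h s (%t k. a t k + b t k)"
proof -
 have m: "(%t. hsq s (a t)) : BM" "(%t. hsq s (b t)) : BM"
  by (rule hsq_measurable[OF L2hD(1)[OF a]], rule hsq_measurable[OF L2hD(1)[OF b]])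
 have "(NI {0..T} (%t. hsq s (%k. a t k + b t k)))
  <= (LN t. 2 * (hsq s (a t) * indicator {0..T} t) + 2 * (hsq s (b t) * indicator {0..T} t))"
  by (intro nn_integral_mono) (use hsq_add_le[of s] in \<open>auto simp: indicator_def\<close>)
 also have "... = 2 * (NI {0..T} (%t. hsq s (a t))) + 2 * (NI {0..T} (%t. hsq s (b t)))"
  using m by (subst nn_integral_add) (simp_all add: nn_integral_cmult)
 also have "... < infy" using L2hD(2)[OF a] L2hD(2)[OF b] by (simp add: mult_lt_top)
 finally show ?thesis using L2hD(1)[OF a] L2hD(1)[OF b] by (simp add: L2h_def)
qed

lemma L2h_scaleR: assumes a: "L2h s a" shows "L2h s (%t k. c *R a t k)"
 by (rule L2h_scaled[OF _ _ a, where C="c^2"]) (use L2hD(1)[OF a] in \<open>auto simp: hsq_scaleR\<close>)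

lemma L2h_vec: assumes "!!i. L2h s (%t k. a t k $ i)" shows "L2h s (a :: real => int^3 => complex^3)"
proof -
 have m: "(%t. hsq s (%k. a t k $ i)) : BM" for i by (rule hsq_measurable[OF L2hD(1)[OF assms]])
 have "(NI {0..T} (%t. hsq s (a t))) = (\<Sum>i\<in>UNIV. \<integral>\<^sup>+t\<in>{0..T}. hsq s (%k. a t k $ i) \<partial>lborel)"
  unfolding hsq_vec[of s] sum_distrib_right by (rule nn_integral_sum) (use m in simp)
 also have "... < infy" using L2hD(2)[OF assms] by simp
 finally show ?thesis using vec3_measurable[OF L2hD(1)[OF assms]] by (simp add: L2h_def)
qed

lemma L2h_from_norm: assumes m: "!!k. (%t. a t k) : BM" and i: "set_integrable lebesgue {0..T} n"
  and le: "AET t. hsq s (a t) <= ennreal (C * n t)" and C: "0 <= C" shows "L2h s a"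
proof -
 have "(NI {0..T} (%t. hsq s (a t))) = (\<integral>\<^sup>+t\<in>{0..T}. hsq s (a t) \<partial>lebesgue)"
  by (rule nn_integral_completion[symmetric])
 also have "... <= (\<integral>\<^sup>+t. ennreal (norm (C * (indicator {0..T} t *R n t))) \<partial>lebesgue)"
 proof (rule nn_integral_mono_AE)
  show "AE t in lebesgue. hsq s (a t) * indicator {0..T} t <= ennreal (norm (C * (indicator {0..T} t *R n t)))"
  unfolding AE_completion_iff using le
  proof eventually_elim
  case (elim t)
  thus ?case using order_trans[OF _ ennreal_leI[OF abs_ge_self[of "C * n t"]]] by (cases "t : {0..T}") auto
  qed
 qed
 also have "... < infy" using integrable_mult_right[OF i[unfolded si_def], of C] unfolding integrable_iff_bounded by simp
 finally show ?thesis using m by (simp add: L2h_def)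
qed

lemma sc_L2h: assumes u: "u : L2_time T (sobolev L (real s)) (sobolev_norm L (real s))"
 shows "L2h s (sc u)" "AET t. u t : L2_torus L & hsq s (ft (u t)) < infy"
proof -
 show ae: "AET t. u t : L2_torus L & hsq s (ft (u t)) < infy" using u unfolding L2_time_def AE_completion_iff sobolev_iff by blast
 show "L2h s (sc u)"
 proof (rule L2h_from_norm[where C=1])
  show "(%t. sc u t k) : BM" for k by (rule sc_measurable) (use u in \<open>simp add: L2_time_def\<close>)
  show "set_integrable lebesgue {0..T} (%t. (sobolev_norm L (real s) (u t))^2)" using u by (simp add: L2_time_def)
  show "AET t. hsq s (sc u t) <= ennreal (1 * (sobolev_norm L (real s) (u t))^2)" using ae
  proof eventually_elim
  case (elim t)
  thus ?case by (auto simp: sc_in sobolev_norm2)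
  qed
 qed simp
qed

lemma vc_L2h_sobolev: assumes u: "!!i. (%t x. u t x $ i) : L2_time T (sobolev L (real s)) (sobolev_norm L (real s))"
 shows "L2h s (vc u)" "AET t. vL2 (u t) & hsq s (vft (u t)) < infy"
proof -
 show "L2h s (vc u)" by (rule L2h_vec) (unfold vc_nth, rule sc_L2h(1)[OF u])
 have "AE t in lborel. \<forall>i. t : {0..T} --> (%x. u t x $ i) : L2_torus L & hsq s (ft (%x. u t x $ i)) < infy"
  unfolding AE_all_countable using sc_L2h(2)[OF u] by blast
 thus "AET t. vL2 (u t) & hsq s (vft (u t)) < infy" by eventually_elim (auto simp: vL2_def hsq_vec[of s "vft _"])
qed

lemma hsq_le_norm: assumes "w : Hsol L (real s)" shows "hsq s (vft w) <= ennreal (Cp ^ s * (Hsol_norm L (real s) w)^2)"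
proof -
 have w: "hsq s (vft w) < infy" "vft w 0 = 0" using assms by (auto simp: Hsol_iff)
 have f: "ksq s (vft w) < infy" by (rule le_less_trans[OF ksq_le_hsq w(1)])
 have "hsq s (vft w) <= ennreal (Cp ^ s) * ksq s (vft w)" by (rule hsq_le_ksq[of "vft w", OF w(2)])
 also have "... = ennreal (Cp ^ s * (Hsol_norm L (real s) w)^2)"
  unfolding Hsol_norm2[OF w(1)] using f Cp_pos by (simp add: ennreal_mult less_imp_le)
 finally show ?thesis .
qed

lemma vc_L2h_Hsol: assumes u: "u : L2_time T (Hsol L (real s)) (Hsol_norm L (real s))"
 shows "L2h s (vc u)" "AET t. u t : Hsol L (real s)"
proof -
 show ae: "AET t. u t : Hsol L (real s)" using u unfolding L2_time_def AE_completion_iff by blast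
 show "L2h s (vc u)"
 proof (rule L2h_from_norm[where C="Cp ^ s"])
  show "(%t. vc u t k) : BM" for k by (rule vc_measurable jm_nth)+ (use u in \<open>simp add: L2_time_def\<close>)
  show "set_integrable lebesgue {0..T} (%t. (Hsol_norm L (real s) (u t))^2)" using u by (simp add: L2_time_def)
  show "AET t. hsq s (vc u t) <= ennreal (Cp ^ s * (Hsol_norm L (real s) (u t))^2)"
  using ae by eventually_elim (auto simp: vc_in hsq_le_norm)
 qed (use Cp_pos in simp)
qed

lemma L2_timeI:
 fixes N :: "(real^3 => 'a::real_normed_vector) => real" assumes jm: "jointly_measurable T u" and X: "AET t. u t : X"
  and n: "AET t. (N (u t))^2 = enn2real (e t)" and e: "e : BM" "AET t. e t <= hsq s (a t)" and a: "L2h s a"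
 shows "u : L2_time T X N"
proof -
 have "SI {0..T} (%t. enn2real (e t))" unfolding si_def
 proof (rule integrableI_bounded)
  have "(LN t. ennreal (norm (indicator {0..T} t *R enn2real (e t)))) <= (NI {0..T} (%t. hsq s (a t)))"
  proof (rule nn_integral_mono_AE)
  show "AE t in lborel. ennreal (norm (indicator {0..T} t *R enn2real (e t))) <= hsq s (a t) * indicator {0..T} t" using e(2)
  proof eventually_elim
  case (elim t)
  have "ennreal (enn2real (e t)) <= e t" by (cases "e t") auto
  thus ?case using elim by (cases "t : {0..T}") auto
  qed
  qed
  thus "(LN t. ennreal (norm (indicator {0..T} t *R enn2real (e t)))) < infy" using L2hD(2)[OF a] by (rule le_less_trans)
 qed (use e(1) in measurable)
 hence "set_integrable lebesgue {0..T} (%t. (N (u t))^2)" by (subst lebesgue_set_integral(1)[OF n]) (use e(1) in auto)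
 thus ?thesis using jm X by (simp add: L2_time_def AE_completion_iff)
qed

text \<open>The space-time L^2 pairing, up to the factor \<open>L^3\<close> in Parseval's
  identity.\<close>

definition PT :: "(real => int^3 => complex^3) => (real => int^3 => complex^3) => real" where
 "PT a V = (LBINT t:{0..T}. (LINT k|cs. a t k <.> V t k))"

lemma PT_integrable: assumes a: "L2h 0 a" and V: "L2h 0 V"
 shows "(%t. (LINT k|cs. a t k <.> V t k)) : BM" "SI {0..T} (%t. (LINT k|cs. a t k <.> V t k))"
proof -
 show m: "(%t. (LINT k|cs. a t k <.> V t k)) : BM" by (rule bm_cs_integral)
  (rule cs_joint, use L2hD(1)[OF a] L2hD(1)[OF V] in measurable)
 have hm: "(%t. hsq 0 (a t)) : BM" "(%t. hsq 0 (V t)) : BM"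
  by (rule hsq_measurable[OF L2hD(1)[OF a]], rule hsq_measurable[OF L2hD(1)[OF V]])
 have p: "ennreal (norm (LINT k|cs. a t k <.> V t k)) <= hsq 0 (a t) + hsq 0 (V t)" for t
 proof -
  have "ennreal (norm (LINT k|cs. a t k <.> V t k)) <= (SN k. ennreal (norm (a t k <.> V t k)))" by (rule norm_int_bound)
  also have "... <= (SN k. ennreal (jap k ^ 0 * (norm (a t k))^2) + ennreal (jap k ^ 0 * (norm (V t k))^2))"
  proof (rule nn_integral_mono)
  fix k
  have "0 <= norm (a t k) * norm (V t k)" by simp
  hence "norm (a t k <.> V t k) <= (norm (a t k))^2 + (norm (V t k))^2"
  using Cauchy_Schwarz_ineq2[of "a t k" "V t k"] sum_squares_bound[of "norm (a t k)" "norm (V t k)"] by simp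
  hence "ennreal (norm (a t k <.> V t k)) <= ennreal ((norm (a t k))^2 + (norm (V t k))^2)" by (rule ennreal_leI)
  thus "ennreal (norm (a t k <.> V t k)) <= ennreal (jap k ^ 0 * (norm (a t k))^2) + ennreal (jap k ^ 0 * (norm (V t k))^2)"
  by (simp add: ennreal_plus)
  qed
  also have "... = hsq 0 (a t) + hsq 0 (V t)" unfolding hsq_def by (rule nn_integral_add) auto
  finally show ?thesis .
 qed
 show "SI {0..T} (%t. (LINT k|cs. a t k <.> V t k))" unfolding si_def
 proof (rule integrableI_bounded)
  have "(LN t. ennreal (norm (indicator {0..T} t *R (LINT k|cs. a t k <.> V t k))))
  <= (LN t. hsq 0 (a t) * indicator {0..T} t + hsq 0 (V t) * indicator {0..T} t)"
  by (intro nn_integral_mono) (use p in \<open>auto simp: indicator_def\<close>)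
  also have "... < infy" using hm L2hD(2)[OF a] L2hD(2)[OF V] by (subst nn_integral_add) auto
  finally show "(LN t. ennreal (norm (indicator {0..T} t *R (LINT k|cs. a t k <.> V t k)))) < infy" .
 qed (use m in simp)
qed

lemma PT_add: assumes a: "L2h 0 a" and b: "L2h 0 b" and V: "L2h 0 V" shows "PT (%t k. a t k + b t k) V = PT a V + PT b V"
proof -
 have "PT (%t k. a t k + b t k) V = (LBINT t:{0..T}. (LINT k|cs. a t k <.> V t k) + (LINT k|cs. b t k <.> V t k))"
  unfolding PT_def
 proof (rule set_lebesgue_integral_cong_AE)
  show "AET t. (LINT k|cs. (a t k + b t k) <.> V t k) = (LINT k|cs. a t k <.> V t k) + (LINT k|cs. b t k <.> V t k)"
  using L2h_AE[OF a] L2h_AE[OF b] L2h_AE[OF V]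
  by eventually_elim (auto simp: inner_add_left intro!: bochner_add integrable_cs_inner)
 qed (use PT_integrable(1)[OF L2h_add[OF a b] V] PT_integrable(1)[OF a V] PT_integrable(1)[OF b V] in auto)
 thus ?thesis unfolding PT_def set_integral_add(2)[OF PT_integrable(2)[OF a V] PT_integrable(2)[OF b V]] .
qed

lemma PT_scaleR: "PT (%t k. c *R a t k) V = c * PT a V" by (simp add: PT_def sli_def)

text \<open>Only the value of the space integral at almost every time enters, and the coefficients
  determine it; the representatives chosen by \<open>wpartial\<close> and
  \<open>helmholtz_inv\<close> are thus immaterial.\<close>

lemma spacetime_PT: assumes e: "AET t. torus_integral L (F t) = L ^ 3 * (LINT k|cs. a t k <.> V t k)"
  and a: "L2h 0 a" and V: "L2h 0 V" shows "ST L T F = L ^ 3 * PT a V" unfolding spacetime_integral_def PT_def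
 by (subst lebesgue_set_integral(2)[OF e]) (use PT_integrable(1)[OF a V] in auto)

lemma axis_bounded_linear: "bounded_linear (%x::'a::euclidean_space. axis i x :: 'a^3)"
proof -
 have "linear (%x::'a. axis i x :: 'a^3)" by (rule linearI) (simp_all add: axis_def vec_eq_iff)
 thus ?thesis by (simp add: linear_conv_bounded_linear)
qed

lemma vec3_sum: "(v :: 'a::euclidean_space^3) = (\<Sum>i\<in>UNIV. axis i (v $ i))"
 by (simp add: vec_eq_iff sum_component axis_def)

lemma integrable_vec3:
 fixes f :: "'t => 'a::euclidean_space^3" assumes "!!i. integrable M (%t. f t $ i)" shows "integrable M f"
proof -
 have "integrable M (%t. \<Sum>i\<in>UNIV. axis i (f t $ i))"
  by (intro bochnerI_sum integrable_bounded_linear[OF axis_bounded_linear] assms)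
 thus ?thesis by (simp only: vec3_sum[symmetric])
qed

text \<open>The definition of \<open>time_derivative\<close> integrates in time pointwise in space.
  Fubini on \<open>[0, T]\<close> times the cell shows that the coefficients of such an integral are
  the integrals of the coefficients.\<close>

lemma time_field: assumes jm: "jointly_measurable T u" and psi: "psi : BM" "!!t. t : {0..T} ==> \<bar>psi t\<bar> <= C"
  and ae: "AET t. u t : L2_torus L" and h: "L2h 0 (sc u)" shows "(%x. LBINT t:{0..T}. psi t * u t x) : BM"
  and "integrable tm (%x. LBINT t:{0..T}. psi t * u t x)" and "AE x in tm. SI {0..T} (%t. psi t * u t x)"
  and "ft (%x. LBINT t:{0..T}. psi t * u t x) k = (LBINT t:{0..T}. psi t *R sc u t k)"
proof -
 define g where "g = (%t x. psi t * (indicator {0..T} t *R u t x))"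
 interpret ps: pair_sigma_finite "lborel :: real measure" tm by (intro pair_sigma_finite.intro sigma_finite_lborel tm_sigma)
 have gm: "(%p. g (fst p) (snd p)) : BM" unfolding g_def
  by (intro borel_measurable_times jm[unfolded jm_iff] m_comp[OF _ psi(1)] bm_cont continuous_intros)
 have gl: "(%p. g (fst p) (snd p)) : BMs (lborel <*M> tm)" by (rule joint_ltm[OF gm])
 have e: "indicator {0..T} t *R (psi t * u t x) = g t x" for t x by (simp add: g_def)
 have C: "0 <= C" using psi(2)[of 0] T_pos by simp
 have "(LN t. (TN x. ennreal \<bar>g t x\<bar>))
  <= (LN t. ennreal (C * L ^ 3) * indicator {0..T} t + ennreal (C * L ^ 3) * (hsq 0 (sc u t) * indicator {0..T} t))"
 proof (rule nn_integral_mono_AE)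
  show "AE t in lborel. (TN x. ennreal \<bar>g t x\<bar>) <= ennreal (C * L ^ 3) * indicator {0..T} t + ennreal (C * L ^ 3) * (hsq 0 (sc u t) * indicator {0..T} t)"
  using ae
  proof eventually_elim
  case (elim t)
  show ?case
  proof (cases "t : {0..T}")
  case True
  hence u: "u t : L2_torus L" using elim by simp
  have um: "u t : BMs tm" using u by (intro m_tm) (simp add: L2_torus_def)
  have "(TN x. ennreal \<bar>g t x\<bar>) <= (TN x. ennreal C * ennreal \<bar>u t x\<bar>)"
  using True C by (intro nn_integral_mono) (auto simp: g_def abs_mult ennreal_mult[symmetric] intro!: ennreal_leI mult_right_mono psi(2))
  also have "... = ennreal C * (TN x. ennreal \<bar>u t x\<bar>)" using um by (intro nn_integral_cmult) simp
  also have "... <= ennreal C * (ennreal (L ^ 3) + ennreal (L ^ 3) * hsq 0 (ft (u t)))" by (intro mult_lmono L1_le_L2[OF u]) simp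
  finally show ?thesis using True C L3_pos by (simp add: sc_in distrib_left ennreal_mult mult.assoc)
  qed (simp add: g_def)
  qed
 qed
 also have "... < infy" using L2hD(2)[OF h] hsq_measurable[of "sc u" borel 0, OF L2hD(1)[OF h]] T_pos
  by (subst nn_integral_add) (auto simp: nn_integral_cmult mult_lt_top)
 finally have fin: "(LN t. (TN x. ennreal \<bar>g t x\<bar>)) < infy" .
 have gi: "integrable (lborel <*M> tm) (%(t,x). g t x)"
 proof (rule integrableI_bounded)
  have "(\<integral>\<^sup>+p. ennreal (norm (case p of (t,x) => g t x)) \<partial>(lborel <*M> tm)) = (LN t. (TN x. ennreal \<bar>g t x\<bar>))"
  using gl by (subst ps.M2.nn_integral_fst[symmetric]) (simp_all add: split_beta')
  thus "(\<integral>\<^sup>+p. ennreal (norm (case p of (t,x) => g t x)) \<partial>(lborel <*M> tm)) < infy" using fin by simp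
 qed (use gl in \<open>simp add: split_beta'\<close>)
 have F: "(LBINT t:{0..T}. psi t * u t x) = (LINT t|lborel. g t x)" for x by (simp only: sli_def e)
 have "(%p. g (snd p) (fst p)) : BM"
  by (rule m_comp[OF _ gm, of "%p. (snd p, fst p)", simplified]) (intro bm_cont continuous_intros)
 thus "(%x. LBINT t:{0..T}. psi t * u t x) : BM"
  unfolding F by (intro sigma_finite_measure.borel_measurable_lebesgue_integral[OF sigma_finite_lborel])
  (simp add: split_beta' borel_prod[symmetric] cong: measurable_cong_sets)
 show "integrable tm (%x. LBINT t:{0..T}. psi t * u t x)" unfolding F by (rule ps.integrable_snd[OF gi])
 show "AE x in tm. SI {0..T} (%t. psi t * u t x)" unfolding si_def e by (rule ps.AE_integrable_snd[OF gi])
 let ?h = "%t x. complex_of_real (g t x) * cnj (ch k x)"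
 have hi: "integrable (lborel <*M> tm) (%(t,x). ?h t x)"
 proof (rule bochnerI_bound[OF gi])
  have "(%p. ?h (fst p) (snd p)) : BM" by (intro borel_measurable_times m_comp[OF gm borel_measurable_of_real] cnj_measurable
  m_comp[OF _ ch_measurable] bm_cont continuous_intros)
  from joint_ltm[OF this] show "(%(t,x). ?h t x) : BMs (lborel <*M> tm)" by (simp add: split_beta')
 qed (auto simp: norm_mult)
 have "ft (%x. LBINT t:{0..T}. psi t * u t x) k = (LINT x|tm. (LINT t|lborel. ?h t x)) / of_real (L ^ 3)"
  unfolding ft_cf cf_def F by (simp only: integral_mult_left_zero integral_complex_of_real)
 also have "... = (LINT t|lborel. (LINT x|tm. ?h t x)) / of_real (L ^ 3)" by (simp only: ps.Fubini_integral[OF hi])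
 also have "... = (LINT t|lborel. (LINT x|tm. ?h t x) / of_real (L ^ 3))" by (rule integral_divide_zero[symmetric])
 also have "... = (LINT t|lborel. indicator {0..T} t *R psi t *R sc u t k)"
 proof (rule bint_cong[OF refl])
  fix t
  have "(LINT x|tm. ?h t x) = of_real (psi t * indicator {0..T} t) * (LINT x|tm. complex_of_real (u t x) * cnj (ch k x))"
  by (simp add: g_def mult.assoc[symmetric] flip: integral_mult_right_zero)
  thus "(LINT x|tm. ?h t x) / of_real (L ^ 3) = indicator {0..T} t *R psi t *R sc u t k"
  unfolding sc_def ft_cf cf_def by (cases "t : {0..T}") (simp_all add: scaleR_conv_of_real)
 qed
 finally show "ft (%x. LBINT t:{0..T}. psi t * u t x) k = (LBINT t:{0..T}. psi t *R sc u t k)" by (simp add: sli_def)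
qed

lemma L2_space_time_L2h: assumes f: "f : L2_space_time L T" shows "L2h 0 (vc f)" "AET t. vL2 (f t)"
proof -
 define g where "g = (%p::real \<times> (real^3). indicator ({0..T} \<times> cell L) p *R (norm (f (fst p) (snd p)))^2)"
 have jm: "jointly_measurable T f" and per: "!!t. t : {0..T} ==> periodic L (f t)" and gi: "integrable lborel g"
  using f by (auto simp: L2_space_time_def si_def g_def)
 have gi': "integrable (lborel <*M> lborel) g" using gi by (simp add: lborel_prod)
 have fm: "f t : BM" if "t : {0..T}" for t
 proof -
  have "(%x::real^3. (t, x)) : BM" by (intro bm_cont continuous_intros)
  from m_comp[OF this jm[unfolded jm_iff]] show ?thesis using that by simp
 qed
 have e: "(%x. g (t, x)) = (%x. indicator (cell L) x *R (norm (f t x))^2)" if "t : {0..T}" for t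
  using that by (auto simp: g_def indicator_def fun_eq_iff)
 have ae: "AET t. integrable tm (%x. (norm (f t x))^2)" using lborel_pair.AE_integrable_fst'[OF gi']
 proof eventually_elim
  case (elim t)
  show ?case
  proof
  assume "t : {0..T}"
  from elim[unfolded e[OF this]] show "integrable tm (%x. (norm (f t x))^2)" by (simp add: integrable_tm)
  qed
 qed
 have v: "vL2 (f t)" if t: "t : {0..T}" and i: "integrable tm (%x. (norm (f t x))^2)" for t unfolding vL2_def L2_torus_def si_tm
 proof (intro allI CollectI conjI)
  fix i
  show m: "(%x. f t x $ i) : BM" by (rule m_comp[OF fm[OF t] bm_nth])
  show "periodic L (%x. f t x $ i)" using per[OF t] by (simp add: periodic_def)
  show "integrable tm (%x. (f t x $ i)^2)"
  proof (rule bochnerI_bound[OF i])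
  show "(%x. (f t x $ i)^2) : BMs tm" using m by (intro m_tm) simp
  have "(f t x $ i)^2 <= (norm (f t x))^2" for x
  using component_le_norm_cart[of "f t x" i] by (simp add: abs_le_square_iff[symmetric])
  thus "AE x in tm. norm ((f t x $ i)^2) <= norm ((norm (f t x))^2)" by simp
  qed
 qed
 show ae': "AET t. vL2 (f t)" using ae by eventually_elim (use v in blast)
 have L0: "ennreal (1 / L ^ 3) * ennreal (L ^ 3) = 1" using L3_pos by (simp add: ennreal_mult[symmetric])
 \<comment> \<open>The \<open>3\<close> counts the components, each bounded by the full norm;
   \<open>L^3\<close> is the normalisation of the coefficients.\<close>
 have "(NI {0..T} (%t. hsq 0 (vc f t))) <= (LN t. ennreal (3 / L ^ 3) * (LN x. ennreal (norm (g (t, x)))))"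
 proof (rule nn_integral_mono_AE)
  show "AE t in lborel. hsq 0 (vc f t) * indicator {0..T} t <= ennreal (3 / L ^ 3) * (LN x. ennreal (norm (g (t, x))))" using ae'
  proof eventually_elim
  case (elim t)
  show ?case
  proof (cases "t : {0..T}")
  case True
  let ?I = "\<integral>\<^sup>+x. ennreal (norm (g (t, x))) \<partial>lborel"
  have I: "(TN x. ennreal ((f t x $ i)^2)) <= ?I" for i
  proof -
  have "(TN x. ennreal ((f t x $ i)^2)) = (LN x. ennreal ((f t x $ i)^2) * indicator (cell L) x)"
  unfolding tm_def by (rule nn_integral_restrict_space) simp
  also have "... <= ?I" using component_le_norm_cart[of "f t _" i] True
  by (intro nn_integral_mono) (auto simp: g_def indicator_def abs_le_square_iff[symmetric] intro!: ennreal_leI)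
  finally show ?thesis .
  qed
  have "hsq 0 (ft (%x. f t x $ i)) <= ennreal (1 / L ^ 3) * ?I" for i
  proof -
  have "hsq 0 (ft (%x. f t x $ i)) = ennreal (1 / L ^ 3) * (ennreal (L ^ 3) * hsq 0 (ft (%x. f t x $ i)))"
  unfolding mult.assoc[symmetric] L0 by simp
  also have "ennreal (L ^ 3) * hsq 0 (ft (%x. f t x $ i)) = (TN x. ennreal ((f t x $ i)^2))"
  by (rule L2_nn[symmetric]) (use elim True in \<open>simp add: vL2_def\<close>)
  finally show ?thesis using I[of i] by (simp add: mult_lmono)
  qed
  hence "(\<Sum>i\<in>UNIV. hsq 0 (ft (%x. f t x $ i))) <= (\<Sum>i\<in>(UNIV::3 set). ennreal (1 / L ^ 3) * ?I)" by (intro sum_mono)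
  also have "... = (3 * ennreal (1 / L ^ 3)) * ?I" by (simp add: mult.assoc)
  also have "3 * ennreal (1 / L ^ 3) = ennreal (3 / L ^ 3)" using L3_pos ennreal_mult'[of 3 "1 / L ^ 3"] by simp
  finally show ?thesis using True by (simp add: vc_in hsq_vec[of 0 "vft (f t)"])
  qed simp
  qed
 qed
 also have "... = ennreal (3 / L ^ 3) * (\<integral>\<^sup>+p. ennreal (norm (g p)) \<partial>(lborel <*M> lborel))"
 proof -
  have m: "(%p. ennreal (norm (g p))) : BMs (lborel <*M> lborel)" using gi' by auto
  show ?thesis unfolding lborel.nn_integral_fst[OF m, symmetric]
  by (rule nn_integral_cmult) (rule lborel.borel_measurable_nn_integral_fst[OF m])
 qed
 also have "... < infy" using gi' by (simp add: integrable_iff_bounded mult_lt_top)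
 finally show "L2h 0 (vc f)" using vc_measurable[OF jm_nth[OF jm]] by (simp add: L2h_def)
qed

end

section \<open>The weak formulation in terms of coefficients\<close>

context mhd begin

lemma pair_tm: assumes v: "vL2 v" and w: "vL2 w"
 shows "torus_integral L (%x. v x <.> w x) = L ^ 3 * (LINT k|cs. vft v k <.> vft w k)"
proof -
 have L2: "(%x. v x $ i) : L2_torus L" "(%x. w x $ i) : L2_torus L" for i using v w by (auto simp: vL2_def)
 note p = torus_parseval[OF L2]
 have "torus_integral L (%x. v x <.> w x) = (\<Sum>i\<in>UNIV. (LINT x|tm. v x $ i * w x $ i))"
  unfolding tint_tm inner_vec_def inner_real_def by (rule bochner_sum[OF p(1)])
 also have "... = L ^ 3 * (\<Sum>i\<in>UNIV. (LINT k|cs. ft (%x. v x $ i) k <.> ft (%x. w x $ i) k))"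
  unfolding p(2) sum_distrib_left ..
 also have "(\<Sum>i\<in>UNIV. (LINT k|cs. ft (%x. v x $ i) k <.> ft (%x. w x $ i) k)) = (LINT k|cs. vft v k <.> vft w k)"
  unfolding inner_vec_def vft_nth by (rule bochner_sum[symmetric]) (intro integrable_cs_inner ft_hsq0 L2)
 finally show ?thesis .
qed

lemma vft_hsq0: assumes "vL2 v" shows "hsq 0 (vft v) < infy" unfolding hsq_vec using ft_hsq0 assms by (simp add: vL2_def)

text \<open>Integration by parts on the Fourier side: taking the derivatives off \<open>v\<close>
  leaves minus the pairing of \<open>v\<close> with the row-wise divergence of
  \<open>A\<close>.\<close>

lemma pair_jacobian: assumes A: "!!i. vL2 (%x. A x $ i)" and v: "vL2 v" and h: "hsq 1 (vft v) < infy"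
 shows "torus_integral L (%x. A x <.> wjacobian L v x) = - (L ^ 3 * (LINT k|cs. (\<chi> i. \<i> * wdot k (vft (%x. A x $ i) k)) <.> vft v k))"
proof -
 have J: "wpartial L j (%y. v y $ i) : L2_torus L" "ft (wpartial L j (%y. v y $ i)) k = iwv k j * ft (%y. v y $ i) k" for i j k
  using wpartial_L2[of "%y. v y $ i"] v le_less_trans[OF hsq_comp_le h, of i] by (auto simp: vL2_def)
 have J2: "vL2 (%x. wjacobian L v x $ i)" for i using J(1) by (simp add: vL2_def wjacobian_def)
 have Jc: "vft (%x. wjacobian L v x $ i) k $ j = iwv k j * ft (%y. v y $ i) k" for i j k using J(2) by (simp add: wjacobian_def)
 note p = pair_tm[OF A J2]
 have row: "vft (%x. A x $ i) k <.> vft (%x. wjacobian L v x $ i) k = - ((\<i> * wdot k (vft (%x. A x $ i) k)) <.> ft (%y. v y $ i) k)" for i k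
  unfolding inner_vec_def[of "vft _ _"] Jc by (rule sum_inner_wave)
 have i: "integrable tm (%x. A x $ i <.> wjacobian L v x $ i)" for i unfolding inner_vec_def inner_real_def
  by (rule bochnerI_sum, rule torus_parseval(1)) (use A J2 in \<open>auto simp: vL2_def\<close>)
 have "torus_integral L (%x. A x <.> wjacobian L v x) = (\<Sum>i\<in>UNIV. torus_integral L (%x. A x $ i <.> wjacobian L v x $ i))"
  unfolding tint_tm inner_vec_def[of "A _"] by (rule bochner_sum[OF i])
 also have "... = L ^ 3 * (\<Sum>i\<in>UNIV. (LINT k|cs. vft (%x. A x $ i) k <.> vft (%x. wjacobian L v x $ i) k))"
  unfolding p sum_distrib_left ..
 also have "(\<Sum>i\<in>UNIV. (LINT k|cs. vft (%x. A x $ i) k <.> vft (%x. wjacobian L v x $ i) k))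
  = (LINT k|cs. (\<Sum>i\<in>UNIV. vft (%x. A x $ i) k <.> vft (%x. wjacobian L v x $ i) k))"
  by (rule bochner_sum[symmetric]) (intro integrable_cs_inner vft_hsq0 A J2)
 also have "... = - (LINT k|cs. (\<chi> i. \<i> * wdot k (vft (%x. A x $ i) k)) <.> vft v k)"
  unfolding row by (simp add: inner_vec_def[of "vec_lambda _"] sum_negf)
 finally show ?thesis by simp
qed

text \<open>\<open>adv a b\<close> is the divergence of the tensor product of \<open>b\<close> and
  \<open>a\<close>, hence the reversed order of \<open>P\<close> and \<open>Q\<close>.\<close>

lemma pair_tensor: assumes P: "vL2 P" "hsq 1 (vft P) < infy" and Q: "vL2 Q" "hsq 1 (vft Q) < infy" and al: "al > 0"
  and v: "vL2 v" "hsq 1 (vft v) < infy" shows "torus_integral L (%x. G_ten L al (tensor P Q) x <.> wjacobian L v x)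
  = - (L ^ 3 * (LINT k|cs. (gsym al k *R adv (vft Q) (vft P) k) <.> vft v k))"
proof -
 have c: "hsq 1 (ft (%x. P x $ i)) < infy" "hsq 1 (ft (%x. Q x $ i)) < infy" for i
  using le_less_trans[OF hsq_comp_le P(2), of i] le_less_trans[OF hsq_comp_le Q(2), of i] by simp_all
 have m: "(%x. P x $ i * Q x $ j) : L2_torus L" "ft (%x. P x $ i * Q x $ j) k = conv (ft (%x. P x $ i)) (ft (%x. Q x $ j)) k" for i j k
  using mult_L2[OF _ c(1) _ c(2)] P Q by (auto simp: vL2_def)
 note g = helmholtz_inv_L2[OF m(1) al]
 have e: "G_ten L al (tensor P Q) x $ i $ j = helmholtz_inv L al (%y. P y $ i * Q y $ j) x" for x i j
  by (simp add: G_ten_def componentwise_def tensor_def)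
 have A: "vL2 (%x. G_ten L al (tensor P Q) x $ i)" for i using g(1) by (simp add: vL2_def e)
 have "\<i> * wdot k (vft (%x. G_ten L al (tensor P Q) x $ i) k) = (gsym al k *R adv (vft Q) (vft P) k) $ i" for k i
  by (simp add: wdot_def e g(3) m(2) adv_def sum_distrib_left scaleR_cx mult_ac)
 hence "(\<chi> i. \<i> * wdot k (vft (%x. G_ten L al (tensor P Q) x $ i) k)) = gsym al k *R adv (vft Q) (vft P) k" for k
  by (simp add: vec_eq_iff)
 thus ?thesis using pair_jacobian[OF A v] by simp
qed

lemma pair_gradients: assumes w: "vL2 w" "hsq 2 (vft w) < infy" and v: "vL2 v" "hsq 1 (vft v) < infy"
 shows "torus_integral L (%x. wjacobian L w x <.> wjacobian L v x) = L ^ 3 * (LINT k|cs. ((K k)^2 *R vft w k) <.> vft v k)"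
proof -
 have h: "hsq 1 (vft w) < infy" by (rule le_less_trans[OF hsq_mono_s w(2)]) simp
 have J: "wpartial L j (%y. w y $ i) : L2_torus L" "ft (wpartial L j (%y. w y $ i)) k = iwv k j * ft (%y. w y $ i) k" for i j k
  using wpartial_L2[of "%y. w y $ i"] w le_less_trans[OF hsq_comp_le h, of i] by (auto simp: vL2_def)
 have A: "vL2 (%x. wjacobian L w x $ i)" for i using J(1) by (simp add: vL2_def wjacobian_def)
 have "\<i> * wdot k (vft (%x. wjacobian L w x $ i) k) = - ((K k)^2 *R vft w k) $ i" for k i
 proof -
  have "\<i> * wdot k (vft (%x. wjacobian L w x $ i) k) = - (\<Sum>j\<in>UNIV. complex_of_real (wave L k $ j) * of_real (wave L k $ j)) * ft (%y. w y $ i) k"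
  by (simp add: wdot_def wjacobian_def J(2) sum_distrib_left sum_distrib_right sum_negf mult_ac)
  thus ?thesis unfolding sum_wave2 by (simp add: scaleR_cx)
 qed
 hence "(\<chi> i. \<i> * wdot k (vft (%x. wjacobian L w x $ i) k)) = - ((K k)^2 *R vft w k)" for k by (simp add: vec_eq_iff)
 thus ?thesis using pair_jacobian[OF A v] by simp
qed

definition gc :: "int^3 => complex => complex^3" where "gc k z = (\<chi> j. iwv k j * z)"

lemma pair_pressure: assumes q: "q : L2_torus L" "hsq 1 (ft q) < infy" and v: "vL2 v"
 shows "torus_integral L (%x. wgrad L q x <.> v x) = L ^ 3 * (LINT k|cs. gc k (ft q k) <.> vft v k)"
proof -
 note p = wpartial_L2[OF q]
 have "vL2 (wgrad L q)" using p(1) by (simp add: vL2_def wgrad_def)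
 moreover have "vft (wgrad L q) k = gc k (ft q k)" for k by (simp add: vec_eq_iff wgrad_def p(2) gc_def)
 ultimately show ?thesis using pair_tm[of "wgrad L q" v] v by simp
qed

lemma G_vec_L2: assumes f: "vL2 f" and al: "al > 0" shows "vL2 (G_vec L al f)" "vft (G_vec L al f) k = gsym al k *R vft f k"
proof -
 have "(%x. f x $ i) : L2_torus L" for i using f by (simp add: vL2_def)
 note g = helmholtz_inv_L2[OF this al]
 show "vL2 (G_vec L al f)" "vft (G_vec L al f) k = gsym al k *R vft f k"
  using g by (simp_all add: vL2_def G_vec_def componentwise_def vec_eq_iff scaleR_cx)
qed

lemma D_vec_L2: assumes f: "vL2 f" and al: "al > 0" shows "vL2 (D_vec L al N f)" "vft (D_vec L al N f) k = Dsym al N k *R vft f k"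
proof -
 have "(%x. f x $ i) : L2_torus L" for i using f by (simp add: vL2_def)
 note g = deconv_L2[OF this al]
 show "vL2 (D_vec L al N f)" "vft (D_vec L al N f) k = Dsym al N k *R vft f k"
  using g by (simp_all add: vL2_def D_vec_def componentwise_def vec_eq_iff scaleR_cx)
qed

definition uu :: "(real => real^3 => real^3) => (real => real^3 => real^3) => real => int^3 => mode" where
 "uu w b t k = (vc w t k, vc b t k)"

text \<open>The residuals of the two equations, mode by mode.\<close>

definition R1 where
 "R1 w' w b q f t k = vc w' t k + (X1 (uu w b t) k + (gc k (sc q t k) + (nu *R ((K k)^2 *R vc w t k) + (- 1) *R (gsym a1 k *R vc f t k))))"
definition R2 where
 "R2 b' w b t k = vc b' t k + (X2 (uu w b t) k + mu *R ((K k)^2 *R vc b t k))"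

lemma L2h_adv: assumes al: "al > 0" and m: "!!k. (%t. a t k) : BM" "!!k. (%t. b t k) : BM"
  and A: "!!t. hsq 1 (a t) <= A" "!!t. hsq 1 (b t) <= A" "A < infy" shows "L2h 0 (%t k. gsym al k *R adv (a t) (b t) k)"
proof (rule L2h_bounded)
 show "(%t. gsym al k *R adv (a t) (b t) k) : BM" for k by (intro borel_measurable_scaleR borel_measurable_const adv_measurable m)
 fix t
 have "hsq 0 (%k. gsym al k *R adv (a t) (b t) k) <= hsq 1 (%k. gsym al k *R adv (a t) (b t) k)" by (rule hsq_mono_s) simp
 also have "... <= ennreal ((Cg al)^2) * (latS * (hsq 1 (a t) * hsq 1 (b t)))" by (rule gsym_adv_bound[OF al])
 also have "... <= ennreal ((Cg al)^2) * (latS * (A * A))" by (intro mult_lmono mult_mono A) auto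
 finally show "hsq 0 (%k. gsym al k *R adv (a t) (b t) k) <= ennreal ((Cg al)^2) * (latS * (A * A))" .
 show "ennreal ((Cg al)^2) * (latS * (A * A)) < infy" using A(3) latS_finite by (simp add: mult_lt_top)
qed

lemma L2h_K2: assumes "L2h 2 a" shows "L2h 0 (%t k. (K k)^2 *R a t k)"
proof (rule L2h_scaled[OF _ _ assms, where C=1])
 show "(%t. (K k)^2 *R a t k) : BM" for k by (intro borel_measurable_scaleR borel_measurable_const L2hD(1)[OF assms])
 have "jap k ^ 0 * (norm ((K k)^2 *R z))^2 <= jap k ^ 2 * (norm z)^2" for k and z :: 'a
  using power_mono[OF K2_le_jap[of k], of 2] by (simp add: power_mult_distrib mult_right_mono)
 hence "hsq 0 (%k. (K k)^2 *R a t k) <= hsq 2 (a t)" for t unfolding hsq_def by (intro nn_integral_mono ennreal_leI)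
 thus "AET t. hsq 0 (%k. (K k)^2 *R a t k) <= ennreal 1 * hsq 2 (a t)" by simp
qed

lemma L2h_gsym: assumes "L2h 0 a" shows "L2h 0 (%t k. gsym al k *R a t k)"
proof (rule L2h_scaled[OF _ _ assms, where C=1])
 show "(%t. gsym al k *R a t k) : BM" for k by (intro borel_measurable_scaleR borel_measurable_const L2hD(1)[OF assms])
 have "hsq 0 (%k. gsym al k *R a t k) <= hsq 0 (a t)" for t
  by (rule hsq_mono_norm) (use gsym_pos[of al] gsym_le_1[of al] in \<open>simp add: mult_left_le_one_le less_imp_le\<close>)
 thus "AET t. hsq 0 (%k. gsym al k *R a t k) <= ennreal 1 * hsq 0 (a t)" by simp
qed

lemma gc_norm: "norm (gc k z) = K k * norm z"
proof -
 have "(norm (gc k z))^2 = (K k * norm z)^2"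
  by (simp add: gc_def norm_vec_def L2_set_def sum_nonneg norm_mult power_mult_distrib sum_distrib_right)
 thus ?thesis by (simp add: power2_eq_iff_nonneg)
qed

lemma gc_measurable: assumes "a : BMs M" shows "(%t. gc k (a t)) : BMs M"
 by (rule vec3_measurable) (use assms in \<open>simp add: gc_def\<close>)

lemma L2h_gc: assumes "L2h 1 a" shows "L2h 0 (%t k. gc k (a t k))"
proof (rule L2h_scaled[OF _ _ assms, where C=1])
 show "(%t. gc k (a t k)) : BM" for k by (rule gc_measurable[OF L2hD(1)[OF assms]])
 have "jap k ^ 0 * (norm (gc k z))^2 <= jap k ^ 1 * (norm z)^2" for k z
  using K2_le_jap[of k] by (simp add: gc_norm power_mult_distrib mult_right_mono)
 hence "hsq 0 (%k. gc k (a t k)) <= hsq 1 (a t)" for t unfolding hsq_def by (intro nn_integral_mono ennreal_leI)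
 thus "AET t. hsq 0 (%k. gc k (a t k)) <= ennreal 1 * hsq 1 (a t)" by simp
qed

text \<open>The two identities of \<open>regular_weak_solution\<close>, named so that each can be
  rewritten as one proposition.\<close>

abbreviation "eq_w w' w b q f v \<equiv> ST L T (%t x. w' t x <.> v t x)
 - ST L T (%t x. G_ten L a1 (tensor (D_vec L a1 N1 (w t)) (D_vec L a1 N1 (w t))) x <.> wjacobian L (v t) x)
 + ST L T (%t x. G_ten L a1 (tensor (D_vec L a2 N2 (b t)) (D_vec L a2 N2 (b t))) x <.> wjacobian L (v t) x)
 + ST L T (%t x. wgrad L (q t) x <.> v t x) + nu * ST L T (%t x. wjacobian L (w t) x <.> wjacobian L (v t) x)
 = ST L T (%t x. G_vec L a1 (f t) x <.> v t x)"
abbreviation "eq_b b' w b v \<equiv> ST L T (%t x. b' t x <.> v t x)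
 - ST L T (%t x. G_ten L a2 (tensor (D_vec L a2 N2 (b t)) (D_vec L a1 N1 (w t))) x <.> wjacobian L (v t) x)
 + ST L T (%t x. G_ten L a2 (tensor (D_vec L a1 N1 (w t)) (D_vec L a2 N2 (b t))) x <.> wjacobian L (v t) x)
 + mu * ST L T (%t x. wjacobian L (b t) x <.> wjacobian L (v t) x) = 0"

end

text \<open>What the two directions share: it is applied to the fields built from a solution of the
  mode equations and to an arbitrary weak solution. The uniform h^1 bound makes the nonlinear terms
  square integrable in time.\<close>

locale mhd_state = mhd L T nu mu a1 a2 N1 N2 for L T nu mu a1 a2 :: real and N1 N2 :: nat +
 fixes w b w' b' :: "real => real^3 => real^3" and q :: "real => real^3 => real" and f :: "real => real^3 => real^3" and A :: real
 assumes w: "w : L2_time T (Hsol L 2) (Hsol_norm L 2)" and b: "b : L2_time T (Hsol L 2) (Hsol_norm L 2)"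
  and w': "w' : L2_time T (Hsol L 0) (Hsol_norm L 0)" and b': "b' : L2_time T (Hsol L 0) (Hsol_norm L 0)"
  and q: "q : L2_time T (sobolev L 1) (sobolev_norm L 1)" and f: "f : L2_space_time L T"
  and bound: "!!t. hsq 1 (uu w b t) <= ennreal A"
begin

lemma w_L2h: "L2h 2 (vc w)" "AET t. w t : Hsol L 2" using vc_L2h_Hsol[of w 2] w by simp_all
lemma b_L2h: "L2h 2 (vc b)" "AET t. b t : Hsol L 2" using vc_L2h_Hsol[of b 2] b by simp_all
lemma w'_L2h: "L2h 0 (vc w')" "AET t. w' t : Hsol L 0" using vc_L2h_Hsol[of w' 0] w' by simp_all
lemma b'_L2h: "L2h 0 (vc b')" "AET t. b' t : Hsol L 0" using vc_L2h_Hsol[of b' 0] b' by simp_all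
lemma q_L2h: "L2h 1 (sc q)" "AET t. q t : L2_torus L & hsq 1 (ft (q t)) < infy" using sc_L2h[of q 1] q by simp_all
lemmas f_L2h = L2_space_time_L2h[OF f]

lemma uu_measurable: "(%t. uu w b t k) : BM"
 unfolding uu_def by (intro borel_measurable_Pair L2hD(1)[OF w_L2h(1)] L2hD(1)[OF b_L2h(1)])

abbreviation "WW t \<equiv> Wc (uu w b t)"
abbreviation "HH t \<equiv> Hc (uu w b t)"

lemma WH_measurable: "(%t. WW t k) : BM" "(%t. HH t k) : BM"
 unfolding Wc_def Hc_def using fst_snd_measurable[OF uu_measurable[of k]] by (auto intro: borel_measurable_scaleR)

lemma WH_bound: "hsq 1 (WW t) <= ennreal (ND^2) * ennreal A" "hsq 1 (HH t) <= ennreal (ND^2) * ennreal A"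
 by (rule order_trans[OF hsq_W mult_lmono[OF bound]], simp, rule order_trans[OF hsq_H mult_lmono[OF bound]], simp)

lemma WH_L2h: assumes "al > 0" "P = WW \<or> P = HH" "Q = WW \<or> Q = HH" shows "L2h 0 (%t k. gsym al k *R adv (P t) (Q t) k)"
 by (rule L2h_adv[OF assms(1), where A="ennreal (ND^2) * ennreal A"])
  (use assms(2,3) WH_measurable WH_bound in \<open>auto simp: mult_lt_top\<close>)

lemma WH_fields:
 "AET t. vL2 (D_vec L a1 N1 (w t)) & vft (D_vec L a1 N1 (w t)) = WW t \<and>
  vL2 (D_vec L a2 N2 (b t)) & vft (D_vec L a2 N2 (b t)) = HH t" using w_L2h(2) b_L2h(2)
proof eventually_elim
 case (elim t)
 show ?case
 proof
  assume t: "t : {0..T}"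
  hence "vL2 (w t)" "vL2 (b t)" using elim Hsol_iff[of _ 2] by auto
  thus "vL2 (D_vec L a1 N1 (w t)) & vft (D_vec L a1 N1 (w t)) = WW t \<and>
  vL2 (D_vec L a2 N2 (b t)) & vft (D_vec L a2 N2 (b t)) = HH t"
  using t D_vec_L2(1)[OF _ a1_pos] D_vec_L2(1)[OF _ a2_pos] D_vec_L2(2)[OF _ a1_pos] D_vec_L2(2)[OF _ a2_pos]
  by (simp add: fun_eq_iff Wc_def Hc_def uu_def vc_in)
 qed
qed

lemma spacetime_tensor: assumes al: "al > 0" and PQ: "P = WW \<or> P = HH" "Q = WW \<or> Q = HH"
  and F: "AET t. vL2 (p t) & vft (p t) = P t & vL2 (r t) & vft (r t) = Q t"
  and v: "L2h 1 (vc v)" "AET t. vL2 (v t) & hsq 1 (vft (v t)) < infy"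
 shows "ST L T (%t x. G_ten L al (tensor (p t) (r t)) x <.> wjacobian L (v t) x)
  = - (L ^ 3 * PT (%t k. gsym al k *R adv (Q t) (P t) k) (vc v))"
proof -
 have f: "hsq 1 (WW t) < infy" "hsq 1 (HH t) < infy" for t
  by (rule le_less_trans[OF WH_bound(1)], simp add: mult_lt_top, rule le_less_trans[OF WH_bound(2)], simp add: mult_lt_top)
 have V: "L2h 0 (vc v)" by (rule L2h_scaled[OF L2hD(1)[OF v(1)] _ v(1), where C=1]) (use hsq_mono_s[of 0 1] in auto)
 have "ST L T (%t x. G_ten L al (tensor (p t) (r t)) x <.> wjacobian L (v t) x)
  = L ^ 3 * PT (%t k. (- 1) *R (gsym al k *R adv (Q t) (P t) k)) (vc v)"
 proof (rule spacetime_PT[OF _ L2h_scaleR[OF WH_L2h[OF al PQ(2,1)]] V])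
  show "AET t. torus_integral L (%x. G_ten L al (tensor (p t) (r t)) x <.> wjacobian L (v t) x)
  = L ^ 3 * (LINT k|cs. ((- 1) *R (gsym al k *R adv (Q t) (P t) k)) <.> vc v t k)" using F v(2)
  proof eventually_elim
  case (elim t)
  show ?case
  proof
  assume t: "t : {0..T}"
  have "hsq 1 (vft (p t)) < infy" "hsq 1 (vft (r t)) < infy" using elim t PQ f by auto
  from pair_tensor[OF _ this(1) _ this(2) al, of "v t"] elim t
  show "torus_integral L (%x. G_ten L al (tensor (p t) (r t)) x <.> wjacobian L (v t) x)
  = L ^ 3 * (LINT k|cs. ((- 1) *R (gsym al k *R adv (Q t) (P t) k)) <.> vc v t k)" by (simp add: vc_in)
  qed
  qed
 qed
 thus ?thesis unfolding PT_scaleR by simp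
qed

lemma spacetime_viscous: assumes z: "L2h 2 (vc z)" "AET t. z t : Hsol L 2"
  and v: "L2h 0 (vc v)" "AET t. vL2 (v t) & hsq 1 (vft (v t)) < infy"
 shows "ST L T (%t x. wjacobian L (z t) x <.> wjacobian L (v t) x) = L ^ 3 * PT (%t k. (K k)^2 *R vc z t k) (vc v)"
proof (rule spacetime_PT[OF _ L2h_K2[OF z(1)] v(1)])
 show "AET t. torus_integral L (%x. wjacobian L (z t) x <.> wjacobian L (v t) x)
  = L ^ 3 * (LINT k|cs. ((K k)^2 *R vc z t k) <.> vc v t k)"
  using z(2) v(2) by eventually_elim (use Hsol_iff[of _ 2] pair_gradients in \<open>auto simp: vc_in\<close>)
qed

lemma spacetime_pair: assumes z: "L2h 0 (vc z)" "AET t. vL2 (z t)"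
  and v: "L2h 0 (vc v)" "AET t. vL2 (v t) & hsq 1 (vft (v t)) < infy"
 shows "ST L T (%t x. z t x <.> v t x) = L ^ 3 * PT (vc z) (vc v)"
proof (rule spacetime_PT[OF _ z(1) v(1)])
 show "AET t. torus_integral L (%x. z t x <.> v t x) = L ^ 3 * (LINT k|cs. vc z t k <.> vc v t k)"
  using z(2) v(2) by eventually_elim (use pair_tm in \<open>auto simp: vc_in\<close>)
qed

lemma R1_L2h: "L2h 0 (R1 w' w b q f)" and R2_L2h: "L2h 0 (R2 b' w b)"
proof -
 have X: "L2h 0 (%t k. gsym a1 k *R adv (WW t) (WW t) k + (- 1) *R (gsym a1 k *R adv (HH t) (HH t) k))"
  "L2h 0 (%t k. gsym a2 k *R adv (WW t) (HH t) k + (- 1) *R (gsym a2 k *R adv (HH t) (WW t) k))"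
  by (intro L2h_add L2h_scaleR WH_L2h a1_pos a2_pos; simp)+
 show "L2h 0 (R1 w' w b q f)" unfolding R1_def[abs_def] X1_def scaleR_diff_right
  using X(1) by (intro L2h_add L2h_scaleR L2h_gsym L2h_K2 L2h_gc w'_L2h w_L2h q_L2h f_L2h) simp
 show "L2h 0 (R2 b' w b)" unfolding R2_def[abs_def] X2_def scaleR_diff_right
  using X(2) by (intro L2h_add L2h_scaleR L2h_K2 b'_L2h b_L2h) simp
qed

text \<open>Every term is \<open>L^3\<close> times a pairing with the coefficients of
  \<open>v\<close>, so each identity says that one residual pairs to zero. Existence uses one
  direction of the equivalence, uniqueness the other.\<close>

lemma weak_form: assumes v: "!!i. (%t x. v t x $ i) : L2_time T (sobolev L 1) (sobolev_norm L 1)"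
 shows "eq_w w' w b q f v <-> PT (R1 w' w b q f) (vc v) = 0" and "eq_b b' w b v <-> PT (R2 b' w b) (vc v) = 0"
proof -
 have V: "L2h 1 (vc v)" "AET t. vL2 (v t) & hsq 1 (vft (v t)) < infy" using vc_L2h_sobolev[of v 1] v by simp_all
 have V0: "L2h 0 (vc v)" by (rule L2h_scaled[OF L2hD(1)[OF V(1)] _ V(1), where C=1]) (use hsq_mono_s[of 0 1] in auto)
 have WW: "AET t. vL2 (D_vec L a1 N1 (w t)) & vft (D_vec L a1 N1 (w t)) = WW t & vL2 (D_vec L a1 N1 (w t)) & vft (D_vec L a1 N1 (w t)) = WW t"
  "AET t. vL2 (D_vec L a2 N2 (b t)) & vft (D_vec L a2 N2 (b t)) = HH t & vL2 (D_vec L a2 N2 (b t)) & vft (D_vec L a2 N2 (b t)) = HH t"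
  "AET t. vL2 (D_vec L a2 N2 (b t)) & vft (D_vec L a2 N2 (b t)) = HH t & vL2 (D_vec L a1 N1 (w t)) & vft (D_vec L a1 N1 (w t)) = WW t"
  using WH_fields by (eventually_elim; blast)+
 note t1 = spacetime_tensor[OF a1_pos _ _ WW(1) V] spacetime_tensor[OF a1_pos _ _ WW(2) V]
 note t2 = spacetime_tensor[OF a2_pos _ _ WW(3) V] spacetime_tensor[OF a2_pos _ _ WH_fields V]
 have z: "AET t. vL2 (w' t)" "AET t. vL2 (b' t)" using w'_L2h(2) b'_L2h(2) Hsol_iff[of _ 0] by (eventually_elim; simp)+
 have a: "L2h 0 (%t k. gsym a1 k *R adv (WW t) (WW t) k)" "L2h 0 (%t k. gsym a1 k *R adv (HH t) (HH t) k)"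
  "L2h 0 (%t k. gsym a2 k *R adv (WW t) (HH t) k)" "L2h 0 (%t k. gsym a2 k *R adv (HH t) (WW t) k)"
  by (intro WH_L2h a1_pos a2_pos; simp)+
 note n = L2h_scaleR[OF a(2), of "- 1"] and n' = L2h_scaleR[OF a(4), of "- 1"]
 note x = L2h_add[OF a(1) n] and x' = L2h_add[OF a(3) n']
 note vw = L2h_scaleR[OF L2h_K2[OF w_L2h(1)], of nu] and vb = L2h_scaleR[OF L2h_K2[OF b_L2h(1)], of mu]
  and vf = L2h_scaleR[OF L2h_gsym[OF f_L2h(1), of a1], of "- 1"] and vq = L2h_gc[OF q_L2h(1)]
 note y3 = L2h_add[OF vw vf]
 note y2 = L2h_add[OF vq y3]
 have p: "ST L T (%t x. wgrad L (q t) x <.> v t x) = L ^ 3 * PT (%t k. gc k (sc q t k)) (vc v)"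
 proof (rule spacetime_PT[OF _ L2h_gc[OF q_L2h(1)] V0])
  show "AET t. torus_integral L (%x. wgrad L (q t) x <.> v t x) = L ^ 3 * (LINT k|cs. gc k (sc q t k) <.> vc v t k)"
  using q_L2h(2) V(2) by eventually_elim (use pair_pressure in \<open>auto simp: vc_in sc_in\<close>)
 qed
 have g: "ST L T (%t x. G_vec L a1 (f t) x <.> v t x) = L ^ 3 * PT (%t k. gsym a1 k *R vc f t k) (vc v)"
 proof (rule spacetime_PT[OF _ L2h_gsym[OF f_L2h(1)] V0])
  show "AET t. torus_integral L (%x. G_vec L a1 (f t) x <.> v t x) = L ^ 3 * (LINT k|cs. (gsym a1 k *R vc f t k) <.> vc v t k)"
  using f_L2h(2) V(2)
  proof eventually_elim
  case (elim t)
  show ?case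
  proof
  assume t: "t : {0..T}"
  hence ft: "vL2 (f t)" "vL2 (v t)" using elim by auto
  show "torus_integral L (%x. G_vec L a1 (f t) x <.> v t x) = L ^ 3 * (LINT k|cs. (gsym a1 k *R vc f t k) <.> vc v t k)"
  unfolding pair_tm[OF G_vec_L2(1)[OF ft(1) a1_pos] ft(2)] G_vec_L2(2)[OF ft(1) a1_pos] vc_in[OF t] ..
  qed
  qed
 qed
 have X: "X1 (uu w b t) k = gsym a1 k *R adv (WW t) (WW t) k + (- 1) *R (gsym a1 k *R adv (HH t) (HH t) k)"
  "X2 (uu w b t) k = gsym a2 k *R adv (WW t) (HH t) k + (- 1) *R (gsym a2 k *R adv (HH t) (WW t) k)" for t k
  by (simp_all add: X1_def X2_def scaleR_diff_right)
 have e1: "PT (R1 w' w b q f) (vc v) = PT (vc w') (vc v) + ((PT (%t k. gsym a1 k *R adv (WW t) (WW t) k) (vc v) - PT (%t k. gsym a1 k *R adv (HH t) (HH t) k) (vc v))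
  + (PT (%t k. gc k (sc q t k)) (vc v) + (nu * PT (%t k. (K k)^2 *R vc w t k) (vc v) - PT (%t k. gsym a1 k *R vc f t k) (vc v))))"
  unfolding R1_def[abs_def] X PT_add[OF w'_L2h(1) L2h_add[OF x y2] V0] PT_add[OF x y2 V0] PT_add[OF a(1) n V0]
  PT_add[OF vq y3 V0] PT_add[OF vw vf V0] PT_scaleR by simp
 have e2: "PT (R2 b' w b) (vc v) = PT (vc b') (vc v) + ((PT (%t k. gsym a2 k *R adv (WW t) (HH t) k) (vc v) - PT (%t k. gsym a2 k *R adv (HH t) (WW t) k) (vc v))
  + mu * PT (%t k. (K k)^2 *R vc b t k) (vc v))"
  unfolding R2_def[abs_def] X PT_add[OF b'_L2h(1) L2h_add[OF x' vb] V0] PT_add[OF x' vb V0] PT_add[OF a(3) n' V0] PT_scaleR by simp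
 have c: "L ^ 3 * x = 0 <-> x = 0" for x using L3_pos by simp
 note sp = spacetime_pair[OF w'_L2h(1) z(1) V0 V(2)] spacetime_pair[OF b'_L2h(1) z(2) V0 V(2)] spacetime_viscous[OF w_L2h V0 V(2)] spacetime_viscous[OF b_L2h V0 V(2)] p g
 show "eq_w w' w b q f v <-> PT (R1 w' w b q f) (vc v) = 0" (is "?l = ?r <-> ?p = 0")
 proof -
  have "?l - ?r = L ^ 3 * ?p" unfolding e1 sp using t1 by (simp add: algebra_simps)
  thus ?thesis unfolding right_minus_eq[symmetric, of ?l ?r] by (simp only: c)
 qed
 show "eq_b b' w b v <-> PT (R2 b' w b) (vc v) = 0" (is "?l = 0 <-> ?p = 0")
 proof -
  have "?l = L ^ 3 * ?p" unfolding e2 sp using t2 by (simp add: algebra_simps)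
  thus ?thesis by (simp only: c)
 qed
qed

end

section \<open>From a weak solution to its modes\<close>

context mhd begin

lemma tt_L2: "tt z n : L2_torus L" by (rule test_L2(1)[OF tt_test])

lemma tt_pairing: assumes c: "!!k. c (- k) = cnj (c k)" "hsq 0 c < infy" shows "(LINT k|cs. c k <.> ft (tt z n) k) = c n <.> z"
proof -
 note r = rr_L2[OF c]
 have "L ^ 3 * (LINT k|cs. c k <.> ft (tt z n) k) = L ^ 3 * (c n <.> z)"
  using torus_parseval(2)[OF r(1) tt_L2[of z n]] tt_integral[OF L2_imp_L1[OF r(1)], of z n] by (auto simp: r(2))
 thus ?thesis using L3_pos by simp
qed

lemma tt_hsq1: "hsq 1 (ft (tt z n)) < infy"
proof -
 have s: "ft (tt z n) k = 0" if "k \<notin> {n, - n}" for k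
 proof -
  have "cf (%x. z * ch n x) m = (if n = m then z else 0)" for m unfolding cf_cmult by (simp add: cf_ch)
  thus ?thesis using that unfolding ft_cf tt_def cf_Re[OF P1_cmult[OF P2_imp_P1[OF P2_ch]]] by auto
 qed
 let ?g = "%k. jap k ^ 1 * (norm (ft (tt z n) k))^2"
 have "hsq 1 (ft (tt z n)) <= ennreal (\<Sum>k\<in>{n, - n}. ?g k)"
 proof (rule hsq_le_finite_sums)
  fix F :: "(int^3) set" assume F: "finite F"
  have "(\<Sum>k\<in>F. ?g k) <= (\<Sum>k\<in>F \<union> {n, - n}. ?g k)" using F jap_pos by (intro sum_mono2) (auto simp: less_imp_le)
  also have "... = (\<Sum>k\<in>{n, - n}. ?g k)" using F s by (intro sum.mono_neutral_right) auto
  finally show "(\<Sum>k\<in>F. ?g k) <= (\<Sum>k\<in>{n, - n}. ?g k)" .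
 qed
 thus ?thesis by (rule le_less_trans) simp
qed

lemma ft_cmult: assumes "f : L2_torus L" shows "(%x. c * f x) : L2_torus L" "ft (%x. c * f x) k = of_real c * ft f k"
 using L2_torus_lincomb[OF L2_torus_zero assms, of c] ft_lincomb[OF L2_imp_L1[OF L2_torus_zero] L2_imp_L1[OF assms], of c k] by simp_all

lemma test_field: assumes g: "g : BM" and fin: "(NI {0..T} (%t. ennreal ((g t)^2))) < infy"
 shows "(%t x. g t * tt z n x) : L2_time T (sobolev L 1) (sobolev_norm L 1)"
proof -
 note c = ft_cmult[OF tt_L2[of z n]]
 have h: "hsq 1 (ft (%x. g t * tt z n x)) = ennreal ((g t)^2) * hsq 1 (ft (tt z n))" for t
  using hsq_scaleR[of 1 "g t" "ft (tt z n)"] by (simp add: c(2)[abs_def] scaleR_conv_of_real)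
 have hf: "hsq 1 (ft (%x. g t * tt z n x)) < infy" for t unfolding h using tt_hsq1[of z n] by (simp add: mult_lt_top)
 have "(NI {0..T} (%t. hsq 1 (%k. g t *R ft (tt z n) k)))
  = (LN t. hsq 1 (ft (tt z n)) * (ennreal ((g t)^2) * indicator {0..T} t))" by (simp add: hsq_scaleR mult_ac)
 also have "... = hsq 1 (ft (tt z n)) * (NI {0..T} (%t. ennreal ((g t)^2)))" using g by (intro nn_integral_cmult) simp
 also have "... < infy" using tt_hsq1[of z n] fin by (simp add: mult_lt_top)
 finally have a: "L2h 1 (%t k. g t *R ft (tt z n) k)" using g by (simp add: L2h_def)
 have "(%t x. g t * tt z n x) : L2_time T (sobolev L (real 1)) (sobolev_norm L (real 1))"
 proof (rule L2_timeI[OF _ _ _ _ _ a])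
  have "continuous_on UNIV (tt z n)" using tt_has_derivative by (intro differentiable_imp_continuous_on) (auto simp: differentiable_on_def differentiable_def)
  hence t: "(%p::real \<times> (real^3). tt z n (snd p)) : BM"
  by (intro bm_cont continuous_on_compose2[OF _ continuous_on_snd]) (auto intro: continuous_on_id)
  have f: "(%p::real \<times> (real^3). indicator {0..T} (fst p) * g (fst p)) : BM"
  by (rule m_comp[of fst _ borel]) (use g in \<open>auto intro!: bm_cont continuous_intros\<close>)
  show "jointly_measurable T (%t x. g t * tt z n x)"
  unfolding jm_iff using borel_measurable_times[OF f t] by (simp add: mult.assoc)
  show "AET t. (%x. g t * tt z n x) : sobolev L (real 1)" unfolding sobolev_iff using c(1) hf by simp
  show "AET t. (sobolev_norm L (real 1) (%x. g t * tt z n x))^2 = enn2real (hsq 1 (ft (%x. g t * tt z n x)))"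
  using sobolev_norm2[OF hf] by simp
  show "(%t. hsq 1 (ft (%x. g t * tt z n x))) : BM" unfolding h using g by measurable
  show "AET t. hsq 1 (ft (%x. g t * tt z n x)) <= hsq 1 (%k. g t *R ft (tt z n) k)" unfolding h hsq_scaleR by simp
 qed
 thus ?thesis by simp
qed

text \<open>The test function is \<open>g t\<close> times a trigonometric function in the component
  \<open>i\<close>, where \<open>g\<close> is the very coefficient of \<open>R\<close> that is to
  vanish; the pairing becomes the integral of \<open>g^2\<close>. Such a \<open>g\<close> is merely
  square integrable, which the class of test functions allows.\<close>

lemma PT_zero: assumes R: "L2h 0 R" and h: "!!t. herm (R t)"
  and z: "!!v. (!!i. (%t x. v t x $ i) : L2_time T (sobolev L 1) (sobolev_norm L 1)) ==> PT R (vc v) = 0"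
 shows "AET t. (\<forall>k. R t k = 0)"
proof -
 have "AET t. R t n $ i <.> y = 0" for n i y
 proof -
  define g where "g = (%t. R t n $ i <.> y)"
  have gm: "g : BM" unfolding g_def by (intro borel_measurable_inner m_comp[OF L2hD(1)[OF R] bm_nth] borel_measurable_const)
  define v where "v = (%t x. (\<chi> j. if j = i then g t * tt y n x else 0) :: real^3)"
  have rm: "(%t. hsq 0 (R t)) : BM" by (rule hsq_measurable[OF L2hD(1)[OF R]])
  have le: "ennreal ((g t)^2) <= ennreal ((norm y)^2) * hsq 0 (R t)" for t
  proof -
  have "\<bar>g t\<bar> <= norm y * norm (R t n)"
  using order_trans[OF Cauchy_Schwarz_ineq2 mult_right_mono[OF Finite_Cartesian_Product.norm_nth_le norm_ge_zero], of "R t n" i y]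
  by (simp add: g_def mult.commute)
  hence "\<bar>g t\<bar>^2 <= (norm y * norm (R t n))^2" by (intro power_mono) auto
  hence "ennreal ((g t)^2) <= ennreal ((norm y)^2 * (norm (R t n))^2)" by (intro ennreal_leI) (simp add: power_mult_distrib)
  also have "... <= ennreal ((norm y)^2) * hsq 0 (R t)" by (simp add: ennreal_mult mult_lmono hsq_point)
  finally show ?thesis .
  qed
  have "(NI {0..T} (%t. ennreal ((g t)^2))) <= (LN t. ennreal ((norm y)^2) * (hsq 0 (R t) * indicator {0..T} t))"
  by (intro nn_integral_mono) (use le in \<open>auto simp: indicator_def\<close>)
  also have "... = ennreal ((norm y)^2) * (NI {0..T} (%t. hsq 0 (R t)))" using rm by (intro nn_integral_cmult) simp
  also have "... < infy" using L2hD(2)[OF R] by (simp add: mult_lt_top)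
  finally have fin: "(NI {0..T} (%t. ennreal ((g t)^2))) < infy" .
  have vL: "(%t x. v t x $ j) : L2_time T (sobolev L 1) (sobolev_norm L 1)" for j
  using test_field[OF gm fin] test_field[of "%t. 0"] by (cases "j = i") (simp_all add: v_def)
  hence "PT R (vc v) = 0" by (rule z)
  moreover have "PT R (vc v) = (LBINT t:{0..T}. (g t)^2)" unfolding PT_def
  proof (rule set_lebesgue_integral_cong_AE)
  show "AET t. (LINT k|cs. R t k <.> vc v t k) = (g t)^2" using L2h_AE[OF R]
  proof eventually_elim
  case (elim t)
  show ?case
  proof
  assume t: "t : {0..T}"
  have c: "hsq 0 (%k. R t k $ i) < infy" by (rule le_less_trans[OF hsq_comp_le]) (use elim t in simp)
  have "R t k <.> vc v t k = g t * (R t k $ i <.> ft (tt y n) k)" for k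
  proof -
  have f: "ft (%x. v t x $ j) k = (if j = i then of_real (g t) * ft (tt y n) k else 0)" for j
  by (simp add: v_def ft_cmult(2)[OF tt_L2])
  have "R t k <.> vc v t k = (\<Sum>j\<in>UNIV. if j = i then R t k $ j <.> (g t *R ft (tt y n) k) else 0)"
  unfolding inner_vec_def vc_in[OF t] vft_nth f by (intro sum.cong refl) (simp add: scaleR_conv_of_real)
  thus ?thesis by simp
  qed
  hence "(LINT k|cs. R t k <.> vc v t k) = g t * (LINT k|cs. R t k $ i <.> ft (tt y n) k)" by simp
  also have "(LINT k|cs. R t k $ i <.> ft (tt y n) k) = R t n $ i <.> y"
  by (rule tt_pairing[OF _ c]) (use h[of t] in \<open>simp add: herm_def\<close>)
  finally show "(LINT k|cs. R t k <.> vc v t k) = (g t)^2" by (simp add: g_def power2_eq_square)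
  qed
  qed
  have "!!j. jointly_measurable T (%t x. v t x $ j)" using vL by (simp add: L2_time_def)
  note vm = vc_measurable[OF this]
  show "(%t. (LINT k|cs. R t k <.> vc v t k)) : BMs lborel" unfolding measurable_lborel1 by (intro bm_cs_integral)
  (rule cs_joint, use L2hD(1)[OF R] vm in measurable)
  show "(%t. (g t)^2) : BMs lborel" using gm by simp
  qed simp
  ultimately have z: "(LINT t|lborel. indicator {0..T} t *R (g t)^2) = 0" by (simp add: sli_def)
  have "integrable lborel (%t. indicator {0..T} t *R (g t)^2)"
  proof (rule integrableI_bounded)
  have "(LN t. ennreal (norm (indicator {0..T} t *R (g t)^2))) = (NI {0..T} (%t. ennreal ((g t)^2)))"
  by (intro nn_integral_cong) (simp add: indicator_def)
  thus "(LN t. ennreal (norm (indicator {0..T} t *R (g t)^2))) < infy" using fin by simp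
  qed (use gm in simp)
  hence "AE t in lborel. indicator {0..T} t *R (g t)^2 = 0" using z by (subst (asm) integral_nonneg_eq_0_iff_AE) auto
  thus ?thesis by eventually_elim (auto simp: g_def)
 qed
 \<comment> \<open>Countably many modes and the two directions \<open>1\<close> and
   \<open>\<i>\<close> suffice, so one null set of times covers all of them.\<close>
 hence "AE t in lborel. \<forall>n i. t : {0..T} --> R t n $ i <.> 1 = 0 & R t n $ i <.> \<i> = 0"
  unfolding AE_all_countable AE_conj_iff imp_conjR by blast
 thus ?thesis by eventually_elim (auto simp: vec_eq_iff complex_eq_iff inner_complex_def)
qed

lemma hn_point: assumes "hsq 1 d < infy" shows "norm (d k) <= hn d"
proof (rule power2_le_imp_le[OF _ hn_nonneg])
 show "(norm (d k))^2 <= (hn d)^2" using hsq_point[of d k 1] unfolding hsq_hn[OF assms] by (simp add: ennreal_le_iff)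
qed

lemma Hsol_norm_nonneg: "0 <= Hsol_norm L s w" by (simp add: Hsol_norm_def infsum_nonneg)

lemma hn_le_norm: assumes "d : Hsol L 1" shows "hn (vft d) <= sqrt Cp * Hsol_norm L 1 d"
proof (rule hn_le)
 show "0 <= sqrt Cp * Hsol_norm L 1 d" using Cp_pos Hsol_norm_nonneg by simp
 show "hsq 1 (vft d) <= ennreal ((sqrt Cp * Hsol_norm L 1 d)^2)"
  using hsq_le_norm[of d 1] assms Cp_pos by (simp add: power_mult_distrib)
qed

lemma Hsol_diff: assumes "v : Hsol L 1" "w : Hsol L 1" shows "(%x. v x - w x) : Hsol L 1"
proof -
 note i = Hsol_iff[of _ 1, unfolded of_nat_1]
 have v: "vL2 v" "vL2 w" using assms unfolding i by auto
 have e: "vft (%x. v x - w x) = (%k. vft v k - vft w k)" by (rule ext, rule vft_diff[OF v])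
 show ?thesis using assms vL2_diff[OF v] hsq_diff_finite[of 1 "vft v" "vft w"] unfolding i e by (auto simp: divfree_def wdot_diff)
qed

lemma C_time_tendsto: assumes w: "w : C_time T (Hsol L 1) (Hsol_norm L 1)" and t: "t : {0..T}"
 shows "((%s. hn (%k. vft (w s) k - vft (w t) k)) ---> 0) (at t within {0..T})"
proof (rule tendsto_0_le[where K="sqrt Cp"])
 show "((%s. Hsol_norm L 1 (%x. w s x - w t x)) ---> 0) (at t within {0..T})" using w t by (simp add: C_time_def)
 have "hn (%k. vft (w s) k - vft (w t) k) <= Hsol_norm L 1 (%x. w s x - w t x) * sqrt Cp" if s: "s : {0..T}" for s
 proof -
  have h: "w s : Hsol L 1" "w t : Hsol L 1" using w s t by (auto simp: C_time_def)
  have v: "vL2 (w s)" "vL2 (w t)" using h Hsol_iff[of _ 1] by auto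
  have e: "vft (%x. w s x - w t x) = (%k. vft (w s) k - vft (w t) k)" by (rule ext, rule vft_diff[OF v])
  show ?thesis using hn_le_norm[OF Hsol_diff[OF h]] unfolding e by (simp add: mult.commute)
 qed
 thus "\<forall>\<^sub>F s in at t within {0..T}. norm (hn (%k. vft (w s) k - vft (w t) k)) <= norm (Hsol_norm L 1 (%x. w s x - w t x)) * sqrt Cp"
  by (auto simp: eventually_at_filter abs_of_nonneg[OF hn_nonneg] abs_of_nonneg[OF Hsol_norm_nonneg] intro!: always_eventually)
qed

lemma C_time_finite: assumes "w : C_time T (Hsol L 1) (Hsol_norm L 1)" "t : {0..T}"
 shows "vL2 (w t)" "hsq 1 (vft (w t)) < infy" "divfree (vft (w t))" "vft (w t) 0 = 0"
 using assms Hsol_iff[of "w t" 1] by (auto simp: C_time_def)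

lemma C_time_bounded: assumes w: "w : C_time T (Hsol L 1) (Hsol_norm L 1)"
 obtains A where "0 <= A" "!!t. hsq 1 (vc w t) <= ennreal A"
proof -
 note f = C_time_finite[OF w]
 have "continuous_on {0..T} (%t. hn (vft (w t)))" unfolding continuous_on_def
 proof
  fix t assume t: "t : {0..T}"
  have "norm (hn (vft (w s)) - hn (vft (w t))) <= hn (%k. vft (w s) k - vft (w t) k)" if s: "s : {0..T}" for s
  proof -
  note a = f(2)[OF s] and b = f(2)[OF t]
  have "hn (vft (w s)) <= hn (%k. vft (w s) k - vft (w t) k) + hn (vft (w t))"
  using hn_triangle[OF hsq_diff_finite[OF a b] b] by simp
  moreover have "hn (vft (w t)) <= hn (%k. vft (w s) k - vft (w t) k) + hn (vft (w s))"
  using hn_triangle[OF hsq_diff_finite[OF b a] a] hn_minus_commute[of "vft (w t)" "vft (w s)"] by simp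
  ultimately show ?thesis by (simp add: abs_le_iff)
  qed
  hence "\<forall>\<^sub>F s in at t within {0..T}. norm (hn (vft (w s)) - hn (vft (w t))) <= norm (hn (%k. vft (w s) k - vft (w t) k)) * 1"
  by (auto simp: eventually_at_filter abs_of_nonneg[OF hn_nonneg] intro!: always_eventually)
  from tendsto_0_le[OF C_time_tendsto[OF w t] this]
  show "((%t. hn (vft (w t))) ---> hn (vft (w t))) (at t within {0..T})" by (simp add: LIM_zero_iff)
 qed
 hence "bounded ((%t. hn (vft (w t))) ` {0..T})" by (intro compact_imp_bounded compact_continuous_image) auto
 then obtain B where B: "!!t. t : {0..T} ==> norm (hn (vft (w t))) <= B" unfolding bounded_iff by blast
 have "hsq 1 (vc w t) <= ennreal (B^2)" for t
 proof (cases "t : {0..T}")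
  case True
  have "(hn (vft (w t)))^2 <= B^2" using B[OF True] hn_nonneg by (intro power_mono) auto
  thus ?thesis unfolding vc_in[OF True] hsq_hn[OF f(2)[OF True]] by (rule ennreal_leI)
 qed (simp add: vc_out hsq_zero)
 thus ?thesis by (rule that[rotated]) simp
qed

lemma C_time_continuous: assumes w: "w : C_time T (Hsol L 1) (Hsol_norm L 1)" shows "continuous_on {0..T} (%t. vc w t k)"
 unfolding continuous_on_def
proof
 fix t assume t: "t : {0..T}"
 note f = C_time_finite[OF w]
 have "\<forall>\<^sub>F s in at t within {0..T}. norm (vc w s k - vc w t k) <= norm (hn (%k. vft (w s) k - vft (w t) k)) * 1"
 proof -
  have "norm (vc w s k - vc w t k) <= hn (%k. vft (w s) k - vft (w t) k)" if s: "s : {0..T}" for s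
  using hn_point[OF hsq_diff_finite[OF f(2)[OF s] f(2)[OF t]], of k] by (simp add: vc_in[OF s] vc_in[OF t])
  thus ?thesis by (auto simp: eventually_at_filter abs_of_nonneg[OF hn_nonneg] intro!: always_eventually)
 qed
 from tendsto_0_le[OF C_time_tendsto[OF w t] this]
 show "((%t. vc w t k) ---> vc w t k) (at t within {0..T})" by (simp add: LIM_zero_iff)
qed

lemma X_herm: assumes "good u" shows "herm (X1 u)" "herm (X2 u)"
proof -
 note g = good_WH[OF assms]
 show "herm (X1 u)" "herm (X2 u)"
  using adv_herm[OF g(1) g(1)] adv_herm[OF g(3) g(3)] adv_herm[OF g(1) g(3)] adv_herm[OF g(3) g(1)]
  by (auto simp: herm_def X1_def X2_def scaleR_cx)
qed

lemma uu_good: assumes w: "w : C_time T (Hsol L 1) (Hsol_norm L 1)" and b: "b : C_time T (Hsol L 1) (Hsol_norm L 1)"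
 shows "good (uu w b t)"
proof (cases "t : {0..T}")
 case True
 thus ?thesis using C_time_finite[OF w] C_time_finite[OF b] vft_herm by (simp add: good_def uu_def vc_in zero_prod_def)
next
 case False
 thus ?thesis by (simp add: good_def uu_def vc_out zero_prod_def herm_def divfree_def wdot_def)
qed

lemma L2h_nth: assumes "L2h s (a :: real => int^3 => complex^3)" shows "L2h s (%t k. a t k $ i)"
 by (rule L2h_scaled[OF m_comp[OF L2hD(1)[OF assms] bm_nth] _ assms, where C=1]) (simp add: hsq_comp_le)

lemma L2h_mono: assumes "L2h s a" "r <= s" shows "L2h r a"
 by (rule L2h_scaled[OF L2hD(1)[OF assms(1)] _ assms(1), where C=1]) (simp add: hsq_mono_s[OF assms(2)])

lemma lebesgue_vec_nth:
 fixes u :: "real => real^3 => real^3" assumes "!!i. SI {0..T} (%t. psi t * u t x $ i)"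
 shows "(LINT t:{0..T}|lebesgue. psi t *R u t x) $ i = (LBINT t:{0..T}. psi t * u t x $ i)"
proof -
 have v: "integrable lborel (%t. indicator {0..T} t *R psi t *R u t x)"
  by (rule integrable_vec3) (use assms in \<open>simp add: si_def mult.assoc\<close>)
 have lb: "(LINT t:{0..T}|lebesgue. psi t *R u t x) = (LINT t|lborel. indicator {0..T} t *R psi t *R u t x)"
  unfolding sli_def by (rule integral_completion) (use v in auto)
 show ?thesis unfolding lb vec_nth_integral(2)[OF v] by (simp add: sli_def mult.assoc)
qed

lemma time_test_cont:
 assumes "ph : time_test T" shows "continuous_on UNIV ph" "continuous_on UNIV (deriv ph)" "(ph has_real_derivative deriv ph t) (at t)"
proof -
 have d: "((deriv ^^ n) ph) differentiable (at t)" for n t using assms by (simp add: time_test_def)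
 show "continuous_on UNIV ph" "continuous_on UNIV (deriv ph)"
  using d[of 0] d[of 1] by (auto intro!: differentiable_imp_continuous_on simp: differentiable_on_def intro: differentiable_at_withinI)
 show "(ph has_real_derivative deriv ph t) (at t)" using d[of 0 t] by (simp add: DERIV_deriv_iff_real_differentiable)
qed

lemma time_test_bounded:
 assumes "ph : time_test T" shows "\<exists>C. \<forall>t\<in>{0..T}. \<bar>deriv ph t\<bar> <= C & \<bar>ph t\<bar> <= C"
proof -
 have b: "\<exists>C. \<forall>t\<in>{0..T}. \<bar>psi t\<bar> <= C" if "continuous_on UNIV psi" for psi :: "real => real"
  using compact_imp_bounded[OF compact_continuous_image[OF continuous_on_subset[OF that subset_UNIV] compact_Icc]]
  unfolding bounded_iff by auto
 obtain C1 C2 where "\<forall>t\<in>{0..T}. \<bar>deriv ph t\<bar> <= C1" "\<forall>t\<in>{0..T}. \<bar>ph t\<bar> <= C2"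
  using b time_test_cont(1,2)[OF assms] by metis
 thus ?thesis by (intro exI[of _ "max C1 C2"]) (auto simp: le_max_iff_disj)
qed

text \<open>\<open>time_derivative\<close> compares time integrals at almost every point of space.
  Fourier coefficients, taken by \<open>time_field\<close>, turn this into a weak derivative of each
  mode, which \<open>ac_from_weak_derivative\<close> integrates.\<close>

lemma weak_derivative_modes:
 assumes w: "w : L2_time T (Hsol L 2) (Hsol_norm L 2)" and wc: "w : C_time T (Hsol L 1) (Hsol_norm L 1)"
  and w': "w' : L2_time T (Hsol L 0) (Hsol_norm L 0)" and d: "time_derivative T w w'" and t: "t : {0..T}"
 shows "SI {0..T} (%s. vc w' s k)" "vc w t k = vc w 0 k + (LBINT s:{0..t}. vc w' s k)"
proof -
 have L: "L2h 0 (vc w)" "L2h 0 (vc w')" using L2h_mono[of 2 "vc w" 0] vc_L2h_Hsol[of w 2] vc_L2h_Hsol[of w' 0] w w' by simp_all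
 have ae: "AET t. vL2 (w t)" "AET t. vL2 (w' t)"
  using vc_L2h_Hsol(2)[of w 2] vc_L2h_Hsol(2)[of w' 0] w w' unfolding Hsol_iff by auto
 have jm: "jointly_measurable T w" "jointly_measurable T w'" using w w' by (auto simp: L2_time_def)
 show i: "SI {0..T} (%s. vc w' s k)" by (rule nn_time_si(2)[OF L2hD[OF L(2)]])
 have iw: "SI {0..T} (%s. vc w s k)" by (rule nn_time_si(2)[OF L2hD[OF L(1)]])
 have comp: "(%t x. u t x $ i) = (%t. (%x. u t x $ i))" for u :: "real => real^3 => real^3" and i by simp
 show "vc w t k = vc w 0 k + (LBINT s:{0..t}. vc w' s k)"
 proof (rule ac_from_weak_derivative[OF T_pos C_time_continuous[OF wc] i _ t])
  fix ph assume ph: "ph : time_test T"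
  obtain C where C: "!!t. t : {0..T} ==> \<bar>deriv ph t\<bar> <= C" "!!t. t : {0..T} ==> \<bar>ph t\<bar> <= C"
  using time_test_bounded[OF ph] by metis
  note m = bm_cont[OF time_test_cont(1)[OF ph]] bm_cont[OF time_test_cont(2)[OF ph]]
  have ci: "L2h 0 (sc (%t x. w t x $ i))" "L2h 0 (sc (%t x. w' t x $ i))" for i
  unfolding vc_nth[symmetric, abs_def] by (rule L2h_nth[OF L(1)], rule L2h_nth[OF L(2)])
  have ai: "AET t. (%x. w t x $ i) : L2_torus L" "AET t. (%x. w' t x $ i) : L2_torus L" for i
  using ae by (eventually_elim; simp add: vL2_def)+
  note F = time_field[OF jm_nth[OF jm(1)] m(2) C(1) ai(1) ci(1)]
  note G = time_field[OF jm_nth[OF jm(2)] m(1) C(2) ai(2) ci(2)]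
  have swap: "(LBINT t:{0..T}. deriv ph t *R vc w t k $ i) = - (LBINT t:{0..T}. ph t *R vc w' t k $ i)" for i
  proof -
  have x: "AE x in tm. (LBINT t:{0..T}. deriv ph t * w t x $ i) = - (LBINT t:{0..T}. ph t * w' t x $ i)"
  proof -
  have "AE x in lborel. (LINT t:{0..T}|lebesgue. deriv ph t *R w t x) = - (LINT t:{0..T}|lebesgue. ph t *R w' t x)"
  using d ph by (simp add: time_derivative_def)
  hence D: "AE x in tm. (LINT t:{0..T}|lebesgue. deriv ph t *R w t x) = - (LINT t:{0..T}|lebesgue. ph t *R w' t x)"
  unfolding AE_tm by eventually_elim simp
  have vec: "AE x in tm. \<forall>i. SI {0..T} (%t. deriv ph t * w t x $ i) & SI {0..T} (%t. ph t * w' t x $ i)"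
  unfolding AE_all_countable using F(3) G(3) by (simp add: AE_conj_iff)
  show ?thesis using D vec
  proof eventually_elim
  case (elim x)
  have "(LINT t:{0..T}|lebesgue. deriv ph t *R w t x) $ i = - ((LINT t:{0..T}|lebesgue. ph t *R w' t x) $ i)" using elim(1) by simp
  thus ?case using elim(2) by (simp add: lebesgue_vec_nth)
  qed
  qed
  have "ft (%x. LBINT t:{0..T}. deriv ph t * w t x $ i) k = - ft (%x. LBINT t:{0..T}. ph t * w' t x $ i) k"
  proof -
  have hm: "(%x. complex_of_real (H x) * cnj (ch k x)) : BMs tm" if "H : BM" for H
  using that by (intro m_tm borel_measurable_times cnj_measurable ch_measurable) simp
  have "(LINT x|tm. complex_of_real (LBINT t:{0..T}. deriv ph t * w t x $ i) * cnj (ch k x))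
  = (LINT x|tm. - (complex_of_real (LBINT t:{0..T}. ph t * w' t x $ i) * cnj (ch k x)))"
  proof (rule integral_cong_AE)
  show "AE x in tm. complex_of_real (LBINT t:{0..T}. deriv ph t * w t x $ i) * cnj (ch k x)
  = - (complex_of_real (LBINT t:{0..T}. ph t * w' t x $ i) * cnj (ch k x))" using x by eventually_elim simp
  qed (use hm[OF F(1)] hm[OF G(1)] in auto)
  thus ?thesis unfolding ft_cf cf_def by simp
  qed
  moreover have "ft (%x. LBINT t:{0..T}. deriv ph t * w t x $ i) k = (LBINT t:{0..T}. deriv ph t *R sc (%t x. w t x $ i) t k)"
  by (rule F(4))
  moreover have "ft (%x. LBINT t:{0..T}. ph t * w' t x $ i) k = (LBINT t:{0..T}. ph t *R sc (%t x. w' t x $ i) t k)"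
  by (rule G(4))
  ultimately show ?thesis by (simp only: vc_nth)
  qed
  have s: "SI {0..T} (%t. deriv ph t *R vc w t k)" "SI {0..T} (%t. ph t *R vc w' t k)"
  by (rule si_scaleR[OF iw _ _ C(1)], simp, use m in simp, assumption)
  (rule si_scaleR[OF i _ _ C(2)], simp, use m in simp, assumption)
  show "(LBINT t:{0..T}. deriv ph t *R vc w t k) = - (LBINT t:{0..T}. ph t *R vc w' t k)"
  unfolding sli_def vec_eq_iff vector_uminus_component
  vec_nth_integral(2)[OF s(1)[unfolded si_def]] vec_nth_integral(2)[OF s(2)[unfolded si_def]] using swap by (simp add: sli_def)
 qed
qed

end

section \<open>The problem with given data\<close>

locale mhd_problem = mhd L T nu mu a1 a2 N1 N2 for L T nu mu a1 a2 :: real and N1 N2 :: nat +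
 fixes U0 B0 :: "real^3 => real^3" and f :: "real => real^3 => real^3"
 assumes U0: "U0 : Hsol L 0" and B0: "B0 : Hsol L 0" and f: "f : L2_space_time L T" and fm: "zero_mean L T f"
begin

definition ini :: "int^3 => mode" where "ini k = (gsym a1 k *R vft U0 k, gsym a2 k *R vft B0 k)"
text \<open>Mode zero is removed by hand: the mean of \<open>f\<close> vanishes only at almost every
  time, while \<open>good\<close> is required at every time.\<close>

definition frc :: "real => int^3 => complex^3" where "frc t k = (if k = 0 then 0 else leray k (vc f t k))"

lemma UB: "vL2 U0" "vL2 B0" "divfree (vft U0)" "divfree (vft B0)" "vft U0 0 = 0" "vft B0 0 = 0"
 using U0 B0 Hsol_iff[of _ 0] by auto

lemmas f_L2h = L2_space_time_L2h[OF f]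

lemma f_mean: "AET t. vc f t 0 = 0"
 using f_L2h(2) fm[unfolded zero_mean_def AE_completion_iff] by eventually_elim (auto simp: mean_iff vc_in)

lemma frc_L2h: "L2h 0 frc"
proof (rule L2h_scaled[OF _ _ f_L2h(1), where C=1])
 show "(%t. frc t k) : BM" for k unfolding frc_def using m_comp[OF L2hD(1)[OF f_L2h(1)] leray_measurable] by (cases "k = 0") auto
 have "hsq 0 (frc t) <= hsq 0 (vc f t)" for t by (rule hsq_mono_norm) (simp add: frc_def leray_norm)
 thus "AET t. hsq 0 (frc t) <= ennreal 1 * hsq 0 (vc f t)" by simp
qed

lemma ini_good: "good ini" using UB vft_herm[of U0] vft_herm[of B0]
 by (simp add: good_def ini_def herm_def divfree_def wdot_scaleR scaleR_cx zero_prod_def)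

lemma frc_good: "good (%k. (frc t k, 0))"
proof -
 have "herm (leray' :: int^3 => complex^3)" if "leray' = (%k. leray k (vc f t k))" for leray'
  unfolding that herm_def by (intro allI leray_cnj) (use vc_herm[of f t] in \<open>simp add: herm_def\<close>)
 hence "herm (frc t)" by (simp add: frc_def herm_def)
 moreover have "divfree (frc t)" by (simp add: frc_def divfree_def wdot_leray) (simp add: wdot_def)
 moreover have "frc t 0 = 0" "herm (%k. 0)" "divfree (%k. 0)" by (simp_all add: frc_def herm_def divfree_def wdot_def)
 ultimately show ?thesis by (simp add: good_def zero_prod_def)
qed

lemma ini_h2: "hsq 2 ini < infy"
proof -
 have "hsq 2 (%k. gsym al k *R vft V k) < infy" if "al > 0" "vL2 V" for al V
  by (rule le_less_trans[OF gsym_hsq2[OF that(1), of 0, unfolded add_0]]) (use vft_hsq0[OF that(2)] in \<open>simp add: mult_lt_top\<close>)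
 from this[OF a1_pos UB(1)] this[OF a2_pos UB(2)] show ?thesis unfolding hsq_prod[of 2 ini] ini_def by simp
qed

sublocale mhd_data L T nu mu a1 a2 N1 N2 ini frc
 by unfold_locales (rule ini_good, rule ini_h2, rule L2hD(1)[OF frc_L2h], rule frc_good, rule L2hD(2)[OF frc_L2h])

text \<open>The pressure that solves the divergence of the momentum equation,
  \<open>wdot Y + \<i> K^2 q = 0\<close> with \<open>Y\<close> the nonlinear term minus the filtered
  forcing. At \<open>k = 0\<close> the quotient is \<open>0\<close>, in accordance with the zero
  mean of the pressure.\<close>

definition qf :: "(int^3 => mode) => real => int^3 => complex" where
 "qf u t k = \<i> * wdot k (X1 u k - gsym a1 k *R vc f t k) / of_real ((K k)^2)"

lemma wdot_gc: "wdot k (gc k z) = \<i> * of_real ((K k)^2) * z"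
 unfolding sum_wave2[symmetric] by (simp add: wdot_def gc_def sum_distrib_left sum_distrib_right mult_ac)

lemma leray_gc: "leray k (X1 u k - gsym a1 k *R vc f t k) = X1 u k - gsym a1 k *R vc f t k + gc k (qf u t k)"
 by (simp add: vec_eq_iff leray_def gc_def qf_def) (simp add: field_simps)

text \<open>The divergence of the momentum balance determines the pressure, and what remains is its Leray projection.\<close>

lemma residual_iff: assumes w: "wdot k w = 0" and w': "wdot k w' = 0" and z: "k = 0 ==> vc f t 0 = 0 & q = 0"
 shows "w' + (X1 u k + (gc k q + (nu *R ((K k)^2 *R w) + (- 1) *R (gsym a1 k *R vc f t k)))) = 0 <->
  q = qf u t k & w' = - ((nu * (K k)^2) *R w) + (fst (NN u k) + fst (Ff t k))"
proof -
 let ?Y = "X1 u k - gsym a1 k *R vc f t k"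
 have F: "fst (NN u k) + fst (Ff t k) = - leray k ?Y"
  using z by (cases "k = 0") (simp_all add: NN_def Ff_def frc_def leray_diff leray_scaleR leray_0)
 have e: "w' + (X1 u k + (gc k q + (nu *R ((K k)^2 *R w) + (- 1) *R (gsym a1 k *R vc f t k)))) = w' + (nu * (K k)^2) *R w + (?Y + gc k q)"
  by simp
 have q: "q = qf u t k" if "w' + (nu * (K k)^2) *R w + (?Y + gc k q) = 0"
 proof (cases "k = 0")
  case True thus ?thesis using z by (simp add: qf_def)
 next
  case False
  \<comment> \<open>The divergence removes the solenoidal terms and leaves the nonlinear term, the
    forcing and the pressure.\<close>
  have "wdot k (w' + (nu * (K k)^2) *R w + (?Y + gc k q)) = 0" unfolding that by (simp add: wdot_def)
  hence 1: "wdot k ?Y + \<i> * of_real ((K k)^2) * q = 0" by (simp add: wdot_add wdot_scaleR w w' wdot_gc)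
  have "complex_of_real ((K k)^2) ~= 0" using K_pos[OF False] by simp
  moreover have "of_real ((K k)^2) * q = \<i> * wdot k ?Y"
  proof -
  have "wdot k ?Y = - (\<i> * (of_real ((K k)^2) * q))" using 1 by (simp add: eq_neg_iff_add_eq_0 mult.assoc)
  thus ?thesis by simp
  qed
  ultimately show ?thesis unfolding qf_def by (simp add: eq_divide_eq mult.commute)
 qed
 have alg: "x + c + y = 0 <-> x = - c + - y" for x c y :: "complex^3"
  unfolding minus_add_distrib[symmetric] eq_neg_iff_add_eq_0 add.assoc ..
 show ?thesis unfolding e F leray_gc[of k u t] using q unfolding alg by auto
qed

text \<open>Gathers what uniqueness needs from an arbitrary weak solution: coefficients that are
  bounded in h^1 and solve the mode equation with the prescribed initial value, and a pressure given
  by \<open>qf\<close>.\<close>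

lemma weak_solution_modes: assumes S: "regular_weak_solution L T nu mu a1 a2 N1 N2 U0 B0 f w b q"
 obtains A where "0 <= A" "!!t. hsq 1 (uu w b t) <= ennreal A" "!!k. (%t. uu w b t k) : BM"
  "!!t. uu w b t 0 = 0" "sol ini (%s k. NN (uu w b s) k + Ff s k) (uu w b)"
  "!!t. t : {0..T} ==> vL2 (w t) & vL2 (b t)"
  "AET t. q t : L2_torus L & (\<forall>k. ft (q t) k = qf (uu w b t) t k)"
proof -
 have w: "w : L2_time T (Hsol L 2) (Hsol_norm L 2)" "w : C_time T (Hsol L 1) (Hsol_norm L 1)"
  and b: "b : L2_time T (Hsol L 2) (Hsol_norm L 2)" "b : C_time T (Hsol L 1) (Hsol_norm L 1)"
  and q: "q : L2_time T (sobolev L 1) (sobolev_norm L 1)" "zero_mean L T q"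
  and i: "((%t. Hsol_norm L 1 (%x. w t x - G_vec L a1 U0 x)) ---> 0) (at_right 0)"
  "((%t. Hsol_norm L 1 (%x. b t x - G_vec L a2 B0 x)) ---> 0) (at_right 0)" using S unfolding regular_weak_solution_def by blast+
 obtain w' b' where w': "w' : L2_time T (Hsol L 0) (Hsol_norm L 0)" "time_derivative T w w'"
  and b': "b' : L2_time T (Hsol L 0) (Hsol_norm L 0)" "time_derivative T b b'"
  and weak: "!!v. (!!i. (%t x. v t x $ i) : L2_time T (sobolev L 1) (sobolev_norm L 1)) ==>
  eq_w w' w b q f v"
  "!!h. (!!i. (%t x. h t x $ i) : L2_time T (sobolev L 1) (sobolev_norm L 1)) ==>
  eq_b b' w b h" using S unfolding regular_weak_solution_def by blast
 obtain A1 A2 where A: "0 <= A1" "!!t. hsq 1 (vc w t) <= ennreal A1" "0 <= A2" "!!t. hsq 1 (vc b t) <= ennreal A2"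
  using C_time_bounded[OF w(2)] C_time_bounded[OF b(2)] by metis
 have bound: "hsq 1 (uu w b t) <= ennreal (A1 + A2)" for t
  unfolding hsq_prod[of 1 "uu w b t"] ennreal_plus[OF A(1,3)] using add_mono[OF A(2,4)] by (simp add: uu_def)
 interpret st: mhd_state L T nu mu a1 a2 N1 N2 w b w' b' q f "A1 + A2"
  by unfold_locales (fact w(1) b(1) w'(1) b'(1) q(1) f bound)+
 have good: "good (uu w b t)" for t by (rule uu_good[OF w(2) b(2)])
 have herm: "herm (R1 w' w b q f t)" "herm (R2 b' w b t)" for t
  using vc_herm[of w' t] vc_herm[of b' t] vc_herm[of w t] vc_herm[of b t] vc_herm[of f t] X_herm[OF good[of t]]
  by (simp_all add: herm_def R1_def R2_def gc_def sc_def ft_minus wave_minus scaleR_cx)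
 \<comment> \<open>The weak form says that the residual pairs to zero with every admissible test
   function, hence it vanishes at almost every time.\<close>
 have r1: "AET t. (\<forall>k. R1 w' w b q f t k = 0)"
  by (rule PT_zero[OF st.R1_L2h herm(1)]) (subst st.weak_form(1)[symmetric], assumption, rule weak(1))
 have r2: "AET t. (\<forall>k. R2 b' w b t k = 0)"
  by (rule PT_zero[OF st.R2_L2h herm(2)]) (subst st.weak_form(2)[symmetric], assumption, rule weak(2))
 note g = good[unfolded good_def uu_def divfree_def fst_conv snd_conv]
 have eqs: "AET t. (\<forall>k. ft (q t) k = qf (uu w b t) t k \<and>
  (vc w' t k, vc b' t k) = - Lam k (uu w b t k) + (NN (uu w b t) k + Ff t k))"
  using r1 r2 st.w'_L2h(2) f_mean q(2)[unfolded zero_mean_def AE_completion_iff]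
 proof eventually_elim
  case (elim t)
  show ?case
  proof (intro impI allI)
  fix k assume t: "t : {0..T}"
  have "wdot k (vc w t k) = 0" "wdot k (vc w' t k) = 0"
  using g[of t] elim(3) t Hsol_iff[of "w' t" 0] by (auto simp: vc_in divfree_def)
  moreover have "vc f t 0 = 0 & sc q t k = 0" if "k = 0" using elim(4,5) t that by (simp add: sc_in ft_0 tint_tm)
  ultimately have "sc q t k = qf (uu w b t) t k & vc w' t k = - ((nu * (K k)^2) *R vc w t k) + (fst (NN (uu w b t) k) + fst (Ff t k))"
  using elim(1) t residual_iff[of k "vc w t k" "vc w' t k" t "sc q t k" "uu w b t"] by (simp add: R1_def)
  moreover have "vc b' t k = - (X2 (uu w b t) k + mu *R ((K k)^2 *R vc b t k))"
  unfolding eq_neg_iff_add_eq_0 using elim(2) t by (simp add: R2_def)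
  hence "vc b' t k = - ((mu * (K k)^2) *R vc b t k) + snd (NN (uu w b t) k)" by (simp add: NN_def)
  ultimately show "ft (q t) k = qf (uu w b t) t k & (vc w' t k, vc b' t k) = - Lam k (uu w b t k) + (NN (uu w b t) k + Ff t k)"
  using t by (simp add: sc_in Lam_def uu_def Ff_def prod_eq_iff)
  qed
 qed
 note dw = weak_derivative_modes[OF w w'] and db = weak_derivative_modes[OF b b']
 \<comment> \<open>The initial condition is a limit at \<open>0+\<close>, not a value; it is
   compared, mode by mode, with the value given by continuity in time.\<close>
 have init: "vc z 0 k = gsym al k *R vft Z k"
  if z: "z : C_time T (Hsol L 1) (Hsol_norm L 1)" and l: "((%t. Hsol_norm L 1 (%x. z t x - G_vec L al Z x)) ---> 0) (at_right 0)"
  and Z: "vL2 Z" "divfree (vft Z)" "vft Z 0 = 0" and al: "al > 0" for z Z al k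
 proof -
  note G = G_vec_L2[OF Z(1) al]
  have h: "hsq 1 (vft (G_vec L al Z)) < infy"
  proof -
  have "hsq 1 (vft (G_vec L al Z)) <= hsq (0 + 2) (%k. gsym al k *R vft Z k)" unfolding G(2)[abs_def] by (rule hsq_mono_s) simp
  also have "... < infy" by (rule le_less_trans[OF gsym_hsq2[OF al]]) (use vft_hsq0[OF Z(1)] in \<open>simp add: mult_lt_top\<close>)
  finally show ?thesis .
  qed
  have GH: "G_vec L al Z : Hsol L 1" using Hsol_iff[of "G_vec L al Z" 1] G h Z by (simp add: divfree_def wdot_scaleR)
  have ev: "\<forall>\<^sub>F t in at_right 0. t : {0..T}" using eventually_at_right_real[OF T_pos] by eventually_elim auto
  have le: "norm (vc z t k - vft (G_vec L al Z) k) <= norm (Hsol_norm L 1 (%x. z t x - G_vec L al Z x)) * sqrt Cp" if t: "t : {0..T}" for t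
  proof -
  have zt: "z t : Hsol L 1" using z t by (simp add: C_time_def)
  note d = Hsol_diff[OF zt GH]
  have e: "vft (%x. z t x - G_vec L al Z x) k = vc z t k - vft (G_vec L al Z) k"
  using vft_diff[OF _ G(1), of "z t" k] C_time_finite(1)[OF z t] by (simp add: vc_in[OF t])
  have "hsq 1 (vft (%x. z t x - G_vec L al Z x)) < infy" using d Hsol_iff[of _ 1] by simp
  from order_trans[OF hn_point[OF this, of k] hn_le_norm[OF d]]
  show ?thesis unfolding e by (simp add: abs_of_nonneg[OF Hsol_norm_nonneg] mult.commute)
  qed
  have 1: "((%t. vc z t k) ---> vft (G_vec L al Z) k) (at_right 0)"
  by (rule LIM_zero_cancel, rule tendsto_0_le[OF l eventually_mono[OF ev le]])
  have "((%t. vc z t k) ---> vc z 0 k) (at 0 within {0..T})"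
  using C_time_continuous[OF z, of k] T_pos by (auto simp: continuous_on_def)
  hence 2: "((%t. vc z t k) ---> vc z 0 k) (at_right 0)" using T_pos by (simp add: at_within_Icc_at_right)
  show ?thesis using tendsto_unique[OF _ 2 1] G(2) by simp
 qed
 have u0: "uu w b 0 k = ini k" for k
  unfolding uu_def ini_def using init[OF w(2) i(1) UB(1,3,5) a1_pos] init[OF b(2) i(2) UB(2,4,6) a2_pos] by simp
 have sol: "sol ini (%s k. NN (uu w b s) k + Ff s k) (uu w b)" unfolding sol_def
 proof (intro allI conjI ballI)
  fix k
  let ?d = "%s. (vc w' s k, vc b' s k)"
  let ?n = "%s. - Lam k (uu w b s k) + (NN (uu w b s) k + Ff s k)"
  have nm: "?n : BM" by (intro borel_measurable_add borel_measurable_uminus NN_measurable st.uu_measurable Ff_meas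
  m_comp[OF st.uu_measurable bm_cont[OF linear_continuous_on[OF Lam_bounded_linear]]])
  have dm: "?d : BM" by (intro borel_measurable_Pair L2hD(1)[OF st.w'_L2h(1)] L2hD(1)[OF st.b'_L2h(1)])
  \<comment> \<open>The mode equations are known at almost every time, which is enough inside the
    integrals.\<close>
  have ae: "AE s in lborel. indicator {0..t} s *R ?d s = indicator {0..t} s *R ?n s" if "t : {0..T}" for t
  using eqs by eventually_elim (use that in \<open>auto simp: indicator_def zero_prod_def\<close>)
  have di: "SI {0..t} ?d" "(LBINT s:{0..t}. ?d s) = ((LBINT s:{0..t}. vc w' s k), (LBINT s:{0..t}. vc b' s k))"
  if t: "t : {0..T}" for t
  proof -
  have j: "integrable lborel (%s. indicator {0..t} s *R vc w' s k)" "integrable lborel (%s. indicator {0..t} s *R vc b' s k)"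
  using si_subset[OF dw(1)[OF t, of k], of "{0..t}"] si_subset[OF db(1)[OF t, of k], of "{0..t}"] t by (auto simp: si_def)
  have e: "indicator {0..t} s *R ?d s = (indicator {0..t} s *R vc w' s k, indicator {0..t} s *R vc b' s k)" for s by simp
  show "SI {0..t} ?d" "(LBINT s:{0..t}. ?d s) = ((LBINT s:{0..t}. vc w' s k), (LBINT s:{0..t}. vc b' s k))"
  unfolding si_def sli_def e by (rule integral_pair[OF j])+
  qed
  have T: "T : {0..T}" using T_pos by simp
  have im: "(%s. indicator {0..t} s *R h s) : BMs lborel" if "h : BM" for h :: "real => mode" and t
  using that by (intro borel_measurable_scaleR borel_measurable_indicator) simp_all
  show "SI {0..T} ?n" using di(1)[OF T] integrable_cong_AE[OF im[OF dm] im[OF nm] ae[OF T]] unfolding si_def by blast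
  fix t assume t: "t : {0..T}"
  have "(LBINT s:{0..t}. ?n s) = (LBINT s:{0..t}. ?d s)"
  unfolding sli_def by (rule integral_cong_AE[OF im[OF nm] im[OF dm]]) (use ae[OF t] in eventually_elim, simp)
  thus "uu w b t k = ini k + (LBINT s:{0..t}. ?n s)"
  unfolding u0[symmetric] using dw(2)[OF t, of k] db(2)[OF t, of k] by (simp add: uu_def di(2)[OF t])
 qed
 have qq: "AET t. q t : L2_torus L & (\<forall>k. ft (q t) k = qf (uu w b t) t k)" using eqs st.q_L2h(2) by eventually_elim auto
 show ?thesis by (rule that[OF add_nonneg_nonneg[OF A(1,3)] bound st.uu_measurable good_zero[OF good] sol _ qq])
  (use C_time_finite(1)[OF w(2)] C_time_finite(1)[OF b(2)] in blast)
qed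

end

section \<open>From coefficients back to fields\<close>

context mhd begin

lemma jointly_measurableI:
 fixes v :: "real => real^3 => 'a::euclidean_space" shows "(%p. v (fst p) (snd p)) : BM ==> jointly_measurable T v"
 unfolding jm_iff by (erule borel_measurable_scaleR[rotated], rule m_comp[of fst _ borel])
  (auto intro!: bm_cont continuous_intros)

lemma vrr_L2_time: assumes c: "L2h s c" and h: "!!t. herm (c t)" and d: "!!t. divfree (c t)" "!!t. c t 0 = 0"
 shows "(%t. vrr (c t)) : L2_time T (Hsol L (real s)) (Hsol_norm L (real s))" and "AET t. vL2 (vrr (c t)) & vft (vrr (c t)) = c t"
proof -
 show ae: "AET t. vL2 (vrr (c t)) & vft (vrr (c t)) = c t"
  using L2h_AE[OF L2h_mono[OF c le0]] by eventually_elim (use vrr_L2[OF h] in auto)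
 have ae': "AET t. vL2 (vrr (c t)) & vft (vrr (c t)) = c t & hsq s (c t) < infy" using ae L2h_AE[OF c] by eventually_elim auto
 show "(%t. vrr (c t)) : L2_time T (Hsol L (real s)) (Hsol_norm L (real s))"
 proof (rule L2_timeI[where e="%t. ksq s (c t)", OF jointly_measurableI[OF vrr_joint[OF L2hD(1)[OF c]]] _ _ _ _ c])
  show "AET t. vrr (c t) : Hsol L (real s)" using ae' by eventually_elim (use d in \<open>auto simp: Hsol_iff\<close>)
  show "AET t. (Hsol_norm L (real s) (vrr (c t)))^2 = enn2real (ksq s (c t))" using ae' by eventually_elim (auto simp: Hsol_norm2)
  show "(%t. ksq s (c t)) : BM" by (rule ksq_measurable[OF L2hD(1)[OF c]])
  show "AET t. ksq s (c t) <= hsq s (c t)" by (simp add: ksq_le_hsq)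
 qed
qed

lemma rr_L2_time: assumes c: "L2h s c" and h: "!!t k. c t (- k) = cnj (c t k)"
 shows "(%t. rr (c t)) : L2_time T (sobolev L (real s)) (sobolev_norm L (real s))"
  and "AET t. rr (c t) : L2_torus L & ft (rr (c t)) = c t"
proof -
 show ae: "AET t. rr (c t) : L2_torus L & ft (rr (c t)) = c t"
  using L2h_AE[OF L2h_mono[OF c le0]] by eventually_elim (use rr_L2[of "c _"] h in auto)
 have ae': "AET t. rr (c t) : L2_torus L & ft (rr (c t)) = c t & hsq s (c t) < infy" using ae L2h_AE[OF c] by eventually_elim auto
 show "(%t. rr (c t)) : L2_time T (sobolev L (real s)) (sobolev_norm L (real s))"
 proof (rule L2_timeI[where e="%t. hsq s (c t)", OF jointly_measurableI[OF rr_joint[OF L2hD(1)[OF c]]] _ _ _ _ c])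
  show "AET t. rr (c t) : sobolev L (real s)" using ae' by eventually_elim (auto simp: sobolev_iff)
  show "AET t. (sobolev_norm L (real s) (rr (c t)))^2 = enn2real (hsq s (c t))"
  using ae' by eventually_elim (auto simp: sobolev_norm2)
  show "(%t. hsq s (c t)) : BM" by (rule hsq_measurable[OF L2hD(1)[OF c]])
 qed simp
qed

text \<open>The converse of \<open>weak_derivative_modes\<close>: the product rule on each mode,
  with the test function vanishing at both ends, and then uniqueness of Fourier coefficients to
  return to an identity at almost every point of space.\<close>

lemma vrr_time_derivative: assumes c: "L2h 0 c" "!!t. herm (c t)" and c': "L2h 0 c'" "!!t. herm (c' t)"
  and ac: "!!t k. t : {0..T} ==> c t k = c0 k + (LBINT s:{0..t}. c' s k)"
 shows "time_derivative T (%t. vrr (c t)) (%t. vrr (c' t))" unfolding time_derivative_def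
proof
 fix ph assume ph: "ph : time_test T"
 obtain C where C: "!!t. t : {0..T} ==> \<bar>deriv ph t\<bar> <= C" "!!t. t : {0..T} ==> \<bar>ph t\<bar> <= C"
  using time_test_bounded[OF ph] by metis
 note cont = time_test_cont(1,2)[OF ph]
 note m = bm_cont[OF cont(1)] bm_cont[OF cont(2)]
 have field: "jointly_measurable T (%t x. vrr (e t) x $ i)" "L2h 0 (sc (%t x. vrr (e t) x $ i))"
  "AET t. (%x. vrr (e t) x $ i) : L2_torus L"
  "AET t. sc (%t x. vrr (e t) x $ i) t k = e t k $ i" if e: "L2h 0 e" "!!t. herm (e t)" for e i k
 proof -
  have ae: "AET t. vL2 (vrr (e t)) & vft (vrr (e t)) = e t" using L2h_AE[OF e(1)] by eventually_elim (use vrr_L2[OF e(2)] in auto)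
  show j: "jointly_measurable T (%t x. vrr (e t) x $ i)"
  by (rule jm_nth[OF jointly_measurableI[OF vrr_joint[OF L2hD(1)[OF e(1)]]]])
  show "AET t. (%x. vrr (e t) x $ i) : L2_torus L" using ae by eventually_elim (auto simp: vL2_def)
  show s: "AET t. sc (%t x. vrr (e t) x $ i) t k = e t k $ i" for k
  using ae by eventually_elim (auto simp: sc_in simp flip: vft_nth)
  show "L2h 0 (sc (%t x. vrr (e t) x $ i))"
  proof (rule L2h_scaled[OF sc_measurable[OF j] _ L2h_nth[OF e(1), of i], where C=1])
  have "AE t in lborel. \<forall>k. t : {0..T} --> sc (%t x. vrr (e t) x $ i) t k = e t k $ i"
  unfolding AE_all_countable using s by blast
  thus "AET t. hsq 0 (sc (%t x. vrr (e t) x $ i) t) <= ennreal 1 * hsq 0 (%k. e t k $ i)"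
  by eventually_elim (auto intro: hsq_mono_norm)
  qed
 qed
 note fc = field[of c, OF c] and fc' = field[of c', OF c']
 have per: "periodic L (%x. LBINT t:{0..T}. psi t * vrr (e t) x $ i)" for psi and e :: "real => int^3 => complex^3" and i
  using rr_periodic by (simp add: periodic_def vrr_def)
 have parts: "(LBINT t:{0..T}. deriv ph t *R c t k) = - (LBINT t:{0..T}. ph t *R c' t k)" for k
 proof -
  have i: "SI {0..T} (%t. c t k)" "SI {0..T} (%t. c' t k)"
  by (rule nn_time_si(2)[OF L2hD[OF c(1)]], rule nn_time_si(2)[OF L2hD[OF c'(1)]])
  have s: "SI {0..T} (%t. deriv ph t *R c t k)" "SI {0..T} (%t. ph t *R c' t k)"
  by (rule si_scaleR[OF i(1) _ _ C(1)], simp, use m in simp, assumption)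
  (rule si_scaleR[OF i(2) _ _ C(2)], simp, use m in simp, assumption)
  have d: "SI {0..T} (deriv ph)" by (rule borel_integrable_atLeastAtMost'[OF continuous_on_subset[OF cont(2)]]) simp
  have f: "ph t = 0 + (LBINT s:{0..t}. deriv ph s)" if "t : {0..T}" for t
  proof -
  obtain a b where "0 < a" "b < T" "\<forall>t. t \<notin> {a..b} --> ph t = 0" using ph by (auto simp: time_test_def)
  hence "ph 0 = 0" by auto
  moreover have "(LINT s|lborel. indicator {0..t} s *R deriv ph s) = ph t - ph 0"
  proof (rule integral_FTC_Icc)
  show "(ph has_vector_derivative deriv ph x) (at x within {0..t})" for x
  by (rule has_vector_derivative_at_within[OF time_test_cont(3)[OF ph, unfolded has_real_derivative_iff_has_vector_derivative]])
  show "continuous_on {0..t} (deriv ph)" by (rule continuous_on_subset[OF cont(2) subset_UNIV])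
  qed (use that in simp)
  ultimately show ?thesis by (simp add: sli_def)
  qed
  have T: "T : {0..T}" using T_pos by simp
  have g: "c t k = c0 k + (LBINT s:{0..t}. c' s k)" if "t : {0..T}" for t by (rule ac[OF that])
  have "ph T *R c T k = 0 *R c0 k + (LBINT s:{0..T}. deriv ph s *R c s k + ph s *R c' s k)"
  by (rule ac_product_rule(2)[OF bounded_bilinear_scaleR d i(2) f g T])
  moreover have "ph T = 0"
  proof -
  obtain a b where "0 < a" "b < T" "\<forall>t. t \<notin> {a..b} --> ph t = 0" using ph by (auto simp: time_test_def)
  thus ?thesis by auto
  qed
  ultimately show ?thesis unfolding set_integral_add(2)[OF s] by (simp add: eq_neg_iff_add_eq_0)
 qed
 have AEi: "AE x in lborel. (LBINT t:{0..T}. deriv ph t * vrr (c t) x $ i) = - (LBINT t:{0..T}. ph t * vrr (c' t) x $ i)" for i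
 proof -
  note F = time_field[OF fc(1) m(2) C(1) fc(3) fc(2)] and G = time_field[OF fc'(1) m(1) C(2) fc'(3) fc'(2)]
  have L1: "(%x. LBINT t:{0..T}. deriv ph t * vrr (c t) x $ i) : L1_torus L" "(%x. LBINT t:{0..T}. ph t * vrr (c' t) x $ i) : L1_torus L"
  unfolding L1_torus_def si_tm using F(1,2) G(1,2) per by auto
  note z = L2_imp_L1[OF L2_torus_zero]
  have cong: "(LBINT t:{0..T}. psi t *R sc (%t x. vrr (e t) x $ i) t k) = (LBINT t:{0..T}. psi t *R e t k) $ i"
  if e: "L2h 0 e" "!!t. herm (e t)" and psi: "psi : BM" "!!t. t : {0..T} ==> \<bar>psi t\<bar> <= C" for psi e k
  proof -
  have "SI {0..T} (%t. psi t *R e t k)"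
  by (rule si_scaleR[OF nn_time_si(2)[OF L2hD[OF e(1)]] _ _ psi(2)]) (use psi(1) in simp_all)
  hence "(LBINT t:{0..T}. psi t *R e t k) $ i = (LBINT t:{0..T}. psi t *R e t k $ i)"
  unfolding sli_def si_def by (simp add: vec_nth_integral(2))
  moreover have "(LBINT t:{0..T}. psi t *R sc (%t x. vrr (e t) x $ i) t k) = (LBINT t:{0..T}. psi t *R e t k $ i)"
  proof (rule set_lebesgue_integral_cong_AE)
  show "(%t. psi t *R sc (%t x. vrr (e t) x $ i) t k) : BMs lborel" "(%t. psi t *R e t k $ i) : BMs lborel"
  using psi(1) sc_measurable[OF field(1)[of e, OF e]] m_comp[OF L2hD(1)[OF e(1)] bm_nth] by simp_all
  show "AET t. psi t *R sc (%t x. vrr (e t) x $ i) t k = psi t *R e t k $ i"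
  using field(4)[of e i k, OF e] by eventually_elim simp
  qed simp
  ultimately show ?thesis by simp
  qed
  have "AE x in lborel. (LBINT t:{0..T}. deriv ph t * vrr (c t) x $ i) = 0 + (- 1) * (LBINT t:{0..T}. ph t * vrr (c' t) x $ i)"
  proof (rule ft_unique[OF L1(1) L1_torus_lincomb[OF z L1(2)]])
  fix k
  have "ft (%x. LBINT t:{0..T}. deriv ph t * vrr (c t) x $ i) k = (LBINT t:{0..T}. deriv ph t *R c t k) $ i"
  by (rule trans[OF F(4) cong[OF c m(2) C(1)]])
  moreover have "ft (%x. LBINT t:{0..T}. ph t * vrr (c' t) x $ i) k = (LBINT t:{0..T}. ph t *R c' t k) $ i"
  by (rule trans[OF G(4) cong[OF c' m(1) C(2)]])
  ultimately show "ft (%x. LBINT t:{0..T}. deriv ph t * vrr (c t) x $ i) k = ft (%x. 0 + (- 1) * (LBINT t:{0..T}. ph t * vrr (c' t) x $ i)) k"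
  unfolding ft_lincomb[OF z L1(2)] parts by simp
  qed
  thus ?thesis by simp
 qed
 have "AE x in tm. \<forall>i. SI {0..T} (%t. deriv ph t * vrr (c t) x $ i) & SI {0..T} (%t. ph t * vrr (c' t) x $ i)"
  unfolding AE_all_countable using time_field(3)[OF fc(1) m(2) C(1) fc(3) fc(2)] time_field(3)[OF fc'(1) m(1) C(2) fc'(3) fc'(2)]
  by (simp add: AE_conj_iff)
 hence "AE x in lborel. \<forall>i. SI {0..T} (%t. deriv ph t * vrr (c t) x $ i) & SI {0..T} (%t. ph t * vrr (c' t) x $ i)"
  by (rule AE_periodic[rotated]) (use rr_periodic in \<open>simp add: periodic_def vrr_def\<close>)
 moreover have "AE x in lborel. \<forall>i. (LBINT t:{0..T}. deriv ph t * vrr (c t) x $ i) = - (LBINT t:{0..T}. ph t * vrr (c' t) x $ i)"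
  unfolding AE_all_countable using AEi by blast
 ultimately show "AE x in lborel. (LINT t:{0..T}|lebesgue. deriv ph t *R vrr (c t) x) = - (LINT t:{0..T}|lebesgue. ph t *R vrr (c' t) x)"
 proof eventually_elim
  case (elim x)
  have "(LINT t:{0..T}|lebesgue. deriv ph t *R vrr (c t) x) $ i = (LBINT t:{0..T}. deriv ph t * vrr (c t) x $ i)"
  "(LINT t:{0..T}|lebesgue. ph t *R vrr (c' t) x) $ i = (LBINT t:{0..T}. ph t * vrr (c' t) x $ i)" for i
  by (rule lebesgue_vec_nth, use elim in blast)+
  thus ?case using elim(2) by (simp add: vec_eq_iff)
 qed
qed

lemma Hsol_norm_le: assumes "vL2 v" "vL2 z" "hsq 1 (%k. vft v k - vft z k) <= ennreal E" "0 <= E"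
 shows "Hsol_norm L 1 (%x. v x - z x) <= sqrt E"
proof (rule real_le_rsqrt)
 have e: "vft (%x. v x - z x) = (%k. vft v k - vft z k)" by (rule ext, rule vft_diff[OF assms(1,2)])
 have f: "hsq 1 (vft (%x. v x - z x)) < infy" unfolding e by (rule le_less_trans[OF assms(3)]) simp
 have "(Hsol_norm L 1 (%x. v x - z x))^2 = enn2real (ksq 1 (vft (%x. v x - z x)))" using Hsol_norm2[OF f] by simp
 also have "... <= E" by (rule enn2real_leI[OF assms(4)]) (use order_trans[OF ksq_le_hsq assms(3)] e in simp)
 finally show "(Hsol_norm L 1 (%x. v x - z x))^2 <= E" .
qed

text \<open>\<open>jap <= ep * jap^2 + 1 / ep\<close>: the first term suffices if
  \<open>ep * jap\<close> is at least \<open>1\<close>, the second otherwise.\<close>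

lemma hsq_interpolate: assumes e: "0 < ep" shows "hsq 1 a <= ennreal ep * hsq 2 a + ennreal (1 / ep) * hsq 0 a"
proof -
 have p: "jap k ^ 1 * x <= ep * (jap k ^ 2 * x) + 1 / ep * (jap k ^ 0 * x)" if x: "0 <= x" for k x
 proof -
  have "jap k <= ep * (jap k)^2 + 1 / ep"
  proof (cases "1 <= ep * jap k")
  case True
  hence "1 * jap k <= ep * jap k * jap k" using jap_pos[of k] by (intro mult_right_mono) auto
  moreover have "0 <= 1 / ep" using e by simp
  ultimately show ?thesis unfolding power2_eq_square mult.assoc by linarith
  next
  case False
  hence "jap k <= 1 / ep" using e by (simp add: pos_le_divide_eq mult.commute)
  moreover have "0 <= ep * (jap k)^2" using e by simp
  ultimately show ?thesis by linarith
  qed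
  from mult_right_mono[OF this x] show ?thesis by (simp add: distrib_right mult.assoc)
 qed
 have "hsq 1 a <= (SN k. ennreal ep * ennreal (jap k ^ 2 * (norm (a k))^2) + ennreal (1 / ep) * ennreal (jap k ^ 0 * (norm (a k))^2))"
  unfolding hsq_def[of 1 a]
 proof (rule nn_integral_mono)
  fix k
  have j: "0 <= jap k ^ n * (norm (a k))^2" for n using jap_pos[of k] by simp
  show "ennreal (jap k ^ 1 * (norm (a k))^2) <= ennreal ep * ennreal (jap k ^ 2 * (norm (a k))^2) + ennreal (1 / ep) * ennreal (jap k ^ 0 * (norm (a k))^2)"
  using ennreal_leI[OF p[OF zero_le_power2, of k "norm (a k)"]] e j
  by (simp only: ennreal_plus ennreal_mult mult_nonneg_nonneg less_imp_le zero_less_divide_1_iff)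
 qed
 also have "... = ennreal ep * hsq 2 a + ennreal (1 / ep) * hsq 0 a"
  unfolding hsq_def by (simp add: nn_integral_add nn_integral_cmult)
 finally show ?thesis .
qed

text \<open>Cauchy-Schwarz against the indicator of \<open>{s<..t}\<close> gives the factor
  \<open>t - s\<close> on each mode; the modes are then summed.\<close>

lemma time_increment:
 assumes d: "L2h 0 d" and u: "!!t k. t : {0..T} ==> u t k = c0 k + (LBINT s:{0..t}. d s k)" and st: "0 <= s" "s <= t" "t <= T"
 shows "hsq 0 (%k. u t k - (u s k :: mode)) <= ennreal (t - s) * (NI {0..T} (%r. hsq 0 (d r)))"
proof -
 have p: "ennreal ((norm (u t k - u s k))^2) <= ennreal (t - s) * (NI {0..T} (%r. ennreal (jap k ^ 0 * (norm (d r k))^2)))" for k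
 proof -
  note i = nn_time_si[OF L2hD[OF d], of k]
  have I: "SI A (%r. d r k)" "SI A (%r. (norm (d r k))^2)" if "A \<subseteq> {0..T}" "A : sets borel" for A
  using si_subset[OF i(2)] si_subset[OF i(1)] that by auto
  let ?A = "{s<..t}"
  let ?g = "%r. indicator ?A r *R d r k"
  have A: "?A \<subseteq> {0..T}" "{0..t} \<subseteq> {0..T}" "{0..s} \<subseteq> {0..T}" using st by auto
  have gi: "integrable lborel ?g" "integrable lborel (%r. (norm (?g r))^2)"
  proof -
  have "(norm (?g r))^2 = indicator ?A r *R (norm (d r k))^2" for r by (simp add: indicator_def)
  thus "integrable lborel ?g" "integrable lborel (%r. (norm (?g r))^2)"
  using I[OF A(1) greaterThanAtMost_borel] by (simp_all only: si_def)
  qed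
  have "u t k - u s k = (LINT r|lborel. indicator {0..t} r *R d r k - indicator {0..s} r *R d r k)"
  using u[of t k] u[of s k] st I(1)[OF A(2)] I(1)[OF A(3)] by (simp add: sli_def si_def)
  also have "... = (LINT r|lborel. ?g r)" using st by (intro bint_cong) (auto simp: indicator_def)
  finally have e: "u t k - u s k = (LINT r|lborel. ?g r)" .
  have one: "integrable lborel (%r. (norm (indicator ?A r :: real))^2)" "(LINT r|lborel. (norm (indicator ?A r :: real))^2) = t - s"
  proof -
  have "(norm (indicator ?A r :: real))^2 = indicator ?A r" for r by (simp add: indicator_def)
  thus "integrable lborel (%r. (norm (indicator ?A r :: real))^2)" "(LINT r|lborel. (norm (indicator ?A r :: real))^2) = t - s"
  using st by simp_all
  qed
  have "norm (u t k - u s k) <= (LINT r|lborel. norm (indicator ?A r :: real) * norm (?g r))"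
  proof -
  have "(LINT r|lborel. norm (indicator ?A r :: real) * norm (?g r)) = (LINT r|lborel. norm (?g r))"
  by (intro bint_cong) (simp_all add: indicator_def)
  thus ?thesis unfolding e by (simp only: integral_norm_bound)
  qed
  hence "(norm (u t k - u s k))^2 <= (LINT r|lborel. norm (indicator ?A r :: real) * norm (?g r))^2" by (intro power_mono) auto
  also have "... <= (t - s) * (LINT r|lborel. (norm (?g r))^2)"
  using integral_norm2_CS[OF _ _ one(1) gi(2)] gi(1) unfolding one(2) by simp
  finally have "ennreal ((norm (u t k - u s k))^2) <= ennreal (t - s) * ennreal (LINT r|lborel. (norm (?g r))^2)"
  using st by (subst ennreal_mult[symmetric]) (auto intro: ennreal_leI)
  also have "ennreal (LINT r|lborel. (norm (?g r))^2) = (LN r. ennreal ((norm (?g r))^2))"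
  by (rule nn_integral_eq_integral[symmetric, OF gi(2)]) simp
  also have "... <= (NI {0..T} (%r. ennreal (jap k ^ 0 * (norm (d r k))^2)))"
  using A(1) by (intro nn_integral_mono) (auto simp: indicator_def)
  finally show ?thesis by (simp add: mult_lmono)
 qed
 have "hsq 0 (%k. u t k - u s k) <= (SN k. ennreal (t - s) * (NI {0..T} (%r. ennreal (jap k ^ 0 * (norm (d r k))^2))))"
  unfolding hsq_def[of 0 "%k. u t k - u s k"] by (rule nn_integral_mono) (use p in simp)
 also have "... = ennreal (t - s) * (NI {0..T} (%r. hsq 0 (d r)))"
  unfolding nn_time_swap[of d 0 T, OF L2hD(1)[OF d], symmetric] by (rule nn_integral_cmult) simp
 finally show ?thesis .
qed

text \<open>Interpolation between a bounded h^2 norm and squared l^2 increments of order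
  \<open>t - s\<close>, with \<open>ep = sqrt (t - s)\<close>. It provides the continuity in time
  with values in H_1 and the limit at the initial time.\<close>

lemma time_hoelder: assumes d: "L2h 0 d" and u: "!!t k. t : {0..T} ==> u t k = c0 k + (LBINT s:{0..t}. d s k)"
  and B: "!!t. hsq 2 (u t) <= ennreal B" "0 <= B"
 obtains C where "0 <= C" "!!s t. s : {0..T} ==> t : {0..T} ==> hsq 1 (%k. u t k - (u s k :: mode)) <= ennreal (C * sqrt \<bar>s - t\<bar>)"
proof
 define J where "J = enn2real (NI {0..T} (%r. hsq 0 (d r)))"
 have J: "(NI {0..T} (%r. hsq 0 (d r))) = ennreal J" "0 <= J" using L2hD(2)[OF d] by (simp_all add: J_def less_top)
 show "0 <= 4 * B + J" using B(2) J(2) by simp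
 have le: "hsq 1 (%k. u t k - u s k) <= ennreal ((4 * B + J) * sqrt (t - s))" if "0 <= s" "s < t" "t <= T" for s t
 proof -
  define e where "e = sqrt (t - s)"
  have e: "0 < e" "t - s = e * e" using that by (simp_all add: e_def)
  have "hsq 2 (%k. u t k - u s k) <= 2 * ennreal B + 2 * ennreal B"
  by (rule order_trans[OF hsq_diff_le]) (intro add_mono mult_lmono B; simp)
  also have "... = ennreal (4 * B)" using two_ennreal[OF B(2) B(2)] by simp
  finally have 2: "hsq 2 (%k. u t k - u s k) <= ennreal (4 * B)" .
  have 0: "hsq 0 (%k. u t k - u s k) <= ennreal (e * e) * ennreal J"
  using time_increment[OF d u that(1) less_imp_le[OF that(2)] that(3)] unfolding J(1) e(2) .
  have "hsq 1 (%k. u t k - u s k) <= ennreal e * ennreal (4 * B) + ennreal (1 / e) * (ennreal (e * e) * ennreal J)"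
  by (rule order_trans[OF hsq_interpolate[OF e(1)]]) (intro add_mono mult_lmono 2 0; simp)
  also have "... = ennreal (e * (4 * B) + 1 / e * (e * e * J))"
  using e(1) B(2) J(2) by (simp only: ennreal_plus ennreal_mult mult_nonneg_nonneg less_imp_le zero_less_divide_1_iff zero_le_numeral)
  also have "e * (4 * B) + 1 / e * (e * e * J) = (4 * B + J) * e" using e(1) by (simp add: field_simps)
  finally show ?thesis by (simp add: e_def)
 qed
 show "hsq 1 (%k. u t k - u s k) <= ennreal ((4 * B + J) * sqrt \<bar>s - t\<bar>)" if "s : {0..T}" "t : {0..T}" for s t
 proof -
  consider "s < t" | "t < s" | "s = t" by linarith
  thus ?thesis
  proof cases
  case 1 thus ?thesis using le[of s t] that by simp
  next
  case 2 thus ?thesis using le[of t s] that hsq_minus_commute[of 1 "u t" "u s"] by simp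
  next
  case 3 thus ?thesis by (simp add: hsq_zero)
  qed
 qed
qed

lemma good_Lam: assumes "good u" shows "good (%k. - Lam k (u k))"
 using assms by (simp add: good_def Lam_def herm_def divfree_def wdot_scaleR wdot_uminus wave_minus scaleR_cx zero_prod_def)

end

context mhd_problem begin

lemma qf_cnj: assumes "good u" shows "qf u t (- k) = cnj (qf u t k)"
proof -
 have "wdot (- k) (X1 u (- k) - gsym a1 (- k) *R vc f t (- k)) = - cnj (wdot k (X1 u k - gsym a1 k *R vc f t k))"
  by (rule wdot_cnj) (use X_herm(1)[OF assms] vc_herm[of f t] in \<open>simp add: herm_def scaleR_cx\<close>)
 thus ?thesis by (simp add: qf_def wave_minus)
qed

text \<open>The divergence costs one factor \<open>K\<close> and the division by \<open>K^2\<close>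
  returns two, so the pressure is one derivative better than the terms it balances.\<close>

lemma qf_bound: "hsq 1 (qf u t) <= ennreal Cp * hsq 0 (%k. X1 u k - gsym a1 k *R vc f t k)"
proof -
 have "jap k ^ 1 * (norm (qf u t k))^2 <= Cp * (jap k ^ 0 * (norm (X1 u k - gsym a1 k *R vc f t k))^2)" for k
 proof (cases "k = 0")
  case False
  let ?Y = "X1 u k - gsym a1 k *R vc f t k"
  have K: "0 < K k" by (rule K_pos[OF False])
  have "norm (qf u t k) <= norm ?Y / K k"
  using wdot_norm_le[of k ?Y] K by (simp add: qf_def norm_divide norm_mult norm_power power2_eq_square pos_divide_le_eq pos_le_divide_eq mult.commute)
  hence "(norm (qf u t k))^2 <= (norm ?Y / K k)^2" by (rule power_mono) simp
  hence "jap k * (norm (qf u t k))^2 <= Cp * (K k)^2 * (norm ?Y / K k)^2"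
  using jap_le_K2[OF False] jap_pos[of k] Cp_pos by (intro mult_mono) auto
  also have "... = Cp * (norm ?Y)^2" using K by (simp add: power_divide)
  finally show ?thesis by simp
 qed (use Cp_pos in \<open>simp add: qf_def\<close>)
 hence "hsq 1 (qf u t) <= (SN k. ennreal Cp * ennreal (jap k ^ 0 * (norm (X1 u k - gsym a1 k *R vc f t k))^2))"
  unfolding hsq_def[of 1] using Cp_pos by (intro nn_integral_mono) (simp add: ennreal_mult[symmetric] ennreal_leI)
 also have "... = ennreal Cp * hsq 0 (%k. X1 u k - gsym a1 k *R vc f t k)" unfolding hsq_def by (rule nn_integral_cmult) simp
 finally show ?thesis .
qed

section \<open>Existence and uniqueness\<close>

theorem weak_solution_exists: "\<exists>w b q. regular_weak_solution L T nu mu a1 a2 N1 N2 U0 B0 f w b q"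
proof -
 obtain u Bd where um: "!!k. (%t. u t k) : BM" and ug: "!!t. good (u t)" and Bd: "0 <= Bd"
  and u2: "!!t. hsq 2 (u t) <= ennreal Bd" and us: "sol ini (%s k. NN (u s) k + Ff s k) u" by (rule solution_exists) blast
 \<comment> \<open>The right-hand side of the mode equation; the fields built from it are the time
   derivatives.\<close>
 define d where "d = (%t k. - Lam k (u t k) + (NN (u t) k + Ff t k))"
 define w where "w = (%t. vrr (%k. fst (u t k)))"
 define b where "b = (%t. vrr (%k. snd (u t k)))"
 define w' where "w' = (%t. vrr (%k. fst (d t k)))"
 define b' where "b' = (%t. vrr (%k. snd (d t k)))"
 define q where "q = (%t. rr (qf (u t) t))"
 note g = ug[unfolded good_def]
 have u1: "hsq s (u t) <= ennreal Bd" if "s <= 2" for s t by (rule order_trans[OF hsq_mono_s[OF that] u2])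
 have fin: "hsq s (u t) < infy" if "s <= 2" for s t by (rule le_less_trans[OF u1[OF that]]) simp
 have ac: "u t k = ini k + (LBINT s:{0..t}. d s k)" if "t : {0..T}" for t k unfolding d_def by (rule solD(2)[OF us that])
 have dm: "(%t. d t k) : BM" for k unfolding d_def by (intro borel_measurable_add borel_measurable_uminus NN_measurable um Ff_meas
  m_comp[OF um bm_cont[OF linear_continuous_on[OF Lam_bounded_linear]]])
 have dg: "good (d t)" for t unfolding d_def by (intro good_add good_Lam NN_good Ff_good ug)
 note dg' = dg[unfolded good_def]
 have NNf: "L2h 0 (%t k. NN (u t) k)"
 proof (rule L2h_bounded[OF NN_measurable[OF um]])
  fix t
  have "hsq 0 (NN (u t)) <= hsq 1 (NN (u t))" by (rule hsq_mono_s) simp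
  also have "... <= CN * (hsq 1 (u t) * hsq 1 (u t))" by (rule NN_bound[OF fin]) simp
  also have "... <= CN * (ennreal Bd * ennreal Bd)" by (intro mult_lmono mult_mono u1) auto
  finally show "hsq 0 (NN (u t)) <= CN * (ennreal Bd * ennreal Bd)" .
  show "CN * (ennreal Bd * ennreal Bd) < infy" using CN_finite by (simp add: mult_lt_top)
 qed
 have ul: "L2h 2 u" by (rule L2h_bounded[OF um u2]) simp
 have dl: "L2h 0 d"
 proof -
  have "L2h 0 (%t k. - Lam k (u t k))"
  proof (rule L2h_scaled[OF _ _ L2h_K2[OF ul], where C="(nu + mu)^2"])
  show "(%t. - Lam k (u t k)) : BM" for k
  by (intro borel_measurable_uminus m_comp[OF um bm_cont[OF linear_continuous_on[OF Lam_bounded_linear]]])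
  have "hsq 0 (%k. - Lam k (u t k)) <= ennreal ((nu + mu)^2) * hsq 0 (%k. (K k)^2 *R u t k)" for t
  by (rule hsq_mono_scaled) (use Lam_norm nu_pos mu_pos in \<open>simp_all add: mult.assoc\<close>)
  thus "AET t. hsq 0 (%k. - Lam k (u t k)) <= ennreal ((nu + mu)^2) * hsq 0 (%k. (K k)^2 *R u t k)" by simp
  qed
  moreover have "L2h 0 Ff"
  by (rule L2h_scaled[OF Ff_meas _ frc_L2h, where C="(Cg a1)^2"]) (use order_trans[OF hsq_mono_s[of 0 1] Ff_hsq] in simp)
  ultimately show ?thesis unfolding d_def by (intro L2h_add NNf)
 qed
 have pr: "L2h s (%t k. fst (e t k))" "L2h s (%t k. snd (e t k))" if "L2h s e" for s and e :: "real => int^3 => mode"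
  by (rule L2h_scaled[OF fst_snd_measurable(1)[OF L2hD(1)[OF that]] _ that, where C=1], simp add: hsq_fst_le,
  rule L2h_scaled[OF fst_snd_measurable(2)[OF L2hD(1)[OF that]] _ that, where C=1], simp add: hsq_snd_le)
 have h0: "hsq s (%k. fst (u t k)) < infy" "hsq s (%k. snd (u t k)) < infy" if "s <= 2" for s t
  using le_less_trans[OF hsq_fst_le fin[OF that]] le_less_trans[OF hsq_snd_le fin[OF that]] by auto
 have wv: "vL2 (w t)" "vft (w t) = (%k. fst (u t k))" and bv: "vL2 (b t)" "vft (b t) = (%k. snd (u t k))" for t
  unfolding w_def b_def using vrr_L2[of "%k. fst (u t k)"] vrr_L2[of "%k. snd (u t k)"] g h0[of 0] by (auto simp: fun_eq_iff)
 have L2: "w : L2_time T (Hsol L 2) (Hsol_norm L 2)" "b : L2_time T (Hsol L 2) (Hsol_norm L 2)"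
  unfolding w_def b_def using vrr_L2_time(1)[OF pr(1)[OF ul]] vrr_L2_time(1)[OF pr(2)[OF ul]] g by simp_all
 have L0: "w' : L2_time T (Hsol L 0) (Hsol_norm L 0)" "b' : L2_time T (Hsol L 0) (Hsol_norm L 0)"
  unfolding w'_def b'_def using vrr_L2_time(1)[OF pr(1)[OF dl]] vrr_L2_time(1)[OF pr(2)[OF dl]] dg' by simp_all
 have d': "AET t. vft (w' t) = (%k. fst (d t k)) & vft (b' t) = (%k. snd (d t k))"
  using vrr_L2_time(2)[OF pr(1)[OF dl]] vrr_L2_time(2)[OF pr(2)[OF dl]] dg' unfolding w'_def b'_def
  by (simp add: AE_conj_iff imp_conjR)
 have ql: "L2h 1 (%t. qf (u t) t)"
 proof -
  have Xm: "(%t. X1 (u t) k) : BM" for k unfolding X1_def Wc_def Hc_def using fst_snd_measurable[OF um]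
  by (intro borel_measurable_scaleR borel_measurable_diff adv_measurable borel_measurable_const)
  have Ym: "(%t. X1 (u t) k - gsym a1 k *R vc f t k) : BM" for k
  by (intro borel_measurable_diff Xm borel_measurable_scaleR borel_measurable_const L2hD(1)[OF f_L2h(1)])
  have X: "L2h 0 (%t. X1 (u t))"
  proof -
  have m: "(%t. Wc (u t) k) : BM" "(%t. Hc (u t) k) : BM" for k
  unfolding Wc_def Hc_def using fst_snd_measurable[OF um] by (auto intro: borel_measurable_scaleR)
  have l: "hsq 1 (Wc (u t)) <= ennreal (ND^2) * ennreal Bd" "hsq 1 (Hc (u t)) <= ennreal (ND^2) * ennreal Bd" for t
  by (rule order_trans[OF hsq_W mult_lmono[OF u1]]; simp) (rule order_trans[OF hsq_H mult_lmono[OF u1]]; simp)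
  have f: "ennreal (ND^2) * ennreal Bd < infy" by (simp add: mult_lt_top)
  show ?thesis unfolding X1_def[abs_def] scaleR_diff_right
  using L2h_add[OF L2h_adv[OF a1_pos m(1) m(1) l(1) l(1) f] L2h_scaleR[OF L2h_adv[OF a1_pos m(2) m(2) l(2) l(2) f], of "- 1"]] by simp
  qed
  have Y: "L2h 0 (%t k. X1 (u t) k + (- 1) *R (gsym a1 k *R vc f t k))" by (intro L2h_add X L2h_scaleR L2h_gsym f_L2h)
  show ?thesis
  proof (rule L2h_scaled[OF _ _ Y, where C=Cp])
  show "(%t. qf (u t) t k) : BM" for k
  unfolding qf_def by (intro borel_measurable_divide borel_measurable_times borel_measurable_const
  m_comp[OF Ym bm_cont[OF linear_continuous_on[OF wdot_bounded_linear]]])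
  qed (use qf_bound in simp)
 qed
 note qT = rr_L2_time[OF ql qf_cnj[OF ug]]
 have q0: "zero_mean L T q" unfolding zero_mean_def AE_completion_iff using qT(2)
 proof eventually_elim
  case (elim t)
  have "qf (u t) t 0 = 0" by (simp add: qf_def)
  hence "ft (rr (qf (u t) t)) 0 = 0" if "t : {0..T}" using elim that by simp
  thus ?case using L_pos by (auto simp: q_def ft_0 tint_tm)
 qed
 \<comment> \<open>This one estimate gives both the continuity on \<open>[0, T]\<close> and the
   limits at \<open>0+\<close>.\<close>
 obtain C where C: "0 <= C" "!!s t. s : {0..T} ==> t : {0..T} ==> hsq 1 (%k. u t k - u s k) <= ennreal (C * sqrt \<bar>s - t\<bar>)"
  using time_hoelder[OF dl ac u2 Bd] by blast
 have C0: "0 <= C * sqrt \<bar>s - t\<bar>" for s t using C(1) by simp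
 have lim: "((%s. sqrt (C * sqrt \<bar>t - s\<bar>)) ---> 0) (at t within S)" for t S
 proof -
  have "((%s. sqrt (C * sqrt \<bar>t - s\<bar>)) ---> sqrt (C * sqrt \<bar>t - t\<bar>)) (at t within S)" by (intro tendsto_intros)
  thus ?thesis by simp
 qed
 have inc: "Hsol_norm L 1 (%x. w s x - z x) <= sqrt (C * sqrt \<bar>t - s\<bar>)" "Hsol_norm L 1 (%x. b s x - y x) <= sqrt (C * sqrt \<bar>t - s\<bar>)"
  if "s : {0..T}" "t : {0..T}" "vL2 z" "vft z = (%k. fst (u t k))" "vL2 y" "vft y = (%k. snd (u t k))" for s t z y
 proof -
  note c = C(2)[OF that(2,1)]
  have "hsq 1 (%k. fst (u s k) - fst (u t k)) <= ennreal (C * sqrt \<bar>t - s\<bar>)" "hsq 1 (%k. snd (u s k) - snd (u t k)) <= ennreal (C * sqrt \<bar>t - s\<bar>)"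
  using order_trans[OF hsq_fst_le c] order_trans[OF hsq_snd_le c] by simp_all
  thus "Hsol_norm L 1 (%x. w s x - z x) <= sqrt (C * sqrt \<bar>t - s\<bar>)" "Hsol_norm L 1 (%x. b s x - y x) <= sqrt (C * sqrt \<bar>t - s\<bar>)"
  using that by (auto intro!: Hsol_norm_le C0 wv(1) bv(1) simp: wv(2) bv(2))
 qed
 have squeeze: "((%s. Hsol_norm L 1 (h s)) ---> 0) F"
  if "\<forall>\<^sub>F s in F. Hsol_norm L 1 (h s) <= sqrt (C * sqrt \<bar>t - s\<bar>)" "F = at t within S" for h F t S
  by (rule tendsto_sandwich[OF _ that(1) tendsto_const lim[of t S, folded that(2)]]) (simp add: Hsol_norm_nonneg)
 have Ct: "w : C_time T (Hsol L 1) (Hsol_norm L 1)" "b : C_time T (Hsol L 1) (Hsol_norm L 1)"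
 proof -
  have "w t : Hsol L 1" "b t : Hsol L 1" for t using Hsol_iff[of _ 1] wv[of t] bv[of t] g h0[of 1] by auto
  moreover have "\<forall>\<^sub>F s in at t within {0..T}. Hsol_norm L 1 (%x. w s x - w t x) <= sqrt (C * sqrt \<bar>t - s\<bar>)"
  "\<forall>\<^sub>F s in at t within {0..T}. Hsol_norm L 1 (%x. b s x - b t x) <= sqrt (C * sqrt \<bar>t - s\<bar>)" if "t : {0..T}" for t
  using inc[OF _ that wv bv] by (auto simp: eventually_at_filter intro!: always_eventually)
  ultimately show "w : C_time T (Hsol L 1) (Hsol_norm L 1)" "b : C_time T (Hsol L 1) (Hsol_norm L 1)"
  using squeeze[OF _ refl] by (auto simp: C_time_def)
 qed
 have u0: "u 0 k = ini k" for k
 proof -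
  \<comment> \<open>The initial value is attained because the integral over the single point
    \<open>0\<close> vanishes.\<close>
  have "AE s in lborel. indicator {0..0::real} s *R d s k = 0"
  using AE_lborel_singleton[of "0::real"] by eventually_elim (simp add: indicator_def)
  hence "(LBINT s:{0..0}. d s k) = 0" unfolding sli_def by (rule integral_eq_zero_AE)
  thus ?thesis using ac[of 0 k] T_pos by simp
 qed
 have Gv: "vL2 (G_vec L a1 U0)" "vft (G_vec L a1 U0) = (%k. fst (u 0 k))" "vL2 (G_vec L a2 B0)" "vft (G_vec L a2 B0) = (%k. snd (u 0 k))"
  using G_vec_L2[OF UB(1) a1_pos] G_vec_L2[OF UB(2) a2_pos] by (simp_all add: u0 ini_def fun_eq_iff)
 have ev: "\<forall>\<^sub>F s in at_right 0. s : {0..T}" using eventually_at_right_real[OF T_pos] by eventually_elim auto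
 have T0: "0 : {0..T}" using T_pos by simp
 have I: "((%t. Hsol_norm L 1 (%x. w t x - G_vec L a1 U0 x)) ---> 0) (at_right 0)" "((%t. Hsol_norm L 1 (%x. b t x - G_vec L a2 B0 x)) ---> 0) (at_right 0)"
  by (rule squeeze[OF eventually_mono[OF ev inc(1)[OF _ T0 Gv]] refl], assumption, rule squeeze[OF eventually_mono[OF ev inc(2)[OF _ T0 Gv]] refl], assumption)
 have vcu: "vc w t k = indicator {0..T} t *R fst (u t k)" "vc b t k = indicator {0..T} t *R snd (u t k)" for t k
  by (simp_all add: vc_def wv bv)
 have uub: "hsq 1 (uu w b t) <= ennreal Bd" for t
  by (rule order_trans[OF hsq_mono_norm u1[of 1 t]]) (auto simp: uu_def vcu indicator_def zero_prod_def[symmetric])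
 have uut: "uu w b t = u t" if "t : {0..T}" for t using that by (simp add: uu_def vcu fun_eq_iff)
 have qL: "q : L2_time T (sobolev L 1) (sobolev_norm L 1)" using qT(1) by (simp add: q_def)
 interpret st: mhd_state L T nu mu a1 a2 N1 N2 w b w' b' q f Bd by unfold_locales (fact L2 L0 qL f uub)+
 \<comment> \<open>\<open>residual_iff\<close> from right to left: the projected equation together
   with the choice of \<open>qf\<close> as pressure gives the full momentum balance.\<close>
 have R: "AET t. (\<forall>k. R1 w' w b q f t k = 0 & R2 b' w b t k = 0)" using d' qT(2) f_mean
 proof eventually_elim
  case (elim t)
  show ?case
  proof (intro impI allI)
  fix k assume t: "t : {0..T}"
  have e: "vc w' t k = fst (d t k)" "vc b' t k = snd (d t k)" "vc w t k = fst (u t k)" "vc b t k = snd (u t k)" "sc q t k = qf (u t) t k"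
  using elim t by (simp_all add: vc_in sc_in wv bv q_def)
  have z: "k = 0 ==> vc f t 0 = 0 & qf (u t) t k = 0" using elim(3) t by (simp add: qf_def)
  have f: "wdot k (fst (u t k)) = 0" "wdot k (fst (d t k)) = 0" using g dg' by (auto simp: divfree_def)
  have "R1 w' w b q f t k = 0"
  unfolding R1_def e uut[OF t] by (rule residual_iff[THEN iffD2, OF f z]) (simp_all add: d_def Lam_def)
  moreover have "R2 b' w b t k = 0" unfolding R2_def e uut[OF t] by (simp add: d_def Lam_def NN_def Ff_def)
  ultimately show "R1 w' w b q f t k = 0 & R2 b' w b t k = 0" ..
  qed
 qed
 have PT0: "PT r (vc v) = 0" if r: "L2h 0 r" "AET t. (\<forall>k. r t k = 0)"
  and v: "!!i. (%t x. v t x $ i) : L2_time T (sobolev L 1) (sobolev_norm L 1)" for r v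
 proof -
  have V: "L2h 0 (vc v)" by (rule L2h_mono[of 1]) (use vc_L2h_sobolev(1)[of v 1] v in simp_all)
  have "AE t in lborel. indicator {0..T} t *R (LINT k|cs. r t k <.> vc v t k) = 0" using r(2) by eventually_elim (simp add: indicator_def)
  thus ?thesis unfolding PT_def sli_def by (rule integral_eq_zero_AE)
 qed
 have R': "AET t. (\<forall>k. R1 w' w b q f t k = 0)" "AET t. (\<forall>k. R2 b' w b t k = 0)"
  using R by (eventually_elim; blast)+
 note weak = st.weak_form(1)[THEN iffD2, OF _ PT0[OF st.R1_L2h R'(1)]] st.weak_form(2)[THEN iffD2, OF _ PT0[OF st.R2_L2h R'(2)]]
 have td: "time_derivative T w w'" "time_derivative T b b'"
 proof -
  have di: "SI {0..t} (%s. d s k)" if "t : {0..T}" for t k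
  by (rule si_subset[OF nn_time_si(2)[OF L2hD[OF dl]]]) (use that in auto)
  have a: "fst (u t k) = fst (ini k) + (LBINT s:{0..t}. fst (d s k))" "snd (u t k) = snd (ini k) + (LBINT s:{0..t}. snd (d s k))"
  if "t : {0..T}" for t k using arg_cong[OF ac[OF that, of k], of fst] arg_cong[OF ac[OF that, of k], of snd]
  integral_bounded_linear[OF bounded_linear_fst di[OF that, of k, unfolded si_def]]
  integral_bounded_linear[OF bounded_linear_snd di[OF that, of k, unfolded si_def]] by (simp_all add: sli_def)
  note u0l = L2h_mono[OF ul, of 0, simplified]
  show "time_derivative T w w'" "time_derivative T b b'" unfolding w_def w'_def b_def b'_def
  using vrr_time_derivative[OF pr(1)[OF u0l] _ pr(1)[OF dl] _ a(1)] vrr_time_derivative[OF pr(2)[OF u0l] _ pr(2)[OF dl] _ a(2)] g dg'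
  by blast+
 qed
 have "regular_weak_solution L T nu mu a1 a2 N1 N2 U0 B0 f w b q" unfolding regular_weak_solution_def
  by (intro conjI IntI L2 Ct qL q0 I exI[of _ w'] exI[of _ b'] L0 td allI impI; (rule weak; blast)?)
 thus ?thesis by blast
qed

text \<open>Both solutions have coefficients that solve the same mode equation under a common h^1
  bound, so they coincide at every time. The pressures, given by \<open>qf\<close> of the same
  coefficients, then agree at almost every time.\<close>

theorem weak_solution_unique:
 assumes S: "regular_weak_solution L T nu mu a1 a2 N1 N2 U0 B0 f w b q" and S': "regular_weak_solution L T nu mu a1 a2 N1 N2 U0 B0 f w2 b2 q2"
 shows "(\<forall>t\<in>{0..T}. AE x in lborel. w2 t x = w t x & b2 t x = b t x) & (AE t in lebesgue. t : {0..T} --> (AE x in lborel. q2 t x = q t x))"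
proof -
 obtain A where A: "0 <= A" "!!t. hsq 1 (uu w b t) <= ennreal A" "!!k. (%t. uu w b t k) : BM"
  "!!t. uu w b t 0 = 0" "sol ini (%s k. NN (uu w b s) k + Ff s k) (uu w b)"
  "!!t. t : {0..T} ==> vL2 (w t) & vL2 (b t)" "AET t. q t : L2_torus L & (\<forall>k. ft (q t) k = qf (uu w b t) t k)"
  using weak_solution_modes[OF S] by blast
 obtain B where B: "0 <= B" "!!t. hsq 1 (uu w2 b2 t) <= ennreal B" "!!k. (%t. uu w2 b2 t k) : BM"
  "!!t. uu w2 b2 t 0 = 0" "sol ini (%s k. NN (uu w2 b2 s) k + Ff s k) (uu w2 b2)"
  "!!t. t : {0..T} ==> vL2 (w2 t) & vL2 (b2 t)" "AET t. q2 t : L2_torus L & (\<forall>k. ft (q2 t) k = qf (uu w2 b2 t) t k)"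
  using weak_solution_modes[OF S'] by blast
 have eq: "uu w2 b2 t = uu w b t" if t: "t : {0..T}" for t
 proof (rule sol_unique[OF B(5) A(5) B(3) A(3) Ff_meas _ _ _ B(4) A(4) t])
  show "hsq 1 (uu w2 b2 t) <= ennreal (max A B)" "hsq 1 (uu w b t) <= ennreal (max A B)" "0 <= max A B" for t
  using order_trans[OF A(2) ennreal_leI[OF max.cobounded1]] order_trans[OF B(2) ennreal_leI[OF max.cobounded2]] A(1) by auto
 qed
 have c: "vft (w2 t) k = vft (w t) k" "vft (b2 t) k = vft (b t) k" if t: "t : {0..T}" for t k
  using fun_cong[OF eq[OF t], of k] by (simp_all add: uu_def vc_in[OF t])
 have "AE x in lborel. w2 t x = w t x & b2 t x = b t x" if t: "t : {0..T}" for t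
 proof -
  have v: "vL2 (w t)" "vL2 (b t)" "vL2 (w2 t)" "vL2 (b2 t)" using A(6)[OF t] B(6)[OF t] by auto
  show ?thesis using vft_unique[OF v(3,1) c(1)[OF t]] vft_unique[OF v(4,2) c(2)[OF t]] by eventually_elim simp
 qed
 moreover have "AE t in lebesgue. t : {0..T} --> (AE x in lborel. q2 t x = q t x)" unfolding AE_completion_iff using A(7) B(7)
 proof eventually_elim
  case (elim t)
  thus ?case using ft_unique[OF L2_imp_L1 L2_imp_L1, of "q2 t" "q t"] eq[of t] by simp
 qed
 ultimately show ?thesis by blast
qed

end

theorem theorem3p1:
  fixes L T \<nu> \<mu> \<alpha>1 \<alpha>2 :: real and N1 N2 :: nat
    and u0 B0 :: "real^3 \<Rightarrow> real^3" and f :: "real \<Rightarrow> real^3 \<Rightarrow> real^3"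
  assumes "L > 0" "T > 0" "\<nu> > 0" "\<mu> > 0" "\<alpha>1 > 0" "\<alpha>2 > 0"
    and "u0 \<in> Hsol L 0" "B0 \<in> Hsol L 0"
    and "f \<in> L2_space_time L T" "zero_mean L T f"
  shows "\<exists>w b q.
    regular_weak_solution L T \<nu> \<mu> \<alpha>1 \<alpha>2 N1 N2 u0 B0 f w b q \<and>
    (\<forall>w2 b2 q2. regular_weak_solution L T \<nu> \<mu> \<alpha>1 \<alpha>2 N1 N2 u0 B0 f w2 b2 q2 \<longrightarrow>
       (\<forall>t\<in>{0..T}. AE x in lborel. w2 t x = w t x \<and> b2 t x = b t x) \<and>
       (AE t in lebesgue. t \<in> {0..T} \<longrightarrow> (AE x in lborel. q2 t x = q t x)))"
proof -
  interpret mhd_problem L T \<nu> \<mu> \<alpha>1 \<alpha>2 N1 N2 u0 B0 f by unfold_locales (fact assms)+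
  obtain w b q where "regular_weak_solution L T \<nu> \<mu> \<alpha>1 \<alpha>2 N1 N2 u0 B0 f w b q" using weak_solution_exists by blast
  with weak_solution_unique[OF this] show ?thesis by blast
qed

end
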